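(* The following easy quantum groups are all basic, for every $n\ge 1$: (1) the classical ones: $O_n,S_n,H_n,B_n,S_n',B_n'$; (2) the free ones: $O_n^+,S_n^+,H_n^+,B_n^+,S_n'^+,B_n'^+$; (3) the half-liberated ones: $O_n^*,H_n^*$.
   Context: Compact quantum groups $G$ are described by Hopf $C^*$-algebras $C(G)$ in the sense of Woronowicz, with full and reduced versions identified. $G$ is classical if $C(G)$ is commutative. A closed subgroup $H\subset G$ is given by a surjective morphism of Hopf $C^*$-algebras $C(G)\to C(H)$. For a discrete group $\Lambda$, $\widehat{\Lambda}$ is given by $C(\widehat{\Lambda})=C^*(\Lambda)$ with $\Delta(g)=g\otimes g$; it is classical iff $\Lambda$ is abelian. $G$ is called basic if it is either classical, or has a non-classical group dual subgroup $\widehat{\Lambda}\subset G$. Each free quantum group below is defined by the universal $C^*$-algebra generated by self-adjoint elements $u_{ij}$ ($i,j=1,\ldots,n$) with $u=(u_{ij})$ orthogonal ($uu^t=u^tu=1$), comultiplication $\Delta(u_{ij})=\sum_ku_{ik}\otimes u_{kj}$, and the following additional relations. $O_n^+$: none. $S_n^+$: the $u_{ij}$ are projections summing to $1$ on each row and column. $H_n^+$: $u$ is cubic, i.e. $u_{ij}u_{ik}=u_{ji}u_{ki}=0$ for $j\neq k$. $B_n^+$: the entries of $u$ sum to $1$ on each row and each column. $S_n'^+$: $u$ is cubic and has the same sum on all rows and columns. $B_n'^+$: $u$ has the same sum on all rows and columns. The classical groups $O_n,S_n,H_n,B_n,S_n',B_n'$ are the classical versions of these, obtained by adding commutativity of the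 $u_{ij}$: the orthogonal group, the permutation group, the hyperoctahedral group, the group of orthogonal matrices with row and column sums $1$, $S_n'=\mathbb Z_2\times S_n$, and $B_n'=\mathbb Z_2\times B_n$. The half-liberated quantum groups $O_n^*\subset O_n^+$ and $H_n^*\subset H_n^+$ are obtained by imposing on $C(O_n^+)$, respectively $C(H_n^+)$, the half-commutation relations $abc=cba$ for all $a,b,c\in\{u_{ij}\}$. *)

theory Defs
  imports Complex_Main "HOL-Algebra.Module" "HOL-Library.Poly_Mapping"
    "HOL-Library.Nonpos_Ints"
begin

section \<open>Unital $*$-algebras and C*-algebras\<close>

record 'a star_algebra = "(complex, 'a) module" +
  star :: "'a \<Rightarrow> 'a"

record 'a cstar_algebra = "'a star_algebra" +
  nrm :: "'a \<Rightarrow> real"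

definition star_hom ::
  "('a, 'r) star_algebra_scheme \<Rightarrow> ('b, 's) star_algebra_scheme \<Rightarrow> ('a \<Rightarrow> 'b) set" where
  "star_hom A B = {h \<in> ring_hom A B.
     (\<forall>c. \<forall>x \<in> carrier A. h (c \<odot>\<^bsub>A\<^esub> x) = c \<odot>\<^bsub>B\<^esub> h x) \<and>
     (\<forall>x \<in> carrier A. h (star A x) = star B (h x))}"

definition cstar_seminorm :: "('a, 'r) star_algebra_scheme \<Rightarrow> ('a \<Rightarrow> real) \<Rightarrow> bool" where
  "cstar_seminorm A p \<longleftrightarrow>
     (\<forall>x \<in> carrier A. 0 \<le> p x) \<and>
     (\<forall>x \<in> carrier A. \<forall>y \<in> carrier A. p (x \<oplus>\<^bsub>A\<^esub> y) \<le> p x + p y) \<and>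
     (\<forall>c. \<forall>x \<in> carrier A. p (c \<odot>\<^bsub>A\<^esub> x) = cmod c * p x) \<and>
     (\<forall>x \<in> carrier A. \<forall>y \<in> carrier A. p (x \<otimes>\<^bsub>A\<^esub> y) \<le> p x * p y) \<and>
     (\<forall>x \<in> carrier A. p (star A x \<otimes>\<^bsub>A\<^esub> x) = (p x)\<^sup>2)"

text \<open>
  Separation and completion of a $*$-algebra \<open>A\<close> with respect to a C*-seminorm \<open>p\<close>:
  the elements are the classes of \<open>p\<close>-Cauchy sequences modulo sequences of limit \<open>0\<close>.
\<close>

definition cauchy_seqs :: "('a, 'r) star_algebra_scheme \<Rightarrow> ('a \<Rightarrow> real) \<Rightarrow> (nat \<Rightarrow> 'a) set" where
  "cauchy_seqs A p = {s. (\<forall>k. s k \<in> carrier A) \<and>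
     (\<forall>e > 0. \<exists>N. \<forall>k \<ge> N. \<forall>l \<ge> N. p (s k \<ominus>\<^bsub>A\<^esub> s l) < e)}"

definition seq_class ::
  "('a, 'r) star_algebra_scheme \<Rightarrow> ('a \<Rightarrow> real) \<Rightarrow> (nat \<Rightarrow> 'a) \<Rightarrow> (nat \<Rightarrow> 'a) set" where
  "seq_class A p s = {t \<in> cauchy_seqs A p. (\<lambda>k. p (s k \<ominus>\<^bsub>A\<^esub> t k)) \<longlonglongrightarrow> 0}"

definition completion ::
  "('a, 'r) star_algebra_scheme \<Rightarrow> ('a \<Rightarrow> real) \<Rightarrow> (nat \<Rightarrow> 'a) set cstar_algebra" where
  "completion A p =
    \<lparr>carrier = seq_class A p ` cauchy_seqs A p,
     mult = (\<lambda>P Q. \<Union>s \<in> P. \<Union>t \<in> Q. seq_class A p (\<lambda>k. s k \<otimes>\<^bsub>A\<^esub> t k)),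
     one = seq_class A p (\<lambda>_. \<one>\<^bsub>A\<^esub>),
     zero = seq_class A p (\<lambda>_. \<zero>\<^bsub>A\<^esub>),
     add = (\<lambda>P Q. \<Union>s \<in> P. \<Union>t \<in> Q. seq_class A p (\<lambda>k. s k \<oplus>\<^bsub>A\<^esub> t k)),
     smult = (\<lambda>c P. \<Union>s \<in> P. seq_class A p (\<lambda>k. c \<odot>\<^bsub>A\<^esub> s k)),
     star = (\<lambda>P. \<Union>s \<in> P. seq_class A p (\<lambda>k. star A (s k))),
     nrm = (\<lambda>P. THE r. \<exists>s \<in> P. (\<lambda>k. p (s k)) \<longlonglongrightarrow> r)\<rparr>"

definition in_completion ::
  "('a, 'r) star_algebra_scheme \<Rightarrow> ('a \<Rightarrow> real) \<Rightarrow> 'a \<Rightarrow> (nat \<Rightarrow> 'a) set" where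
  "in_completion A p x = seq_class A p (\<lambda>_. x)"

text \<open>
  The universal C*-algebra obtained from a $*$-algebra \<open>A\<close> by imposing relations \<open>x = y\<close> for
  \<open>(x, y) \<in> R\<close>.  The universal norm is usually written as a supremum over the representations of
  \<open>A\<close> satisfying the relations; these induce exactly the C*-seminorms below, and using the
  seminorms avoids quantifying over all C*-algebras.  In all uses below the
  supremum is finite, as the relations bound the generators.
\<close>

definition universal_norm ::
  "('a, 'r) star_algebra_scheme \<Rightarrow> ('a \<times> 'a) set \<Rightarrow> 'a \<Rightarrow> real" where
  "universal_norm A R x =
     (SUP p \<in> {p. cstar_seminorm A p \<and> (\<forall>(y, z) \<in> R. p (y \<ominus>\<^bsub>A\<^esub> z) = 0)}. p x)"

definition universal_cstar ::
  "('a, 'r) star_algebra_scheme \<Rightarrow> ('a \<times> 'a) set \<Rightarrow> (nat \<Rightarrow> 'a) set cstar_algebra" where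
  "universal_cstar A R = completion A (universal_norm A R)"

text \<open>
  The $*$-algebra with basis a monoid \<open>M\<close>, for an antimultiplicative involution \<open>\<iota>\<close> of \<open>M\<close>.
\<close>

definition monoid_algebra ::
  "('m, 'r) monoid_scheme \<Rightarrow> ('m \<Rightarrow> 'm) \<Rightarrow> ('m \<Rightarrow>\<^sub>0 complex) star_algebra" where
  "monoid_algebra M \<iota> =
    \<lparr>carrier = {f. Poly_Mapping.keys f \<subseteq> carrier M},
     mult = (\<lambda>f g. \<Sum>a \<in> Poly_Mapping.keys f. \<Sum>b \<in> Poly_Mapping.keys g.
       Poly_Mapping.single (a \<otimes>\<^bsub>M\<^esub> b) (Poly_Mapping.lookup f a * Poly_Mapping.lookup g b)),
     one = Poly_Mapping.single \<one>\<^bsub>M\<^esub> 1,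
     zero = 0,
     add = (+),
     smult = (\<lambda>c. Poly_Mapping.map ((*) c)),
     star = (\<lambda>f. \<Sum>a \<in> Poly_Mapping.keys f.
       Poly_Mapping.single (\<iota> a) (cnj (Poly_Mapping.lookup f a)))\<rparr>"

section \<open>The minimal tensor product\<close>

definition state :: "('a, 'r) star_algebra_scheme \<Rightarrow> ('a \<Rightarrow> complex) \<Rightarrow> bool" where
  "state A \<phi> \<longleftrightarrow>
     (\<forall>x \<in> carrier A. \<forall>y \<in> carrier A. \<phi> (x \<oplus>\<^bsub>A\<^esub> y) = \<phi> x + \<phi> y) \<and>
     (\<forall>c. \<forall>x \<in> carrier A. \<phi> (c \<odot>\<^bsub>A\<^esub> x) = c * \<phi> x) \<and>
     (\<forall>x \<in> carrier A. \<phi> (star A x \<otimes>\<^bsub>A\<^esub> x) \<in> \<real>\<^sub>\<ge>\<^sub>0) \<and>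
     \<phi> \<one>\<^bsub>A\<^esub> = 1"

text \<open>
  The formal linear combinations of pairs \<open>(a, b)\<close>, of which the algebraic tensor product of
  \<open>A\<close> and \<open>B\<close> is the quotient by the bilinearity relations.  Passing to this quotient is part
  of the completion below, since the minimal norm is a norm on the algebraic tensor product.
\<close>

definition pre_tensor ::
  "('a, 'r) star_algebra_scheme \<Rightarrow> ('b, 's) star_algebra_scheme \<Rightarrow>
    ('a \<times> 'b \<Rightarrow>\<^sub>0 complex) star_algebra" where
  "pre_tensor A B = monoid_algebra (A \<times>\<times> B) (map_prod (star A) (star B))"

definition tensor_functional ::
  "('a \<Rightarrow> complex) \<Rightarrow> ('b \<Rightarrow> complex) \<Rightarrow> ('a \<times> 'b \<Rightarrow>\<^sub>0 complex) \<Rightarrow> complex" where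
  "tensor_functional \<phi> \<psi> f =
     (\<Sum>(a, b) \<in> Poly_Mapping.keys f. Poly_Mapping.lookup f (a, b) * \<phi> a * \<psi> b)"

text \<open>
  The spatial norm of \<open>x\<close>: the supremum, over all states \<open>\<phi>\<close> of \<open>A\<close> and \<open>\<psi>\<close> of \<open>B\<close>, of the
  operator norm of \<open>x\<close> in the tensor product of the GNS representations of \<open>\<phi>\<close> and \<open>\<psi>\<close>.
  This operator norm is computed on the dense subspace of vectors \<open>y \<xi>\<close>, where \<open>\<xi>\<close> is the
  tensor product of the cyclic vectors, using \<open>\<parallel>y \<xi>\<parallel>\<^sup>2 = (\<phi> \<otimes> \<psi>) (y\<^sup>* y)\<close>.
\<close>

definition min_norm ::
  "('a, 'r) star_algebra_scheme \<Rightarrow> ('b, 's) star_algebra_scheme \<Rightarrow>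
    ('a \<times> 'b \<Rightarrow>\<^sub>0 complex) \<Rightarrow> real" where
  "min_norm A B x = (let T = pre_tensor A B; sq = (\<lambda>z. star T z \<otimes>\<^bsub>T\<^esub> z) in
     Sup (insert 0
       {sqrt (Re (tensor_functional \<phi> \<psi> (sq (x \<otimes>\<^bsub>T\<^esub> y))) / Re (tensor_functional \<phi> \<psi> (sq y)))
        | \<phi> \<psi> y. state A \<phi> \<and> state B \<psi> \<and> y \<in> carrier T \<and> tensor_functional \<phi> \<psi> (sq y) \<noteq> 0}))"

type_synonym ('a, 'b) tensor = "(nat \<Rightarrow> ('a \<times> 'b \<Rightarrow>\<^sub>0 complex)) set"

definition min_tensor ::
  "('a, 'r) star_algebra_scheme \<Rightarrow> ('b, 's) star_algebra_scheme \<Rightarrow>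
    ('a, 'b) tensor cstar_algebra" where
  "min_tensor A B = completion (pre_tensor A B) (min_norm A B)"

definition elem_tensor ::
  "('a, 'r) star_algebra_scheme \<Rightarrow> ('b, 's) star_algebra_scheme \<Rightarrow> 'a \<Rightarrow> 'b \<Rightarrow> ('a, 'b) tensor" where
  "elem_tensor A B a b =
     in_completion (pre_tensor A B) (min_norm A B) (Poly_Mapping.single (a, b) 1)"

section \<open>Compact quantum groups\<close>

text \<open>
  The record carries the data of a Hopf C*-algebra: \<open>C(G)\<close>, in its full version for the
  quantum groups constructed below, and \<open>\<Delta> : C(G) \<rightarrow> C(G) \<otimes> C(G)\<close>.
\<close>

record 'a quantum_group =
  C_alg :: "'a cstar_algebra"
  comult :: "'a \<Rightarrow> ('a, 'a) tensor"

definition classical :: "'a quantum_group \<Rightarrow> bool" where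
  "classical G \<longleftrightarrow> (\<forall>x \<in> carrier (C_alg G). \<forall>y \<in> carrier (C_alg G).
     x \<otimes>\<^bsub>C_alg G\<^esub> y = y \<otimes>\<^bsub>C_alg G\<^esub> x)"

text \<open>
  Morphisms of Hopf C*-algebras \<open>C(G) \<rightarrow> C(H)\<close>; the map \<open>\<rho>\<close> is \<open>\<pi> \<otimes> \<pi>\<close>, which exists and is
  uniquely determined by its values on elementary tensors.
\<close>

definition hopf_morphism :: "'a quantum_group \<Rightarrow> 'b quantum_group \<Rightarrow> ('a \<Rightarrow> 'b) \<Rightarrow> bool" where
  "hopf_morphism G H \<pi> \<longleftrightarrow> (let A = C_alg G; B = C_alg H in
     \<pi> \<in> star_hom A B \<and>
     (\<exists>\<rho> \<in> star_hom (min_tensor A A) (min_tensor B B).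
        (\<forall>a \<in> carrier A. \<forall>b \<in> carrier A.
           \<rho> (elem_tensor A A a b) = elem_tensor B B (\<pi> a) (\<pi> b)) \<and>
        (\<forall>a \<in> carrier A. comult H (\<pi> a) = \<rho> (comult G a))))"

definition closed_subgroup :: "'b quantum_group \<Rightarrow> 'a quantum_group \<Rightarrow> bool" where
  "closed_subgroup H G \<longleftrightarrow>
     (\<exists>\<pi>. hopf_morphism G H \<pi> \<and> \<pi> ` carrier (C_alg G) = carrier (C_alg H))"

text \<open>
  The dual of a discrete group \<open>\<Lambda>\<close>.  The comultiplication is the only $*$-homomorphism with the
  stated values, since \<open>C\<^sup>*(\<Lambda>)\<close> is generated by \<open>\<Lambda>\<close>.
\<close>

definition group_cstar :: "'g monoid \<Rightarrow> (nat \<Rightarrow> ('g \<Rightarrow>\<^sub>0 complex)) set cstar_algebra" where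
  "group_cstar \<Lambda> = universal_cstar (monoid_algebra \<Lambda> (m_inv \<Lambda>)) {}"

definition group_elem :: "'g monoid \<Rightarrow> 'g \<Rightarrow> (nat \<Rightarrow> ('g \<Rightarrow>\<^sub>0 complex)) set" where
  "group_elem \<Lambda> g =
     in_completion (monoid_algebra \<Lambda> (m_inv \<Lambda>)) (universal_norm (monoid_algebra \<Lambda> (m_inv \<Lambda>)) {})
       (Poly_Mapping.single g 1)"

definition group_dual :: "'g monoid \<Rightarrow> (nat \<Rightarrow> ('g \<Rightarrow>\<^sub>0 complex)) set quantum_group" where
  "group_dual \<Lambda> = (let A = group_cstar \<Lambda> in
    \<lparr>C_alg = A,
     comult = (SOME \<Delta>. \<Delta> \<in> star_hom A (min_tensor A A) \<and>
       (\<forall>g \<in> carrier \<Lambda>. \<Delta> (group_elem \<Lambda> g) =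
          elem_tensor A A (group_elem \<Lambda> g) (group_elem \<Lambda> g)))\<rparr>)"

text \<open>
  It is no restriction to take the elements of \<open>\<Lambda>\<close> in the type \<open>'a\<close> of the elements of \<open>C(G)\<close>:
  if the dual of \<open>\<Lambda>\<close> is a closed subgroup of \<open>G\<close>, then \<open>\<Lambda>\<close> embeds into \<open>C\<^sup>*(\<Lambda>)\<close>, onto which \<open>C(G)\<close>
  surjects, so that \<open>\<Lambda>\<close> is isomorphic to a group with carrier contained in \<open>'a\<close>.
\<close>

definition basic :: "'a quantum_group \<Rightarrow> bool" where
  "basic G \<longleftrightarrow> classical G \<or>
     (\<exists>\<Lambda> :: 'a monoid. group \<Lambda> \<and> \<not> classical (group_dual \<Lambda>) \<and> closed_subgroup (group_dual \<Lambda>) G)"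

section \<open>Quantum groups defined by generators and relations\<close>

text \<open>
  The free $*$-algebra on self-adjoint generators \<open>u\<^sub>i\<^sub>j\<close>.  Indices run over \<open>0, \<dots>, n - 1\<close>.
\<close>

type_synonym free_elem = "(nat \<times> nat) list \<Rightarrow>\<^sub>0 complex"

definition free_star_algebra :: "nat \<Rightarrow> free_elem star_algebra" where
  "free_star_algebra n = monoid_algebra
     \<lparr>carrier = lists ({..<n} \<times> {..<n}), mult = (@), one = []\<rparr> rev"

definition gen :: "nat \<Rightarrow> nat \<Rightarrow> free_elem" where
  "gen i j = Poly_Mapping.single [(i, j)] 1"

definition row_sum :: "nat \<Rightarrow> nat \<Rightarrow> free_elem" where
  "row_sum n i = (\<Oplus>\<^bsub>free_star_algebra n\<^esub> k \<in> {..<n}. gen i k)"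

definition col_sum :: "nat \<Rightarrow> nat \<Rightarrow> free_elem" where
  "col_sum n j = (\<Oplus>\<^bsub>free_star_algebra n\<^esub> k \<in> {..<n}. gen k j)"

type_synonym relations = "(free_elem \<times> free_elem) set"

definition orthogonal_rel :: "nat \<Rightarrow> relations" where
  "orthogonal_rel n = (let F = free_star_algebra n in
     {(\<Oplus>\<^bsub>F\<^esub> k \<in> {..<n}. gen i k \<otimes>\<^bsub>F\<^esub> gen j k, if i = j then \<one>\<^bsub>F\<^esub> else \<zero>\<^bsub>F\<^esub>) | i j. i < n \<and> j < n} \<union>
     {(\<Oplus>\<^bsub>F\<^esub> k \<in> {..<n}. gen k i \<otimes>\<^bsub>F\<^esub> gen k j, if i = j then \<one>\<^bsub>F\<^esub> else \<zero>\<^bsub>F\<^esub>) | i j. i < n \<and> j < n})"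

definition projection_rel :: "nat \<Rightarrow> relations" where
  "projection_rel n = {(gen i j \<otimes>\<^bsub>free_star_algebra n\<^esub> gen i j, gen i j) | i j. i < n \<and> j < n}"

definition sum_one_rel :: "nat \<Rightarrow> relations" where
  "sum_one_rel n = {(row_sum n i, \<one>\<^bsub>free_star_algebra n\<^esub>) | i. i < n} \<union>
     {(col_sum n j, \<one>\<^bsub>free_star_algebra n\<^esub>) | j. j < n}"

definition same_sum_rel :: "nat \<Rightarrow> relations" where
  "same_sum_rel n = {(row_sum n i, row_sum n j) | i j. i < n \<and> j < n} \<union>
     {(col_sum n i, col_sum n j) | i j. i < n \<and> j < n} \<union>
     {(row_sum n i, col_sum n j) | i j. i < n \<and> j < n}"

definition cubic_rel :: "nat \<Rightarrow> relations" where
  "cubic_rel n = (let F = free_star_algebra n in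
     {(gen i j \<otimes>\<^bsub>F\<^esub> gen i k, \<zero>\<^bsub>F\<^esub>) | i j k. i < n \<and> j < n \<and> k < n \<and> j \<noteq> k} \<union>
     {(gen j i \<otimes>\<^bsub>F\<^esub> gen k i, \<zero>\<^bsub>F\<^esub>) | i j k. i < n \<and> j < n \<and> k < n \<and> j \<noteq> k})"

definition commutation_rel :: "nat \<Rightarrow> relations" where
  "commutation_rel n = (let F = free_star_algebra n; U = {gen i j | i j. i < n \<and> j < n} in
     {(a \<otimes>\<^bsub>F\<^esub> b, b \<otimes>\<^bsub>F\<^esub> a) | a b. a \<in> U \<and> b \<in> U})"

definition half_commutation_rel :: "nat \<Rightarrow> relations" where
  "half_commutation_rel n = (let F = free_star_algebra n; U = {gen i j | i j. i < n \<and> j < n} in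
     {(a \<otimes>\<^bsub>F\<^esub> b \<otimes>\<^bsub>F\<^esub> c, c \<otimes>\<^bsub>F\<^esub> b \<otimes>\<^bsub>F\<^esub> a) | a b c. a \<in> U \<and> b \<in> U \<and> c \<in> U})"

text \<open>
  The quantum group with \<open>C(G)\<close> the universal C*-algebra generated by the self-adjoint entries of
  an orthogonal matrix subject to the additional relations \<open>R\<close>.  As for group duals, the
  comultiplication is determined by its values on the generators.
\<close>

definition matrix_quantum_group ::
  "nat \<Rightarrow> relations \<Rightarrow> (nat \<Rightarrow> free_elem) set quantum_group" where
  "matrix_quantum_group n R = (let
     F = free_star_algebra n;
     A = universal_cstar F (orthogonal_rel n \<union> R);
     v = (\<lambda>i j. in_completion F (universal_norm F (orthogonal_rel n \<union> R)) (gen i j)) in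
    \<lparr>C_alg = A,
     comult = (SOME \<Delta>. \<Delta> \<in> star_hom A (min_tensor A A) \<and>
       (\<forall>i < n. \<forall>j < n. \<Delta> (v i j) =
          (\<Oplus>\<^bsub>min_tensor A A\<^esub> k \<in> {..<n}. elem_tensor A A (v i k) (v k j))))\<rparr>)"

definition "O_plus n = matrix_quantum_group n {}"
definition "S_plus n = matrix_quantum_group n (projection_rel n \<union> sum_one_rel n)"
definition "H_plus n = matrix_quantum_group n (cubic_rel n)"
definition "B_plus n = matrix_quantum_group n (sum_one_rel n)"
definition "S'_plus n = matrix_quantum_group n (cubic_rel n \<union> same_sum_rel n)"
definition "B'_plus n = matrix_quantum_group n (same_sum_rel n)"

definition "O_class n = matrix_quantum_group n (commutation_rel n)"
definition "S_class n =
  matrix_quantum_group n (projection_rel n \<union> sum_one_rel n \<union> commutation_rel n)"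
definition "H_class n = matrix_quantum_group n (cubic_rel n \<union> commutation_rel n)"
definition "B_class n = matrix_quantum_group n (sum_one_rel n \<union> commutation_rel n)"
definition "S'_class n =
  matrix_quantum_group n (cubic_rel n \<union> same_sum_rel n \<union> commutation_rel n)"
definition "B'_class n = matrix_quantum_group n (same_sum_rel n \<union> commutation_rel n)"

definition "O_half n = matrix_quantum_group n (half_commutation_rel n)"
definition "H_half n = matrix_quantum_group n (cubic_rel n \<union> half_commutation_rel n)"

end

theory Submission
  imports Defs
begin

text \<open>
  For small \<open>n\<close> the generators commute: always for \<open>n = 1\<close>, for \<open>B\<^sub>n\<^sup>+\<close> up to \<open>n = 2\<close>, and for \<open>S\<^sub>n\<^sup>+\<close> and
  \<open>S'\<^sub>n\<^sup>+\<close> up to \<open>n = 3\<close>; the classical quantum groups have commuting generators by definition.  In these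
  cases \<open>C(G)\<close> is commutative.

  In all other cases the dual of the dihedral group of order 6 is a closed subgroup.  This group is
  generated by two involutions \<open>g\<close> and \<open>h\<close> that do not commute.  Let \<open>v\<close>, \<open>w\<close> be orthonormal vectors, \<open>P\<^sub>v\<close>, \<open>P\<^sub>w\<close>
  the projections onto their lines and \<open>P\<^sub>0\<close> the projection onto the complement, and map \<open>u\<^sub>i\<^sub>j\<close> to the entry
  \<open>(i, j)\<close> of \<open>P\<^sub>0 k + P\<^sub>v g + P\<^sub>w h\<close>, where \<open>k\<close> is \<open>1\<close> or \<open>h\<close>.  As the projections are mutually orthogonal with
  sum \<open>1\<close>, this matrix is orthogonal, and its entries behave under the comultiplication of the group dual
  exactly like the generators of \<open>C(G)\<close> (lemmas \<open>contract\<close> and \<open>closed_subgroup_dual\<close>).  What remains is to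
  choose \<open>v\<close> and \<open>w\<close> such that the additional relations hold:

    \<^item> \<open>v = e\<^sub>0\<close>, \<open>w = e\<^sub>1\<close>, \<open>k = h\<close> gives the diagonal matrix with entries \<open>g, h, h, \<dots>\<close>, which is cubic with
      half-commuting entries; this serves \<open>O\<^sub>n\<^sup>+\<close>, \<open>H\<^sub>n\<^sup>+\<close>, \<open>O\<^sub>n\<^sup>*\<close> and \<open>H\<^sub>n\<^sup>*\<close> for \<open>n \<ge> 2\<close>;
    \<^item> \<open>v\<close> proportional to the vector of ones gives common line sums \<open>g\<close>, for \<open>B'\<^sub>n\<^sup>+\<close> and \<open>n \<ge> 2\<close>;
    \<^item> \<open>v\<close> and \<open>w\<close> orthogonal to the vector of ones and \<open>k = 1\<close> give line sums \<open>1\<close>, for \<open>B\<^sub>n\<^sup>+\<close> and \<open>n \<ge> 3\<close>;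
    \<^item> \<open>v = (e\<^sub>0 - e\<^sub>1) / \<surd>2\<close>, \<open>w = (e\<^sub>2 - e\<^sub>3) / \<surd>2\<close> and \<open>k = 1\<close> give a magic unitary with entries \<open>(1 \<plusminus> g) / 2\<close>,
      \<open>(1 \<plusminus> h) / 2\<close>, \<open>0\<close> and \<open>1\<close>, for \<open>S\<^sub>n\<^sup>+\<close>, \<open>S'\<^sub>n\<^sup>+\<close> and \<open>n \<ge> 4\<close>.

  The group being finite, its C*-algebra is the group algebra (\<open>emb_surj\<close>), so no completion interferes
  with surjectivity.

  The larger part of the argument concerns the C*-algebras themselves, since the comultiplications, the universal
  algebras and the tensor products only have their meaning once certain norms are known to be finite.  Two
  facts carry this part: \<open>p_square_le_sum_of_squares\<close>, which says \<open>\<parallel>x\<parallel>\<^sup>2 \<le> \<parallel>x\<^sup>2 + y\<^sup>2\<parallel>\<close> for commuting self-adjoint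
  elements, and \<open>sqrt_exists\<close>, which provides a square root of \<open>1 - h\<close> for \<open>\<parallel>h\<parallel> < 1\<close>.  They imply that
  homomorphisms are contractive (\<open>seminorm_le_nrm\<close>), that the entries of orthogonal matrices are bounded
  (\<open>bounded_of_squares_sum_one\<close>), that projections with sum \<open>1\<close> are orthogonal (\<open>projections_orthogonal\<close>),
  and that GNS representations act by bounded operators (\<open>embedded_bounded\<close>).  Schur's product theorem
  (\<open>psd_schur\<close>) makes product states positive; it follows that the minimal norm is a C*-seminorm and that
  \<open>\<pi> \<otimes> \<pi>\<close> exists for surjective \<open>\<pi>\<close> (\<open>tensor_of_surjections\<close>).
\<close>

section \<open>Unital $*$-algebras and C*-seminorms\<close>

locale star_alg = ring A for A :: "('a, 'r) star_algebra_scheme" (structure) +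
  assumes smult_closed [simp, intro]: "x \<in> carrier A \<Longrightarrow> c \<odot> x \<in> carrier A"
    and smult_r_distr: "\<lbrakk>x \<in> carrier A; y \<in> carrier A\<rbrakk> \<Longrightarrow> c \<odot> (x \<oplus> y) = (c \<odot> x) \<oplus> (c \<odot> y)"
    and smult_l_distr: "x \<in> carrier A \<Longrightarrow> (c + d) \<odot> x = (c \<odot> x) \<oplus> (d \<odot> x)"
    and smult_smult: "x \<in> carrier A \<Longrightarrow> c \<odot> (d \<odot> x) = (c * d) \<odot> x"
    and smult_1 [simp]: "x \<in> carrier A \<Longrightarrow> 1 \<odot> x = x"
    and smult_l_assoc: "\<lbrakk>x \<in> carrier A; y \<in> carrier A\<rbrakk> \<Longrightarrow> (c \<odot> x) \<otimes> y = c \<odot> (x \<otimes> y)"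
    and smult_r_assoc: "\<lbrakk>x \<in> carrier A; y \<in> carrier A\<rbrakk> \<Longrightarrow> x \<otimes> (c \<odot> y) = c \<odot> (x \<otimes> y)"
    and star_closed [simp, intro]: "x \<in> carrier A \<Longrightarrow> star A x \<in> carrier A"
    and star_star [simp]: "x \<in> carrier A \<Longrightarrow> star A (star A x) = x"
    and star_add: "\<lbrakk>x \<in> carrier A; y \<in> carrier A\<rbrakk> \<Longrightarrow> star A (x \<oplus> y) = star A x \<oplus> star A y"
    and star_mult: "\<lbrakk>x \<in> carrier A; y \<in> carrier A\<rbrakk> \<Longrightarrow> star A (x \<otimes> y) = star A y \<otimes> star A x"
    and star_smult: "x \<in> carrier A \<Longrightarrow> star A (c \<odot> x) = cnj c \<odot> star A x"
begin

text \<open>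
  With the right unit law among its rules, the method \<open>algebra\<close> also normalises in rings that need
  not be commutative.
\<close>

declare r_one [algebra ring "zero A" "add A" "a_inv A" "a_minus A" "one A" "mult A"]

lemma smult_0_left [simp]:
  assumes "x \<in> carrier A" shows "0 \<odot> x = \<zero>"
proof -
  have "0 \<odot> x \<oplus> 0 \<odot> x = 0 \<odot> x" using smult_l_distr[OF assms, of 0 0] by simp
  then show ?thesis using assms by (metis add.r_cancel_one' smult_closed)
qed

lemma minus_smult: "x \<in> carrier A \<Longrightarrow> \<ominus> x = (- 1) \<odot> x"
  using smult_l_distr[of x "- 1" 1] by (simp add: minus_equality)

lemma smult_zero_right [simp]: "c \<odot> \<zero> = \<zero>"
  using smult_smult[of \<zero> c 0] by simp

lemma smult_minus: "x \<in> carrier A \<Longrightarrow> c \<odot> (\<ominus> x) = \<ominus> (c \<odot> x)"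
  by (simp add: minus_smult smult_smult)

lemma smult_diff: "\<lbrakk>x \<in> carrier A; y \<in> carrier A\<rbrakk> \<Longrightarrow> c \<odot> (x \<ominus> y) = (c \<odot> x) \<ominus> (c \<odot> y)"
  by (simp add: a_minus_def smult_r_distr smult_minus)

lemma star_zero [simp]: "star A \<zero> = \<zero>"
  using star_smult[of \<zero> 0] by simp

lemma star_one [simp]: "star A \<one> = \<one>"
proof -
  have "star A \<one> = star A \<one> \<otimes> star A (star A \<one>)" by simp
  also have "\<dots> = star A (star A \<one> \<otimes> \<one>)" by (subst star_mult) auto
  finally show ?thesis by simp
qed

lemma star_minus: "x \<in> carrier A \<Longrightarrow> star A (\<ominus> x) = \<ominus> (star A x)"
  by (simp add: minus_smult star_smult)

lemma star_diff: "\<lbrakk>x \<in> carrier A; y \<in> carrier A\<rbrakk> \<Longrightarrow> star A (x \<ominus> y) = star A x \<ominus> star A y"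
  by (simp add: a_minus_def star_add star_minus)

lemma smult_2: "x \<in> carrier A \<Longrightarrow> 2 \<odot> x = x \<oplus> x"
  using smult_l_distr[of x 1 1] by simp

lemma smult_finsum:
  assumes "f \<in> I \<rightarrow> carrier A"
  shows "c \<odot> (\<Oplus>i\<in>I. f i) = (\<Oplus>i\<in>I. c \<odot> f i)"
  using assms
proof (induction I rule: infinite_finite_induct)
  case (insert i I)
  then show ?case by (simp add: smult_r_distr Pi_def)
qed auto

lemma star_finsum:
  assumes "f \<in> I \<rightarrow> carrier A"
  shows "star A (\<Oplus>i\<in>I. f i) = (\<Oplus>i\<in>I. star A (f i))"
  using assms
proof (induction I rule: infinite_finite_induct)
  case (insert i I)
  then show ?case by (simp add: star_add Pi_def)
qed auto

lemma smult_sum: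
  assumes "x \<in> carrier A"
  shows "(\<Sum>i\<in>I. c i) \<odot> x = (\<Oplus>i\<in>I. c i \<odot> x)"
  using assms
proof (induction I rule: infinite_finite_induct)
  case (insert i I)
  then show ?case by (simp add: smult_l_distr Pi_def)
qed auto

lemma finsum_mult_left:
  assumes "f \<in> I \<rightarrow> carrier A" "x \<in> carrier A"
  shows "x \<otimes> (\<Oplus>i\<in>I. f i) = (\<Oplus>i\<in>I. x \<otimes> f i)"
  using assms
proof (induction I rule: infinite_finite_induct)
  case (insert i I)
  then show ?case by (simp add: r_distr Pi_def)
qed auto

lemma finsum_mult_right:
  assumes "f \<in> I \<rightarrow> carrier A" "x \<in> carrier A"
  shows "(\<Oplus>i\<in>I. f i) \<otimes> x = (\<Oplus>i\<in>I. f i \<otimes> x)"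
  using assms
proof (induction I rule: infinite_finite_induct)
  case (insert i I)
  then show ?case by (simp add: l_distr Pi_def)
qed auto

lemma finsum_swap:
  assumes "\<And>i j. i \<in> I \<Longrightarrow> j \<in> J \<Longrightarrow> f i j \<in> carrier A" "finite I" "finite J"
  shows "(\<Oplus>i\<in>I. \<Oplus>j\<in>J. f i j) = (\<Oplus>j\<in>J. \<Oplus>i\<in>I. f i j)"
  using assms(2,1)
proof (induction I rule: finite_induct)
  case empty
  then show ?case by simp
next
  case (insert i I)
  have "(\<Oplus>i\<in>insert i I. \<Oplus>j\<in>J. f i j) = (\<Oplus>j\<in>J. f i j) \<oplus> (\<Oplus>i\<in>I. \<Oplus>j\<in>J. f i j)"
    by (rule finsum_insert) (use insert in \<open>auto intro!: finsum_closed\<close>)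
  also have "\<dots> = (\<Oplus>j\<in>J. f i j) \<oplus> (\<Oplus>j\<in>J. \<Oplus>i\<in>I. f i j)" using insert by simp
  also have "\<dots> = (\<Oplus>j\<in>J. f i j \<oplus> (\<Oplus>i\<in>I. f i j))"
    by (rule finsum_addf[symmetric]) (use insert in \<open>auto intro!: finsum_closed\<close>)
  also have "\<dots> = (\<Oplus>j\<in>J. \<Oplus>i\<in>insert i I. f i j)"
    by (rule finsum_cong') (use insert in \<open>auto intro!: finsum_closed finsum_insert[symmetric]\<close>)
  finally show ?case .
qed

lemma finsum_remove:
  assumes "finite I" "i \<in> I" "f \<in> I \<rightarrow> carrier A"
  shows "(\<Oplus>k\<in>I. f k) = f i \<oplus> (\<Oplus>k\<in>I - {i}. f k)"
proof -
  have "(\<Oplus>k\<in>insert i (I - {i}). f k) = f i \<oplus> (\<Oplus>k\<in>I - {i}. f k)"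
    by (rule finsum_insert) (use assms in \<open>auto simp: Pi_def\<close>)
  then show ?thesis using assms(2) by (simp add: insert_absorb)
qed

lemma finsum_delta:
  assumes "finite I" "i \<in> I" "f i \<in> carrier A"
  shows "(\<Oplus>k\<in>I. if k = i then f k else \<zero>) = f i"
proof -
  have "(\<Oplus>k\<in>I. if k = i then f k else \<zero>)
      = (if i = i then f i else \<zero>) \<oplus> (\<Oplus>k\<in>I - {i}. if k = i then f k else \<zero>)"
    by (rule finsum_remove) (use assms in auto)
  also have "(\<Oplus>k\<in>I - {i}. if k = i then f k else \<zero>) = \<zero>"
    by (rule add.finprod_one_eqI) auto
  finally show ?thesis using assms by simp
qed

end

text \<open>
  A C*-seminorm \<open>p\<close> is a C*-norm on the quotient of \<open>A\<close> by the elements with \<open>p x = 0\<close>.  Working with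
  seminorms on \<open>A\<close> itself avoids forming that quotient.
\<close>

locale seminormed = star_alg A for A :: "('a, 'r) star_algebra_scheme" (structure) +
  fixes p :: "'a \<Rightarrow> real"
  assumes seminorm: "cstar_seminorm A p"
begin

lemma p_nonneg: "x \<in> carrier A \<Longrightarrow> 0 \<le> p x"
  and p_add: "\<lbrakk>x \<in> carrier A; y \<in> carrier A\<rbrakk> \<Longrightarrow> p (x \<oplus> y) \<le> p x + p y"
  and p_smult: "x \<in> carrier A \<Longrightarrow> p (c \<odot> x) = cmod c * p x"
  and p_mult: "\<lbrakk>x \<in> carrier A; y \<in> carrier A\<rbrakk> \<Longrightarrow> p (x \<otimes> y) \<le> p x * p y"
  and p_star_mult: "x \<in> carrier A \<Longrightarrow> p (star A x \<otimes> x) = (p x)\<^sup>2"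
  using seminorm by (auto simp: cstar_seminorm_def)

lemma p_zero [simp]: "p \<zero> = 0"
  using p_smult[of \<zero> 0] by simp

lemma p_minus: "x \<in> carrier A \<Longrightarrow> p (\<ominus> x) = p x"
  by (simp add: minus_smult p_smult)

lemma p_diff_commute: "\<lbrakk>x \<in> carrier A; y \<in> carrier A\<rbrakk> \<Longrightarrow> p (x \<ominus> y) = p (y \<ominus> x)"
  using p_minus[of "x \<ominus> y"] by (simp add: minus_add a_minus_def a_comm)

lemma p_diff_triangle:
  assumes "x \<in> carrier A" "y \<in> carrier A" "z \<in> carrier A"
  shows "p (x \<ominus> z) \<le> p (x \<ominus> y) + p (y \<ominus> z)"
proof -
  have "x \<ominus> z = (x \<ominus> y) \<oplus> (y \<ominus> z)" using assms by algebra
  then show ?thesis using p_add[of "x \<ominus> y" "y \<ominus> z"] assms by simp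
qed

lemma p_le_add_diff:
  assumes "x \<in> carrier A" "y \<in> carrier A"
  shows "p x \<le> p y + p (x \<ominus> y)"
proof -
  have "x = y \<oplus> (x \<ominus> y)" using assms by algebra
  then show ?thesis using p_add[of y "x \<ominus> y"] assms by simp
qed

lemma p_diff_abs:
  assumes "x \<in> carrier A" "y \<in> carrier A"
  shows "\<bar>p x - p y\<bar> \<le> p (x \<ominus> y)"
  using p_le_add_diff[OF assms] p_le_add_diff[OF assms(2,1)] p_diff_commute[OF assms] by linarith

text \<open>
  The C*-identity and submultiplicativity give \<open>(p x)\<^sup>2 \<le> p (x\<^sup>*) * p x\<close>.
\<close>

lemma p_star_le: "x \<in> carrier A \<Longrightarrow> p x \<le> p (star A x)"
proof (cases "p x = 0")
  case False
  assume x: "x \<in> carrier A"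
  have "p x * p x \<le> p (star A x) * p x"
    using p_mult[of "star A x" x] p_star_mult[OF x] x by (simp add: power2_eq_square)
  then show ?thesis using False p_nonneg[OF x] by simp
qed (simp add: p_nonneg)

lemma p_star [simp]: "x \<in> carrier A \<Longrightarrow> p (star A x) = p x"
  using p_star_le[of x] p_star_le[of "star A x"] by simp

lemma p_one: "p \<one> \<le> 1"
proof -
  have "p \<one> = (p \<one>)\<^sup>2" using p_star_mult[of \<one>] by simp
  then have "p \<one> * (1 - p \<one>) = 0" by (simp add: power2_eq_square algebra_simps)
  then show ?thesis by auto
qed

lemma p_self_adjoint: "\<lbrakk>x \<in> carrier A; star A x = x\<rbrakk> \<Longrightarrow> p (x \<otimes> x) = (p x)\<^sup>2"
  using p_star_mult[of x] by simp

lemma p_finsum: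
  assumes "f \<in> I \<rightarrow> carrier A" "finite I"
  shows "p (\<Oplus>i\<in>I. f i) \<le> (\<Sum>i\<in>I. p (f i))"
  using assms(2,1)
proof (induction I rule: finite_induct)
  case (insert i I)
  have "p (\<Oplus>i\<in>insert i I. f i) \<le> p (f i) + p (\<Oplus>i\<in>I. f i)"
    using insert by (simp add: Pi_def p_add finsum_closed)
  then show ?case using insert by (simp add: Pi_def)
qed auto

text \<open>
  The element \<open>x\<close> is the real part of \<open>u = x + \<i> y\<close>, so \<open>p x \<le> p u\<close>, while \<open>u\<^sup>* u = x\<^sup>2 + y\<^sup>2\<close> because
  \<open>x\<close> and \<open>y\<close> commute.  This stands in for the order on self-adjoint elements: most norm estimates below
  come from writing down a suitable sum of two commuting squares.
\<close>

lemma p_square_le_sum_of_squares: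
  assumes "x \<in> carrier A" "y \<in> carrier A" "star A x = x" "star A y = y" "x \<otimes> y = y \<otimes> x"
  shows "(p x)\<^sup>2 \<le> p (x \<otimes> x \<oplus> y \<otimes> y)"
proof -
  define u where "u = x \<oplus> (\<i> \<odot> y)"
  have u: "u \<in> carrier A" using assms by (simp add: u_def)
  have su: "star A u = x \<ominus> (\<i> \<odot> y)"
    using assms by (simp add: u_def star_add star_smult a_minus_def minus_smult smult_smult)
  let ?z = "\<i> \<odot> y"
  have z: "?z \<in> carrier A" using assms by simp
  have xz: "x \<otimes> ?z = ?z \<otimes> x" using assms by (simp add: smult_l_assoc smult_r_assoc)
  have zz: "?z \<otimes> ?z = \<ominus> (y \<otimes> y)"
    using assms by (simp add: smult_l_assoc smult_r_assoc smult_smult minus_smult)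
  have "star A u \<otimes> u = x \<otimes> x \<oplus> (x \<otimes> ?z \<ominus> ?z \<otimes> x) \<ominus> ?z \<otimes> ?z"
    unfolding su unfolding u_def using assms(1) z by algebra
  also have "\<dots> = x \<otimes> x \<oplus> y \<otimes> y" unfolding xz zz using assms z by algebra
  finally have uu: "star A u \<otimes> u = x \<otimes> x \<oplus> y \<otimes> y" .
  have "u \<oplus> star A u = x \<oplus> x" unfolding su unfolding u_def using assms(1) z by algebra
  also have "\<dots> = 2 \<odot> x" using assms by (simp add: smult_2)
  finally have "2 * p x \<le> p u + p (star A u)"
    using p_add[of u "star A u"] u p_smult[of x 2] assms by simp
  then have "p x \<le> p u" using u by simp
  then have "(p x)\<^sup>2 \<le> (p u)\<^sup>2" using assms by (simp add: p_nonneg power_mono)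
  also have "\<dots> = p (x \<otimes> x \<oplus> y \<otimes> y)" using p_star_mult[OF u] uu by simp
  finally show ?thesis .
qed

end

section \<open>C*-algebras\<close>

locale cstar_alg = seminormed A "nrm A" for A :: "('a, 'r) cstar_algebra_scheme" (structure) +
  assumes nrm_zero_imp: "\<lbrakk>x \<in> carrier A; nrm A x = 0\<rbrakk> \<Longrightarrow> x = \<zero>"
    and complete: "\<lbrakk>\<And>k. s k \<in> carrier A; \<And>e. 0 < e \<Longrightarrow> \<exists>N. \<forall>k\<ge>N. \<forall>l\<ge>N. nrm A (s k \<ominus> s l) < e\<rbrakk>
      \<Longrightarrow> \<exists>a \<in> carrier A. (\<lambda>k. nrm A (s k \<ominus> a)) \<longlonglongrightarrow> 0"
begin

text \<open>
  Convergence in norm, with membership in the carrier included, so that limits are unique and the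
  algebraic operations are continuous without side conditions.
\<close>

definition conv :: "(nat \<Rightarrow> 'a) \<Rightarrow> 'a \<Rightarrow> bool" where
  "conv s a \<longleftrightarrow> (\<forall>k. s k \<in> carrier A) \<and> a \<in> carrier A \<and> (\<lambda>k. nrm A (s k \<ominus> a)) \<longlonglongrightarrow> 0"

lemma conv_const: "a \<in> carrier A \<Longrightarrow> conv (\<lambda>_. a) a"
  by (simp add: conv_def a_minus_def r_neg)

lemma nrm_eqI: "\<lbrakk>x \<in> carrier A; y \<in> carrier A; nrm A (x \<ominus> y) = 0\<rbrakk> \<Longrightarrow> x = y"
  using nrm_zero_imp[of "x \<ominus> y"] by (simp add: a_minus_def) (metis a_inv_closed minus_equality minus_minus)

lemma convI:
  assumes "\<And>k. s k \<in> carrier A" "a \<in> carrier A" "\<And>k. nrm A (s k \<ominus> a) \<le> b k" "b \<longlonglongrightarrow> 0"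
  shows "conv s a"
  unfolding conv_def
proof (intro conjI allI)
  show "(\<lambda>k. nrm A (s k \<ominus> a)) \<longlonglongrightarrow> 0"
    by (rule tendsto_sandwich[OF _ _ tendsto_const assms(4)])
      (use assms in \<open>auto intro!: always_eventually p_nonneg\<close>)
qed (use assms in auto)

lemma conv_unique:
  assumes "conv s a" "conv s b" shows "a = b"
proof (rule nrm_eqI)
  show ab: "a \<in> carrier A" "b \<in> carrier A" using assms by (auto simp: conv_def)
  have "(\<lambda>k. nrm A (s k \<ominus> a) + nrm A (s k \<ominus> b)) \<longlonglongrightarrow> 0 + 0"
    using assms unfolding conv_def by (intro tendsto_add) auto
  moreover have "nrm A (a \<ominus> b) \<le> nrm A (s k \<ominus> a) + nrm A (s k \<ominus> b)" for k
    using p_diff_triangle[of a "s k" b] p_diff_commute[of a "s k"] assms by (auto simp: conv_def)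
  ultimately have "nrm A (a \<ominus> b) \<le> 0" using LIMSEQ_le_const by fastforce
  then show "nrm A (a \<ominus> b) = 0" using ab p_nonneg[of "a \<ominus> b"] by simp
qed

lemma conv_Suc: "conv s a \<Longrightarrow> conv (\<lambda>k. s (Suc k)) a"
  unfolding conv_def by (auto intro: LIMSEQ_Suc[where f = "\<lambda>k. nrm A (s k \<ominus> a)"])

lemma conv_add:
  assumes "conv s a" "conv t b" shows "conv (\<lambda>k. s k \<oplus> t k) (a \<oplus> b)"
proof (rule convI)
  have c: "s k \<in> carrier A" "t k \<in> carrier A" "a \<in> carrier A" "b \<in> carrier A" for k
    using assms by (auto simp: conv_def)
  show "nrm A (s k \<oplus> t k \<ominus> (a \<oplus> b)) \<le> nrm A (s k \<ominus> a) + nrm A (t k \<ominus> b)" for k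
  proof -
    have "s k \<oplus> t k \<ominus> (a \<oplus> b) = (s k \<ominus> a) \<oplus> (t k \<ominus> b)" using c by algebra
    then show ?thesis using p_add[of "s k \<ominus> a" "t k \<ominus> b"] c by simp
  qed
  have "(\<lambda>k. nrm A (s k \<ominus> a) + nrm A (t k \<ominus> b)) \<longlonglongrightarrow> 0 + 0"
    using assms unfolding conv_def by (intro tendsto_add) auto
  then show "(\<lambda>k. nrm A (s k \<ominus> a) + nrm A (t k \<ominus> b)) \<longlonglongrightarrow> 0" by simp
qed (use assms in \<open>auto simp: conv_def\<close>)

lemma conv_smult:
  assumes "conv s a" shows "conv (\<lambda>k. c \<odot> s k) (c \<odot> a)"
proof (rule convI)
  have c: "s k \<in> carrier A" "a \<in> carrier A" for k
    using assms by (auto simp: conv_def)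
  show "nrm A (c \<odot> s k \<ominus> c \<odot> a) \<le> cmod c * nrm A (s k \<ominus> a)" for k
    using c by (simp add: smult_diff[symmetric] p_smult)
  have "(\<lambda>k. cmod c * nrm A (s k \<ominus> a)) \<longlonglongrightarrow> cmod c * 0"
    using assms unfolding conv_def by (intro tendsto_mult tendsto_const) auto
  then show "(\<lambda>k. cmod c * nrm A (s k \<ominus> a)) \<longlonglongrightarrow> 0" by simp
qed (use assms in \<open>auto simp: conv_def\<close>)

lemma conv_star:
  assumes "conv s a" shows "conv (\<lambda>k. star A (s k)) (star A a)"
  using assms by (auto simp: conv_def star_diff[symmetric])

lemma conv_nrm:
  assumes "conv s a" shows "(\<lambda>k. nrm A (s k)) \<longlonglongrightarrow> nrm A a"
proof -
  have "(\<lambda>k. nrm A (s k) - nrm A a) \<longlonglongrightarrow> 0"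
  proof (rule tendsto_rabs_zero_cancel, rule tendsto_sandwich[OF _ _ tendsto_const])
    show "(\<lambda>k. nrm A (s k \<ominus> a)) \<longlonglongrightarrow> 0" using assms by (simp add: conv_def)
  qed (use assms in \<open>auto intro!: always_eventually p_diff_abs simp: conv_def\<close>)
  then show ?thesis by (simp add: LIM_zero_iff)
qed

lemma conv_mult:
  assumes "conv s a" "conv t b" shows "conv (\<lambda>k. s k \<otimes> t k) (a \<otimes> b)"
proof (rule convI)
  have c: "s k \<in> carrier A" "t k \<in> carrier A" "a \<in> carrier A" "b \<in> carrier A" for k
    using assms by (auto simp: conv_def)
  show "nrm A (s k \<otimes> t k \<ominus> a \<otimes> b)
      \<le> nrm A (s k \<ominus> a) * nrm A (t k) + nrm A a * nrm A (t k \<ominus> b)" for k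
  proof -
    have "s k \<otimes> t k \<ominus> a \<otimes> b = (s k \<ominus> a) \<otimes> t k \<oplus> a \<otimes> (t k \<ominus> b)" using c by algebra
    then show ?thesis
      using p_add[of "(s k \<ominus> a) \<otimes> t k" "a \<otimes> (t k \<ominus> b)"] p_mult[of "s k \<ominus> a" "t k"]
        p_mult[of a "t k \<ominus> b"] c by simp
  qed
  have "(\<lambda>k. nrm A (s k \<ominus> a) * nrm A (t k) + nrm A a * nrm A (t k \<ominus> b))
      \<longlonglongrightarrow> 0 * nrm A b + nrm A a * 0"
    using assms conv_nrm[OF assms(2)] unfolding conv_def
    by (intro tendsto_add tendsto_mult tendsto_const) auto
  then show "(\<lambda>k. nrm A (s k \<ominus> a) * nrm A (t k) + nrm A a * nrm A (t k \<ominus> b)) \<longlonglongrightarrow> 0" by simp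
qed (use assms in \<open>auto simp: conv_def\<close>)

lemma Cauchy_conv:
  assumes "\<And>k. s k \<in> carrier A" "\<And>e. 0 < e \<Longrightarrow> \<exists>N. \<forall>k\<ge>N. \<forall>l\<ge>N. nrm A (s k \<ominus> s l) < e"
  shows "\<exists>a. conv s a"
  using complete[OF assms] assms(1) by (auto simp: conv_def)

end

section \<open>Square roots, automatic continuity and positivity\<close>

context cstar_alg
begin

lemma geometric_Cauchy:
  fixes \<omega> :: real
  assumes s: "\<And>k. s k \<in> carrier A" and \<omega>: "0 \<le> \<omega>" "\<omega> < 1"
    and step: "\<And>k. nrm A (s (Suc k) \<ominus> s k) \<le> \<omega> ^ k"
  shows "\<exists>a. conv s a"
proof (rule Cauchy_conv)
  have d: "nrm A (s (k + d) \<ominus> s k) \<le> (\<omega> ^ k - \<omega> ^ (k + d)) / (1 - \<omega>)" for k d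
  proof (induction d)
    case 0
    then show ?case using s by (simp add: a_minus_def r_neg)
  next
    case (Suc d)
    have "nrm A (s (k + Suc d) \<ominus> s k) \<le> nrm A (s (Suc (k + d)) \<ominus> s (k + d)) + nrm A (s (k + d) \<ominus> s k)"
      using p_diff_triangle[of "s (k + Suc d)" "s (k + d)" "s k"] s by simp
    also have "\<dots> \<le> \<omega> ^ (k + d) + (\<omega> ^ k - \<omega> ^ (k + d)) / (1 - \<omega>)"
      using Suc step[of "k + d"] by simp
    also have "\<dots> = (\<omega> ^ k - \<omega> ^ (k + Suc d)) / (1 - \<omega>)"
      using \<omega> by (simp add: field_simps)
    finally show ?case .
  qed
  have bound: "nrm A (s l \<ominus> s k) \<le> \<omega> ^ k / (1 - \<omega>)" if "k \<le> l" for k l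
  proof -
    define d where "d = l - k"
    have l: "l = k + d" using that by (simp add: d_def)
    have "(\<omega> ^ k - \<omega> ^ (k + d)) / (1 - \<omega>) \<le> \<omega> ^ k / (1 - \<omega>)"
      using \<omega> by (intro divide_right_mono) auto
    then show ?thesis using d[where k = k and d = d] unfolding l by linarith
  qed
  fix e :: real assume e: "0 < e"
  have "(\<lambda>k. \<omega> ^ k / (1 - \<omega>)) \<longlonglongrightarrow> 0 / (1 - \<omega>)"
    using \<omega> by (intro tendsto_divide LIMSEQ_realpow_zero tendsto_const) auto
  then have "eventually (\<lambda>k. \<omega> ^ k / (1 - \<omega>) < e) sequentially"
    using e by (intro order_tendstoD(2)) auto
  then obtain N where N: "\<And>k. k \<ge> N \<Longrightarrow> \<omega> ^ k / (1 - \<omega>) < e"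
    by (auto simp: eventually_sequentially)
  show "\<exists>N. \<forall>k\<ge>N. \<forall>l\<ge>N. nrm A (s k \<ominus> s l) < e"
  proof (intro exI[of _ N] allI impI)
    fix k l assume "k \<ge> N" "l \<ge> N"
    then show "nrm A (s k \<ominus> s l) < e"
      using bound[of k l] bound[of l k] N[of k] N[of l] p_diff_commute[of "s k" "s l"] s
      by (cases "k \<le> l") auto
  qed
qed (use s in auto)

text \<open>
  If \<open>y = 1 - w\<close>, then \<open>y\<^sup>2 = 1 - h\<close> amounts to \<open>w = (h + w\<^sup>2) / 2\<close>.  For \<open>\<parallel>h\<parallel> < 1\<close> the iteration
  \<open>w \<mapsto> (h + w\<^sup>2) / 2\<close> started at \<open>0\<close> is a contraction, hence converges.  All iterates are polynomials
  in \<open>h\<close>, so the limit is self-adjoint and commutes with everything that commutes with \<open>h\<close>.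
\<close>

lemma sqrt_exists:
  assumes h: "h \<in> carrier A" "star A h = h" "nrm A h < 1"
  shows "\<exists>y \<in> carrier A. star A y = y \<and> y \<otimes> y = \<one> \<ominus> h \<and>
    (\<forall>z \<in> carrier A. z \<otimes> h = h \<otimes> z \<longrightarrow> z \<otimes> y = y \<otimes> z)"
proof -
  define w where "w = rec_nat \<zero> (\<lambda>_ v. (1/2) \<odot> (h \<oplus> v \<otimes> v))"
  have w0: "w 0 = \<zero>" and wS: "w (Suc k) = (1/2) \<odot> (h \<oplus> w k \<otimes> w k)" for k
    by (simp_all add: w_def)
  have w: "w k \<in> carrier A" for k by (induction k) (use h in \<open>auto simp: w0 wS\<close>)
  have wsa: "star A (w k) = w k" for k
    by (induction k) (use h w in \<open>auto simp: w0 wS star_add star_smult star_mult\<close>)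
  have wc: "z \<otimes> w k = w k \<otimes> z" if z: "z \<in> carrier A" "z \<otimes> h = h \<otimes> z" for z k
  proof (induction k)
    case (Suc k)
    have "z \<otimes> (w k \<otimes> w k) = w k \<otimes> w k \<otimes> z"
      using Suc w z by (metis m_assoc)
    then show ?case using z h w by (simp add: wS smult_r_assoc smult_l_assoc r_distr l_distr)
  qed (use z in \<open>simp add: w0\<close>)
  have ww: "w k \<otimes> w l = w l \<otimes> w k" for k l
    using wc[OF w, of k l] wc[OF h(1) refl, of k] by simp
  \<comment> \<open>The smaller fixed point of the scalar iteration \<open>t \<mapsto> (\<parallel>h\<parallel> + t\<^sup>2) / 2\<close>; it bounds all iterates and
    is less than \<open>1\<close>, so that it also serves as the contraction factor.\<close>
  define \<omega> where "\<omega> = 1 - sqrt (1 - nrm A h)"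
  have nh: "0 \<le> nrm A h" using h by (simp add: p_nonneg)
  have "sqrt (1 - nrm A h) \<le> 1" "0 < sqrt (1 - nrm A h)" using nh h by auto
  then have \<omega>: "0 \<le> \<omega>" "\<omega> < 1" unfolding \<omega>_def by auto
  have "(1 - \<omega>)\<^sup>2 = 1 - nrm A h" using h unfolding \<omega>_def by simp
  then have \<omega>eq: "(nrm A h + \<omega>\<^sup>2) / 2 = \<omega>" by (simp add: power2_eq_square algebra_simps)
  have wn: "nrm A (w k) \<le> \<omega>" for k
  proof (induction k)
    case (Suc k)
    have "nrm A (w (Suc k)) \<le> (nrm A h + nrm A (w k) * nrm A (w k)) / 2"
      unfolding wS using h w p_add[of h "w k \<otimes> w k"] p_mult[of "w k" "w k"]
      by (simp add: p_smult norm_divide)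
    also have "\<dots> \<le> (nrm A h + \<omega> * \<omega>) / 2"
      using Suc \<omega> p_nonneg[OF w[of k]] by (intro divide_right_mono add_left_mono mult_mono) auto
    finally show ?case using \<omega>eq by (simp add: power2_eq_square)
  qed (use \<omega> in \<open>simp add: w0\<close>)
  have "\<exists>a. conv w a"
  proof (rule geometric_Cauchy[OF w \<omega>])
    show "nrm A (w (Suc k) \<ominus> w k) \<le> \<omega> ^ k" for k
    proof (induction k)
      case 0
      have "w (Suc 0) \<ominus> w 0 = (1/2) \<odot> h" using h by (simp add: wS w0 a_minus_def)
      then show ?case using h nh by (simp add: p_smult norm_divide)
    next
      case (Suc k)
      let ?a = "w (Suc k)" and ?b = "w k"
      have "w (Suc (Suc k)) \<ominus> w (Suc k) = (1/2) \<odot> ((h \<oplus> ?a \<otimes> ?a) \<ominus> (h \<oplus> ?b \<otimes> ?b))"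
        using h w by (simp only: wS smult_diff smult_closed a_closed m_closed)
      also have "(h \<oplus> ?a \<otimes> ?a) \<ominus> (h \<oplus> ?b \<otimes> ?b) = (?a \<ominus> ?b) \<otimes> (?a \<oplus> ?b) \<oplus> (?b \<otimes> ?a \<ominus> ?a \<otimes> ?b)"
        using h(1) w[of k] w[of "Suc k"] by algebra
      also have "\<dots> = (?a \<ominus> ?b) \<otimes> (?a \<oplus> ?b)" using w ww[of k "Suc k"] by (simp add: a_minus_def r_neg)
      finally have eq: "nrm A (w (Suc (Suc k)) \<ominus> w (Suc k)) = nrm A ((?a \<ominus> ?b) \<otimes> (?a \<oplus> ?b)) / 2"
        using w by (simp add: p_smult norm_divide)
      have "nrm A ((?a \<ominus> ?b) \<otimes> (?a \<oplus> ?b)) \<le> nrm A (?a \<ominus> ?b) * nrm A (?a \<oplus> ?b)"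
        using w by (simp add: p_mult)
      also have "\<dots> \<le> \<omega> ^ k * (2 * \<omega>)"
        using Suc \<omega> w wn[of k] wn[of "Suc k"] p_add[OF w w, of "Suc k" k]
        by (intro mult_mono) (auto simp: p_nonneg)
      finally show ?case unfolding eq by (simp add: mult.commute mult.left_commute)
    qed
  qed
  then obtain a where a: "conv w a" by blast
  have ac: "a \<in> carrier A" using a by (simp add: conv_def)
  have "conv (\<lambda>k. w (Suc k)) ((1/2) \<odot> (h \<oplus> a \<otimes> a))"
    unfolding wS by (intro conv_smult conv_add conv_mult conv_const a h)
  then have aeq: "a = (1/2) \<odot> (h \<oplus> a \<otimes> a)" using conv_unique[OF conv_Suc[OF a]] by blast
  have "2 \<odot> a = 2 \<odot> ((1/2) \<odot> (h \<oplus> a \<otimes> a))" using aeq by simp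
  then have a2: "a \<oplus> a = h \<oplus> a \<otimes> a" using h ac by (simp add: smult_smult smult_2)
  have "star A a = a" using conv_unique[OF conv_star[OF a]] a wsa by simp
  moreover have "z \<otimes> a = a \<otimes> z" if z: "z \<in> carrier A" "z \<otimes> h = h \<otimes> z" for z
    using conv_unique[OF conv_mult[OF conv_const[OF z(1)] a]] conv_mult[OF a conv_const[OF z(1)]]
      wc[OF z] by simp
  moreover have "(\<one> \<ominus> a) \<otimes> (\<one> \<ominus> a) = \<one> \<ominus> (a \<oplus> a) \<oplus> a \<otimes> a" using ac by algebra
  then have "(\<one> \<ominus> a) \<otimes> (\<one> \<ominus> a) = \<one> \<ominus> (h \<oplus> a \<otimes> a) \<oplus> a \<otimes> a" unfolding a2 .
  then have "(\<one> \<ominus> a) \<otimes> (\<one> \<ominus> a) = \<one> \<ominus> h" using ac h by algebra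
  ultimately show ?thesis
    using ac by (intro bexI[of _ "\<one> \<ominus> a"])
      (simp_all add: star_diff, simp add: a_minus_def l_distr r_distr l_minus r_minus)
qed

text \<open>
  Automatic contractivity.  For self-adjoint \<open>h\<close> with \<open>\<parallel>h\<parallel> < 1\<close> completeness provides a square root
  \<open>y\<close> of \<open>1 - h\<^sup>2\<close>, and then \<open>h\<^sup>2 + y\<^sup>2 = 1\<close> bounds \<open>q h\<close> by \<open>1\<close>, whatever the C*-seminorm \<open>q\<close> is.  The
  general case follows by the C*-identity.
\<close>

lemma seminorm_le_nrm:
  assumes q: "cstar_seminorm A q" and x: "x \<in> carrier A"
  shows "q x \<le> nrm A x"
proof -
  interpret q: seminormed A q by unfold_locales (rule q)
  have sa: "q x \<le> nrm A x" if x: "x \<in> carrier A" "star A x = x" for x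
  proof (rule dense_ge)
    fix t assume t: "nrm A x < t"
    then have t0: "0 < t" using p_nonneg[OF x(1)] by linarith
    define h where "h = complex_of_real (1 / t) \<odot> x"
    have h: "h \<in> carrier A" "star A h = h" "nrm A h < 1"
      using x t t0 by (auto simp: h_def star_smult p_smult norm_divide)
    have hh: "h \<otimes> h \<in> carrier A" "star A (h \<otimes> h) = h \<otimes> h" "nrm A (h \<otimes> h) < 1"
      using h p_self_adjoint[of h] p_nonneg[of h] by (auto simp: star_mult abs_square_less_1)
    obtain y where y: "y \<in> carrier A" "star A y = y" "y \<otimes> y = \<one> \<ominus> h \<otimes> h"
      "\<forall>z \<in> carrier A. z \<otimes> (h \<otimes> h) = h \<otimes> h \<otimes> z \<longrightarrow> z \<otimes> y = y \<otimes> z"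
      using sqrt_exists[OF hh] by blast
    have "h \<otimes> y = y \<otimes> h" using bspec[OF y(4) h(1)] h(1) by (simp add: m_assoc)
    then have "(q h)\<^sup>2 \<le> q (h \<otimes> h \<oplus> y \<otimes> y)"
      using y(1,2) h by (intro q.p_square_le_sum_of_squares)
    also have "h \<otimes> h \<oplus> y \<otimes> y = \<one>" unfolding y(3) using h(1) by algebra
    finally have "(q h)\<^sup>2 \<le> 1\<^sup>2" using q.p_one by simp
    then have "q h \<le> 1" by (rule power2_le_imp_le) simp
    then show "q x \<le> t" using x t0 by (simp add: h_def q.p_smult norm_divide)
  qed
  have "(q x)\<^sup>2 \<le> (nrm A x)\<^sup>2"
    using sa[of "star A x \<otimes> x"] x q.p_star_mult[OF x] p_star_mult[OF x] by (simp add: star_mult)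
  then show ?thesis by (rule power2_le_imp_le) (use x in \<open>simp add: p_nonneg\<close>)
qed

text \<open>
  Positivity is expressed by the norm estimate \<open>\<parallel>t - a\<parallel> \<le> t\<close>, which for self-adjoint \<open>a\<close> says that the
  spectrum of \<open>a\<close> lies in \<open>[0, 2 t]\<close>.  In this form it passes to sums by the triangle inequality alone.
\<close>

definition pos :: "'a \<Rightarrow> bool" where
  "pos a \<longleftrightarrow> a \<in> carrier A \<and> (\<exists>t\<ge>0. nrm A (complex_of_real t \<odot> \<one> \<ominus> a) \<le> t)"

lemma pos_zero: "pos \<zero>"
  by (auto simp: pos_def a_minus_def intro!: exI[of _ 0])

lemma pos_add: assumes "pos a" "pos b" shows "pos (a \<oplus> b)"
proof -
  from assms obtain s t where st: "s \<ge> 0" "nrm A (complex_of_real s \<odot> \<one> \<ominus> a) \<le> s"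
     "t \<ge> 0" "nrm A (complex_of_real t \<odot> \<one> \<ominus> b) \<le> t" and c: "a \<in> carrier A" "b \<in> carrier A"
    by (auto simp: pos_def)
  let ?s = "complex_of_real s \<odot> \<one>" and ?t = "complex_of_real t \<odot> \<one>"
  have st': "?s \<in> carrier A" "?t \<in> carrier A" by auto
  have "complex_of_real (s + t) \<odot> \<one> \<ominus> (a \<oplus> b) = ?s \<oplus> ?t \<ominus> (a \<oplus> b)"
    by (simp add: smult_l_distr)
  also have "\<dots> = (?s \<ominus> a) \<oplus> (?t \<ominus> b)" using st' c by algebra
  finally have "nrm A (complex_of_real (s + t) \<odot> \<one> \<ominus> (a \<oplus> b)) \<le> s + t"
    using p_add[of "?s \<ominus> a" "?t \<ominus> b"] st c by simp
  then show ?thesis unfolding pos_def using st c by (intro conjI exI[of _ "s + t"]) auto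
qed

text \<open>
  After scaling to \<open>\<parallel>h\<parallel> < 1\<close>, a square root \<open>y\<close> of \<open>1 - h\<^sup>2\<close> exists, and \<open>y\<^sup>2 + h\<^sup>2 = 1\<close> yields
  \<open>\<parallel>1 - h\<^sup>2\<parallel> = \<parallel>y\<parallel>\<^sup>2 \<le> 1\<close>.
\<close>

lemma pos_square: assumes x: "x \<in> carrier A" "star A x = x" shows "pos (x \<otimes> x)"
proof -
  define t where "t = nrm A x + 1"
  have t: "0 < t" "nrm A x < t" using p_nonneg[OF x(1)] by (auto simp: t_def)
  define h where "h = complex_of_real (1 / t) \<odot> x"
  have h: "h \<in> carrier A" "star A h = h" "nrm A h < 1"
    using x t by (auto simp: h_def star_smult p_smult norm_divide)
  have hh: "h \<otimes> h \<in> carrier A" "star A (h \<otimes> h) = h \<otimes> h" "nrm A (h \<otimes> h) < 1"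
    using h p_self_adjoint[of h] p_nonneg[of h] by (auto simp: star_mult abs_square_less_1)
  obtain y where y: "y \<in> carrier A" "star A y = y" "y \<otimes> y = \<one> \<ominus> h \<otimes> h"
    "\<forall>z \<in> carrier A. z \<otimes> (h \<otimes> h) = h \<otimes> h \<otimes> z \<longrightarrow> z \<otimes> y = y \<otimes> z"
    using sqrt_exists[OF hh] by blast
  have "y \<otimes> h = h \<otimes> y" using bspec[OF y(4) h(1)] h(1) by (simp add: m_assoc)
  then have "(nrm A y)\<^sup>2 \<le> nrm A (y \<otimes> y \<oplus> h \<otimes> h)"
    using y(1,2) h by (intro p_square_le_sum_of_squares)
  also have "y \<otimes> y \<oplus> h \<otimes> h = \<one>" unfolding y(3) using h(1) by algebra
  finally have "nrm A (\<one> \<ominus> h \<otimes> h) \<le> 1" using p_one p_self_adjoint[of y] y(1-3) by simp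
  moreover have "complex_of_real (t * t) \<odot> \<one> \<ominus> x \<otimes> x = complex_of_real (t * t) \<odot> (\<one> \<ominus> h \<otimes> h)"
    using x t by (simp add: h_def smult_diff smult_l_assoc smult_r_assoc smult_smult)
  ultimately have "nrm A (complex_of_real (t * t) \<odot> \<one> \<ominus> x \<otimes> x) \<le> t * t"
    using h t by (simp add: p_smult del: of_real_mult)
  then show ?thesis unfolding pos_def using x t by (intro conjI exI[of _ "t * t"]) auto
qed

lemma pos_finsum:
  assumes "finite I" "\<And>i. i \<in> I \<Longrightarrow> pos (f i)"
  shows "pos (\<Oplus>i\<in>I. f i)"
  using assms
proof (induction I rule: finite_induct)
  case (insert i I)
  then have "f \<in> I \<rightarrow> carrier A" "f i \<in> carrier A" by (auto simp: pos_def)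
  then show ?case using insert by (simp add: pos_add)
qed (simp add: pos_zero)

text \<open>
  This makes the universal C*-algebras below exist: the entries of an orthogonal matrix of self-adjoint
  elements are bounded.  The sum \<open>a\<close> of the other squares is positive, say \<open>\<parallel>t - a\<parallel> \<le> t\<close>, and
  \<open>x\<^sub>i\<^sup>2 = 1 - a\<close>.  Completing \<open>x\<^sub>i\<^sup>2\<close> to a scalar by the square \<open>1 - (t - a) / s\<close> gives \<open>\<parallel>x\<^sub>i\<parallel>\<^sup>2 \<le> 2\<close>; any
  bound independent of the algebra suffices for the application.
\<close>

lemma bounded_of_squares_sum_one:
  assumes x: "\<And>k. k \<in> I \<Longrightarrow> x k \<in> carrier A" "\<And>k. k \<in> I \<Longrightarrow> star A (x k) = x k"
    and I: "finite I" "i \<in> I" and one: "(\<Oplus>k\<in>I. x k \<otimes> x k) = \<one>"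
  shows "nrm A (x i) \<le> 2"
proof -
  let ?x = "x i"
  have xi: "?x \<in> carrier A" "star A ?x = ?x" using x I by auto
  define a where "a = (\<Oplus>k\<in>I - {i}. x k \<otimes> x k)"
  have "pos a" unfolding a_def using x I by (intro pos_finsum pos_square) auto
  then obtain t where t: "t \<ge> 0" "nrm A (complex_of_real t \<odot> \<one> \<ominus> a) \<le> t" and a: "a \<in> carrier A"
    by (auto simp: pos_def)
  have xa: "?x \<otimes> ?x \<oplus> a = \<one>"
    unfolding a_def one[symmetric] using x I by (intro finsum_remove[symmetric]) auto
  have comm: "?x \<otimes> a = a \<otimes> ?x"
  proof -
    have "a = (?x \<otimes> ?x \<oplus> a) \<ominus> ?x \<otimes> ?x" using a xi(1) by algebra
    then have a': "a = \<one> \<ominus> ?x \<otimes> ?x" unfolding xa .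
    have "?x \<otimes> (\<one> \<ominus> ?x \<otimes> ?x) = (\<one> \<ominus> ?x \<otimes> ?x) \<otimes> ?x" using xi(1) by algebra
    then show ?thesis using a' by simp
  qed
  have sa: "star A a = a" unfolding a_def using x I
    by (subst star_finsum) (auto intro!: finsum_cong' simp: star_mult)
  \<comment> \<open>One more than \<open>t\<close>, because a square root of \<open>1 - h\<close> requires the strict inequality \<open>\<parallel>h\<parallel> < 1\<close>.\<close>
  define s where "s = t + 1"
  have s: "0 < s" "t < s" using t by (auto simp: s_def)
  define h where "h = complex_of_real (1 / s) \<odot> (complex_of_real t \<odot> \<one> \<ominus> a)"
  have h: "h \<in> carrier A" "star A h = h" using a sa by (auto simp: h_def star_smult star_diff)
  have "nrm A h = nrm A (complex_of_real t \<odot> \<one> \<ominus> a) / s"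
    unfolding h_def using a s by (simp add: p_smult norm_divide)
  also have "\<dots> < 1" using t s by simp
  finally have hn: "nrm A h < 1" .
  obtain y where y: "y \<in> carrier A" "star A y = y" "y \<otimes> y = \<one> \<ominus> h"
    "\<forall>z \<in> carrier A. z \<otimes> h = h \<otimes> z \<longrightarrow> z \<otimes> y = y \<otimes> z"
    using sqrt_exists[OF h hn] by blast
  define x' where "x' = complex_of_real (1 / sqrt s) \<odot> ?x"
  have x': "x' \<in> carrier A" "star A x' = x'" using xi by (auto simp: x'_def star_smult)
  have "?x \<otimes> h = h \<otimes> ?x" unfolding h_def using xi a comm
    by (simp add: smult_r_assoc smult_l_assoc a_minus_def r_distr l_distr r_minus l_minus)
  then have "?x \<otimes> y = y \<otimes> ?x" using y(4) xi by blast
  then have xy: "x' \<otimes> y = y \<otimes> x'" unfolding x'_def using xi y(1) by (simp add: smult_r_assoc smult_l_assoc)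
  have xx: "x' \<otimes> x' = complex_of_real (1 / s) \<odot> (?x \<otimes> ?x)" unfolding x'_def using xi s
    by (simp add: smult_r_assoc smult_l_assoc smult_smult flip: of_real_mult)
  let ?c = "complex_of_real (1 / s)"
  have "?c \<odot> (complex_of_real t \<odot> \<one>) = complex_of_real (t / s) \<odot> \<one>" by (simp add: smult_smult)
  then have hh: "h = complex_of_real (t / s) \<odot> \<one> \<ominus> ?c \<odot> a"
    unfolding h_def using a by (simp add: smult_diff)
  have "x' \<otimes> x' \<oplus> y \<otimes> y = ?c \<odot> (?x \<otimes> ?x) \<oplus> ?c \<odot> a \<oplus> (\<one> \<ominus> complex_of_real (t / s) \<odot> \<one>)"
    unfolding xx y(3) hh using xi(1) a by (simp add: a_minus_def minus_add) (simp add: a_ac)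
  also have "?c \<odot> (?x \<otimes> ?x) \<oplus> ?c \<odot> a = ?c \<odot> \<one>"
    unfolding xa[symmetric] using xi a by (simp add: smult_r_distr)
  also have "?c \<odot> \<one> \<oplus> (\<one> \<ominus> complex_of_real (t / s) \<odot> \<one>) = (?c + (1 + (- 1) * complex_of_real (t / s))) \<odot> \<one>"
    unfolding smult_l_distr[OF one_closed] a_minus_def minus_smult[OF smult_closed[OF one_closed]]
    by (simp add: smult_smult)
  also have "?c + (1 + (- 1) * complex_of_real (t / s)) = complex_of_real (1 / s + (1 - t / s))" by simp
  also have "1 / s + (1 - t / s) = 2 / s" using s by (simp add: s_def field_simps)
  finally have "x' \<otimes> x' \<oplus> y \<otimes> y = complex_of_real (2 / s) \<odot> \<one>" .
  then have "(nrm A x')\<^sup>2 \<le> nrm A (complex_of_real (2 / s) \<odot> \<one>)"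
    using p_square_le_sum_of_squares[OF x'(1) y(1) x'(2) y(2) xy] by simp
  also have "\<dots> = 2 / s * nrm A \<one>" using s by (simp add: p_smult norm_divide)
  also have "\<dots> \<le> 2 / s * 1" using p_one s by (intro mult_left_mono) auto
  finally have "(nrm A x')\<^sup>2 \<le> 2 / s" by simp
  moreover have "(nrm A x')\<^sup>2 = (nrm A ?x)\<^sup>2 / s"
    unfolding x'_def using xi s by (simp add: p_smult norm_divide power_divide)
  ultimately have "(nrm A ?x)\<^sup>2 \<le> 2" using s by (simp add: divide_le_cancel)
  then have "(nrm A ?x)\<^sup>2 \<le> 2\<^sup>2" by simp
  then show ?thesis by (rule power2_le_imp_le) simp
qed

lemma nrm_projection_le:
  assumes "e \<in> carrier A" "star A e = e" "e \<otimes> e = e" shows "nrm A e \<le> 1"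
proof -
  have "nrm A e = (nrm A e)\<^sup>2" using p_self_adjoint[of e] assms by simp
  then have "nrm A e * (1 - nrm A e) = 0" by (simp add: power2_eq_square algebra_simps)
  then show ?thesis by auto
qed

text \<open>
  A projection \<open>e\<close> is an extreme point of the unit ball of the corner \<open>e A e\<close>.  Averaging the squares of
  \<open>e \<plusminus> b\<close> gives \<open>\<parallel>e + b\<^sup>2\<parallel> \<le> 1\<close>.  For \<open>t > 1\<close> the corner then contains a square root of
  \<open>e - (e + b\<^sup>2) / t\<close>, and \<open>b\<^sup>2 / t\<close> added to its square is \<open>(1 - 1 / t) e\<close>; hence \<open>\<parallel>b\<parallel>\<^sup>2 \<le> t - 1\<close>, and \<open>t\<close>
  may be taken arbitrarily close to \<open>1\<close>.
\<close>

lemma projection_extreme: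
  assumes e: "e \<in> carrier A" "star A e = e" "e \<otimes> e = e"
    and b: "b \<in> carrier A" "star A b = b" "e \<otimes> b = b" "b \<otimes> e = b"
    and n: "nrm A (e \<oplus> b) \<le> 1" "nrm A (e \<ominus> b) \<le> 1"
  shows "b = \<zero>"
proof -
  let ?c = "e \<oplus> b \<otimes> b"
  have "(e \<oplus> b) \<otimes> (e \<oplus> b) \<oplus> (e \<ominus> b) \<otimes> (e \<ominus> b) = (e \<otimes> e \<oplus> b \<otimes> b) \<oplus> (e \<otimes> e \<oplus> b \<otimes> b)"
    using e(1) b(1) by algebra
  also have "\<dots> = 2 \<odot> ?c" using e b by (simp add: smult_2)
  finally have "2 * nrm A ?c = nrm A ((e \<oplus> b) \<otimes> (e \<oplus> b) \<oplus> (e \<ominus> b) \<otimes> (e \<ominus> b))"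
    using p_smult[of ?c 2] e b by simp
  also have "\<dots> \<le> nrm A ((e \<oplus> b) \<otimes> (e \<oplus> b)) + nrm A ((e \<ominus> b) \<otimes> (e \<ominus> b))"
    using e b by (intro p_add) auto
  also have "\<dots> = (nrm A (e \<oplus> b))\<^sup>2 + (nrm A (e \<ominus> b))\<^sup>2"
    using e b p_self_adjoint[of "e \<oplus> b"] p_self_adjoint[of "e \<ominus> b"] by (simp add: star_add star_diff)
  also have "\<dots> \<le> 1 + 1"
    using n e b by (intro add_mono power_le_one) (auto simp: p_nonneg)
  finally have cn: "nrm A ?c \<le> 1" by simp
  have "(nrm A b)\<^sup>2 \<le> r" if r: "r > 0" for r :: real
  proof -
    define t where "t = r + 1"
    have t: "1 < t" using r by (simp add: t_def)
    define h where "h = complex_of_real (1 / t) \<odot> ?c"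
    have h: "h \<in> carrier A" "star A h = h"
      using e b by (auto simp: h_def star_smult star_add star_mult)
    have "nrm A h = nrm A ?c / t"
      unfolding h_def using t e b by (simp add: p_smult norm_divide)
    then have hn: "nrm A h < 1" using cn t by simp
    obtain y where y: "y \<in> carrier A" "star A y = y" "y \<otimes> y = \<one> \<ominus> h"
      "\<forall>z \<in> carrier A. z \<otimes> h = h \<otimes> z \<longrightarrow> z \<otimes> y = y \<otimes> z"
      using sqrt_exists[OF h hn] by blast
    have bb: "e \<otimes> (b \<otimes> b) = b \<otimes> b" "b \<otimes> b \<otimes> e = b \<otimes> b" "b \<otimes> (b \<otimes> b) = b \<otimes> b \<otimes> b"
      using b e by (auto simp: m_assoc) (auto simp: m_assoc[symmetric])
    have he: "e \<otimes> h = h" "h \<otimes> e = h"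
      unfolding h_def using e b bb by (auto simp: smult_r_assoc smult_l_assoc r_distr l_distr)
    have hb: "b \<otimes> h = h \<otimes> b"
      unfolding h_def using e b bb by (auto simp: smult_r_assoc smult_l_assoc r_distr l_distr)
    have ye: "e \<otimes> y = y \<otimes> e" and yb: "b \<otimes> y = y \<otimes> b" using y(4) e(1) b(1) he hb by auto
    \<comment> \<open>The root \<open>y\<close> of \<open>1 - h\<close> is cut down to the corner; it commutes with \<open>e\<close> because \<open>h\<close> does.\<close>
    define y' where "y' = y \<otimes> e"
    have y': "y' \<in> carrier A" "star A y' = y'" using y(1,2) e ye by (auto simp: y'_def star_mult)
    have "y' \<otimes> y' = y \<otimes> (e \<otimes> y) \<otimes> e" unfolding y'_def using y(1) e(1) by (simp add: m_assoc)
    also have "\<dots> = (y \<otimes> y) \<otimes> (e \<otimes> e)" unfolding ye using y(1) e(1) by (simp add: m_assoc)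
    also have "\<dots> = e \<ominus> h" unfolding y(3) e(3) using e h he
      by (simp add: a_minus_def l_distr l_minus)
    finally have yy: "y' \<otimes> y' = e \<ominus> h" .
    define x where "x = complex_of_real (1 / sqrt t) \<odot> b"
    have x: "x \<in> carrier A" "star A x = x" using b by (auto simp: x_def star_smult)
    have "b \<otimes> y' = y' \<otimes> b" unfolding y'_def using yb b(1,3,4) e(1) y(1) ye by (metis m_assoc)
    then have xy: "x \<otimes> y' = y' \<otimes> x" unfolding x_def using b y' by (simp add: smult_r_assoc smult_l_assoc)
    have xx: "x \<otimes> x = complex_of_real (1 / t) \<odot> (b \<otimes> b)" unfolding x_def using b t
      by (simp add: smult_r_assoc smult_l_assoc smult_smult flip: of_real_mult)
    let ?i = "complex_of_real (1 / t)"
    have "x \<otimes> x \<oplus> y' \<otimes> y' = ?i \<odot> (b \<otimes> b) \<oplus> (e \<ominus> (?i \<odot> e \<oplus> ?i \<odot> (b \<otimes> b)))"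
      unfolding xx yy h_def using e b by (simp add: smult_r_distr)
    also have "\<dots> = e \<ominus> ?i \<odot> e"
    proof -
      have "?i \<odot> e \<in> carrier A" "?i \<odot> (b \<otimes> b) \<in> carrier A" using e b by auto
      then show ?thesis using e(1) by algebra
    qed
    also have "\<dots> = (1 + (- 1) * ?i) \<odot> e"
      using e unfolding smult_l_distr[OF e(1)] by (simp add: a_minus_def minus_smult smult_smult)
    also have "1 + (- 1) * ?i = complex_of_real (1 - 1 / t)" by simp
    finally have "x \<otimes> x \<oplus> y' \<otimes> y' = complex_of_real (1 - 1 / t) \<odot> e" .
    then have "(nrm A x)\<^sup>2 \<le> nrm A (complex_of_real (1 - 1 / t) \<odot> e)"
      using p_square_le_sum_of_squares[OF x(1) y'(1) x(2) y'(2) xy] by simp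
    also have "\<dots> = (1 - 1 / t) * nrm A e" using t e(1) by (simp only: p_smult norm_of_real) simp
    also have "\<dots> \<le> (1 - 1 / t) * 1" using nrm_projection_le[OF e] t by (intro mult_left_mono) auto
    finally have "(nrm A x)\<^sup>2 \<le> 1 - 1 / t" by simp
    moreover have "(nrm A x)\<^sup>2 = (nrm A b)\<^sup>2 / t"
      unfolding x_def using b t by (simp add: p_smult norm_divide power_divide)
    ultimately have "(nrm A b)\<^sup>2 \<le> t - 1" using t by (simp add: field_simps)
    then show ?thesis by (simp add: t_def)
  qed
  then have "(nrm A b)\<^sup>2 \<le> 0" using field_le_epsilon[of "(nrm A b)\<^sup>2" 0] by simp
  then have "nrm A b = 0" by simp
  then show ?thesis using nrm_zero_imp b by blast
qed

text \<open>
  Compressed to the corner of \<open>e = p\<^sub>i\<close>, the element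
  \<open>1 - p\<^sub>j\<close> becomes \<open>e - b\<close> with \<open>b = p\<^sub>i p\<^sub>j p\<^sub>i\<close>, and the sum of \<open>1 - p\<^sub>k\<close> over the remaining \<open>N\<close> indices
  becomes \<open>N e + b\<close>.  So both signs of \<open>b\<close> are controlled, and after scaling \<open>e\<close> is the midpoint of two
  elements of the unit ball: \<open>b = 0\<close> by extremality.
\<close>

lemma projections_orthogonal:
  assumes p: "\<And>k. k \<in> I \<Longrightarrow> p k \<in> carrier A" "\<And>k. k \<in> I \<Longrightarrow> star A (p k) = p k"
     "\<And>k. k \<in> I \<Longrightarrow> p k \<otimes> p k = p k"
    and I: "finite I" "i \<in> I" "j \<in> I" "i \<noteq> j" and one: "(\<Oplus>k\<in>I. p k) = \<one>"
  shows "p j \<otimes> p i = \<zero>"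
proof -
  let ?e = "p i" and ?q = "p j"
  have e: "?e \<in> carrier A" "star A ?e = ?e" "?e \<otimes> ?e = ?e"
    and q: "?q \<in> carrier A" "star A ?q = ?q" "?q \<otimes> ?q = ?q" using p I by auto
  define b where "b = ?e \<otimes> ?q \<otimes> ?e"
  have b: "b \<in> carrier A" "star A b = b" "?e \<otimes> b = b" "b \<otimes> ?e = b"
    unfolding b_def using e q by (auto simp: star_mult m_assoc) (auto simp: m_assoc[symmetric])
  have ne: "nrm A ?e \<le> 1" by (rule nrm_projection_le[OF e])
  have compl: "nrm A (\<one> \<ominus> p k) \<le> 1" if "k \<in> I" for k
  proof (rule nrm_projection_le)
    have k: "p k \<in> carrier A" using p that by auto
    have "(\<one> \<ominus> p k) \<otimes> (\<one> \<ominus> p k) = \<one> \<ominus> p k \<ominus> p k \<oplus> p k \<otimes> p k" using k by algebra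
    also have "\<dots> = \<one> \<ominus> p k" unfolding p(3)[OF that] using k by algebra
    finally show "(\<one> \<ominus> p k) \<otimes> (\<one> \<ominus> p k) = \<one> \<ominus> p k" .
  qed (use p that in \<open>auto simp: star_diff\<close>)
  define J where "J = I - {i} - {j}"
  define c where "c = (\<Oplus>k\<in>J. p k)"
  have c: "c \<in> carrier A" unfolding c_def J_def using p by (auto intro!: finsum_closed)
  have "(\<Oplus>k\<in>I. p k) = ?e \<oplus> (\<Oplus>k\<in>I - {i}. p k)" using p I by (intro finsum_remove) auto
  also have "(\<Oplus>k\<in>I - {i}. p k) = ?q \<oplus> c" unfolding c_def J_def using p I by (intro finsum_remove) auto
  finally have sum1: "?e \<oplus> (?q \<oplus> c) = \<one>" using one by simp
  define N where "N = real (card J)"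
  have "finite J" using I by (simp add: J_def)
  have J: "J \<subseteq> I" by (auto simp: J_def)
  have NJ: "(\<Oplus>k\<in>J. \<one> \<ominus> p k) = complex_of_real N \<odot> \<one> \<ominus> c"
    unfolding N_def c_def using \<open>finite J\<close> J
  proof (induction J rule: finite_induct)
    case (insert k K)
    let ?S = "finsum A p K" and ?n = "complex_of_real (real (card K)) \<odot> \<one>"
    have K: "p k \<in> carrier A" "?S \<in> carrier A" using insert p by (auto intro!: finsum_closed)
    have "(\<Oplus>k\<in>insert k K. \<one> \<ominus> p k) = (\<one> \<ominus> p k) \<oplus> (?n \<ominus> ?S)"
      using insert p by (subst finsum_insert) auto
    also have "\<dots> = (?n \<oplus> \<one>) \<ominus> (p k \<oplus> ?S)"
    proof -
      have "?n \<in> carrier A" by auto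
      then show ?thesis using K by algebra
    qed
    also have "p k \<oplus> ?S = finsum A p (insert k K)" using insert p by (subst finsum_insert) auto
    also have "?n \<oplus> \<one> = complex_of_real (real (card (insert k K))) \<odot> \<one>"
      using insert smult_l_distr[of \<one> "complex_of_real (real (card K))" 1] by (simp add: add.commute)
    finally show ?case .
  qed (simp add: a_minus_def)
  have "nrm A (complex_of_real N \<odot> \<one> \<ominus> c) \<le> (\<Sum>k\<in>J. nrm A (\<one> \<ominus> p k))"
    unfolding NJ[symmetric] using \<open>finite J\<close> J p by (intro p_finsum) auto
  also have "\<dots> \<le> N" using sum_mono[of J "\<lambda>k. nrm A (\<one> \<ominus> p k)" "\<lambda>_. 1"] compl J by (auto simp: N_def)
  finally have nc: "nrm A (complex_of_real N \<odot> \<one> \<ominus> c) \<le> N" .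
  let ?N = "complex_of_real N \<odot> \<one>" and ?Ne = "complex_of_real N \<odot> ?e"
  have comp: "?e \<otimes> (?N \<ominus> c) \<otimes> ?e = ?Ne \<oplus> b"
  proof -
    have "c = (?e \<oplus> (?q \<oplus> c)) \<ominus> ?e \<ominus> ?q" using e(1) q(1) c by algebra
    then have c': "c = \<one> \<ominus> ?e \<ominus> ?q" unfolding sum1 .
    have "?e \<otimes> (?N \<ominus> c) \<otimes> ?e = ?e \<otimes> ?N \<otimes> ?e \<ominus> ?e \<otimes> ?e \<oplus> ?e \<otimes> ?e \<otimes> ?e \<oplus> ?e \<otimes> ?q \<otimes> ?e"
    proof -
      have "?N \<in> carrier A" by auto
      then show ?thesis unfolding c' using e(1) q(1) by algebra
    qed
    then show ?thesis unfolding b_def e(3) using e q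
      by (simp add: smult_r_assoc smult_l_assoc a_minus_def a_assoc l_neg)
  qed
  have "nrm A (?Ne \<oplus> b) \<le> nrm A (?e \<otimes> (?N \<ominus> c)) * nrm A ?e"
    unfolding comp[symmetric] using e c by (intro p_mult) auto
  also have "\<dots> \<le> (nrm A ?e * nrm A (?N \<ominus> c)) * nrm A ?e"
    using e c by (intro mult_right_mono p_mult p_nonneg) auto
  also have "\<dots> \<le> (1 * N) * 1"
    using ne nc e c by (intro mult_mono) (auto simp: p_nonneg N_def)
  finally have n1: "nrm A (?Ne \<oplus> b) \<le> N" by simp
  \<comment> \<open>\<open>N\<close> itself may be \<open>0\<close>, whereas \<open>T\<close> can be divided by.\<close>
  define T where "T = N + 1"
  have T: "1 \<le> T" "N \<ge> 0" by (auto simp: T_def N_def)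
  have "complex_of_real T \<odot> ?e \<oplus> b = (?Ne \<oplus> b) \<oplus> ?e"
    unfolding T_def using e b by (simp add: smult_l_distr a_ac)
  then have n1': "nrm A (complex_of_real T \<odot> ?e \<oplus> b) \<le> T"
    using p_add[of "?Ne \<oplus> b" ?e] n1 ne e b by (simp add: T_def)
  have "?e \<otimes> (\<one> \<ominus> ?q) \<otimes> ?e = ?e \<ominus> b"
    unfolding b_def using e q by (simp add: a_minus_def r_distr l_distr r_minus l_minus)
  then have "nrm A (?e \<ominus> b) \<le> nrm A (?e \<otimes> (\<one> \<ominus> ?q)) * nrm A ?e"
    using e q p_mult[of "?e \<otimes> (\<one> \<ominus> ?q)" ?e] by simp
  also have "\<dots> \<le> (nrm A ?e * nrm A (\<one> \<ominus> ?q)) * nrm A ?e"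
    using e q by (intro mult_right_mono p_mult p_nonneg) auto
  also have "\<dots> \<le> (1 * 1) * 1"
    using ne compl[OF I(3)] e q by (intro mult_mono) (auto simp: p_nonneg)
  finally have n2: "nrm A (?e \<ominus> b) \<le> 1" by simp
  have "complex_of_real T \<odot> ?e \<ominus> b = ?Ne \<oplus> (?e \<ominus> b)"
    unfolding T_def using e b by (simp add: smult_l_distr a_minus_def a_ac)
  then have "nrm A (complex_of_real T \<odot> ?e \<ominus> b) \<le> nrm A ?Ne + nrm A (?e \<ominus> b)"
    using p_add[of ?Ne "?e \<ominus> b"] e b by simp
  also have "\<dots> \<le> T" using n2 ne e T mult_left_mono[OF ne T(2)] by (simp add: p_smult T_def)
  finally have n2': "nrm A (complex_of_real T \<odot> ?e \<ominus> b) \<le> T" .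
  define b' where "b' = complex_of_real (1 / T) \<odot> b"
  have i: "complex_of_real (1 / T) \<odot> (complex_of_real T \<odot> ?e) = ?e"
    using T e by (simp add: smult_smult)
  have "?e \<oplus> b' = complex_of_real (1 / T) \<odot> (complex_of_real T \<odot> ?e \<oplus> b)"
    unfolding b'_def using e b i by (simp add: smult_r_distr)
  then have m1: "nrm A (?e \<oplus> b') \<le> 1" using n1' T e b by (simp add: p_smult norm_divide)
  have "?e \<ominus> b' = complex_of_real (1 / T) \<odot> (complex_of_real T \<odot> ?e \<ominus> b)"
    unfolding b'_def using e b i by (simp add: smult_diff)
  then have m2: "nrm A (?e \<ominus> b') \<le> 1" using n2' T e b by (simp add: p_smult norm_divide)
  have "b' = \<zero>"
    by (rule projection_extreme[OF e _ _ _ _ m1 m2])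
      (use b e in \<open>auto simp: b'_def star_smult smult_r_assoc smult_l_assoc\<close>)
  then have "complex_of_real T \<odot> b' = \<zero>" by simp
  then have "b = \<zero>" unfolding b'_def using T b by (simp add: smult_smult)
  moreover have "star A (?q \<otimes> ?e) \<otimes> (?q \<otimes> ?e) = b"
  proof -
    have "star A (?q \<otimes> ?e) \<otimes> (?q \<otimes> ?e) = ?e \<otimes> (?q \<otimes> ?q) \<otimes> ?e"
      using e(1,2) q(1,2) by (simp add: star_mult m_assoc)
    then show ?thesis by (simp add: q(3) b_def)
  qed
  ultimately have "(nrm A (?q \<otimes> ?e))\<^sup>2 = 0" using p_star_mult[of "?q \<otimes> ?e"] e q by simp
  then show ?thesis using nrm_zero_imp[of "?q \<otimes> ?e"] e q by simp
qed

end

section \<open>$*$-homomorphisms\<close>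

locale star_morphism = A: star_alg A + B: star_alg B
  for A :: "('a, 'r) star_algebra_scheme" and B :: "('b, 's) star_algebra_scheme" +
  fixes h :: "'a \<Rightarrow> 'b"
  assumes star_hom: "h \<in> star_hom A B"
begin

lemma hom_closed [simp, intro]: "x \<in> carrier A \<Longrightarrow> h x \<in> carrier B"
  and hom_add: "\<lbrakk>x \<in> carrier A; y \<in> carrier A\<rbrakk> \<Longrightarrow> h (x \<oplus>\<^bsub>A\<^esub> y) = h x \<oplus>\<^bsub>B\<^esub> h y"
  and hom_mult: "\<lbrakk>x \<in> carrier A; y \<in> carrier A\<rbrakk> \<Longrightarrow> h (x \<otimes>\<^bsub>A\<^esub> y) = h x \<otimes>\<^bsub>B\<^esub> h y"
  and hom_one [simp]: "h \<one>\<^bsub>A\<^esub> = \<one>\<^bsub>B\<^esub>"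
  and hom_smult: "x \<in> carrier A \<Longrightarrow> h (c \<odot>\<^bsub>A\<^esub> x) = c \<odot>\<^bsub>B\<^esub> h x"
  and hom_star: "x \<in> carrier A \<Longrightarrow> h (star A x) = star B (h x)"
  using star_hom by (auto simp: star_hom_def ring_hom_def)

lemma hom_zero [simp]: "h \<zero>\<^bsub>A\<^esub> = \<zero>\<^bsub>B\<^esub>"
  using hom_smult[of "\<zero>\<^bsub>A\<^esub>" 0] by simp

lemma hom_diff: "\<lbrakk>x \<in> carrier A; y \<in> carrier A\<rbrakk> \<Longrightarrow> h (x \<ominus>\<^bsub>A\<^esub> y) = h x \<ominus>\<^bsub>B\<^esub> h y"
  by (simp add: a_minus_def A.minus_smult B.minus_smult hom_add hom_smult)

lemma hom_finsum:
  assumes "f \<in> I \<rightarrow> carrier A"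
  shows "h (finsum A f I) = finsum B (\<lambda>i. h (f i)) I"
  using assms
proof (induction I rule: infinite_finite_induct)
  case (insert i I)
  then show ?case by (simp add: hom_add Pi_def A.finsum_closed)
qed auto

text \<open>
  Homomorphisms pull back C*-seminorms.  This is how a representation of an algebra enters its
  universal norm.
\<close>

lemma seminorm_comp:
  assumes "cstar_seminorm B q" shows "cstar_seminorm A (\<lambda>x. q (h x))"
  using assms unfolding cstar_seminorm_def
  by (simp add: hom_add hom_smult hom_mult hom_star)

end

lemma star_hom_contractive:
  assumes "cstar_alg A" "cstar_alg B" "h \<in> star_hom A B" "x \<in> carrier A"
  shows "nrm B (h x) \<le> nrm A x"
proof -
  interpret A: cstar_alg A by fact
  interpret B: cstar_alg B by fact
  interpret star_morphism A B h by unfold_locales fact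
  show ?thesis using A.seminorm_le_nrm[OF seminorm_comp[OF B.seminorm] assms(4)] .
qed

section \<open>Completion\<close>

context seminormed
begin

abbreviation "cauchy \<equiv> cauchy_seqs A p"
abbreviation "cls \<equiv> seq_class A p"
abbreviation "C \<equiv> completion A p"

lemma cauchyD: "s \<in> cauchy \<Longrightarrow> s k \<in> carrier A"
  and cauchyD': "\<lbrakk>s \<in> cauchy; 0 < e\<rbrakk> \<Longrightarrow> \<exists>N. \<forall>k\<ge>N. \<forall>l\<ge>N. p (s k \<ominus> s l) < e"
  by (auto simp: cauchy_seqs_def)

lemma cauchyI: "\<lbrakk>\<And>k. s k \<in> carrier A; \<And>e. 0 < e \<Longrightarrow> \<exists>N. \<forall>k\<ge>N. \<forall>l\<ge>N. p (s k \<ominus> s l) < e\<rbrakk> \<Longrightarrow> s \<in> cauchy"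
  by (auto simp: cauchy_seqs_def)

lemma cauchy_const: "x \<in> carrier A \<Longrightarrow> (\<lambda>_. x) \<in> cauchy"
  by (auto simp: cauchy_seqs_def a_minus_def r_neg)

text \<open>
  All operations of the completion are covered by this estimate; products need it with the bounds of
  the two factors as coefficients.
\<close>

lemma cauchy_dominated:
  assumes "\<And>k. u k \<in> carrier A" "s \<in> cauchy" "t \<in> cauchy" "0 \<le> a" "0 \<le> b"
    "\<And>k l. p (u k \<ominus> u l) \<le> a * p (s k \<ominus> s l) + b * p (t k \<ominus> t l)"
  shows "u \<in> cauchy"
proof (rule cauchyI)
  fix e :: real assume e: "0 < e"
  define d where "d = e / (a + b + 1)"
  have d: "0 < d" using e assms(4,5) by (simp add: d_def)
  obtain M N where M: "\<And>k l. k \<ge> M \<Longrightarrow> l \<ge> M \<Longrightarrow> p (s k \<ominus> s l) < d"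
    and N: "\<And>k l. k \<ge> N \<Longrightarrow> l \<ge> N \<Longrightarrow> p (t k \<ominus> t l) < d"
    using cauchyD'[OF assms(2) d] cauchyD'[OF assms(3) d] by blast
  have "p (u k \<ominus> u l) < e" if "k \<ge> max M N" "l \<ge> max M N" for k l
  proof -
    have "p (u k \<ominus> u l) \<le> a * p (s k \<ominus> s l) + b * p (t k \<ominus> t l)" by fact
    also have "\<dots> \<le> a * d + b * d"
      using M[of k l] N[of k l] that assms(4,5) by (intro add_mono mult_left_mono) auto
    also have "\<dots> < (a + b + 1) * d" using d by (simp add: algebra_simps)
    also have "\<dots> = e" using assms(4,5) by (simp add: d_def)
    finally show ?thesis .
  qed
  then show "\<exists>N. \<forall>k\<ge>N. \<forall>l\<ge>N. p (u k \<ominus> u l) < e" by blast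
qed (use assms in auto)

lemma cauchy_add: assumes "s \<in> cauchy" "t \<in> cauchy" shows "(\<lambda>k. s k \<oplus> t k) \<in> cauchy"
proof (rule cauchy_dominated[OF _ assms, of _ 1 1])
  note c = cauchyD[OF assms(1)] cauchyD[OF assms(2)]
  fix k l
  have "s k \<oplus> t k \<ominus> (s l \<oplus> t l) = (s k \<ominus> s l) \<oplus> (t k \<ominus> t l)" using c by algebra
  then show "p (s k \<oplus> t k \<ominus> (s l \<oplus> t l)) \<le> 1 * p (s k \<ominus> s l) + 1 * p (t k \<ominus> t l)"
    using p_add c by simp
qed (use assms cauchyD in auto)

lemma cauchy_smult: assumes "s \<in> cauchy" shows "(\<lambda>k. c \<odot> s k) \<in> cauchy"
  by (rule cauchy_dominated[OF _ assms assms, of _ "cmod c" 0])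
    (use cauchyD[OF assms] in \<open>auto simp: smult_diff[symmetric] p_smult\<close>)

lemma cauchy_star: assumes "s \<in> cauchy" shows "(\<lambda>k. star A (s k)) \<in> cauchy"
  by (rule cauchy_dominated[OF _ assms assms, of _ 1 0])
    (use cauchyD[OF assms] in \<open>auto simp: star_diff[symmetric]\<close>)

lemma cauchy_convergent: assumes "s \<in> cauchy" shows "convergent (\<lambda>k. p (s k))"
proof -
  have "Cauchy (\<lambda>k. p (s k))"
  proof (rule metric_CauchyI)
    fix e :: real assume e: "0 < e"
    obtain N where N: "\<forall>k\<ge>N. \<forall>l\<ge>N. p (s k \<ominus> s l) < e" using cauchyD'[OF assms e] by blast
    have "dist (p (s k)) (p (s l)) \<le> p (s k \<ominus> s l)" for k l
      using p_diff_abs[OF cauchyD[OF assms] cauchyD[OF assms]] by (simp add: dist_real_def)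
    then show "\<exists>M. \<forall>m\<ge>M. \<forall>n\<ge>M. dist (p (s m)) (p (s n)) < e" using N by (meson le_less_trans)
  qed
  then show ?thesis by (rule Cauchy_convergent)
qed

lemma cauchy_bounded: assumes "s \<in> cauchy" shows "\<exists>B\<ge>0. \<forall>k. p (s k) \<le> B"
proof -
  have "Bseq (\<lambda>k. p (s k))" using cauchy_convergent[OF assms] by (rule convergent_imp_Bseq)
  then obtain K where K: "0 < K" "\<And>k. norm (p (s k)) \<le> K" by (auto simp: Bseq_def)
  have "p (s k) \<le> K" for k using K(2)[of k] by auto
  then show ?thesis using K(1) by (intro exI[of _ K]) auto
qed

lemma cauchy_mult: assumes "s \<in> cauchy" "t \<in> cauchy" shows "(\<lambda>k. s k \<otimes> t k) \<in> cauchy"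
proof -
  note c = cauchyD[OF assms(1)] cauchyD[OF assms(2)]
  obtain K where K: "0 \<le> K" "\<And>k. p (s k) \<le> K" using cauchy_bounded[OF assms(1)] by blast
  obtain L where L: "0 \<le> L" "\<And>k. p (t k) \<le> L" using cauchy_bounded[OF assms(2)] by blast
  show ?thesis
  proof (rule cauchy_dominated[OF _ assms L(1) K(1)])
    fix k l
    have "s k \<otimes> t k \<ominus> s l \<otimes> t l = (s k \<ominus> s l) \<otimes> t k \<oplus> s l \<otimes> (t k \<ominus> t l)"
      using c by algebra
    then have "p (s k \<otimes> t k \<ominus> s l \<otimes> t l) \<le> p (s k \<ominus> s l) * p (t k) + p (s l) * p (t k \<ominus> t l)"
      using p_add[of "(s k \<ominus> s l) \<otimes> t k" "s l \<otimes> (t k \<ominus> t l)"] p_mult[of "s k \<ominus> s l" "t k"]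
        p_mult[of "s l" "t k \<ominus> t l"] c by simp
    also have "\<dots> \<le> L * p (s k \<ominus> s l) + K * p (t k \<ominus> t l)"
      using K(2)[of l] L(2)[of k] c
      by (subst mult.commute) (intro add_mono mult_right_mono; simp add: p_nonneg)
    finally show "p (s k \<otimes> t k \<ominus> s l \<otimes> t l) \<le> L * p (s k \<ominus> s l) + K * p (t k \<ominus> t l)" .
  qed (use c in auto)
qed

text \<open>
  The congruence whose classes are the elements of the completion.
\<close>

definition null :: "(nat \<Rightarrow> 'a) \<Rightarrow> (nat \<Rightarrow> 'a) \<Rightarrow> bool" where
  "null s t \<longleftrightarrow> (\<lambda>k. p (s k \<ominus> t k)) \<longlonglongrightarrow> 0"

lemma nullI:
  assumes "\<And>k. s k \<in> carrier A" "\<And>k. t k \<in> carrier A" "\<And>k. p (s k \<ominus> t k) \<le> b k" "b \<longlonglongrightarrow> 0"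
  shows "null s t"
  unfolding null_def by (rule tendsto_sandwich[OF _ _ tendsto_const assms(4)])
    (use assms in \<open>auto intro!: always_eventually p_nonneg\<close>)

lemma null_refl: "s \<in> cauchy \<Longrightarrow> null s s"
  using cauchyD[of s] by (simp add: null_def a_minus_def r_neg)

lemma null_sym: assumes "null s t" "s \<in> cauchy" "t \<in> cauchy" shows "null t s"
  using assms(1) unfolding null_def
  by (subst p_diff_commute) (use assms(2,3) cauchyD in auto)

lemma null_trans:
  assumes "null s t" "null t u" "s \<in> cauchy" "t \<in> cauchy" "u \<in> cauchy" shows "null s u"
proof (rule nullI)
  show "p (s k \<ominus> u k) \<le> p (s k \<ominus> t k) + p (t k \<ominus> u k)" for k
    by (rule p_diff_triangle) (use assms cauchyD in auto)
  show "(\<lambda>k. p (s k \<ominus> t k) + p (t k \<ominus> u k)) \<longlonglongrightarrow> 0"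
    using tendsto_add[of "\<lambda>k. p (s k \<ominus> t k)" 0 _ "\<lambda>k. p (t k \<ominus> u k)" 0] assms(1,2)
    by (simp add: null_def)
qed (use assms cauchyD in auto)

lemma mem_cls: "t \<in> cls s \<longleftrightarrow> t \<in> cauchy \<and> null s t"
  by (auto simp: seq_class_def null_def)

lemma cls_eq: assumes "s \<in> cauchy" "t \<in> cauchy" shows "cls s = cls t \<longleftrightarrow> null s t"
proof
  assume "cls s = cls t"
  then show "null s t" using null_refl[OF assms(2)] assms(2) mem_cls by blast
next
  assume st: "null s t"
  show "cls s = cls t"
    using null_trans[OF st] null_trans[OF null_sym[OF st assms]] assms by (auto simp: mem_cls)
qed

lemma self_mem_cls: "s \<in> cauchy \<Longrightarrow> s \<in> cls s"
  by (simp add: mem_cls null_refl)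

lemma carrier_C: "carrier C = cls ` cauchy"
  and one_C: "one C = cls (\<lambda>_. \<one>)"
  and zero_C: "zero C = cls (\<lambda>_. \<zero>)"
  by (simp_all add: completion_def)

lemma carrier_CE: assumes "P \<in> carrier C" obtains s where "s \<in> cauchy" "P = cls s"
  using assms carrier_C by auto

lemma cls_carrier: "s \<in> cauchy \<Longrightarrow> cls s \<in> carrier C"
  by (simp add: carrier_C)

lemma cls_add:
  assumes "s \<in> cauchy" "t \<in> cauchy"
  shows "cls s \<oplus>\<^bsub>C\<^esub> cls t = cls (\<lambda>k. s k \<oplus> t k)"
proof -
  have eq: "cls (\<lambda>k. s k \<oplus> t k) = cls (\<lambda>k. s' k \<oplus> t' k)"
    if "s' \<in> cauchy" "null s s'" "t' \<in> cauchy" "null t t'" for s' t'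
  proof (subst cls_eq)
    show "null (\<lambda>k. s k \<oplus> t k) (\<lambda>k. s' k \<oplus> t' k)"
    proof (rule nullI)
      note c = cauchyD[OF assms(1)] cauchyD[OF assms(2)] cauchyD[OF that(1)] cauchyD[OF that(3)]
      show "p (s k \<oplus> t k \<ominus> (s' k \<oplus> t' k)) \<le> p (s k \<ominus> s' k) + p (t k \<ominus> t' k)" for k
      proof -
        have "s k \<oplus> t k \<ominus> (s' k \<oplus> t' k) = (s k \<ominus> s' k) \<oplus> (t k \<ominus> t' k)" using c by algebra
        then show ?thesis using p_add c by simp
      qed
      show "(\<lambda>k. p (s k \<ominus> s' k) + p (t k \<ominus> t' k)) \<longlonglongrightarrow> 0"
        using tendsto_add[of "\<lambda>k. p (s k \<ominus> s' k)" 0 _ "\<lambda>k. p (t k \<ominus> t' k)" 0] that by (simp add: null_def)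
    qed (use that assms cauchyD in auto)
  qed (use assms that in \<open>auto intro: cauchy_add\<close>)
  have "cls s \<oplus>\<^bsub>C\<^esub> cls t = (\<Union>s'\<in>cls s. \<Union>t'\<in>cls t. cls (\<lambda>k. s' k \<oplus> t' k))"
    by (simp add: completion_def)
  also have "\<dots> = (\<Union>s'\<in>cls s. \<Union>t'\<in>cls t. cls (\<lambda>k. s k \<oplus> t k))"
    using eq by (intro SUP_cong refl) (auto simp: mem_cls)
  also have "\<dots> = cls (\<lambda>k. s k \<oplus> t k)" using self_mem_cls assms by auto
  finally show ?thesis .
qed

lemma cls_mult:
  assumes "s \<in> cauchy" "t \<in> cauchy"
  shows "cls s \<otimes>\<^bsub>C\<^esub> cls t = cls (\<lambda>k. s k \<otimes> t k)"
proof -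
  have eq: "cls (\<lambda>k. s k \<otimes> t k) = cls (\<lambda>k. s' k \<otimes> t' k)"
    if st: "s' \<in> cauchy" "null s s'" "t' \<in> cauchy" "null t t'" for s' t'
  proof (subst cls_eq)
    obtain K where K: "0 \<le> K" "\<And>k. p (t k) \<le> K" using cauchy_bounded[OF assms(2)] by blast
    obtain L where L: "0 \<le> L" "\<And>k. p (s' k) \<le> L" using cauchy_bounded[OF st(1)] by blast
    show "null (\<lambda>k. s k \<otimes> t k) (\<lambda>k. s' k \<otimes> t' k)"
    proof (rule nullI)
      note c = cauchyD[OF assms(1)] cauchyD[OF assms(2)] cauchyD[OF st(1)] cauchyD[OF st(3)]
      show "p (s k \<otimes> t k \<ominus> s' k \<otimes> t' k) \<le> p (s k \<ominus> s' k) * K + L * p (t k \<ominus> t' k)" for k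
      proof -
        have "s k \<otimes> t k \<ominus> s' k \<otimes> t' k = (s k \<ominus> s' k) \<otimes> t k \<oplus> s' k \<otimes> (t k \<ominus> t' k)" using c by algebra
        then have "p (s k \<otimes> t k \<ominus> s' k \<otimes> t' k) \<le> p (s k \<ominus> s' k) * p (t k) + p (s' k) * p (t k \<ominus> t' k)"
          using p_add[of "(s k \<ominus> s' k) \<otimes> t k" "s' k \<otimes> (t k \<ominus> t' k)"] p_mult[of "s k \<ominus> s' k" "t k"]
            p_mult[of "s' k" "t k \<ominus> t' k"] c by simp
        also have "\<dots> \<le> p (s k \<ominus> s' k) * K + L * p (t k \<ominus> t' k)"
          using K L c by (intro add_mono mult_right_mono mult_left_mono) (auto simp: p_nonneg)
        finally show ?thesis .
      qed
      show "(\<lambda>k. p (s k \<ominus> s' k) * K + L * p (t k \<ominus> t' k)) \<longlonglongrightarrow> 0"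
        using st unfolding null_def
        by (auto intro!: tendsto_add_zero tendsto_mult_left_zero tendsto_mult_right_zero)
    qed (use st assms cauchyD in auto)
  qed (use assms st in \<open>auto intro: cauchy_mult\<close>)
  have "cls s \<otimes>\<^bsub>C\<^esub> cls t = (\<Union>s'\<in>cls s. \<Union>t'\<in>cls t. cls (\<lambda>k. s' k \<otimes> t' k))"
    by (simp add: completion_def)
  also have "\<dots> = (\<Union>s'\<in>cls s. \<Union>t'\<in>cls t. cls (\<lambda>k. s k \<otimes> t k))"
    using eq by (intro SUP_cong refl) (auto simp: mem_cls)
  also have "\<dots> = cls (\<lambda>k. s k \<otimes> t k)" using self_mem_cls assms by auto
  finally show ?thesis .
qed

lemma cls_smult:
  assumes "s \<in> cauchy"
  shows "c \<odot>\<^bsub>C\<^esub> cls s = cls (\<lambda>k. c \<odot> s k)"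
proof -
  have eq: "cls (\<lambda>k. c \<odot> s k) = cls (\<lambda>k. c \<odot> s' k)" if "s' \<in> cauchy" "null s s'" for s'
  proof (subst cls_eq)
    show "null (\<lambda>k. c \<odot> s k) (\<lambda>k. c \<odot> s' k)"
    proof (rule nullI)
      show "p (c \<odot> s k \<ominus> c \<odot> s' k) \<le> cmod c * p (s k \<ominus> s' k)" for k
        using cauchyD[OF assms] cauchyD[OF that(1)] by (simp add: smult_diff[symmetric] p_smult)
      show "(\<lambda>k. cmod c * p (s k \<ominus> s' k)) \<longlonglongrightarrow> 0"
        using that unfolding null_def by (auto intro!: tendsto_mult_right_zero)
    qed (use that assms cauchyD in auto)
  qed (use assms that in \<open>auto intro: cauchy_smult\<close>)
  have "c \<odot>\<^bsub>C\<^esub> cls s = (\<Union>s'\<in>cls s. cls (\<lambda>k. c \<odot> s' k))" by (simp add: completion_def)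
  also have "\<dots> = (\<Union>s'\<in>cls s. cls (\<lambda>k. c \<odot> s k))"
    using eq by (intro SUP_cong refl) (auto simp: mem_cls)
  also have "\<dots> = cls (\<lambda>k. c \<odot> s k)" using self_mem_cls assms by auto
  finally show ?thesis .
qed

lemma cls_star:
  assumes "s \<in> cauchy"
  shows "star C (cls s) = cls (\<lambda>k. star A (s k))"
proof -
  have eq: "cls (\<lambda>k. star A (s k)) = cls (\<lambda>k. star A (s' k))" if "s' \<in> cauchy" "null s s'" for s'
  proof (subst cls_eq)
    show "null (\<lambda>k. star A (s k)) (\<lambda>k. star A (s' k))"
      using that cauchyD[OF assms] cauchyD[OF that(1)] by (simp add: null_def star_diff[symmetric])
  qed (use assms that in \<open>auto intro: cauchy_star\<close>)
  have "star C (cls s) = (\<Union>s'\<in>cls s. cls (\<lambda>k. star A (s' k)))" by (simp add: completion_def)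
  also have "\<dots> = (\<Union>s'\<in>cls s. cls (\<lambda>k. star A (s k)))"
    using eq by (intro SUP_cong refl) (auto simp: mem_cls)
  also have "\<dots> = cls (\<lambda>k. star A (s k))" using self_mem_cls assms by auto
  finally show ?thesis .
qed

lemma cls_nrm:
  assumes "s \<in> cauchy"
  shows "(\<lambda>k. p (s k)) \<longlonglongrightarrow> nrm C (cls s)"
proof -
  obtain r where r: "(\<lambda>k. p (s k)) \<longlonglongrightarrow> r"
    using cauchy_convergent[OF assms] by (auto simp: convergent_def)
  have "r' = r" if "t \<in> cls s" "(\<lambda>k. p (t k)) \<longlonglongrightarrow> r'" for t r'
  proof -
    have t: "t \<in> cauchy" "null s t" using that by (auto simp: mem_cls)
    have "(\<lambda>k. p (s k) - p (t k)) \<longlonglongrightarrow> 0"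
      by (rule tendsto_rabs_zero_cancel, rule tendsto_sandwich[OF _ _ tendsto_const t(2)[unfolded null_def]])
        (use cauchyD[OF assms] cauchyD[OF t(1)] in \<open>auto intro!: always_eventually p_diff_abs\<close>)
    moreover have "(\<lambda>k. p (s k) - p (t k)) \<longlonglongrightarrow> r - r'" by (intro tendsto_diff r that)
    ultimately show ?thesis using LIMSEQ_unique by fastforce
  qed
  note uniq = this
  have "nrm C (cls s) = (THE r. \<exists>s'\<in>cls s. (\<lambda>k. p (s' k)) \<longlonglongrightarrow> r)"
    by (simp add: completion_def)
  also have "\<dots> = r"
  proof (rule the_equality)
    show "\<exists>s'\<in>cls s. (\<lambda>k. p (s' k)) \<longlonglongrightarrow> r" using r self_mem_cls[OF assms] by blast
  qed (use uniq in blast)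
  finally have "nrm C (cls s) = r" .
  then show ?thesis using r by simp
qed

lemma completion_star_alg: "star_alg C"
proof -
  have ab: "abelian_group C"
  proof (rule abelian_groupI)
    show "\<exists>y\<in>carrier C. y \<oplus>\<^bsub>C\<^esub> x = \<zero>\<^bsub>C\<^esub>" if x: "x \<in> carrier C" for x
    proof -
      obtain s where s: "s \<in> cauchy" "x = cls s" using x by (rule carrier_CE)
      have "cls (\<lambda>k. (- 1) \<odot> s k) \<oplus>\<^bsub>C\<^esub> x = \<zero>\<^bsub>C\<^esub>"
        using s cauchy_smult[OF s(1), of "-1"] cauchyD[OF s(1)]
        by (simp add: cls_add zero_C minus_smult[symmetric] l_neg)
      then show ?thesis using cls_carrier[OF cauchy_smult[OF s(1), of "-1"]] by blast
    qed
  qed (auto elim!: carrier_CE simp: zero_C cls_add cls_carrier cauchy_add cauchy_const cauchyD a_ac)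
  have mon: "monoid C"
    by (rule monoidI)
      (auto elim!: carrier_CE simp: one_C cls_mult cls_carrier cauchy_mult cauchy_const cauchyD m_assoc)
  have "ring C"
    by (rule ringI[OF ab mon])
      (auto elim!: carrier_CE simp: cls_add cls_mult cauchy_add cauchy_mult cauchyD l_distr r_distr)
  then interpret C: ring C .
  show ?thesis
    by unfold_locales
      (auto elim!: carrier_CE simp: cls_add cls_mult cls_smult cls_star cauchy_add cauchy_mult cauchy_smult
        cauchy_star cls_carrier cauchyD smult_r_distr smult_l_distr smult_smult smult_l_assoc smult_r_assoc
        star_add star_mult star_smult)
qed

sublocale C: star_alg C by (rule completion_star_alg)

lemma cauchy_diff: assumes "s \<in> cauchy" "t \<in> cauchy" shows "(\<lambda>k. s k \<ominus> t k) \<in> cauchy"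
  using cauchy_add[OF assms(1) cauchy_smult[OF assms(2), of "-1"]] cauchyD[OF assms(2)]
  by (simp add: a_minus_def minus_smult)

lemma cls_diff: assumes "s \<in> cauchy" "t \<in> cauchy" shows "cls s \<ominus>\<^bsub>C\<^esub> cls t = cls (\<lambda>k. s k \<ominus> t k)"
  using assms cauchyD[OF assms(2)] cauchy_smult[OF assms(2), of "-1"]
  by (simp add: a_minus_def minus_smult C.minus_smult cls_carrier cls_smult cls_add)

lemma completion_seminorm: "cstar_seminorm C (nrm C)"
  unfolding cstar_seminorm_def
proof (intro conjI ballI allI)
  fix x y c assume "x \<in> carrier C" "y \<in> carrier C"
  then obtain s t where s: "s \<in> cauchy" "x = cls s" and t: "t \<in> cauchy" "y = cls t"
    by (metis carrier_CE)
  note c = cauchyD[OF s(1)] cauchyD[OF t(1)]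
  show "0 \<le> nrm C x"
    unfolding s by (rule LIMSEQ_le_const[OF cls_nrm[OF s(1)]]) (use c in \<open>auto intro: p_nonneg\<close>)
  show "nrm C (x \<oplus>\<^bsub>C\<^esub> y) \<le> nrm C x + nrm C y"
    unfolding s t cls_add[OF s(1) t(1)]
    by (rule LIMSEQ_le[OF cls_nrm[OF cauchy_add[OF s(1) t(1)]] tendsto_add[OF cls_nrm[OF s(1)] cls_nrm[OF t(1)]]])
      (use c p_add in auto)
  show "nrm C (x \<otimes>\<^bsub>C\<^esub> y) \<le> nrm C x * nrm C y"
    unfolding s t cls_mult[OF s(1) t(1)]
    by (rule LIMSEQ_le[OF cls_nrm[OF cauchy_mult[OF s(1) t(1)]] tendsto_mult[OF cls_nrm[OF s(1)] cls_nrm[OF t(1)]]])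
      (use c p_mult in auto)
  have "(\<lambda>k. p (c \<odot> s k)) \<longlonglongrightarrow> cmod c * nrm C x"
    unfolding s using tendsto_mult[OF tendsto_const cls_nrm[OF s(1)]] c by (simp add: p_smult)
  then show "nrm C (c \<odot>\<^bsub>C\<^esub> x) = cmod c * nrm C x"
    using cls_nrm[OF cauchy_smult[OF s(1)]] LIMSEQ_unique unfolding s cls_smult[OF s(1)] by blast
  have "(\<lambda>k. p (star A (s k) \<otimes> s k)) \<longlonglongrightarrow> (nrm C x)\<^sup>2"
    unfolding s using tendsto_power[OF cls_nrm[OF s(1)]] c by (simp add: p_star_mult)
  then show "nrm C (star C x \<otimes>\<^bsub>C\<^esub> x) = (nrm C x)\<^sup>2"
    using cls_nrm[OF cauchy_mult[OF cauchy_star[OF s(1)] s(1)]] LIMSEQ_unique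
    unfolding s cls_star[OF s(1)] cls_mult[OF cauchy_star[OF s(1)] s(1)] by blast
qed

interpretation C: seminormed C "nrm C" by unfold_locales (rule completion_seminorm)

abbreviation "emb \<equiv> in_completion A p"

lemma emb_eq: "emb x = cls (\<lambda>_. x)"
  by (simp add: in_completion_def)

lemma emb_hom: "emb \<in> star_hom A C"
  unfolding star_hom_def ring_hom_def
  by (auto simp: emb_eq cls_add cls_mult cls_smult cls_star cauchy_const cls_carrier one_C)

sublocale emb: star_morphism A C emb by unfold_locales (rule emb_hom)

lemma nrm_emb [simp]: assumes "x \<in> carrier A" shows "nrm C (emb x) = p x"
  using cls_nrm[OF cauchy_const[OF assms]] by (simp add: emb_eq LIMSEQ_const_iff)

lemma nrm_cls_le:
  assumes "s \<in> cauchy" "\<And>k. k \<ge> N \<Longrightarrow> p (s k) \<le> e" shows "nrm C (cls s) \<le> e"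
  by (rule LIMSEQ_le_const2[OF cls_nrm[OF assms(1)]]) (use assms(2) in blast)

lemma emb_dense:
  assumes "P \<in> carrier C" "0 < e" obtains x where "x \<in> carrier A" "nrm C (P \<ominus>\<^bsub>C\<^esub> emb x) < e"
proof -
  obtain s where s: "s \<in> cauchy" "P = cls s" using assms(1) by (rule carrier_CE)
  obtain N where N: "\<forall>k\<ge>N. \<forall>l\<ge>N. p (s k \<ominus> s l) < e / 2" using cauchyD'[OF s(1), of "e/2"] assms by auto
  have x: "s N \<in> carrier A" using cauchyD s by blast
  have "nrm C (P \<ominus>\<^bsub>C\<^esub> emb (s N)) = nrm C (cls (\<lambda>k. s k \<ominus> s N))"
    unfolding s(2) emb_eq using cls_diff[OF s(1) cauchy_const[OF x]] by simp
  also have "\<dots> \<le> e / 2"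
    by (rule nrm_cls_le[OF cauchy_diff[OF s(1) cauchy_const[OF x]], of N]) (use N less_imp_le in blast)
  finally show thesis using that[OF x] assms by simp
qed

lemma emb_sequence:
  assumes "\<And>k. P k \<in> carrier C"
  shows "\<exists>x. \<forall>k. x k \<in> carrier A \<and> nrm C (P k \<ominus>\<^bsub>C\<^esub> emb (x k)) < 1 / real (Suc k)"
proof -
  have "\<exists>x. x \<in> carrier A \<and> nrm C (P k \<ominus>\<^bsub>C\<^esub> emb x) < 1 / real (Suc k)" for k
  proof -
    have "0 < 1 / real (Suc k)" by simp
    from emb_dense[OF assms this] show ?thesis by metis
  qed
  then show ?thesis by metis
qed

text \<open>
  Given a Cauchy sequence of classes, a representative sequence of the limit is obtained by choosing for
  the \<open>k\<close>-th class an element of the original algebra at distance less than \<open>1 / (k + 1)\<close>.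
\<close>

lemma completion_cstar_alg: "cstar_alg C"
proof (unfold_locales)
  fix P assume P: "P \<in> carrier C" "nrm C P = 0"
  obtain s where s: "s \<in> cauchy" "P = cls s" using P(1) by (rule carrier_CE)
  have "null s (\<lambda>_. \<zero>)"
    using cls_nrm[OF s(1)] P s cauchyD[OF s(1)] by (simp add: null_def a_minus_def)
  then show "P = \<zero>\<^bsub>C\<^esub>" unfolding s(2) zero_C using cls_eq[OF s(1) cauchy_const[OF zero_closed]] by simp
next
  fix P :: "nat \<Rightarrow> (nat \<Rightarrow> 'a) set"
  assume P: "\<And>k. P k \<in> carrier C"
    and Cau: "\<And>e. 0 < e \<Longrightarrow> \<exists>N. \<forall>k\<ge>N. \<forall>l\<ge>N. nrm C (P k \<ominus>\<^bsub>C\<^esub> P l) < e"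
  obtain x where x: "\<And>k. x k \<in> carrier A"
    and Px: "\<And>k. nrm C (P k \<ominus>\<^bsub>C\<^esub> emb (x k)) < 1 / real (Suc k)"
    using emb_sequence[of P] P by blast
  have small: "\<exists>M. \<forall>k\<ge>M. 1 / real (Suc k) < e" if e: "0 < e" for e
  proof -
    obtain M where M: "1 / real (Suc M) < e" using nat_approx_posE[OF e] by blast
    have "1 / real (Suc k) < e" if "k \<ge> M" for k
    proof -
      have "1 / real (Suc k) \<le> 1 / real (Suc M)" using that by (intro divide_left_mono) auto
      then show ?thesis using M by linarith
    qed
    then show ?thesis by blast
  qed
  have dist: "p (x k \<ominus> x l) \<le> 1 / real (Suc k) + nrm C (P k \<ominus>\<^bsub>C\<^esub> P l) + 1 / real (Suc l)" for k l
  proof -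
    have "p (x k \<ominus> x l) = nrm C (emb (x k) \<ominus>\<^bsub>C\<^esub> emb (x l))"
      using x by (simp add: emb.hom_diff[symmetric])
    also have "\<dots> \<le> nrm C (emb (x k) \<ominus>\<^bsub>C\<^esub> P k) + nrm C (P k \<ominus>\<^bsub>C\<^esub> emb (x l))"
      using x P by (intro C.p_diff_triangle) auto
    also have "nrm C (P k \<ominus>\<^bsub>C\<^esub> emb (x l)) \<le> nrm C (P k \<ominus>\<^bsub>C\<^esub> P l) + nrm C (P l \<ominus>\<^bsub>C\<^esub> emb (x l))"
      using x P by (intro C.p_diff_triangle) auto
    also have "nrm C (emb (x k) \<ominus>\<^bsub>C\<^esub> P k) = nrm C (P k \<ominus>\<^bsub>C\<^esub> emb (x k))"
      using x P by (intro C.p_diff_commute) auto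
    finally show ?thesis using Px[of k] Px[of l] by linarith
  qed
  have xc: "x \<in> cauchy"
  proof (rule cauchyI)
    fix e :: real assume e: "0 < e"
    obtain M where M: "\<And>k. k \<ge> M \<Longrightarrow> 1 / real (Suc k) < e / 3" using small[of "e/3"] e by auto
    obtain N where N: "\<And>k l. k \<ge> N \<Longrightarrow> l \<ge> N \<Longrightarrow> nrm C (P k \<ominus>\<^bsub>C\<^esub> P l) < e / 3"
      using Cau[of "e/3"] e by auto
    have "p (x k \<ominus> x l) < e" if "k \<ge> max M N" "l \<ge> max M N" for k l
    proof -
      have "1 / real (Suc k) < e / 3" "1 / real (Suc l) < e / 3" "nrm C (P k \<ominus>\<^bsub>C\<^esub> P l) < e / 3"
        using that M N by auto
      then show ?thesis using dist[of k l] by linarith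
    qed
    then show "\<exists>N. \<forall>k\<ge>N. \<forall>l\<ge>N. p (x k \<ominus> x l) < e" by blast
  qed (use x in auto)
  show "\<exists>a\<in>carrier C. (\<lambda>k. nrm C (P k \<ominus>\<^bsub>C\<^esub> a)) \<longlonglongrightarrow> 0"
  proof (intro bexI[of _ "cls x"] LIMSEQ_I)
    fix e :: real assume e: "0 < e"
    obtain M where M: "\<And>k. k \<ge> M \<Longrightarrow> 1 / real (Suc k) < e / 2" using small[of "e/2"] e by auto
    obtain N where N: "\<And>k l. k \<ge> N \<Longrightarrow> l \<ge> N \<Longrightarrow> p (x k \<ominus> x l) < e / 2"
      using cauchyD'[OF xc, of "e/2"] e by auto
    have "nrm C (P k \<ominus>\<^bsub>C\<^esub> cls x) < e" if k: "k \<ge> max M N" for k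
    proof -
      have "nrm C (emb (x k) \<ominus>\<^bsub>C\<^esub> cls x) = nrm C (cls (\<lambda>l. x k \<ominus> x l))"
        unfolding emb_eq using cls_diff[OF cauchy_const[OF x] xc] by simp
      also have "\<dots> \<le> e / 2"
        by (rule nrm_cls_le[OF cauchy_diff[OF cauchy_const[OF x] xc], of N])
          (rule less_imp_le[OF N], use k in auto)
      finally have 1: "nrm C (emb (x k) \<ominus>\<^bsub>C\<^esub> cls x) \<le> e / 2" .
      have "nrm C (P k \<ominus>\<^bsub>C\<^esub> cls x) \<le> nrm C (P k \<ominus>\<^bsub>C\<^esub> emb (x k)) + nrm C (emb (x k) \<ominus>\<^bsub>C\<^esub> cls x)"
        using x P xc by (intro C.p_diff_triangle) (auto simp: cls_carrier)
      moreover have "1 / real (Suc k) < e / 2" using M k by simp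
      ultimately show ?thesis using 1 Px[of k] by linarith
    qed
    moreover have "0 \<le> nrm C (P k \<ominus>\<^bsub>C\<^esub> cls x)" for k
      using P xc by (intro C.p_nonneg) (auto simp: cls_carrier)
    ultimately show "\<exists>N. \<forall>k\<ge>N. norm (nrm C (P k \<ominus>\<^bsub>C\<^esub> cls x) - 0) < e"
      by (intro exI[of _ "max M N"]) auto
  qed (simp add: cls_carrier xc)
qed

interpretation C: cstar_alg C by (rule completion_cstar_alg)

text \<open>
  Homomorphisms between C*-algebras are automatically contractive, so agreement on the dense image of
  the original algebra is enough.
\<close>

lemma star_hom_ext:
  assumes "cstar_alg D" "\<Phi> \<in> star_hom C D" "\<Psi> \<in> star_hom C D"
    and eq: "\<And>x. x \<in> carrier A \<Longrightarrow> \<Phi> (emb x) = \<Psi> (emb x)" and P: "P \<in> carrier C"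
  shows "\<Phi> P = \<Psi> P"
proof -
  interpret D: cstar_alg D by fact
  interpret \<Phi>: star_morphism C D \<Phi> by unfold_locales fact
  interpret \<Psi>: star_morphism C D \<Psi> by unfold_locales fact
  have "nrm D (\<Phi> P \<ominus>\<^bsub>D\<^esub> \<Psi> P) \<le> 0 + e" if e: "0 < e" for e
  proof -
    have "0 < e / 2" using e by simp
    from emb_dense[OF P this] obtain x where x: "x \<in> carrier A" "nrm C (P \<ominus>\<^bsub>C\<^esub> emb x) < e / 2" .
    have "nrm D (\<Phi> P \<ominus>\<^bsub>D\<^esub> \<Psi> P) \<le> nrm D (\<Phi> P \<ominus>\<^bsub>D\<^esub> \<Phi> (emb x)) + nrm D (\<Phi> (emb x) \<ominus>\<^bsub>D\<^esub> \<Psi> P)"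
      using P x by (intro D.p_diff_triangle) auto
    also have "nrm D (\<Phi> (emb x) \<ominus>\<^bsub>D\<^esub> \<Psi> P) = nrm D (\<Psi> P \<ominus>\<^bsub>D\<^esub> \<Psi> (emb x))"
      using P x eq by (subst D.p_diff_commute) auto
    also have "nrm D (\<Phi> P \<ominus>\<^bsub>D\<^esub> \<Phi> (emb x)) + nrm D (\<Psi> P \<ominus>\<^bsub>D\<^esub> \<Psi> (emb x)) \<le> e / 2 + e / 2"
      using star_hom_contractive[OF completion_cstar_alg assms(1,2), of "P \<ominus>\<^bsub>C\<^esub> emb x"]
        star_hom_contractive[OF completion_cstar_alg assms(1,3), of "P \<ominus>\<^bsub>C\<^esub> emb x"] P x
      by (simp add: \<Phi>.hom_diff \<Psi>.hom_diff)
    finally show ?thesis by simp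
  qed
  then have "nrm D (\<Phi> P \<ominus>\<^bsub>D\<^esub> \<Psi> P) \<le> 0" by (rule field_le_epsilon)
  then show ?thesis using D.nrm_eqI[of "\<Phi> P" "\<Psi> P"] D.p_nonneg[of "\<Phi> P \<ominus>\<^bsub>D\<^esub> \<Psi> P"] P by auto
qed

text \<open>
  The value at a class is the limit of the values along any of its sequences.  The definite description
  picks this limit; it does not depend on the sequence because \<open>\<Phi>\<close> is dominated by \<open>p\<close>.
\<close>

lemma star_hom_extend:
  assumes "cstar_alg D" "\<Phi> \<in> star_hom A D" and le: "\<And>x. x \<in> carrier A \<Longrightarrow> nrm D (\<Phi> x) \<le> p x"
  shows "\<exists>H \<in> star_hom C D. \<forall>x \<in> carrier A. H (emb x) = \<Phi> x"
proof -
  interpret D: cstar_alg D by fact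
  interpret \<Phi>: star_morphism A D \<Phi> by unfold_locales fact
  have le': "nrm D (\<Phi> x \<ominus>\<^bsub>D\<^esub> \<Phi> y) \<le> p (x \<ominus> y)" if "x \<in> carrier A" "y \<in> carrier A" for x y
    using le[of "x \<ominus> y"] that by (simp add: \<Phi>.hom_diff)
  have ex: "\<exists>d. D.conv (\<lambda>k. \<Phi> (s k)) d" if s: "s \<in> cauchy" for s
  proof (rule D.Cauchy_conv)
    fix e :: real assume "0 < e"
    then obtain N where "\<forall>k\<ge>N. \<forall>l\<ge>N. p (s k \<ominus> s l) < e" using cauchyD'[OF s] by blast
    then show "\<exists>N. \<forall>k\<ge>N. \<forall>l\<ge>N. nrm D (\<Phi> (s k) \<ominus>\<^bsub>D\<^esub> \<Phi> (s l)) < e"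
      using le'[OF cauchyD[OF s] cauchyD[OF s]] by (meson le_less_trans)
  qed (use cauchyD[OF s] in auto)
  define H where "H P = (THE d. \<exists>s\<in>P. D.conv (\<lambda>k. \<Phi> (s k)) d)" for P
  have H: "H (cls s) = d" if s: "s \<in> cauchy" and d: "D.conv (\<lambda>k. \<Phi> (s k)) d" for s d
    unfolding H_def
  proof (rule the_equality)
    show "\<exists>t\<in>cls s. D.conv (\<lambda>k. \<Phi> (t k)) d" using self_mem_cls[OF s] d by blast
    fix d' assume "\<exists>t\<in>cls s. D.conv (\<lambda>k. \<Phi> (t k)) d'"
    then obtain t where t: "t \<in> cauchy" "null s t" "D.conv (\<lambda>k. \<Phi> (t k)) d'" by (auto simp: mem_cls)
    have "D.conv (\<lambda>k. \<Phi> (t k)) d"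
    proof (rule D.convI)
      show "nrm D (\<Phi> (t k) \<ominus>\<^bsub>D\<^esub> d) \<le> p (s k \<ominus> t k) + nrm D (\<Phi> (s k) \<ominus>\<^bsub>D\<^esub> d)" for k
        using D.p_diff_triangle[of "\<Phi> (t k)" "\<Phi> (s k)" d] le'[OF cauchyD[OF t(1)] cauchyD[OF s], of k k]
          p_diff_commute[OF cauchyD[OF t(1)] cauchyD[OF s], of k k] cauchyD[OF t(1)] cauchyD[OF s] d
        by (auto simp: D.conv_def)
      show "(\<lambda>k. p (s k \<ominus> t k) + nrm D (\<Phi> (s k) \<ominus>\<^bsub>D\<^esub> d)) \<longlonglongrightarrow> 0"
        using t(2) d unfolding null_def D.conv_def by (intro tendsto_add_zero) auto
    qed (use cauchyD[OF t(1)] d in \<open>auto simp: D.conv_def\<close>)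
    then show "d' = d" using D.conv_unique t(3) by blast
  qed
  have Hc: "D.conv (\<lambda>k. \<Phi> (s k)) (H (cls s))" if "s \<in> cauchy" for s
    using ex[OF that] H[OF that] by auto
  have emb: "H (emb x) = \<Phi> x" if "x \<in> carrier A" for x
    unfolding emb_eq using that by (intro H cauchy_const D.conv_const) auto
  have "H \<in> star_hom C D"
    unfolding star_hom_def ring_hom_def
  proof (safe; (elim carrier_CE; hypsubst)?)
    fix s t assume s: "s \<in> cauchy" and t: "t \<in> cauchy"
    note c = cauchyD[OF s] cauchyD[OF t]
    show "H (cls s) \<in> carrier D" using Hc[OF s] by (simp add: D.conv_def)
    show "H (cls s \<otimes>\<^bsub>C\<^esub> cls t) = H (cls s) \<otimes>\<^bsub>D\<^esub> H (cls t)"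
      unfolding cls_mult[OF s t]
      using D.conv_mult[OF Hc[OF s] Hc[OF t]] c by (intro H cauchy_mult s t) (simp add: \<Phi>.hom_mult)
    show "H (cls s \<oplus>\<^bsub>C\<^esub> cls t) = H (cls s) \<oplus>\<^bsub>D\<^esub> H (cls t)"
      unfolding cls_add[OF s t]
      using D.conv_add[OF Hc[OF s] Hc[OF t]] c by (intro H cauchy_add s t) (simp add: \<Phi>.hom_add)
  next
    show "H \<one>\<^bsub>C\<^esub> = \<one>\<^bsub>D\<^esub>" using emb[OF one_closed] by simp
  next
    fix c s assume s: "s \<in> cauchy"
    show "H (c \<odot>\<^bsub>C\<^esub> cls s) = c \<odot>\<^bsub>D\<^esub> H (cls s)"
      unfolding cls_smult[OF s]
      using D.conv_smult[OF Hc[OF s]] cauchyD[OF s] by (intro H cauchy_smult s) (simp add: \<Phi>.hom_smult)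
  next
    fix s assume s: "s \<in> cauchy"
    show "H (star C (cls s)) = star D (H (cls s))"
      unfolding cls_star[OF s]
      using D.conv_star[OF Hc[OF s]] cauchyD[OF s] by (intro H cauchy_star s) (simp add: \<Phi>.hom_star)
  qed
  then show ?thesis using emb by blast
qed

end

section \<open>Universal norms\<close>

text \<open>
  The axioms of a C*-seminorm are inequalities between monotone expressions, except for the C*-identity,
  which passes to suprema because squaring is monotone and continuous on nonnegative reals.
\<close>

lemma (in star_alg) seminorm_SUP:
  assumes S: "S \<noteq> {}" "\<And>q. q \<in> S \<Longrightarrow> cstar_seminorm A q"
    and bdd: "\<And>x. x \<in> carrier A \<Longrightarrow> \<exists>K. \<forall>q\<in>S. q x \<le> K"
  shows "cstar_seminorm A (\<lambda>x. SUP q\<in>S. q x)"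
proof -
  have le: "q x \<le> (SUP q\<in>S. q x)" if "q \<in> S" "x \<in> carrier A" for q x
    using bdd[OF that(2)] that(1) by (intro cSUP_upper) (auto simp: bdd_above_def)
  have least: "(SUP q\<in>S. q x) \<le> K" if "\<And>q. q \<in> S \<Longrightarrow> q x \<le> K" for x K
    using S that by (intro cSUP_least) auto
  obtain q0 where q0: "q0 \<in> S" using S by blast
  have sem: "seminormed A q" if "q \<in> S" for q
    using S(2)[OF that] by unfold_locales
  have nn: "0 \<le> (SUP q\<in>S. q x)" if "x \<in> carrier A" for x
    using le[OF q0 that] seminormed.p_nonneg[OF sem[OF q0] that] by linarith
  show ?thesis unfolding cstar_seminorm_def
  proof (intro conjI ballI allI)
    fix x y c assume x: "x \<in> carrier A" and y: "y \<in> carrier A"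
    show "0 \<le> (SUP q\<in>S. q x)" by (rule nn[OF x])
    show "(SUP q\<in>S. q (x \<oplus> y)) \<le> (SUP q\<in>S. q x) + (SUP q\<in>S. q y)"
    proof (rule least)
      fix q assume q: "q \<in> S"
      show "q (x \<oplus> y) \<le> (SUP q\<in>S. q x) + (SUP q\<in>S. q y)"
        using seminormed.p_add[OF sem[OF q] x y] le[OF q x] le[OF q y] by linarith
    qed
    show "(SUP q\<in>S. q (x \<otimes> y)) \<le> (SUP q\<in>S. q x) * (SUP q\<in>S. q y)"
    proof (rule least)
      fix q assume q: "q \<in> S"
      have "q (x \<otimes> y) \<le> q x * q y" using seminormed.p_mult[OF sem[OF q] x y] .
      also have "\<dots> \<le> (SUP q\<in>S. q x) * (SUP q\<in>S. q y)"
        using le[OF q x] le[OF q y] nn[OF x] seminormed.p_nonneg[OF sem[OF q] y] by (intro mult_mono) auto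
      finally show "q (x \<otimes> y) \<le> (SUP q\<in>S. q x) * (SUP q\<in>S. q y)" .
    qed
    show "(SUP q\<in>S. q (c \<odot> x)) = cmod c * (SUP q\<in>S. q x)"
    proof (rule antisym)
      show "(SUP q\<in>S. q (c \<odot> x)) \<le> cmod c * (SUP q\<in>S. q x)"
        by (rule least) (simp add: seminormed.p_smult[OF sem x] le[OF _ x] mult_left_mono)
      show "cmod c * (SUP q\<in>S. q x) \<le> (SUP q\<in>S. q (c \<odot> x))"
      proof (cases "c = 0")
        case False
        have "(SUP q\<in>S. q x) \<le> (SUP q\<in>S. q (c \<odot> x)) / cmod c"
        proof (rule least)
          fix q assume q: "q \<in> S"
          have "cmod c * q x \<le> (SUP q\<in>S. q (c \<odot> x))"
            using seminormed.p_smult[OF sem[OF q] x, of c] le[OF q, of "c \<odot> x"] x by simp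
          then show "q x \<le> (SUP q\<in>S. q (c \<odot> x)) / cmod c" using False by (simp add: field_simps)
        qed
        then show ?thesis using False by (simp add: field_simps)
      qed (use nn x in simp)
    qed
    show "(SUP q\<in>S. q (star A x \<otimes> x)) = (SUP q\<in>S. q x)\<^sup>2"
    proof (rule antisym)
      show "(SUP q\<in>S. q (star A x \<otimes> x)) \<le> (SUP q\<in>S. q x)\<^sup>2"
        by (rule least)
          (simp add: seminormed.p_star_mult[OF sem x] power_mono[OF le[OF _ x] seminormed.p_nonneg[OF sem x]])
      let ?r = "(SUP q\<in>S. q (star A x \<otimes> x))"
      have "(SUP q\<in>S. q x) \<le> sqrt ?r"
      proof (rule least)
        fix q assume q: "q \<in> S"
        have "(q x)\<^sup>2 \<le> ?r"
          using seminormed.p_star_mult[OF sem[OF q] x] le[OF q, of "star A x \<otimes> x"] x by simp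
        then show "q x \<le> sqrt ?r" by (rule real_le_rsqrt)
      qed
      then have "(SUP q\<in>S. q x)\<^sup>2 \<le> (sqrt ?r)\<^sup>2" using nn[OF x] by (intro power_mono)
      also have "\<dots> = ?r" using nn[of "star A x \<otimes> x"] x by simp
      finally show "(SUP q\<in>S. q x)\<^sup>2 \<le> ?r" .
    qed
  qed
qed

definition kills :: "('a, 'r) star_algebra_scheme \<Rightarrow> ('a \<times> 'a) set \<Rightarrow> ('a \<Rightarrow> real) \<Rightarrow> bool" where
  "kills A R p \<longleftrightarrow> cstar_seminorm A p \<and> (\<forall>(y, z) \<in> R. p (y \<ominus>\<^bsub>A\<^esub> z) = 0)"

text \<open>
  The situation in which the universal norm is an honest supremum.
\<close>

locale universal = star_alg A for A :: "('a, 'r) star_algebra_scheme" (structure) +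
  fixes R :: "('a \<times> 'a) set"
  assumes R_carrier: "R \<subseteq> carrier A \<times> carrier A"
    and bounded: "x \<in> carrier A \<Longrightarrow> \<exists>K. \<forall>p. kills A R p \<longrightarrow> p x \<le> K"
begin

lemma universal_norm_eq: "universal_norm A R = (\<lambda>x. SUP p\<in>{p. kills A R p}. p x)"
  by (simp add: universal_norm_def kills_def fun_eq_iff)

lemma kills_zero: "kills A R (\<lambda>_. 0)"
  by (auto simp: kills_def cstar_seminorm_def)

lemma universal_seminorm: "cstar_seminorm A (universal_norm A R)"
  unfolding universal_norm_eq
  by (rule seminorm_SUP) (use kills_zero bounded in \<open>auto simp: kills_def\<close>)

lemma le_universal_norm:
  assumes "kills A R q" "x \<in> carrier A" shows "q x \<le> universal_norm A R x"
  unfolding universal_norm_eq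
  using bounded[OF assms(2)] assms by (intro cSUP_upper) (auto simp: bdd_above_def)

lemma universal_norm_rel: assumes "(y, z) \<in> R" shows "universal_norm A R (y \<ominus> z) = 0"
proof -
  have "(\<lambda>p. p (y \<ominus> z)) ` {p. kills A R p} = {0}"
    using assms kills_zero by (force simp: kills_def image_def)
  then show ?thesis unfolding universal_norm_eq by simp
qed

sublocale seminormed A "universal_norm A R"
  by unfold_locales (rule universal_seminorm)

interpretation C: cstar_alg C by (rule completion_cstar_alg)

lemma emb_rel: assumes "(y, z) \<in> R" shows "in_completion A (universal_norm A R) y = in_completion A (universal_norm A R) z"
proof -
  have yz: "y \<in> carrier A" "z \<in> carrier A" using assms R_carrier by auto
  show ?thesis
    by (rule C.nrm_eqI) (use yz universal_norm_rel[OF assms] in \<open>auto simp: emb.hom_diff[symmetric]\<close>)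
qed

text \<open>
  The universal property: composing \<open>\<Phi>\<close> with the norm of \<open>D\<close> gives a C*-seminorm that kills the
  relations, so \<open>\<Phi>\<close> is dominated by the universal norm.
\<close>

lemma universal_extend:
  assumes "cstar_alg D" "\<Phi> \<in> star_hom A D" and rel: "\<And>y z. (y, z) \<in> R \<Longrightarrow> \<Phi> y = \<Phi> z"
  shows "\<exists>H \<in> star_hom (universal_cstar A R) D. \<forall>x \<in> carrier A. H (in_completion A (universal_norm A R) x) = \<Phi> x"
proof -
  interpret D: cstar_alg D by fact
  interpret \<Phi>: star_morphism A D \<Phi> by unfold_locales fact
  have "nrm D (\<Phi> (y \<ominus> z)) = 0" if yz: "(y, z) \<in> R" for y z
  proof -
    have c: "y \<in> carrier A" "z \<in> carrier A" using yz R_carrier by auto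
    show ?thesis unfolding \<Phi>.hom_diff[OF c] rel[OF yz] using c by (simp add: a_minus_def D.r_neg)
  qed
  then have "kills A R (\<lambda>x. nrm D (\<Phi> x))"
    unfolding kills_def using \<Phi>.seminorm_comp[OF D.seminorm] by auto
  then have "nrm D (\<Phi> x) \<le> universal_norm A R x" if "x \<in> carrier A" for x
    using le_universal_norm that by blast
  then show ?thesis unfolding universal_cstar_def
    using star_hom_extend[OF assms(1,2)] by blast
qed

end

section \<open>Monoid algebras\<close>

text \<open>
  Free $*$-algebras (words, with reversal), group algebras (with inversion) and the $*$-algebra of formal
  combinations of pairs underlying a tensor product are all algebras of such a monoid.
\<close>

locale star_monoid = monoid M for M :: "('m, 'r) monoid_scheme" +
  fixes \<iota> :: "'m \<Rightarrow> 'm"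
  assumes invol_closed [simp, intro]: "a \<in> carrier M \<Longrightarrow> \<iota> a \<in> carrier M"
    and invol_invol [simp]: "a \<in> carrier M \<Longrightarrow> \<iota> (\<iota> a) = a"
    and invol_mult: "\<lbrakk>a \<in> carrier M; b \<in> carrier M\<rbrakk> \<Longrightarrow> \<iota> (a \<otimes>\<^bsub>M\<^esub> b) = \<iota> b \<otimes>\<^bsub>M\<^esub> \<iota> a"
begin

abbreviation "MA \<equiv> monoid_algebra M \<iota>"
abbreviation "sg \<equiv> Poly_Mapping.single :: 'm \<Rightarrow> complex \<Rightarrow> 'm \<Rightarrow>\<^sub>0 complex"

lemma MA_carrier: "f \<in> carrier MA \<longleftrightarrow> Poly_Mapping.keys f \<subseteq> carrier M"
  and MA_add [simp]: "f \<oplus>\<^bsub>MA\<^esub> g = f + g"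
  and MA_zero [simp]: "\<zero>\<^bsub>MA\<^esub> = 0"
  and MA_one: "\<one>\<^bsub>MA\<^esub> = sg \<one>\<^bsub>M\<^esub> 1"
  by (simp_all add: monoid_algebra_def)

lemma MA_smult_lookup: "Poly_Mapping.lookup (c \<odot>\<^bsub>MA\<^esub> f) a = c * Poly_Mapping.lookup f a"
  by (simp add: monoid_algebra_def map.rep_eq when_def)

lemma MA_single [simp, intro]: "a \<in> carrier M \<Longrightarrow> sg a c \<in> carrier MA"
  by (simp add: MA_carrier)

lemma MA_0 [simp, intro]: "0 \<in> carrier MA"
  by (simp add: MA_carrier)

lemma MA_plus [simp, intro]: "f \<in> carrier MA \<Longrightarrow> g \<in> carrier MA \<Longrightarrow> f + g \<in> carrier MA"
  using keys_add[of f g] by (auto simp: MA_carrier)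

lemma MA_sum [intro]: "(\<And>i. i \<in> I \<Longrightarrow> f i \<in> carrier MA) \<Longrightarrow> sum f I \<in> carrier MA"
  by (induction I rule: infinite_finite_induct) auto

lemma MA_smult_closed [simp, intro]: "f \<in> carrier MA \<Longrightarrow> c \<odot>\<^bsub>MA\<^esub> f \<in> carrier MA"
  unfolding MA_carrier by (auto simp: in_keys_iff MA_smult_lookup)

lemma sum_singles:
  assumes "finite K" "Poly_Mapping.keys f \<subseteq> K"
  shows "(\<Sum>a\<in>K. sg a (Poly_Mapping.lookup f a)) = f"
proof (rule poly_mapping_eqI)
  fix k
  have "(\<Sum>a\<in>K. Poly_Mapping.lookup (sg a (Poly_Mapping.lookup f a)) k)
      = (\<Sum>a\<in>K. if a = k then Poly_Mapping.lookup f k else 0)"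
    by (intro sum.cong refl) (simp add: lookup_single when_def)
  also have "\<dots> = Poly_Mapping.lookup f k"
    using assms by (auto simp: in_keys_iff)
  finally show "Poly_Mapping.lookup (\<Sum>a\<in>K. sg a (Poly_Mapping.lookup f a)) k = Poly_Mapping.lookup f k"
    by (simp add: lookup_sum)
qed

lemma MA_induct [consumes 1, case_names single add]:
  assumes "f \<in> carrier MA" "\<And>a c. a \<in> carrier M \<Longrightarrow> P (sg a c)"
    "\<And>f g. f \<in> carrier MA \<Longrightarrow> g \<in> carrier MA \<Longrightarrow> P f \<Longrightarrow> P g \<Longrightarrow> P (f + g)"
  shows "P f"
proof -
  have "P (\<Sum>a\<in>K. sg a (Poly_Mapping.lookup f a))" if "finite K" "K \<subseteq> carrier M" for K
    using that
  proof (induction K rule: finite_induct)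
    case empty
    then show ?case using assms(2)[OF one_closed, of 0] by simp
  next
    case (insert a K)
    have "(\<Sum>a\<in>K. sg a (Poly_Mapping.lookup f a)) \<in> carrier MA" using insert by (intro MA_sum) auto
    then show ?case using insert assms(2,3) by auto
  qed
  from this[of "Poly_Mapping.keys f"] show ?thesis
    using assms(1) sum_singles[of "Poly_Mapping.keys f" f] by (simp add: MA_carrier)
qed

text \<open>
  Sums over supports are awkward because supports do not add; any finite set containing them serves
  equally well.
\<close>

lemma MA_mult_superset:
  assumes "finite K" "Poly_Mapping.keys f \<subseteq> K" "finite L" "Poly_Mapping.keys g \<subseteq> L"
  shows "f \<otimes>\<^bsub>MA\<^esub> g = (\<Sum>a\<in>K. \<Sum>b\<in>L. sg (a \<otimes>\<^bsub>M\<^esub> b) (Poly_Mapping.lookup f a * Poly_Mapping.lookup g b))"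
proof -
  have "f \<otimes>\<^bsub>MA\<^esub> g = (\<Sum>a\<in>Poly_Mapping.keys f. \<Sum>b\<in>Poly_Mapping.keys g.
      sg (a \<otimes>\<^bsub>M\<^esub> b) (Poly_Mapping.lookup f a * Poly_Mapping.lookup g b))"
    by (simp add: monoid_algebra_def)
  also have "\<dots> = (\<Sum>a\<in>Poly_Mapping.keys f. \<Sum>b\<in>L.
      sg (a \<otimes>\<^bsub>M\<^esub> b) (Poly_Mapping.lookup f a * Poly_Mapping.lookup g b))"
    using assms by (intro sum.cong refl sum.mono_neutral_left) (auto simp: in_keys_iff)
  also have "\<dots> = (\<Sum>a\<in>K. \<Sum>b\<in>L. sg (a \<otimes>\<^bsub>M\<^esub> b) (Poly_Mapping.lookup f a * Poly_Mapping.lookup g b))"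
    using assms by (intro sum.mono_neutral_left) (auto simp: in_keys_iff)
  finally show ?thesis .
qed

lemma MA_mult_single: "sg a x \<otimes>\<^bsub>MA\<^esub> sg b y = sg (a \<otimes>\<^bsub>M\<^esub> b) (x * y)"
  by (subst MA_mult_superset[of "{a}" _ "{b}"]) (auto split: if_splits)

lemma MA_mult_add_left: "(f + g) \<otimes>\<^bsub>MA\<^esub> h = f \<otimes>\<^bsub>MA\<^esub> h + g \<otimes>\<^bsub>MA\<^esub> h"
proof -
  let ?K = "Poly_Mapping.keys f \<union> Poly_Mapping.keys g \<union> Poly_Mapping.keys (f + g)" and ?L = "Poly_Mapping.keys h"
  have "finite ?K" by simp
  then show ?thesis
    by (subst (1 2 3) MA_mult_superset[of ?K _ ?L])
      (auto simp: lookup_add distrib_right single_add sum.distrib)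
qed

lemma MA_mult_add_right: "h \<otimes>\<^bsub>MA\<^esub> (f + g) = h \<otimes>\<^bsub>MA\<^esub> f + h \<otimes>\<^bsub>MA\<^esub> g"
proof -
  let ?K = "Poly_Mapping.keys f \<union> Poly_Mapping.keys g \<union> Poly_Mapping.keys (f + g)" and ?L = "Poly_Mapping.keys h"
  have "finite ?K" by simp
  then show ?thesis
    by (subst (1 2 3) MA_mult_superset[of ?L _ ?K])
      (auto simp: lookup_add distrib_left single_add sum.distrib)
qed

lemma MA_mult_0_left [simp]: "0 \<otimes>\<^bsub>MA\<^esub> f = 0"
  and MA_mult_0_right [simp]: "f \<otimes>\<^bsub>MA\<^esub> 0 = 0"
  by (simp_all add: monoid_algebra_def)

lemma MA_mult_sum_left: "sum f I \<otimes>\<^bsub>MA\<^esub> h = (\<Sum>i\<in>I. f i \<otimes>\<^bsub>MA\<^esub> h)"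
  by (induction I rule: infinite_finite_induct) (auto simp: MA_mult_add_left)

lemma MA_mult_sum_right: "h \<otimes>\<^bsub>MA\<^esub> sum f I = (\<Sum>i\<in>I. h \<otimes>\<^bsub>MA\<^esub> f i)"
  by (induction I rule: infinite_finite_induct) (auto simp: MA_mult_add_right)

lemma MA_mult_closed [simp, intro]:
  assumes "f \<in> carrier MA" "g \<in> carrier MA" shows "f \<otimes>\<^bsub>MA\<^esub> g \<in> carrier MA"
proof -
  have "f \<otimes>\<^bsub>MA\<^esub> g = (\<Sum>a\<in>Poly_Mapping.keys f. \<Sum>b\<in>Poly_Mapping.keys g.
      sg (a \<otimes>\<^bsub>M\<^esub> b) (Poly_Mapping.lookup f a * Poly_Mapping.lookup g b))"
    by (rule MA_mult_superset) auto
  then show ?thesis using assms by (auto simp only: MA_carrier[of f] MA_carrier[of g] intro!: MA_sum MA_single)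
qed

lemma MA_smult_single [simp]: "c \<odot>\<^bsub>MA\<^esub> sg a x = sg a (c * x)"
  by (rule poly_mapping_eqI) (simp add: MA_smult_lookup lookup_single when_def)

lemma MA_smult_add: "c \<odot>\<^bsub>MA\<^esub> (f + g) = c \<odot>\<^bsub>MA\<^esub> f + c \<odot>\<^bsub>MA\<^esub> g"
  by (rule poly_mapping_eqI) (simp add: MA_smult_lookup lookup_add distrib_left)

lemma MA_star_superset:
  assumes "finite K" "Poly_Mapping.keys f \<subseteq> K"
  shows "star MA f = (\<Sum>a\<in>K. sg (\<iota> a) (cnj (Poly_Mapping.lookup f a)))"
proof -
  have "star MA f = (\<Sum>a\<in>Poly_Mapping.keys f. sg (\<iota> a) (cnj (Poly_Mapping.lookup f a)))"
    by (simp add: monoid_algebra_def)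
  also have "\<dots> = (\<Sum>a\<in>K. sg (\<iota> a) (cnj (Poly_Mapping.lookup f a)))"
    using assms by (intro sum.mono_neutral_left) (auto simp: in_keys_iff)
  finally show ?thesis .
qed

lemma MA_star_single: "star MA (sg a c) = sg (\<iota> a) (cnj c)"
  by (subst MA_star_superset[of "{a}"]) (auto split: if_splits)

lemma MA_star_add: "star MA (f + g) = star MA f + star MA g"
proof -
  let ?K = "Poly_Mapping.keys f \<union> Poly_Mapping.keys g \<union> Poly_Mapping.keys (f + g)"
  have "finite ?K" by simp
  then show ?thesis
    by (subst (1 2 3) MA_star_superset[of ?K]) (auto simp: lookup_add single_add sum.distrib)
qed

lemma MA_star_closed [simp, intro]:
  assumes "f \<in> carrier MA" shows "star MA f \<in> carrier MA"
  by (subst MA_star_superset[of "Poly_Mapping.keys f"])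
    (use assms in \<open>auto simp only: MA_carrier[of f] finite_keys intro!: MA_sum MA_single invol_closed\<close>)

lemma MA_star_alg: "star_alg MA"
proof -
  have ab: "abelian_group MA"
  proof (rule abelian_groupI)
    fix x assume "x \<in> carrier MA"
    then have "(- 1) \<odot>\<^bsub>MA\<^esub> x \<in> carrier MA" "(- 1) \<odot>\<^bsub>MA\<^esub> x + x = 0"
      by (auto intro!: poly_mapping_eqI simp: MA_smult_lookup lookup_add)
    then show "\<exists>y\<in>carrier MA. y \<oplus>\<^bsub>MA\<^esub> x = \<zero>\<^bsub>MA\<^esub>" by auto
  qed (auto simp: add.assoc add.commute)
  have mon: "monoid MA"
  proof (rule monoidI)
    fix f g h assume fgh: "f \<in> carrier MA" "g \<in> carrier MA" "h \<in> carrier MA"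
    show "f \<otimes>\<^bsub>MA\<^esub> g \<otimes>\<^bsub>MA\<^esub> h = f \<otimes>\<^bsub>MA\<^esub> (g \<otimes>\<^bsub>MA\<^esub> h)"
      using fgh(1)
    proof (induction rule: MA_induct)
      case (single a x)
      show ?case using fgh(2)
      proof (induction rule: MA_induct)
        case (single b y)
        show ?case using fgh(3)
        proof (induction rule: MA_induct)
          case (single c z)
          show ?case using \<open>a \<in> carrier M\<close> \<open>b \<in> carrier M\<close> \<open>c \<in> carrier M\<close>
            by (simp add: MA_mult_single m_assoc mult.assoc)
        qed (simp add: MA_mult_add_right)
      qed (simp add: MA_mult_add_right MA_mult_add_left)
    qed (simp add: MA_mult_add_left)
  next
    fix f assume f: "f \<in> carrier MA"
    show "\<one>\<^bsub>MA\<^esub> \<otimes>\<^bsub>MA\<^esub> f = f" using f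
      by (induction rule: MA_induct) (auto simp: MA_one MA_mult_single MA_mult_add_right)
    show "f \<otimes>\<^bsub>MA\<^esub> \<one>\<^bsub>MA\<^esub> = f" using f
      by (induction rule: MA_induct) (auto simp: MA_one MA_mult_single MA_mult_add_left)
  qed (auto simp: MA_one)
  have "ring MA"
    by (rule ringI[OF ab mon]) (auto simp: MA_mult_add_right MA_mult_add_left)
  then interpret MA: ring MA .
  show ?thesis
  proof unfold_locales
    fix f g :: "'m \<Rightarrow>\<^sub>0 complex" and c d
    assume f: "f \<in> carrier MA" and g: "g \<in> carrier MA"
    show "c \<odot>\<^bsub>MA\<^esub> f \<in> carrier MA" using f by simp
    show "c \<odot>\<^bsub>MA\<^esub> (f \<oplus>\<^bsub>MA\<^esub> g) = c \<odot>\<^bsub>MA\<^esub> f \<oplus>\<^bsub>MA\<^esub> c \<odot>\<^bsub>MA\<^esub> g" by (simp add: MA_smult_add)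
    show "(c + d) \<odot>\<^bsub>MA\<^esub> f = c \<odot>\<^bsub>MA\<^esub> f \<oplus>\<^bsub>MA\<^esub> d \<odot>\<^bsub>MA\<^esub> f"
      by (auto intro!: poly_mapping_eqI simp: MA_smult_lookup lookup_add distrib_right)
    show "c \<odot>\<^bsub>MA\<^esub> (d \<odot>\<^bsub>MA\<^esub> f) = (c * d) \<odot>\<^bsub>MA\<^esub> f"
      by (auto intro!: poly_mapping_eqI simp: MA_smult_lookup)
    show "1 \<odot>\<^bsub>MA\<^esub> f = f"
      by (auto intro!: poly_mapping_eqI simp: MA_smult_lookup)
    show "(c \<odot>\<^bsub>MA\<^esub> f) \<otimes>\<^bsub>MA\<^esub> g = c \<odot>\<^bsub>MA\<^esub> (f \<otimes>\<^bsub>MA\<^esub> g)"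
      using f
    proof (induction rule: MA_induct)
      case (single a x)
      show ?case using g
        by (induction rule: MA_induct) (simp_all add: MA_mult_single MA_mult_add_right MA_smult_add mult.assoc)
    qed (simp add: MA_mult_add_left MA_smult_add)
    show "f \<otimes>\<^bsub>MA\<^esub> (c \<odot>\<^bsub>MA\<^esub> g) = c \<odot>\<^bsub>MA\<^esub> (f \<otimes>\<^bsub>MA\<^esub> g)"
      using f
    proof (induction rule: MA_induct)
      case (single a x)
      show ?case using g
        by (induction rule: MA_induct) (simp_all add: MA_mult_single MA_mult_add_right MA_smult_add mult.left_commute)
    qed (simp add: MA_mult_add_left MA_smult_add)
    show "star MA f \<in> carrier MA" using f by simp
    show "star MA (star MA f) = f" using f
      by (induction rule: MA_induct) (simp_all add: MA_star_single MA_star_add)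
    show "star MA (f \<oplus>\<^bsub>MA\<^esub> g) = star MA f \<oplus>\<^bsub>MA\<^esub> star MA g" by (simp add: MA_star_add)
    show "star MA (f \<otimes>\<^bsub>MA\<^esub> g) = star MA g \<otimes>\<^bsub>MA\<^esub> star MA f"
      using f
    proof (induction rule: MA_induct)
      case (single a x)
      show ?case using g
        by (induction rule: MA_induct)
          (simp_all add: MA_mult_single MA_mult_add_right MA_mult_add_left MA_star_single MA_star_add
            invol_mult \<open>a \<in> carrier M\<close> mult.commute)
    qed (simp add: MA_mult_add_left MA_mult_add_right MA_star_add)
    show "star MA (c \<odot>\<^bsub>MA\<^esub> f) = cnj c \<odot>\<^bsub>MA\<^esub> star MA f"
      using f by (induction rule: MA_induct) (simp_all add: MA_star_single MA_star_add MA_smult_add)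
  qed
qed

sublocale MA: star_alg MA by (rule MA_star_alg)

lemma MA_uminus: "f \<in> carrier MA \<Longrightarrow> \<ominus>\<^bsub>MA\<^esub> f = - f"
  by (auto intro!: poly_mapping_eqI simp: MA.minus_smult MA_smult_lookup)

lemma MA_minus: "g \<in> carrier MA \<Longrightarrow> f \<ominus>\<^bsub>MA\<^esub> g = f - g"
  by (simp add: a_minus_def MA_uminus)

lemma MA_finsum:
  assumes "\<And>i. i \<in> I \<Longrightarrow> f i \<in> carrier MA" "finite I"
  shows "finsum MA f I = sum f I"
  using assms(2,1)
proof (induction I rule: finite_induct)
  case (insert i I)
  have "finsum MA f (insert i I) = f i \<oplus>\<^bsub>MA\<^esub> finsum MA f I"
    by (rule MA.finsum_insert) (use insert in auto)
  then show ?case using insert by simp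
qed simp

lemma MA_star_mult_self:
  assumes f: "f \<in> carrier MA"
  shows "star MA f \<otimes>\<^bsub>MA\<^esub> f = (\<Sum>a\<in>Poly_Mapping.keys f. \<Sum>b\<in>Poly_Mapping.keys f.
    sg (\<iota> a \<otimes>\<^bsub>M\<^esub> b) (cnj (Poly_Mapping.lookup f a) * Poly_Mapping.lookup f b))"
proof -
  have "star MA f \<otimes>\<^bsub>MA\<^esub> f = (\<Sum>a\<in>Poly_Mapping.keys f. sg (\<iota> a) (cnj (Poly_Mapping.lookup f a)))
      \<otimes>\<^bsub>MA\<^esub> (\<Sum>b\<in>Poly_Mapping.keys f. sg b (Poly_Mapping.lookup f b))"
    using MA_star_superset[of "Poly_Mapping.keys f" f] sum_singles[of "Poly_Mapping.keys f" f] by simp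
  then show ?thesis unfolding MA_mult_sum_left MA_mult_sum_right MA_mult_single by (subst sum.swap)
qed

text \<open>
  A bound on the basis elements that is uniform in the seminorm makes the universal norm finite.
\<close>

lemma MA_seminorm_bound:
  assumes "cstar_seminorm MA q" "f \<in> carrier MA" "\<And>a. a \<in> carrier M \<Longrightarrow> q (sg a 1) \<le> b a"
  shows "q f \<le> (\<Sum>a\<in>Poly_Mapping.keys f. cmod (Poly_Mapping.lookup f a) * b a)"
proof -
  interpret q: seminormed MA q by unfold_locales fact
  have k: "a \<in> carrier M" if "a \<in> Poly_Mapping.keys f" for a using that assms(2) by (auto simp: MA_carrier)
  have "f = finsum MA (\<lambda>a. sg a (Poly_Mapping.lookup f a)) (Poly_Mapping.keys f)"
    using sum_singles[of "Poly_Mapping.keys f" f] k by (subst MA_finsum) auto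
  then have "q f \<le> (\<Sum>a\<in>Poly_Mapping.keys f. q (sg a (Poly_Mapping.lookup f a)))"
    using q.p_finsum[of "\<lambda>a. sg a (Poly_Mapping.lookup f a)" "Poly_Mapping.keys f"] k by auto
  also have "\<dots> \<le> (\<Sum>a\<in>Poly_Mapping.keys f. cmod (Poly_Mapping.lookup f a) * b a)"
  proof (rule sum_mono)
    fix a assume a: "a \<in> Poly_Mapping.keys f"
    show "q (sg a (Poly_Mapping.lookup f a)) \<le> cmod (Poly_Mapping.lookup f a) * b a"
      using q.p_smult[of "sg a 1" "Poly_Mapping.lookup f a"] assms(3)[OF k[OF a]] k[OF a]
      by (simp add: mult_left_mono)
  qed
  finally show ?thesis .
qed

end

lemma (in star_monoid) MA_universal:
  assumes T: "star_alg T"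
    and \<theta>: "\<And>a. a \<in> carrier M \<Longrightarrow> \<theta> a \<in> carrier T" "\<theta> \<one>\<^bsub>M\<^esub> = \<one>\<^bsub>T\<^esub>"
      "\<And>a b. \<lbrakk>a \<in> carrier M; b \<in> carrier M\<rbrakk> \<Longrightarrow> \<theta> (a \<otimes>\<^bsub>M\<^esub> b) = \<theta> a \<otimes>\<^bsub>T\<^esub> \<theta> b"
      "\<And>a. a \<in> carrier M \<Longrightarrow> \<theta> (\<iota> a) = star T (\<theta> a)"
  shows "\<exists>h \<in> star_hom MA T. \<forall>a \<in> carrier M. \<forall>c. h (sg a c) = c \<odot>\<^bsub>T\<^esub> \<theta> a"
proof -
  interpret T: star_alg T by fact
  define h where "h f = finsum T (\<lambda>a. Poly_Mapping.lookup f a \<odot>\<^bsub>T\<^esub> \<theta> a) (Poly_Mapping.keys f)" for f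
  have sup: "h f = finsum T (\<lambda>a. Poly_Mapping.lookup f a \<odot>\<^bsub>T\<^esub> \<theta> a) K"
    if "finite K" "Poly_Mapping.keys f \<subseteq> K" "K \<subseteq> carrier M" for f K
    unfolding h_def using that \<theta>(1)
    by (intro T.add.finprod_mono_neutral_cong_left) (auto simp: in_keys_iff)
  have cl: "h f \<in> carrier T" if "f \<in> carrier MA" for f
    unfolding h_def using that \<theta>(1) by (intro T.finsum_closed) (auto simp: MA_carrier)
  have sing: "h (sg a c) = c \<odot>\<^bsub>T\<^esub> \<theta> a" if "a \<in> carrier M" for a c
    using that \<theta>(1) by (subst sup[of "{a}"]) (auto split: if_splits)
  have add: "h (f + g) = h f \<oplus>\<^bsub>T\<^esub> h g" if f: "f \<in> carrier MA" and g: "g \<in> carrier MA" for f g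
  proof -
    let ?K = "Poly_Mapping.keys f \<union> Poly_Mapping.keys g"
    have K: "finite ?K" "Poly_Mapping.keys f \<subseteq> ?K" "Poly_Mapping.keys g \<subseteq> ?K"
      "Poly_Mapping.keys (f + g) \<subseteq> ?K" "?K \<subseteq> carrier M"
      using f g keys_add[of f g] by (auto simp: MA_carrier)
    show ?thesis
      unfolding sup[OF K(1,2,5)] sup[OF K(1,3,5)] sup[OF K(1,4,5)]
      using K(5) \<theta>(1) by (subst T.finsum_addf[symmetric])
        (auto simp: lookup_add T.smult_l_distr intro!: T.finsum_cong')
  qed
  have "h \<in> star_hom MA T"
    unfolding star_hom_def ring_hom_def
  proof (safe)
    fix f c assume f: "f \<in> carrier MA"
    show "h f \<in> carrier T" by (rule cl[OF f])
    show "h (c \<odot>\<^bsub>MA\<^esub> f) = c \<odot>\<^bsub>T\<^esub> h f" using f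
      by (induction rule: MA_induct) (simp_all add: sing \<theta> T.smult_smult MA_smult_add add cl T.smult_r_distr)
    show "h (star MA f) = star T (h f)" using f
      by (induction rule: MA_induct) (simp_all add: sing \<theta> T.star_smult MA_star_single MA_star_add add cl T.star_add)
  next
    fix f g assume f: "f \<in> carrier MA" and g: "g \<in> carrier MA"
    show "h (f \<oplus>\<^bsub>MA\<^esub> g) = h f \<oplus>\<^bsub>T\<^esub> h g" using add f g by simp
    show "h (f \<otimes>\<^bsub>MA\<^esub> g) = h f \<otimes>\<^bsub>T\<^esub> h g" using f
    proof (induction rule: MA_induct)
      case (single a x)
      show ?case using g
        by (induction rule: MA_induct)
          (simp_all add: MA_mult_single \<open>a \<in> carrier M\<close> sing \<theta> T.smult_l_assoc T.smult_r_assoc T.smult_smult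
            MA_mult_add_right add cl T.r_distr mult.commute)
    qed (simp add: MA_mult_add_left add cl g T.l_distr)
  next
    show "h \<one>\<^bsub>MA\<^esub> = \<one>\<^bsub>T\<^esub>" by (simp add: MA_one sing \<theta>)
  qed
  then show ?thesis using sing by blast
qed

section \<open>Positive functionals\<close>

text \<open>
  The Cauchy--Schwarz argument, for a sesquilinear form restricted to the line \<open>x + c y\<close>.  The values
  \<open>c = 1\<close> and \<open>c = \<i>\<close> give hermitian symmetry; real \<open>c\<close> gives the discriminant inequality; for \<open>b = 0\<close>
  the expression is affine along \<open>c = t * cnj z\<close> and would become negative unless \<open>z = 0\<close>.
\<close>

lemma nonneg_quadratic:
  fixes a b z w :: complex
  assumes "\<And>c. a + c * z + cnj c * w + c * cnj c * b \<in> \<real>\<^sub>\<ge>\<^sub>0" "b \<in> \<real>\<^sub>\<ge>\<^sub>0"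
  shows "w = cnj z" "(Re z)\<^sup>2 \<le> Re a * Re b" "b = 0 \<Longrightarrow> z = 0"
proof -
  note nn = assms(1)[unfolded complex_nonneg_Reals_iff]
  have b: "0 \<le> Re b" "Im b = 0" using assms(2) by (simp_all add: complex_nonneg_Reals_iff)
  have a: "0 \<le> Re a" "Im a = 0" using nn[of 0] by simp_all
  have "Im z + Im w = 0" using nn[of 1] a b by simp
  moreover have "Re z - Re w = 0" using nn[of "\<i>"] a b by simp
  ultimately show w: "w = cnj z" by (simp add: complex_eq_iff)
  have q: "0 \<le> Re a + 2 * t * Re z + t\<^sup>2 * Re b" for t
    using nn[of "complex_of_real t"] w b by (simp add: power2_eq_square algebra_simps)
  show "(Re z)\<^sup>2 \<le> Re a * Re b"
  proof (cases "Re b = 0")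
    case True
    have "Re z = 0"
    proof (rule ccontr)
      assume z: "Re z \<noteq> 0"
      have "0 \<le> Re a + 2 * (- (Re a + 1) / (2 * Re z)) * Re z"
        using q[of "- (Re a + 1) / (2 * Re z)"] True by simp
      then show False using z by (simp add: field_simps)
    qed
    then show ?thesis using True by simp
  next
    case False
    then have "0 < Re b" using b by simp
    have "0 \<le> Re a + 2 * (- Re z / Re b) * Re z + (- Re z / Re b)\<^sup>2 * Re b" by (rule q)
    also have "\<dots> = Re a - (Re z)\<^sup>2 / Re b" using False by (simp add: power2_eq_square field_simps)
    finally show ?thesis using \<open>0 < Re b\<close> by (simp add: field_simps)
  qed
  show "z = 0" if b0: "b = 0"
  proof (rule ccontr)
    assume z: "z \<noteq> 0"
    have "0 \<le> Re a + 2 * t * (cmod z)\<^sup>2" for t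
      using nn[of "complex_of_real t * cnj z"] w b0
      unfolding cmod_power2 by (simp add: power2_eq_square algebra_simps)
    from this[of "- (Re a + 1) / (2 * (cmod z)\<^sup>2)"]
    show False using z by (simp add: field_simps)
  qed
qed

definition positive_functional :: "('a, 'r) star_algebra_scheme \<Rightarrow> ('a \<Rightarrow> complex) \<Rightarrow> bool" where
  "positive_functional A \<tau> \<longleftrightarrow>
     (\<forall>x \<in> carrier A. \<forall>y \<in> carrier A. \<tau> (x \<oplus>\<^bsub>A\<^esub> y) = \<tau> x + \<tau> y) \<and>
     (\<forall>c. \<forall>x \<in> carrier A. \<tau> (c \<odot>\<^bsub>A\<^esub> x) = c * \<tau> x) \<and>
     (\<forall>x \<in> carrier A. \<tau> (star A x \<otimes>\<^bsub>A\<^esub> x) \<in> \<real>\<^sub>\<ge>\<^sub>0)"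

locale positive = star_alg A for A :: "('a, 'r) star_algebra_scheme" (structure) +
  fixes \<tau> :: "'a \<Rightarrow> complex"
  assumes pf: "positive_functional A \<tau>"
begin

lemma tau_add: "\<lbrakk>x \<in> carrier A; y \<in> carrier A\<rbrakk> \<Longrightarrow> \<tau> (x \<oplus> y) = \<tau> x + \<tau> y"
  and tau_smult: "x \<in> carrier A \<Longrightarrow> \<tau> (c \<odot> x) = c * \<tau> x"
  and tau_pos: "x \<in> carrier A \<Longrightarrow> \<tau> (star A x \<otimes> x) \<in> \<real>\<^sub>\<ge>\<^sub>0"
  using pf by (auto simp: positive_functional_def)

text \<open>
  The norm of \<open>x \<xi>\<close> in the GNS space of \<open>\<tau>\<close>, where \<open>\<xi>\<close> is the cyclic vector.
\<close>

definition N :: "'a \<Rightarrow> real" where "N x = sqrt (Re (\<tau> (star A x \<otimes> x)))"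

lemma N_sq: "x \<in> carrier A \<Longrightarrow> (N x)\<^sup>2 = Re (\<tau> (star A x \<otimes> x))"
  using tau_pos[of x] by (simp add: N_def complex_nonneg_Reals_iff)

lemma N_nonneg: "x \<in> carrier A \<Longrightarrow> 0 \<le> N x"
  using tau_pos[of x] by (simp add: N_def complex_nonneg_Reals_iff)

lemma tau_expand:
  assumes "x \<in> carrier A" "y \<in> carrier A"
  shows "\<tau> (star A (x \<oplus> c \<odot> y) \<otimes> (x \<oplus> c \<odot> y)) = \<tau> (star A x \<otimes> x) + c * \<tau> (star A x \<otimes> y)
    + cnj c * \<tau> (star A y \<otimes> x) + c * cnj c * \<tau> (star A y \<otimes> y)"
  using assms by (simp add: star_add star_smult l_distr r_distr smult_l_assoc smult_r_assoc smult_smult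
      tau_add tau_smult distrib_left)

lemma cauchy_schwarz:
  assumes "x \<in> carrier A" "y \<in> carrier A"
  shows "Re (\<tau> (star A x \<otimes> y)) \<le> N x * N y" "\<tau> (star A y \<otimes> x) = cnj (\<tau> (star A x \<otimes> y))"
proof -
  have q: "\<tau> (star A x \<otimes> x) + c * \<tau> (star A x \<otimes> y)
    + cnj c * \<tau> (star A y \<otimes> x) + c * cnj c * \<tau> (star A y \<otimes> y) \<in> \<real>\<^sub>\<ge>\<^sub>0" for c
    unfolding tau_expand[OF assms, symmetric] using assms by (intro tau_pos) auto
  note nq = nonneg_quadratic[OF q tau_pos[OF assms(2)]]
  show "\<tau> (star A y \<otimes> x) = cnj (\<tau> (star A x \<otimes> y))" by (rule nq)
  have "(Re (\<tau> (star A x \<otimes> y)))\<^sup>2 \<le> (N x * N y)\<^sup>2"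
    using nq(2) assms by (simp add: power_mult_distrib N_sq)
  then show "Re (\<tau> (star A x \<otimes> y)) \<le> N x * N y"
    using N_nonneg assms by (meson abs_le_square_iff abs_ge_self abs_of_nonneg mult_nonneg_nonneg order_trans power2_le_imp_le)
qed

lemma N_add:
  assumes "x \<in> carrier A" "y \<in> carrier A" shows "N (x \<oplus> y) \<le> N x + N y"
proof -
  have "(N (x \<oplus> y))\<^sup>2 = (N x)\<^sup>2 + Re (\<tau> (star A x \<otimes> y)) + Re (\<tau> (star A y \<otimes> x)) + (N y)\<^sup>2"
    using tau_expand[OF assms, of 1] assms by (simp add: N_sq)
  also have "\<dots> \<le> (N x)\<^sup>2 + N x * N y + N x * N y + (N y)\<^sup>2"
    using cauchy_schwarz[OF assms] by simp
  also have "\<dots> = (N x + N y)\<^sup>2" by (simp add: power2_eq_square algebra_simps)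
  finally show ?thesis by (rule power2_le_imp_le) (use assms N_nonneg in auto)
qed

lemma N_smult: assumes "x \<in> carrier A" shows "N (c \<odot> x) = cmod c * N x"
proof -
  have "\<tau> (star A (c \<odot> x) \<otimes> (c \<odot> x)) = (cnj c * c) * \<tau> (star A x \<otimes> x)"
    using assms by (simp add: star_smult smult_l_assoc smult_r_assoc smult_smult tau_smult)
  also have "cnj c * c = complex_of_real ((cmod c)\<^sup>2)" unfolding complex_norm_square by (rule mult.commute)
  finally show ?thesis by (simp add: N_def real_sqrt_mult)
qed

end

locale positive_family = star_alg A for A :: "('a, 'r) star_algebra_scheme" (structure) +
  fixes \<T> :: "('a \<Rightarrow> complex) set"
  assumes pfs: "\<tau> \<in> \<T> \<Longrightarrow> positive_functional A \<tau>"
    and bounded: "x \<in> carrier A \<Longrightarrow> \<exists>K\<ge>0. \<forall>\<tau>\<in>\<T>. \<forall>y\<in>carrier A. positive.N A \<tau> (x \<otimes> y) \<le> K * positive.N A \<tau> y"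
begin

abbreviation "NN \<equiv> positive.N A"

lemma positive: "\<tau> \<in> \<T> \<Longrightarrow> positive A \<tau>"
  by unfold_locales (rule pfs)

text \<open>
  The operator norm of \<open>x\<close> in the direct sum of the GNS representations of the functionals in \<open>\<T>\<close>,
  computed on the dense subspaces of vectors \<open>y \<xi>\<close>.  No Hilbert space is formed.
\<close>

definition gns :: "'a \<Rightarrow> real" where
  "gns x = Sup (insert 0 {sqrt (Re (\<tau> (star A (x \<otimes> y) \<otimes> (x \<otimes> y))) / Re (\<tau> (star A y \<otimes> y)))
     | \<tau> y. \<tau> \<in> \<T> \<and> y \<in> carrier A \<and> \<tau> (star A y \<otimes> y) \<noteq> 0})"

lemma ratio: "\<lbrakk>\<tau> \<in> \<T>; x \<in> carrier A; y \<in> carrier A\<rbrakk> \<Longrightarrow>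
    sqrt (Re (\<tau> (star A (x \<otimes> y) \<otimes> (x \<otimes> y))) / Re (\<tau> (star A y \<otimes> y))) = NN \<tau> (x \<otimes> y) / NN \<tau> y"
  by (simp add: positive.N_def[OF positive] real_sqrt_divide)

lemma N_pos: assumes "\<tau> \<in> \<T>" "y \<in> carrier A" shows "\<tau> (star A y \<otimes> y) \<noteq> 0 \<longleftrightarrow> 0 < NN \<tau> y"
  using positive.tau_pos[OF positive[OF assms(1)] assms(2)]
  by (auto simp: positive.N_def[OF positive[OF assms(1)]] complex_nonneg_Reals_iff complex_eq_iff)

lemma gns_le:
  assumes "x \<in> carrier A" "0 \<le> K" "\<And>\<tau> y. \<tau> \<in> \<T> \<Longrightarrow> y \<in> carrier A \<Longrightarrow> NN \<tau> (x \<otimes> y) \<le> K * NN \<tau> y"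
  shows "gns x \<le> K"
  unfolding gns_def
proof (rule cSup_least)
  fix r assume "r \<in> insert 0 {sqrt (Re (\<tau> (star A (x \<otimes> y) \<otimes> (x \<otimes> y))) / Re (\<tau> (star A y \<otimes> y)))
     | \<tau> y. \<tau> \<in> \<T> \<and> y \<in> carrier A \<and> \<tau> (star A y \<otimes> y) \<noteq> 0}"
  then consider "r = 0" | \<tau> y where "r = NN \<tau> (x \<otimes> y) / NN \<tau> y" "\<tau> \<in> \<T>" "y \<in> carrier A" "0 < NN \<tau> y"
    using ratio[OF _ assms(1)] N_pos by auto
  then show "r \<le> K" using assms by cases (auto simp: divide_le_eq)
qed simp

lemma gns_bdd:
  assumes "x \<in> carrier A"
  shows "bdd_above (insert 0 {sqrt (Re (\<tau> (star A (x \<otimes> y) \<otimes> (x \<otimes> y))) / Re (\<tau> (star A y \<otimes> y)))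
     | \<tau> y. \<tau> \<in> \<T> \<and> y \<in> carrier A \<and> \<tau> (star A y \<otimes> y) \<noteq> 0})"
proof -
  obtain K where K: "K \<ge> 0" "\<forall>\<tau>\<in>\<T>. \<forall>y\<in>carrier A. NN \<tau> (x \<otimes> y) \<le> K * NN \<tau> y" using bounded[OF assms] by blast
  have "r \<le> K" if r: "r \<in> insert 0 {sqrt (Re (\<tau> (star A (x \<otimes> y) \<otimes> (x \<otimes> y))) / Re (\<tau> (star A y \<otimes> y)))
     | \<tau> y. \<tau> \<in> \<T> \<and> y \<in> carrier A \<and> \<tau> (star A y \<otimes> y) \<noteq> 0}" for r
  proof -
    from r consider "r = 0" | \<tau> y where "r = NN \<tau> (x \<otimes> y) / NN \<tau> y" "\<tau> \<in> \<T>" "y \<in> carrier A" "0 < NN \<tau> y"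
      using ratio[OF _ assms(1)] N_pos by auto
    then show "r \<le> K" using K by cases (auto simp: divide_le_eq)
  qed
  then show ?thesis by (rule bdd_aboveI)
qed

lemma gns_nonneg: "x \<in> carrier A \<Longrightarrow> 0 \<le> gns x"
  unfolding gns_def by (rule cSup_upper[OF _ gns_bdd]) auto

lemma gns_bound:
  assumes "x \<in> carrier A" "\<tau> \<in> \<T>" "y \<in> carrier A"
  shows "NN \<tau> (x \<otimes> y) \<le> gns x * NN \<tau> y"
proof (cases "0 < NN \<tau> y")
  case True
  have "NN \<tau> (x \<otimes> y) / NN \<tau> y \<le> gns x"
    unfolding gns_def
    by (rule cSup_upper[OF _ gns_bdd[OF assms(1)]])
      (use ratio[OF assms(2,1,3)] N_pos[OF assms(2,3)] True assms in \<open>auto intro!: exI[of _ \<tau>] exI[of _ y]\<close>)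
  then show ?thesis using True by (simp add: divide_le_eq)
next
  case False
  then have "NN \<tau> y = 0" using positive.N_nonneg[OF positive[OF assms(2)] assms(3)] by simp
  then show ?thesis using bounded[OF assms(1)] assms by fastforce
qed

text \<open>
  The nontrivial half of the C*-identity: \<open>\<parallel>x y \<xi>\<parallel>\<^sup>2 = \<langle>y \<xi>, x\<^sup>* x y \<xi>\<rangle>\<close>, followed by Cauchy--Schwarz.
\<close>

lemma gns_star_sq: assumes "x \<in> carrier A" shows "(gns x)\<^sup>2 \<le> gns (star A x \<otimes> x)"
proof -
  let ?r = "gns (star A x \<otimes> x)"
  have r: "0 \<le> ?r" using assms by (intro gns_nonneg) auto
  have "gns x \<le> sqrt ?r"
  proof (rule gns_le)
    fix \<tau> y assume t: "\<tau> \<in> \<T>" and y: "y \<in> carrier A"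
    interpret positive A \<tau> by (rule positive[OF t])
    have "(N (x \<otimes> y))\<^sup>2 = Re (\<tau> (star A y \<otimes> ((star A x \<otimes> x) \<otimes> y)))"
      using assms y by (simp add: N_sq star_mult m_assoc)
    also have "\<dots> \<le> N y * N ((star A x \<otimes> x) \<otimes> y)"
      using assms y by (intro cauchy_schwarz) auto
    also have "\<dots> \<le> N y * (?r * N y)"
      using assms y t by (intro mult_left_mono gns_bound N_nonneg) auto
    also have "\<dots> = (sqrt ?r * N y)\<^sup>2" using r by (simp add: power2_eq_square)
    finally show "N (x \<otimes> y) \<le> sqrt ?r * N y"
      by (rule power2_le_imp_le) (use r N_nonneg y in auto)
  qed (use assms r in auto)
  then have "(gns x)\<^sup>2 \<le> (sqrt ?r)\<^sup>2" using assms gns_nonneg by (intro power_mono) auto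
  then show ?thesis using r by simp
qed

lemma gns_seminorm: "cstar_seminorm A gns"
proof -
  have mult: "gns (x \<otimes> y) \<le> gns x * gns y" if x: "x \<in> carrier A" and y: "y \<in> carrier A" for x y
  proof (rule gns_le)
    fix \<tau> z assume t: "\<tau> \<in> \<T>" and z: "z \<in> carrier A"
    have "NN \<tau> (x \<otimes> y \<otimes> z) \<le> gns x * NN \<tau> (y \<otimes> z)"
      using gns_bound[OF x t, of "y \<otimes> z"] x y z by (simp add: m_assoc)
    also have "\<dots> \<le> gns x * (gns y * NN \<tau> z)"
      using x y z t by (intro mult_left_mono gns_bound gns_nonneg) auto
    finally show "NN \<tau> (x \<otimes> y \<otimes> z) \<le> gns x * gns y * NN \<tau> z" by simp
  qed (use x y gns_nonneg in auto)
  have star_le: "gns x \<le> gns (star A x)" if x: "x \<in> carrier A" for x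
  proof (cases "gns x = 0")
    case False
    have "gns x * gns x \<le> gns (star A x) * gns x"
      using gns_star_sq[OF x] mult[of "star A x" x] x by (simp add: power2_eq_square)
    then show ?thesis using False gns_nonneg[OF x] by simp
  qed (use x gns_nonneg in auto)
  have smult_le: "gns (c \<odot> x) \<le> cmod c * gns x" if x: "x \<in> carrier A" for c x
  proof (rule gns_le)
    fix \<tau> y assume t: "\<tau> \<in> \<T>" and y: "y \<in> carrier A"
    interpret positive A \<tau> by (rule positive[OF t])
    show "N ((c \<odot> x) \<otimes> y) \<le> cmod c * gns x * N y"
      using x y gns_bound[OF x t y] by (simp add: smult_l_assoc N_smult mult.assoc mult_left_mono)
  qed (use x gns_nonneg in auto)
  show ?thesis unfolding cstar_seminorm_def
  proof (intro conjI ballI allI)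
    fix x y c assume x: "x \<in> carrier A" and y: "y \<in> carrier A"
    show "0 \<le> gns x" by (rule gns_nonneg[OF x])
    show "gns (x \<otimes> y) \<le> gns x * gns y" by (rule mult[OF x y])
    show "gns (x \<oplus> y) \<le> gns x + gns y"
    proof (rule gns_le)
      fix \<tau> z assume t: "\<tau> \<in> \<T>" and z: "z \<in> carrier A"
      interpret positive A \<tau> by (rule positive[OF t])
      show "N ((x \<oplus> y) \<otimes> z) \<le> (gns x + gns y) * N z"
        using N_add[of "x \<otimes> z" "y \<otimes> z"] gns_bound[OF x t z] gns_bound[OF y t z] x y z
        by (simp add: l_distr distrib_right)
    qed (use x y gns_nonneg in auto)
    show "gns (c \<odot> x) = cmod c * gns x"
    proof (rule antisym[OF smult_le[OF x]])
      show "cmod c * gns x \<le> gns (c \<odot> x)"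
      proof (cases "c = 0")
        case False
        have "gns ((1 / c) \<odot> (c \<odot> x)) \<le> cmod (1 / c) * gns (c \<odot> x)" using x by (intro smult_le) auto
        then show ?thesis using False x by (simp add: smult_smult norm_divide field_simps)
      qed (use x gns_nonneg in auto)
    qed
    have "gns (star A x) = gns x" using star_le[OF x] star_le[of "star A x"] x by simp
    then have "gns (star A x \<otimes> x) \<le> (gns x)\<^sup>2" using mult[of "star A x" x] x by (simp add: power2_eq_square)
    then show "gns (star A x \<otimes> x) = (gns x)\<^sup>2" using gns_star_sq[OF x] by simp
  qed
qed

end

section \<open>Schur products\<close>

definition psd :: "'i set \<Rightarrow> ('i \<Rightarrow> 'i \<Rightarrow> complex) \<Rightarrow> bool" where
  "psd I M \<longleftrightarrow> (\<forall>c. (\<Sum>i\<in>I. \<Sum>j\<in>I. cnj (c i) * c j * M i j) \<in> \<real>\<^sub>\<ge>\<^sub>0)"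

text \<open>
  Schur's product theorem, the reason why product functionals on tensor products are positive.  Induction
  on a set \<open>J\<close> outside of which \<open>N\<close> vanishes.  If \<open>N\<^sub>k\<^sub>k = 0\<close>, then the whole \<open>k\<close>-th row and column vanish.
  Otherwise the rank-one matrix \<open>N\<^sub>i\<^sub>k N\<^sub>k\<^sub>j / N\<^sub>k\<^sub>k\<close> can be subtracted, leaving the Schur complement
  \<open>N'\<close>, which is positive semidefinite and vanishes outside of \<open>J\<close>; the entrywise product of \<open>M\<close> with
  the rank-one matrix is a congruence transform of \<open>M\<close>.
\<close>

lemma psd_schur:
  assumes "finite I" "psd I M" "psd I N"
  shows "psd I (\<lambda>i j. M i j * N i j)"
proof -
  have "psd I (\<lambda>i j. M i j * N i j)"
    if "finite J" "J \<subseteq> I" "psd I N" "\<And>i j. i \<in> I \<Longrightarrow> j \<in> I \<Longrightarrow> i \<notin> J \<or> j \<notin> J \<Longrightarrow> N i j = 0" for J N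
    using that
  proof (induction J arbitrary: N rule: finite_induct)
    case empty
    then show ?case by (auto simp: psd_def)
  next
    case (insert k J)
    have k: "k \<in> I" using insert by auto
    define S where "S c d = (\<Sum>i\<in>I. \<Sum>j\<in>I. cnj (c i) * d j * N i j)" for c d
    define e where "e i = (if i = k then 1 else 0 :: complex)" for i
    have Sp: "S c c \<in> \<real>\<^sub>\<ge>\<^sub>0" for c using insert.prems(2) by (simp add: psd_def S_def)
    have Sce: "S c e = (\<Sum>i\<in>I. cnj (c i) * N i k)" for c
      unfolding S_def e_def using k \<open>finite I\<close>
      by (intro sum.cong refl) (simp add: if_distrib[of "\<lambda>x. _ * x"] if_distrib[of "\<lambda>x. x * _"] cong: if_cong)
    have Sec: "S e c = (\<Sum>j\<in>I. c j * N k j)" for c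
      unfolding S_def e_def using k \<open>finite I\<close>
      by (subst sum.swap, intro sum.cong refl)
        (simp add: if_distrib[of "\<lambda>x. x * _"] if_distrib[of cnj] cong: if_cong)
    have See: "S e e = N k k"
      unfolding Sec e_def using k \<open>finite I\<close> by (simp add: if_distrib[of "\<lambda>x. x * _"] cong: if_cong)
    have expand: "S (\<lambda>i. c i + t * e i) (\<lambda>i. c i + t * e i)
        = S c c + t * S c e + cnj t * S e c + t * cnj t * N k k" for c t
    proof -
      have "S (\<lambda>i. c i + t * e i) (\<lambda>i. c i + t * e i) = S c c + t * S c e + cnj t * S e c + t * cnj t * S e e"
        unfolding S_def sum_distrib_left sum.distrib[symmetric]
        by (intro sum.cong refl) (simp add: algebra_simps)
      then show ?thesis by (simp add: See)
    qed
    have q: "S c c + t * S c e + cnj t * S e c + t * cnj t * N k k \<in> \<real>\<^sub>\<ge>\<^sub>0" for c t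
      unfolding expand[symmetric] by (rule Sp)
    have b: "N k k \<in> \<real>\<^sub>\<ge>\<^sub>0" using Sp[of e] See by simp
    note nq = nonneg_quadratic[OF q b]
    have herm: "S e c = cnj (S c e)" for c by (rule nq(1))
    have ind: "S (\<lambda>i. if i = j then 1 else 0) e = N j k" "S e (\<lambda>i. if i = j then 1 else 0) = N k j"
      if "j \<in> I" for j
      unfolding Sce Sec using that \<open>finite I\<close>
      by (simp_all add: if_distrib[of "\<lambda>x. x * _"] if_distrib[of cnj] cong: if_cong)
    have hermN: "N k j = cnj (N j k)" if "j \<in> I" for j using herm ind[OF that] by metis
    show ?case
    proof (cases "N k k = 0")
      case True
      have z: "N j k = 0" "N k j = 0" if "j \<in> I" for j
        using nq(3)[OF True] ind[OF that] hermN[OF that] by (metis complex_cnj_zero)+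
      show ?thesis
      proof (rule insert.IH)
        show "N i j = 0" if "i \<in> I" "j \<in> I" "i \<notin> J \<or> j \<notin> J" for i j
          using that z insert.prems(3)[of i j] by (cases "i = k \<or> j = k") auto
      qed (use insert.prems in auto)
    next
      case False
      define b where "b = N k k"
      have b0: "b \<noteq> 0" "cnj b = b" "1 / b \<in> \<real>\<^sub>\<ge>\<^sub>0"
        using False b nonneg_Reals_divide_I[OF nonneg_Reals_one_I b]
        unfolding b_def by (simp_all add: complex_nonneg_Reals_iff complex_eq_iff del: nonneg_Reals_divide_I)
      define N' where "N' i j = N i j - N i k * N k j / b" for i j
      have "psd I N'" unfolding psd_def
      proof
        fix c
        \<comment> \<open>The minimiser of the quadratic form of \<open>N\<close> on the line \<open>c + t e\<close>; the minimum is the form of \<open>N'\<close>.\<close>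
        define t where "t = - S e c / b"
        have ct: "cnj t = - S c e / b" unfolding t_def using herm[of c] b0 by simp
        have "(\<Sum>i\<in>I. \<Sum>j\<in>I. cnj (c i) * c j * N' i j) = S c c - (\<Sum>i\<in>I. \<Sum>j\<in>I. (cnj (c i) * N i k) * (c j * N k j)) / b"
          unfolding S_def N'_def sum_divide_distrib sum_subtractf[symmetric]
          by (intro sum.cong refl) (simp add: algebra_simps)
        also have "(\<Sum>i\<in>I. \<Sum>j\<in>I. (cnj (c i) * N i k) * (c j * N k j)) = S c e * S e c"
          unfolding Sce Sec sum_product ..
        also have "S c c - S c e * S e c / b = S c c + t * S c e + cnj t * S e c + t * cnj t * N k k"
          unfolding ct b_def[symmetric] unfolding t_def using b0 by (simp add: field_simps)
        also have "\<dots> \<in> \<real>\<^sub>\<ge>\<^sub>0" by (rule q)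
        finally show "(\<Sum>i\<in>I. \<Sum>j\<in>I. cnj (c i) * c j * N' i j) \<in> \<real>\<^sub>\<ge>\<^sub>0" .
      qed
      moreover have "N' i j = 0" if "i \<in> I" "j \<in> I" "i \<notin> J \<or> j \<notin> J" for i j
      proof (cases "i = k \<or> j = k")
        case True
        then show ?thesis using b0 by (auto simp: N'_def b_def)
      next
        case False
        then have "i \<notin> insert k J \<or> j \<notin> insert k J" using that by auto
        then have "N i j = 0" "N i k = 0 \<or> N k j = 0"
          using insert.prems(3)[OF that(1,2)] insert.prems(3)[OF that(1) k] insert.prems(3)[OF k that(2)] by auto
        then show ?thesis by (auto simp: N'_def)
      qed
      ultimately have IH: "psd I (\<lambda>i j. M i j * N' i j)" using insert by auto
      show ?thesis unfolding psd_def
      proof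
        fix c
        define d where "d j = c j * N k j" for j
        have "(\<Sum>i\<in>I. \<Sum>j\<in>I. cnj (c i) * c j * (M i j * N i j))
          = (\<Sum>i\<in>I. \<Sum>j\<in>I. cnj (c i) * c j * (M i j * N' i j)) + (1 / b) * (\<Sum>i\<in>I. \<Sum>j\<in>I. cnj (d i) * d j * M i j)"
          unfolding sum_distrib_left sum.distrib[symmetric]
        proof (intro sum.cong refl)
          fix i j assume i: "i \<in> I"
          have "cnj (N k i) = N i k" using hermN[OF i] by simp
          then show "cnj (c i) * c j * (M i j * N i j)
            = cnj (c i) * c j * (M i j * N' i j) + (1 / b) * (cnj (d i) * d j * M i j)"
            by (simp add: N'_def d_def algebra_simps)
        qed
        also have "\<dots> \<in> \<real>\<^sub>\<ge>\<^sub>0"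
          using IH \<open>psd I M\<close> b0(3) unfolding psd_def by (intro nonneg_Reals_add_I nonneg_Reals_mult_I) auto
        finally show "(\<Sum>i\<in>I. \<Sum>j\<in>I. cnj (c i) * c j * (M i j * N i j)) \<in> \<real>\<^sub>\<ge>\<^sub>0" .
      qed
    qed
  qed
  from this[OF assms(1) subset_refl assms(3)] show ?thesis by simp
qed

lemma state_positive: "state A \<phi> \<Longrightarrow> positive_functional A \<phi>"
  by (simp add: state_def positive_functional_def)

lemma (in positive) tau_finsum:
  assumes "\<And>i. i \<in> I \<Longrightarrow> f i \<in> carrier A"
  shows "\<tau> (finsum A f I) = (\<Sum>i\<in>I. \<tau> (f i))"
proof -
  have "\<tau> (0 \<odot> \<zero>) = 0" by (subst tau_smult) auto
  then have z: "\<tau> \<zero> = 0" by simp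
  show ?thesis using assms
  proof (induction I rule: infinite_finite_induct)
    case (insert i I)
    then have "finsum A f (insert i I) = f i \<oplus> finsum A f I" by (intro finsum_insert) auto
    then show ?case using insert by (simp add: tau_add finsum_closed)
  qed (auto simp: z)
qed

lemma (in positive) psd_tau:
  assumes "\<And>i. i \<in> I \<Longrightarrow> a i \<in> carrier A"
  shows "psd I (\<lambda>i j. \<tau> (star A (a i) \<otimes> a j))"
  unfolding psd_def
proof
  fix c
  define x where "x = (\<Oplus>i\<in>I. c i \<odot> a i)"
  have x: "x \<in> carrier A" unfolding x_def using assms by auto
  have "star A x \<otimes> x = (\<Oplus>i\<in>I. (cnj (c i) \<odot> star A (a i)) \<otimes> x)"
  proof -
    have "star A x = (\<Oplus>i\<in>I. star A (c i \<odot> a i))" unfolding x_def using assms by (intro star_finsum) auto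
    also have "\<dots> = (\<Oplus>i\<in>I. cnj (c i) \<odot> star A (a i))"
      using assms by (intro finsum_cong') (auto simp: star_smult)
    finally show ?thesis using assms x by (simp add: finsum_mult_right Pi_def)
  qed
  then have "\<tau> (star A x \<otimes> x) = (\<Sum>i\<in>I. \<tau> ((cnj (c i) \<odot> star A (a i)) \<otimes> x))"
    using assms x by (simp add: tau_finsum)
  also have "\<dots> = (\<Sum>i\<in>I. \<Sum>j\<in>I. cnj (c i) * c j * \<tau> (star A (a i) \<otimes> a j))"
  proof (intro sum.cong refl)
    fix i assume i: "i \<in> I"
    have "(cnj (c i) \<odot> star A (a i)) \<otimes> x = (\<Oplus>j\<in>I. (cnj (c i) \<odot> star A (a i)) \<otimes> (c j \<odot> a j))"
      unfolding x_def using assms i by (intro finsum_mult_left) auto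
    then have "\<tau> ((cnj (c i) \<odot> star A (a i)) \<otimes> x) = (\<Sum>j\<in>I. \<tau> ((cnj (c i) \<odot> star A (a i)) \<otimes> (c j \<odot> a j)))"
      using assms i by (simp add: tau_finsum)
    also have "\<dots> = (\<Sum>j\<in>I. cnj (c i) * c j * \<tau> (star A (a i) \<otimes> a j))"
      using assms i by (intro sum.cong refl) (simp add: smult_l_assoc smult_r_assoc smult_smult tau_smult)
    finally show "\<tau> ((cnj (c i) \<odot> star A (a i)) \<otimes> x) = \<dots>" .
  qed
  finally show "(\<Sum>i\<in>I. \<Sum>j\<in>I. cnj (c i) * c j * \<tau> (star A (a i) \<otimes> a j)) \<in> \<real>\<^sub>\<ge>\<^sub>0"
    using tau_pos[OF x] by simp
qed

text \<open>
  For \<open>c > \<parallel>a\<parallel>\<^sup>2\<close> there is a self-adjoint \<open>z\<close> with \<open>z\<^sup>2 + a\<^sup>* a / c = 1\<close>.  Evaluated at a vector \<open>y \<xi>\<close> of a GNS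
  representation this gives \<open>\<parallel>a y \<xi>\<parallel>\<^sup>2 \<le> c \<parallel>y \<xi>\<parallel>\<^sup>2\<close>, so that boundedness is automatic.  The map \<open>E\<close> is not assumed
  linear, since \<open>a \<mapsto> (a, 1)\<close> into formal combinations of pairs is not; only the functionals have to
  see it as linear.
\<close>

lemma embedded_bounded:
  assumes X: "cstar_alg X" and T: "star_alg T"
    and pf: "\<And>\<tau>. \<tau> \<in> \<T> \<Longrightarrow> positive_functional T \<tau>"
    and E: "\<And>a. a \<in> carrier X \<Longrightarrow> E a \<in> carrier T" "E \<one>\<^bsub>X\<^esub> = \<one>\<^bsub>T\<^esub>"
      "\<And>a b. \<lbrakk>a \<in> carrier X; b \<in> carrier X\<rbrakk> \<Longrightarrow> E (a \<otimes>\<^bsub>X\<^esub> b) = E a \<otimes>\<^bsub>T\<^esub> E b"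
      "\<And>a. a \<in> carrier X \<Longrightarrow> E (star X a) = star T (E a)"
    and lin: "\<And>\<tau> y a b c. \<lbrakk>\<tau> \<in> \<T>; y \<in> carrier T; a \<in> carrier X; b \<in> carrier X\<rbrakk> \<Longrightarrow>
        \<tau> (star T y \<otimes>\<^bsub>T\<^esub> E (a \<oplus>\<^bsub>X\<^esub> (c \<odot>\<^bsub>X\<^esub> b)) \<otimes>\<^bsub>T\<^esub> y)
        = \<tau> (star T y \<otimes>\<^bsub>T\<^esub> E a \<otimes>\<^bsub>T\<^esub> y) + c * \<tau> (star T y \<otimes>\<^bsub>T\<^esub> E b \<otimes>\<^bsub>T\<^esub> y)"
    and a: "a \<in> carrier X"
  shows "\<exists>K\<ge>0. \<forall>\<tau>\<in>\<T>. \<forall>y\<in>carrier T. positive.N T \<tau> (E a \<otimes>\<^bsub>T\<^esub> y) \<le> K * positive.N T \<tau> y"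
proof -
  interpret X: cstar_alg X by fact
  interpret T: star_alg T by fact
  define c where "c = (nrm X a)\<^sup>2 + 1"
  have c: "0 < c" "(nrm X a)\<^sup>2 < c" using a by (auto simp: c_def add_nonneg_pos)
  let ?aa = "star X a \<otimes>\<^bsub>X\<^esub> a"
  define h where "h = complex_of_real (1 / c) \<odot>\<^bsub>X\<^esub> ?aa"
  have h: "h \<in> carrier X" "star X h = h" using a by (auto simp: h_def X.star_smult X.star_mult)
  have "nrm X h < 1" unfolding h_def using a c by (simp add: X.p_smult X.p_star_mult norm_divide)
  then obtain z where z: "z \<in> carrier X" "star X z = z" "z \<otimes>\<^bsub>X\<^esub> z = \<one>\<^bsub>X\<^esub> \<ominus>\<^bsub>X\<^esub> h"
    using X.sqrt_exists[OF h] by blast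
  have "z \<otimes>\<^bsub>X\<^esub> z \<oplus>\<^bsub>X\<^esub> h = \<one>\<^bsub>X\<^esub>" unfolding z(3) using h(1) by (simp add: a_minus_def X.a_assoc X.l_neg)
  then have one: "z \<otimes>\<^bsub>X\<^esub> z \<oplus>\<^bsub>X\<^esub> complex_of_real (1 / c) \<odot>\<^bsub>X\<^esub> ?aa = \<one>\<^bsub>X\<^esub>" by (simp add: h_def)
  show ?thesis
  proof (intro exI[of _ "sqrt c"] conjI ballI)
    fix \<tau> y assume t: "\<tau> \<in> \<T>" and y: "y \<in> carrier T"
    interpret positive T \<tau> by unfold_locales (rule pf[OF t])
    have sq: "\<tau> (star T y \<otimes>\<^bsub>T\<^esub> E (star X b \<otimes>\<^bsub>X\<^esub> b) \<otimes>\<^bsub>T\<^esub> y) = \<tau> (star T (E b \<otimes>\<^bsub>T\<^esub> y) \<otimes>\<^bsub>T\<^esub> (E b \<otimes>\<^bsub>T\<^esub> y))"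
      if "b \<in> carrier X" for b
      using that y by (simp add: E T.star_mult T.m_assoc)
    have "\<tau> (star T y \<otimes>\<^bsub>T\<^esub> y) = \<tau> (star T y \<otimes>\<^bsub>T\<^esub> E (z \<otimes>\<^bsub>X\<^esub> z \<oplus>\<^bsub>X\<^esub> complex_of_real (1 / c) \<odot>\<^bsub>X\<^esub> ?aa) \<otimes>\<^bsub>T\<^esub> y)"
      unfolding one using y by (simp add: E)
    also have "\<dots> = \<tau> (star T y \<otimes>\<^bsub>T\<^esub> E (z \<otimes>\<^bsub>X\<^esub> z) \<otimes>\<^bsub>T\<^esub> y) + complex_of_real (1 / c) * \<tau> (star T y \<otimes>\<^bsub>T\<^esub> E ?aa \<otimes>\<^bsub>T\<^esub> y)"
      using t y z(1) a by (intro lin) auto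
    finally have "\<tau> (star T y \<otimes>\<^bsub>T\<^esub> y) = \<tau> (star T (E z \<otimes>\<^bsub>T\<^esub> y) \<otimes>\<^bsub>T\<^esub> (E z \<otimes>\<^bsub>T\<^esub> y))
        + complex_of_real (1 / c) * \<tau> (star T (E a \<otimes>\<^bsub>T\<^esub> y) \<otimes>\<^bsub>T\<^esub> (E a \<otimes>\<^bsub>T\<^esub> y))"
      using sq[OF z(1)] sq[OF a] z(2) by simp
    then have "Re (\<tau> (star T y \<otimes>\<^bsub>T\<^esub> y)) = Re (\<tau> (star T (E z \<otimes>\<^bsub>T\<^esub> y) \<otimes>\<^bsub>T\<^esub> (E z \<otimes>\<^bsub>T\<^esub> y))
        + complex_of_real (1 / c) * \<tau> (star T (E a \<otimes>\<^bsub>T\<^esub> y) \<otimes>\<^bsub>T\<^esub> (E a \<otimes>\<^bsub>T\<^esub> y)))" by simp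
    also have "\<dots> = Re (\<tau> (star T (E z \<otimes>\<^bsub>T\<^esub> y) \<otimes>\<^bsub>T\<^esub> (E z \<otimes>\<^bsub>T\<^esub> y)))
        + Re (\<tau> (star T (E a \<otimes>\<^bsub>T\<^esub> y) \<otimes>\<^bsub>T\<^esub> (E a \<otimes>\<^bsub>T\<^esub> y))) / c"
      by (simp only: plus_complex.sel Re_complex_of_real Im_complex_of_real times_complex.sel) simp
    finally have "(N y)\<^sup>2 = (N (E z \<otimes>\<^bsub>T\<^esub> y))\<^sup>2 + (N (E a \<otimes>\<^bsub>T\<^esub> y))\<^sup>2 / c"
      using y E z a by (simp add: N_sq)
    then have "(N (E a \<otimes>\<^bsub>T\<^esub> y))\<^sup>2 / c \<le> (N y)\<^sup>2" by simp
    then have "(N (E a \<otimes>\<^bsub>T\<^esub> y))\<^sup>2 \<le> (sqrt c * N y)\<^sup>2"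
      using c by (simp add: power_mult_distrib pos_divide_le_eq mult.commute)
    then show "N (E a \<otimes>\<^bsub>T\<^esub> y) \<le> sqrt c * N y"
      by (rule power2_le_imp_le) (use c y N_nonneg in auto)
  qed (use c in auto)
qed

section \<open>Minimal tensor products\<close>

locale cstar_pair = A: cstar_alg A + B: cstar_alg B
  for A :: "('a, 'r) cstar_algebra_scheme" and B :: "('b, 's) cstar_algebra_scheme"
begin

abbreviation "T \<equiv> pre_tensor A B"
abbreviation "sg \<equiv> Poly_Mapping.single :: 'a \<times> 'b \<Rightarrow> complex \<Rightarrow> 'a \<times> 'b \<Rightarrow>\<^sub>0 complex"

sublocale T: star_monoid "A \<times>\<times> B" "map_prod (star A) (star B)"
  rewrites "monoid_algebra (A \<times>\<times> B) (map_prod (star A) (star B)) = T"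
proof -
  interpret monoid "A \<times>\<times> B" by (rule DirProd_monoid[OF A.is_monoid B.is_monoid])
  show "star_monoid (A \<times>\<times> B) (map_prod (star A) (star B))"
    by unfold_locales (auto simp: DirProd_def A.star_mult B.star_mult)
qed (simp add: pre_tensor_def)

lemma carrier_prod: "carrier (A \<times>\<times> B) = carrier A \<times> carrier B"
  and one_prod: "\<one>\<^bsub>A \<times>\<times> B\<^esub> = (\<one>\<^bsub>A\<^esub>, \<one>\<^bsub>B\<^esub>)"
  and mult_prod: "(a, b) \<otimes>\<^bsub>A \<times>\<times> B\<^esub> (a', b') = (a \<otimes>\<^bsub>A\<^esub> a', b \<otimes>\<^bsub>B\<^esub> b')"
  by (auto simp: DirProd_def)


lemma tf_superset:
  assumes "finite K" "Poly_Mapping.keys f \<subseteq> K"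
  shows "tensor_functional \<phi> \<psi> f = (\<Sum>k\<in>K. Poly_Mapping.lookup f k * (\<phi> (fst k) * \<psi> (snd k)))"
proof -
  have "tensor_functional \<phi> \<psi> f = (\<Sum>k\<in>Poly_Mapping.keys f. Poly_Mapping.lookup f k * (\<phi> (fst k) * \<psi> (snd k)))"
    unfolding tensor_functional_def by (intro sum.cong refl) (auto simp: mult.assoc)
  also have "\<dots> = (\<Sum>k\<in>K. Poly_Mapping.lookup f k * (\<phi> (fst k) * \<psi> (snd k)))"
    using assms by (intro sum.mono_neutral_left) (auto simp: in_keys_iff)
  finally show ?thesis .
qed

lemma tf_single [simp]: "tensor_functional \<phi> \<psi> (sg k c) = c * (\<phi> (fst k) * \<psi> (snd k))"
  by (subst tf_superset[of "{k}"]) (auto split: if_splits)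

lemma tf_add: "tensor_functional \<phi> \<psi> (f + g) = tensor_functional \<phi> \<psi> f + tensor_functional \<phi> \<psi> g"
proof -
  let ?K = "Poly_Mapping.keys f \<union> Poly_Mapping.keys g \<union> Poly_Mapping.keys (f + g)"
  have "finite ?K" by simp
  then show ?thesis
    by (subst (1 2 3) tf_superset[of ?K]) (auto simp: lookup_add distrib_right sum.distrib)
qed

lemma tf_0 [simp]: "tensor_functional \<phi> \<psi> 0 = 0"
  by (simp add: tensor_functional_def)

lemma tf_sum: "tensor_functional \<phi> \<psi> (sum f I) = (\<Sum>i\<in>I. tensor_functional \<phi> \<psi> (f i))"
  by (induction I rule: infinite_finite_induct) (auto simp: tf_add)

lemma tf_smult: assumes "f \<in> carrier T" shows "tensor_functional \<phi> \<psi> (c \<odot>\<^bsub>T\<^esub> f) = c * tensor_functional \<phi> \<psi> f"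
  using assms by (induction rule: T.MA_induct) (simp_all add: T.MA_smult_add tf_add distrib_left)

text \<open>
  On \<open>f\<^sup>* f\<close> the product functional is a quadratic form in the coefficients of \<open>f\<close>, whose matrix is the
  entrywise product of two Gram matrices.
\<close>

lemma tf_positive:
  assumes "state A \<phi>" "state B \<psi>" shows "positive_functional T (tensor_functional \<phi> \<psi>)"
proof -
  interpret P: positive A \<phi> by unfold_locales (rule state_positive[OF assms(1)])
  interpret Q: positive B \<psi> by unfold_locales (rule state_positive[OF assms(2)])
  have "tensor_functional \<phi> \<psi> (star T f \<otimes>\<^bsub>T\<^esub> f) \<in> \<real>\<^sub>\<ge>\<^sub>0" if f: "f \<in> carrier T" for f
  proof -
    let ?K = "Poly_Mapping.keys f" and ?l = "Poly_Mapping.lookup f"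
    have k: "fst k \<in> carrier A" "snd k \<in> carrier B" if "k \<in> ?K" for k
      using f that by (auto simp: T.MA_carrier carrier_prod)
    have "tensor_functional \<phi> \<psi> (star T f \<otimes>\<^bsub>T\<^esub> f) = (\<Sum>k\<in>?K. \<Sum>l\<in>?K. cnj (?l k) * ?l l *
        (\<phi> (star A (fst k) \<otimes>\<^bsub>A\<^esub> fst l) * \<psi> (star B (snd k) \<otimes>\<^bsub>B\<^esub> snd l)))"
      unfolding T.MA_star_mult_self[OF f] tf_sum
      by (intro sum.cong refl) (auto simp: DirProd_def split: prod.splits)
    also have "\<dots> \<in> \<real>\<^sub>\<ge>\<^sub>0"
    proof -
      have "psd ?K (\<lambda>k l. \<phi> (star A (fst k) \<otimes>\<^bsub>A\<^esub> fst l) * \<psi> (star B (snd k) \<otimes>\<^bsub>B\<^esub> snd l))"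
        using k by (intro psd_schur P.psd_tau Q.psd_tau) auto
      then show ?thesis unfolding psd_def by (rule spec)
    qed
    finally show ?thesis .
  qed
  then show ?thesis by (auto simp: positive_functional_def tf_add tf_smult)
qed

text \<open>
  Reduces the comparison of two elements inside products to the case of elementary factors.
\<close>

lemma tf_sandwich:
  assumes r: "r \<in> carrier T" "r' \<in> carrier T"
    and eq: "\<And>p q. \<lbrakk>p \<in> carrier (A \<times>\<times> B); q \<in> carrier (A \<times>\<times> B)\<rbrakk> \<Longrightarrow>
      tensor_functional \<phi> \<psi> (sg p 1 \<otimes>\<^bsub>T\<^esub> r \<otimes>\<^bsub>T\<^esub> sg q 1) = tensor_functional \<phi> \<psi> (sg p 1 \<otimes>\<^bsub>T\<^esub> r' \<otimes>\<^bsub>T\<^esub> sg q 1)"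
    and uv: "u \<in> carrier T" "v \<in> carrier T"
  shows "tensor_functional \<phi> \<psi> (u \<otimes>\<^bsub>T\<^esub> r \<otimes>\<^bsub>T\<^esub> v) = tensor_functional \<phi> \<psi> (u \<otimes>\<^bsub>T\<^esub> r' \<otimes>\<^bsub>T\<^esub> v)"
  using uv(1)
proof (induction rule: T.MA_induct)
  case (single p c)
  show ?case using uv(2)
  proof (induction rule: T.MA_induct)
    case (single q d)
    have "sg p c \<otimes>\<^bsub>T\<^esub> s \<otimes>\<^bsub>T\<^esub> sg q d = (c * d) \<odot>\<^bsub>T\<^esub> (sg p 1 \<otimes>\<^bsub>T\<^esub> s \<otimes>\<^bsub>T\<^esub> sg q 1)" if s: "s \<in> carrier T" for s
    proof -
      have "sg p c = c \<odot>\<^bsub>T\<^esub> sg p 1" "sg q d = d \<odot>\<^bsub>T\<^esub> sg q 1" by simp_all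
      then show ?thesis using s \<open>p \<in> _\<close> \<open>q \<in> _\<close>
        by (simp only: T.MA.smult_l_assoc T.MA.smult_r_assoc T.MA.smult_smult T.MA_single T.MA_mult_closed mult.commute
          T.MA_smult_closed)
    qed
    then show ?case using r eq[OF \<open>p \<in> _\<close> \<open>q \<in> _\<close>] \<open>p \<in> _\<close> \<open>q \<in> _\<close> by (simp add: tf_smult)
  qed (simp add: T.MA_mult_add_right tf_add)
qed (simp add: T.MA_mult_add_left tf_add)

text \<open>
  Product functionals do not see the difference between formal combinations of pairs and tensors.
\<close>

lemma tf_left:
  assumes "state A \<phi>" "a \<in> carrier A" "a' \<in> carrier A" "b \<in> carrier B" "u \<in> carrier T" "v \<in> carrier T"
  shows "tensor_functional \<phi> \<psi> (u \<otimes>\<^bsub>T\<^esub> sg (a \<oplus>\<^bsub>A\<^esub> c \<odot>\<^bsub>A\<^esub> a', b) 1 \<otimes>\<^bsub>T\<^esub> v)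
    = tensor_functional \<phi> \<psi> (u \<otimes>\<^bsub>T\<^esub> (sg (a, b) 1 + sg (a', b) c) \<otimes>\<^bsub>T\<^esub> v)"
proof -
  interpret P: positive A \<phi> by unfold_locales (rule state_positive[OF assms(1)])
  show ?thesis
    by (rule tf_sandwich) (use assms in \<open>auto simp: carrier_prod T.MA_mult_add_left T.MA_mult_add_right
      T.MA_mult_single mult_prod tf_add A.l_distr A.r_distr A.smult_l_assoc A.smult_r_assoc
      P.tau_add P.tau_smult algebra_simps\<close>)
qed

lemma tf_right:
  assumes "state B \<psi>" "a \<in> carrier A" "b \<in> carrier B" "b' \<in> carrier B" "u \<in> carrier T" "v \<in> carrier T"
  shows "tensor_functional \<phi> \<psi> (u \<otimes>\<^bsub>T\<^esub> sg (a, b \<oplus>\<^bsub>B\<^esub> c \<odot>\<^bsub>B\<^esub> b') 1 \<otimes>\<^bsub>T\<^esub> v)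
    = tensor_functional \<phi> \<psi> (u \<otimes>\<^bsub>T\<^esub> (sg (a, b) 1 + sg (a, b') c) \<otimes>\<^bsub>T\<^esub> v)"
proof -
  interpret Q: positive B \<psi> by unfold_locales (rule state_positive[OF assms(1)])
  show ?thesis
    by (rule tf_sandwich) (use assms in \<open>auto simp: carrier_prod T.MA_mult_add_left T.MA_mult_add_right
      T.MA_mult_single mult_prod tf_add B.l_distr B.r_distr B.smult_l_assoc B.smult_r_assoc
      Q.tau_add Q.tau_smult algebra_simps\<close>)
qed

lemma tf_split:
  assumes "r \<in> carrier T" "k \<in> carrier (A \<times>\<times> B)" "u \<in> carrier T" "v \<in> carrier T"
  shows "tensor_functional \<phi> \<psi> (u \<otimes>\<^bsub>T\<^esub> (r + sg k c) \<otimes>\<^bsub>T\<^esub> v)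
    = tensor_functional \<phi> \<psi> (u \<otimes>\<^bsub>T\<^esub> r \<otimes>\<^bsub>T\<^esub> v) + c * tensor_functional \<phi> \<psi> (u \<otimes>\<^bsub>T\<^esub> sg k 1 \<otimes>\<^bsub>T\<^esub> v)"
proof -
  have "sg k c = c \<odot>\<^bsub>T\<^esub> sg k 1" by simp
  then have "u \<otimes>\<^bsub>T\<^esub> sg k c \<otimes>\<^bsub>T\<^esub> v = c \<odot>\<^bsub>T\<^esub> (u \<otimes>\<^bsub>T\<^esub> sg k 1 \<otimes>\<^bsub>T\<^esub> v)"
    using assms by (simp only: T.MA.smult_l_assoc T.MA.smult_r_assoc T.MA_single T.MA_mult_closed)
  then show ?thesis using assms
    by (simp add: T.MA_mult_add_left T.MA_mult_add_right tf_add tf_smult)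
qed

text \<open>
  The functionals over which the minimal norm is the supremum.
\<close>

definition \<T> :: "(('a \<times> 'b \<Rightarrow>\<^sub>0 complex) \<Rightarrow> complex) set" where
  "\<T> = {tensor_functional \<phi> \<psi> | \<phi> \<psi>. state A \<phi> \<and> state B \<psi>}"

lemma T_positive: "\<tau> \<in> \<T> \<Longrightarrow> positive_functional T \<tau>"
  using tf_positive by (auto simp: \<T>_def)

lemma left_bounded:
  assumes "a \<in> carrier A"
  shows "\<exists>K\<ge>0. \<forall>\<tau>\<in>\<T>. \<forall>y\<in>carrier T. positive.N T \<tau> (sg (a, \<one>\<^bsub>B\<^esub>) 1 \<otimes>\<^bsub>T\<^esub> y) \<le> K * positive.N T \<tau> y"
proof (rule embedded_bounded[OF A.cstar_alg_axioms T.MA_star_alg T_positive _ _ _ _ _ assms])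
  fix \<tau> y a a' c assume "\<tau> \<in> \<T>" "y \<in> carrier T" "a \<in> carrier A" "a' \<in> carrier A"
  then show "\<tau> (star T y \<otimes>\<^bsub>T\<^esub> sg (a \<oplus>\<^bsub>A\<^esub> (c \<odot>\<^bsub>A\<^esub> a'), \<one>\<^bsub>B\<^esub>) 1 \<otimes>\<^bsub>T\<^esub> y)
      = \<tau> (star T y \<otimes>\<^bsub>T\<^esub> sg (a, \<one>\<^bsub>B\<^esub>) 1 \<otimes>\<^bsub>T\<^esub> y) + c * \<tau> (star T y \<otimes>\<^bsub>T\<^esub> sg (a', \<one>\<^bsub>B\<^esub>) 1 \<otimes>\<^bsub>T\<^esub> y)"
    by (auto simp: \<T>_def tf_left tf_split carrier_prod)
qed (auto simp: carrier_prod one_prod T.MA_one T.MA_mult_single mult_prod T.MA_star_single)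

lemma right_bounded:
  assumes "b \<in> carrier B"
  shows "\<exists>K\<ge>0. \<forall>\<tau>\<in>\<T>. \<forall>y\<in>carrier T. positive.N T \<tau> (sg (\<one>\<^bsub>A\<^esub>, b) 1 \<otimes>\<^bsub>T\<^esub> y) \<le> K * positive.N T \<tau> y"
proof (rule embedded_bounded[OF B.cstar_alg_axioms T.MA_star_alg T_positive _ _ _ _ _ assms])
  fix \<tau> y b b' c assume "\<tau> \<in> \<T>" "y \<in> carrier T" "b \<in> carrier B" "b' \<in> carrier B"
  then show "\<tau> (star T y \<otimes>\<^bsub>T\<^esub> sg (\<one>\<^bsub>A\<^esub>, b \<oplus>\<^bsub>B\<^esub> (c \<odot>\<^bsub>B\<^esub> b')) 1 \<otimes>\<^bsub>T\<^esub> y)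
      = \<tau> (star T y \<otimes>\<^bsub>T\<^esub> sg (\<one>\<^bsub>A\<^esub>, b) 1 \<otimes>\<^bsub>T\<^esub> y) + c * \<tau> (star T y \<otimes>\<^bsub>T\<^esub> sg (\<one>\<^bsub>A\<^esub>, b') 1 \<otimes>\<^bsub>T\<^esub> y)"
    by (auto simp: \<T>_def tf_right tf_split carrier_prod)
qed (auto simp: carrier_prod one_prod T.MA_one T.MA_mult_single mult_prod T.MA_star_single)

lemma bounded:
  assumes "x \<in> carrier T"
  shows "\<exists>K\<ge>0. \<forall>\<tau>\<in>\<T>. \<forall>y\<in>carrier T. positive.N T \<tau> (x \<otimes>\<^bsub>T\<^esub> y) \<le> K * positive.N T \<tau> y"
  using assms
proof (induction rule: T.MA_induct)
  case (single k c)
  obtain a b where k: "k = (a, b)" and ab: "a \<in> carrier A" "b \<in> carrier B"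
    using single by (auto simp: carrier_prod)
  obtain K where K: "K \<ge> 0" "\<And>\<tau> y. \<tau> \<in> \<T> \<Longrightarrow> y \<in> carrier T \<Longrightarrow>
      positive.N T \<tau> (sg (a, \<one>\<^bsub>B\<^esub>) 1 \<otimes>\<^bsub>T\<^esub> y) \<le> K * positive.N T \<tau> y"
    using left_bounded[OF ab(1)] by blast
  obtain L where L: "L \<ge> 0" "\<And>\<tau> y. \<tau> \<in> \<T> \<Longrightarrow> y \<in> carrier T \<Longrightarrow>
      positive.N T \<tau> (sg (\<one>\<^bsub>A\<^esub>, b) 1 \<otimes>\<^bsub>T\<^esub> y) \<le> L * positive.N T \<tau> y"
    using right_bounded[OF ab(2)] by blast
  show ?case
  proof (intro exI[of _ "cmod c * (K * L)"] conjI ballI)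
    fix \<tau> y assume t: "\<tau> \<in> \<T>" and y: "y \<in> carrier T"
    interpret positive T \<tau> by unfold_locales (rule T_positive[OF t])
    let ?l = "sg (a, \<one>\<^bsub>B\<^esub>) 1" and ?r = "sg (\<one>\<^bsub>A\<^esub>, b) 1"
    have lr: "?l \<in> carrier T" "?r \<in> carrier T" using ab by (auto simp: carrier_prod)
    have "sg k c = c \<odot>\<^bsub>T\<^esub> (?l \<otimes>\<^bsub>T\<^esub> ?r)" using ab by (simp add: k T.MA_mult_single mult_prod)
    then have "sg k c \<otimes>\<^bsub>T\<^esub> y = c \<odot>\<^bsub>T\<^esub> (?l \<otimes>\<^bsub>T\<^esub> (?r \<otimes>\<^bsub>T\<^esub> y))"
      using lr y by (simp only: T.MA.smult_l_assoc T.MA.m_assoc T.MA_mult_closed)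
    then have "N (sg k c \<otimes>\<^bsub>T\<^esub> y) = cmod c * N (?l \<otimes>\<^bsub>T\<^esub> (?r \<otimes>\<^bsub>T\<^esub> y))"
      using lr y by (simp only: N_smult T.MA_mult_closed)
    also have "\<dots> \<le> cmod c * (K * N (?r \<otimes>\<^bsub>T\<^esub> y))"
      using lr y by (intro mult_left_mono K t) auto
    also have "\<dots> \<le> cmod c * (K * (L * N y))"
      using K(1) y by (intro mult_left_mono L t) auto
    finally show "N (sg k c \<otimes>\<^bsub>T\<^esub> y) \<le> cmod c * (K * L) * N y" by (simp add: mult.assoc)
  qed (use K L in auto)
next
  case (add f g)
  obtain K where K: "K \<ge> 0" "\<And>\<tau> y. \<tau> \<in> \<T> \<Longrightarrow> y \<in> carrier T \<Longrightarrow>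
      positive.N T \<tau> (f \<otimes>\<^bsub>T\<^esub> y) \<le> K * positive.N T \<tau> y"
    using add(3) by blast
  obtain L where L: "L \<ge> 0" "\<And>\<tau> y. \<tau> \<in> \<T> \<Longrightarrow> y \<in> carrier T \<Longrightarrow>
      positive.N T \<tau> (g \<otimes>\<^bsub>T\<^esub> y) \<le> L * positive.N T \<tau> y"
    using add(4) by blast
  show ?case
  proof (intro exI[of _ "K + L"] conjI ballI)
    fix \<tau> y assume t: "\<tau> \<in> \<T>" and y: "y \<in> carrier T"
    interpret positive T \<tau> by unfold_locales (rule T_positive[OF t])
    show "N ((f + g) \<otimes>\<^bsub>T\<^esub> y) \<le> (K + L) * N y"
      using N_add[of "f \<otimes>\<^bsub>T\<^esub> y" "g \<otimes>\<^bsub>T\<^esub> y"] K(2)[OF t y] L(2)[OF t y] add y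
      by (simp add: T.MA_mult_add_left distrib_right)
  qed (use K L in auto)
qed

sublocale G: positive_family T \<T>
  by unfold_locales (auto simp: T_positive bounded)

lemma min_norm_eq: "min_norm A B = G.gns"
proof
  fix x
  have "{sqrt (Re (tensor_functional \<phi> \<psi> (star T (x \<otimes>\<^bsub>T\<^esub> y) \<otimes>\<^bsub>T\<^esub> (x \<otimes>\<^bsub>T\<^esub> y))) / Re (tensor_functional \<phi> \<psi> (star T y \<otimes>\<^bsub>T\<^esub> y)))
        | \<phi> \<psi> y. state A \<phi> \<and> state B \<psi> \<and> y \<in> carrier T \<and> tensor_functional \<phi> \<psi> (star T y \<otimes>\<^bsub>T\<^esub> y) \<noteq> 0}
     = {sqrt (Re (\<tau> (star T (x \<otimes>\<^bsub>T\<^esub> y) \<otimes>\<^bsub>T\<^esub> (x \<otimes>\<^bsub>T\<^esub> y))) / Re (\<tau> (star T y \<otimes>\<^bsub>T\<^esub> y)))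
     | \<tau> y. \<tau> \<in> \<T> \<and> y \<in> carrier T \<and> \<tau> (star T y \<otimes>\<^bsub>T\<^esub> y) \<noteq> 0}"
    unfolding \<T>_def by blast
  then show "min_norm A B x = G.gns x"
    unfolding min_norm_def G.gns_def Let_def by (simp only:)
qed

lemma min_seminorm: "cstar_seminorm T (min_norm A B)"
  unfolding min_norm_eq by (rule G.gns_seminorm)

sublocale mt: seminormed T "min_norm A B"
  by unfold_locales (rule min_seminorm)

lemma min_tensor_eq: "completion T (min_norm A B) = min_tensor A B"
  by (simp add: min_tensor_def)

lemma min_tensor_cstar: "cstar_alg (min_tensor A B)"
  using mt.completion_cstar_alg by (simp add: min_tensor_eq)

sublocale MT: cstar_alg "min_tensor A B" by (rule min_tensor_cstar)

abbreviation "et \<equiv> elem_tensor A B"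

lemma et_eq: "et a b = mt.emb (sg (a, b) 1)"
  by (simp add: elem_tensor_def)

sublocale emb: star_morphism T "min_tensor A B" mt.emb
  using mt.emb_hom by unfold_locales (simp add: min_tensor_eq)

lemma et_closed [simp, intro]: "\<lbrakk>a \<in> carrier A; b \<in> carrier B\<rbrakk> \<Longrightarrow> et a b \<in> carrier (min_tensor A B)"
  unfolding et_eq by (rule emb.hom_closed) (simp add: carrier_prod)

lemma et_mult: "\<lbrakk>a \<in> carrier A; b \<in> carrier B; a' \<in> carrier A; b' \<in> carrier B\<rbrakk> \<Longrightarrow>
    et a b \<otimes>\<^bsub>min_tensor A B\<^esub> et a' b' = et (a \<otimes>\<^bsub>A\<^esub> a') (b \<otimes>\<^bsub>B\<^esub> b')"
  unfolding et_eq by (subst emb.hom_mult[symmetric]) (auto simp: carrier_prod T.MA_mult_single mult_prod)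

lemma et_star: "\<lbrakk>a \<in> carrier A; b \<in> carrier B\<rbrakk> \<Longrightarrow> star (min_tensor A B) (et a b) = et (star A a) (star B b)"
  unfolding et_eq by (subst emb.hom_star[symmetric]) (auto simp: carrier_prod T.MA_star_single)

lemma et_one: "et \<one>\<^bsub>A\<^esub> \<one>\<^bsub>B\<^esub> = \<one>\<^bsub>min_tensor A B\<^esub>"
  unfolding et_eq using emb.hom_one by (simp add: T.MA_one one_prod)

text \<open>
  If all product functionals agree on \<open>r\<close> and \<open>r'\<close> inside every product, then \<open>r - r'\<close> acts as zero in the
  GNS representations that define the minimal norm.  In particular the bilinearity relations of the
  tensor product hold in the completion.
\<close>

lemma emb_eqI:
  assumes r: "r \<in> carrier T" "r' \<in> carrier T"
    and eq: "\<And>\<phi> \<psi> u v. \<lbrakk>state A \<phi>; state B \<psi>; u \<in> carrier T; v \<in> carrier T\<rbrakk> \<Longrightarrow>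
      tensor_functional \<phi> \<psi> (u \<otimes>\<^bsub>T\<^esub> r \<otimes>\<^bsub>T\<^esub> v) = tensor_functional \<phi> \<psi> (u \<otimes>\<^bsub>T\<^esub> r' \<otimes>\<^bsub>T\<^esub> v)"
  shows "mt.emb r = mt.emb r'"
proof -
  let ?d = "r \<ominus>\<^bsub>T\<^esub> r'"
  have d: "?d \<in> carrier T" using r by simp
  have "G.gns ?d \<le> 0"
  proof (rule G.gns_le[OF d])
    fix \<tau> y assume t: "\<tau> \<in> \<T>" and y: "y \<in> carrier T"
    interpret positive T \<tau> by unfold_locales (rule T_positive[OF t])
    obtain \<phi> \<psi> where st: "state A \<phi>" "state B \<psi>" "\<tau> = tensor_functional \<phi> \<psi>" using t by (auto simp: \<T>_def)
    let ?u = "star T (?d \<otimes>\<^bsub>T\<^esub> y)"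
    have u: "?u \<in> carrier T" using d y by simp
    have "?u \<otimes>\<^bsub>T\<^esub> (?d \<otimes>\<^bsub>T\<^esub> y) = ?u \<otimes>\<^bsub>T\<^esub> r \<otimes>\<^bsub>T\<^esub> y \<oplus>\<^bsub>T\<^esub> (- 1) \<odot>\<^bsub>T\<^esub> (?u \<otimes>\<^bsub>T\<^esub> r' \<otimes>\<^bsub>T\<^esub> y)"
    proof -
      have "w \<otimes>\<^bsub>T\<^esub> (?d \<otimes>\<^bsub>T\<^esub> y) = w \<otimes>\<^bsub>T\<^esub> r \<otimes>\<^bsub>T\<^esub> y \<oplus>\<^bsub>T\<^esub> (- 1) \<odot>\<^bsub>T\<^esub> (w \<otimes>\<^bsub>T\<^esub> r' \<otimes>\<^bsub>T\<^esub> y)" if "w \<in> carrier T" for w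
        using that r y unfolding a_minus_def
        by (simp del: T.MA_add add: T.MA.minus_smult T.MA.l_distr T.MA.r_distr T.MA.smult_l_assoc T.MA.smult_r_assoc T.MA.m_assoc)
      from this[OF u] show ?thesis .
    qed
    then have "\<tau> (?u \<otimes>\<^bsub>T\<^esub> (?d \<otimes>\<^bsub>T\<^esub> y)) = \<tau> (?u \<otimes>\<^bsub>T\<^esub> r \<otimes>\<^bsub>T\<^esub> y) + (- 1) * \<tau> (?u \<otimes>\<^bsub>T\<^esub> r' \<otimes>\<^bsub>T\<^esub> y)"
      using u r y tau_add tau_smult by (simp only: T.MA_mult_closed T.MA_smult_closed)
    also have "\<dots> = 0" unfolding st(3) using eq[OF st(1,2) u y] by simp
    finally show "N (?d \<otimes>\<^bsub>T\<^esub> y) \<le> 0 * N y" by (simp add: N_def)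
  qed simp
  then have "min_norm A B ?d = 0" using G.gns_nonneg[OF d] by (simp add: min_norm_eq)
  then have "nrm (min_tensor A B) (mt.emb r \<ominus>\<^bsub>min_tensor A B\<^esub> mt.emb r') = 0"
    using r d mt.nrm_emb[OF d] by (simp add: emb.hom_diff[symmetric] min_tensor_eq)
  then show ?thesis using r by (intro MT.nrm_eqI) auto
qed

lemma et_left:
  assumes "a \<in> carrier A" "a' \<in> carrier A" "b \<in> carrier B"
  shows "et (a \<oplus>\<^bsub>A\<^esub> c \<odot>\<^bsub>A\<^esub> a') b = et a b \<oplus>\<^bsub>min_tensor A B\<^esub> c \<odot>\<^bsub>min_tensor A B\<^esub> et a' b"
proof -
  have "mt.emb (sg (a \<oplus>\<^bsub>A\<^esub> c \<odot>\<^bsub>A\<^esub> a', b) 1) = mt.emb (sg (a, b) 1 \<oplus>\<^bsub>T\<^esub> c \<odot>\<^bsub>T\<^esub> sg (a', b) 1)"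
    by (rule emb_eqI) (use assms in \<open>auto simp: carrier_prod tf_left\<close>)
  then show ?thesis unfolding et_eq using assms by (subst (asm) emb.hom_add) (auto simp: carrier_prod emb.hom_smult[symmetric])
qed

lemma et_right:
  assumes "a \<in> carrier A" "b \<in> carrier B" "b' \<in> carrier B"
  shows "et a (b \<oplus>\<^bsub>B\<^esub> c \<odot>\<^bsub>B\<^esub> b') = et a b \<oplus>\<^bsub>min_tensor A B\<^esub> c \<odot>\<^bsub>min_tensor A B\<^esub> et a b'"
proof -
  have "mt.emb (sg (a, b \<oplus>\<^bsub>B\<^esub> c \<odot>\<^bsub>B\<^esub> b') 1) = mt.emb (sg (a, b) 1 \<oplus>\<^bsub>T\<^esub> c \<odot>\<^bsub>T\<^esub> sg (a, b') 1)"
    by (rule emb_eqI) (use assms in \<open>auto simp: carrier_prod tf_right\<close>)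
  then show ?thesis unfolding et_eq using assms by (subst (asm) emb.hom_add) (auto simp: carrier_prod emb.hom_smult[symmetric])
qed

lemma et_add_left: "\<lbrakk>a \<in> carrier A; a' \<in> carrier A; b \<in> carrier B\<rbrakk> \<Longrightarrow>
    et (a \<oplus>\<^bsub>A\<^esub> a') b = et a b \<oplus>\<^bsub>min_tensor A B\<^esub> et a' b"
  using et_left[of a a' b 1] by simp

lemma et_add_right: "\<lbrakk>a \<in> carrier A; b \<in> carrier B; b' \<in> carrier B\<rbrakk> \<Longrightarrow>
    et a (b \<oplus>\<^bsub>B\<^esub> b') = et a b \<oplus>\<^bsub>min_tensor A B\<^esub> et a b'"
  using et_right[of a b b' 1] by simp

lemma et_zero_left [simp]: assumes "b \<in> carrier B" shows "et \<zero>\<^bsub>A\<^esub> b = \<zero>\<^bsub>min_tensor A B\<^esub>"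
  using et_add_left[of "\<zero>\<^bsub>A\<^esub>" "\<zero>\<^bsub>A\<^esub>" b] assms MT.add.r_cancel_one'[of "et \<zero>\<^bsub>A\<^esub> b" "et \<zero>\<^bsub>A\<^esub> b"] by simp

lemma et_zero_right [simp]: assumes "a \<in> carrier A" shows "et a \<zero>\<^bsub>B\<^esub> = \<zero>\<^bsub>min_tensor A B\<^esub>"
  using et_add_right[of a "\<zero>\<^bsub>B\<^esub>" "\<zero>\<^bsub>B\<^esub>"] assms MT.add.r_cancel_one'[of "et a \<zero>\<^bsub>B\<^esub>" "et a \<zero>\<^bsub>B\<^esub>"] by simp

lemma et_smult_left: "\<lbrakk>a \<in> carrier A; b \<in> carrier B\<rbrakk> \<Longrightarrow>
    et (c \<odot>\<^bsub>A\<^esub> a) b = c \<odot>\<^bsub>min_tensor A B\<^esub> et a b"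
  using et_left[of "\<zero>\<^bsub>A\<^esub>" a b c] by simp

lemma et_smult_right: "\<lbrakk>a \<in> carrier A; b \<in> carrier B\<rbrakk> \<Longrightarrow>
    et a (c \<odot>\<^bsub>B\<^esub> b) = c \<odot>\<^bsub>min_tensor A B\<^esub> et a b"
  using et_right[of a "\<zero>\<^bsub>B\<^esub>" b c] by simp

lemma et_finsum_left:
  assumes "\<And>i. i \<in> I \<Longrightarrow> f i \<in> carrier A" "b \<in> carrier B" "finite I"
  shows "et (finsum A f I) b = finsum (min_tensor A B) (\<lambda>i. et (f i) b) I"
  using assms(3,1)
proof (induction I rule: finite_induct)
  case (insert i I)
  then show ?case using assms(2) by (simp add: Pi_def et_add_left A.finsum_closed)
qed (use assms in simp)

lemma et_finsum_right:
  assumes "\<And>i. i \<in> I \<Longrightarrow> f i \<in> carrier B" "a \<in> carrier A" "finite I"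
  shows "et a (finsum B f I) = finsum (min_tensor A B) (\<lambda>i. et a (f i)) I"
  using assms(3,1)
proof (induction I rule: finite_induct)
  case (insert i I)
  then show ?case using assms(2) by (simp add: Pi_def et_add_right B.finsum_closed)
qed (use assms in simp)

end

lemma star_hom_comp:
  assumes "h \<in> star_hom A B" "k \<in> star_hom B C" shows "(\<lambda>x. k (h x)) \<in> star_hom A C"
  using assms by (auto simp: star_hom_def ring_hom_def Pi_def)

text \<open>
  The homomorphism \<open>\<pi> \<otimes> \<pi>\<close>.  It is contractive for the minimal norms: product states of \<open>B\<close> pull back to
  product states of \<open>A\<close>, and since \<open>\<pi>\<close> is surjective, every vector \<open>y \<xi>\<close> over \<open>B\<close> is the image of one of the
  same length over \<open>A\<close>.
\<close>

lemma tensor_of_surjections: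
  assumes "cstar_alg A" "cstar_alg B" "\<pi> \<in> star_hom A B" and surj: "\<pi> ` carrier A = carrier B"
  shows "\<exists>\<rho> \<in> star_hom (min_tensor A A) (min_tensor B B). \<forall>a \<in> carrier A. \<forall>b \<in> carrier A.
    \<rho> (elem_tensor A A a b) = elem_tensor B B (\<pi> a) (\<pi> b)"
proof -
  interpret A: cstar_pair A A by (intro cstar_pair.intro assms)
  interpret B: cstar_pair B B by (intro cstar_pair.intro assms)
  interpret \<pi>: star_morphism A B \<pi> by unfold_locales (rule assms(3))
  let ?\<theta> = "\<lambda>k. B.sg (map_prod \<pi> \<pi> k) 1"
  have "\<exists>h\<in>star_hom A.T B.T. \<forall>a\<in>carrier (A \<times>\<times> A). \<forall>c. h (A.sg a c) = c \<odot>\<^bsub>B.T\<^esub> ?\<theta> a"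
    by (rule A.T.MA_universal[OF B.T.MA_star_alg])
      (auto simp: A.carrier_prod B.carrier_prod A.one_prod B.one_prod A.mult_prod B.mult_prod B.T.MA_one
        B.T.MA_mult_single B.T.MA_star_single \<pi>.hom_mult \<pi>.hom_star)
  then obtain h where h: "h \<in> star_hom A.T B.T"
    and hs: "\<And>a b c. a \<in> carrier A \<Longrightarrow> b \<in> carrier A \<Longrightarrow> h (A.sg (a, b) c) = B.sg (\<pi> a, \<pi> b) c"
    by (auto simp: A.carrier_prod)
  interpret h: star_morphism A.T B.T h by unfold_locales (rule h)
  have hsurj: "\<exists>x\<in>carrier A.T. h x = y" if "y \<in> carrier B.T" for y
    using that
  proof (induction rule: B.T.MA_induct)
    case (single k c)
    then obtain a b where "k = (\<pi> a, \<pi> b)" "a \<in> carrier A" "b \<in> carrier A"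
      using surj by (auto simp: B.carrier_prod image_iff) (metis imageE surj)
    then show ?case using hs[of a b c] by (intro bexI[of _ "A.sg (a, b) c"]) (auto simp: A.carrier_prod)
  next
    case (add f g)
    then obtain x y where "x \<in> carrier A.T" "h x = f" "y \<in> carrier A.T" "h y = g" by blast
    then show ?case using h.hom_add[of x y] by (intro bexI[of _ "x + y"]) auto
  qed
  have state: "state A (\<lambda>a. \<phi> (\<pi> a))" if "state B \<phi>" for \<phi>
    using that by (auto simp: state_def \<pi>.hom_add \<pi>.hom_mult \<pi>.hom_smult \<pi>.hom_star)
  have tf: "tensor_functional \<phi> \<psi> (h x) = tensor_functional (\<lambda>a. \<phi> (\<pi> a)) (\<lambda>a. \<psi> (\<pi> a)) x"
    if "x \<in> carrier A.T" for \<phi> \<psi> x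
    using that
  proof (induction rule: A.T.MA_induct)
    case (single k c)
    then show ?case by (cases k) (simp add: hs A.carrier_prod)
  next
    case (add f g)
    then show ?case using h.hom_add[of f g] by (simp add: A.tf_add B.tf_add)
  qed
  have le: "min_norm B B (h x) \<le> min_norm A A x" if x: "x \<in> carrier A.T" for x
    unfolding A.min_norm_eq B.min_norm_eq
  proof (rule B.G.gns_le)
    fix \<tau> y assume t: "\<tau> \<in> B.\<T>" and "y \<in> carrier B.T"
    then obtain x' where x': "x' \<in> carrier A.T" "y = h x'" using hsurj by blast
    obtain \<phi> \<psi> where st: "state B \<phi>" "state B \<psi>" "\<tau> = tensor_functional \<phi> \<psi>" using t by (auto simp: B.\<T>_def)
    define \<sigma> where "\<sigma> = tensor_functional (\<lambda>a. \<phi> (\<pi> a)) (\<lambda>a. \<psi> (\<pi> a))"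
    have s: "\<sigma> \<in> A.\<T>" unfolding A.\<T>_def \<sigma>_def using state st by blast
    interpret \<tau>: positive B.T \<tau> by (rule B.G.positive[OF t])
    interpret \<sigma>: positive A.T \<sigma> by (rule A.G.positive[OF s])
    have st': "\<tau> (h z) = \<sigma> z" if "z \<in> carrier A.T" for z
      unfolding \<sigma>_def st(3) by (rule tf[OF that])
    have N: "\<tau>.N (h z) = \<sigma>.N z" if "z \<in> carrier A.T" for z
      using st'[of "star A.T z \<otimes>\<^bsub>A.T\<^esub> z"] that
      by (simp add: \<tau>.N_def \<sigma>.N_def h.hom_mult h.hom_star)
    show "\<tau>.N (h x \<otimes>\<^bsub>B.T\<^esub> y) \<le> A.G.gns x * \<tau>.N y"
      using A.G.gns_bound[OF x s x'(1)] N[OF x'(1)] N[of "x \<otimes>\<^bsub>A.T\<^esub> x'"] x x'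
      by (simp add: h.hom_mult)
  qed (use x A.G.gns_nonneg in auto)
  let ?\<Phi> = "\<lambda>x. B.mt.emb (h x)"
  have "\<exists>H \<in> star_hom A.mt.C (min_tensor B B). \<forall>x \<in> carrier A.T. H (A.mt.emb x) = ?\<Phi> x"
  proof (rule A.mt.star_hom_extend[OF B.min_tensor_cstar])
    show "?\<Phi> \<in> star_hom A.T (min_tensor B B)" by (rule star_hom_comp[OF h B.emb.star_hom])
    show "nrm (min_tensor B B) (?\<Phi> x) \<le> min_norm A A x" if "x \<in> carrier A.T" for x
      using le[OF that] B.mt.nrm_emb[of "h x"] that by (simp add: B.min_tensor_eq)
  qed
  then obtain H where H: "H \<in> star_hom (min_tensor A A) (min_tensor B B)"
    "\<And>x. x \<in> carrier A.T \<Longrightarrow> H (A.mt.emb x) = ?\<Phi> x" by (auto simp: A.min_tensor_eq)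
  show ?thesis
    by (rule bexI[OF _ H(1)]) (auto simp: A.et_eq B.et_eq H(2) hs A.carrier_prod)
qed

section \<open>Algebras with generators and relations\<close>

abbreviation words :: "nat \<Rightarrow> (nat \<times> nat) list monoid" where
  "words n \<equiv> \<lparr>carrier = lists ({..<n} \<times> {..<n}), mult = (@), one = []\<rparr>"

lemma words_star_monoid: "star_monoid (words n) rev"
  by unfold_locales auto

interpretation W: star_monoid "words n" rev
  rewrites "monoid_algebra (words n) rev = free_star_algebra n" for n
  by (rule words_star_monoid) (simp add: free_star_algebra_def)

lemma gen_closed [simp, intro]: "i < n \<Longrightarrow> j < n \<Longrightarrow> gen i j \<in> carrier (free_star_algebra n)"
  by (simp add: gen_def)

lemma gen_star: "star (free_star_algebra n) (gen i j) = gen i j"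
  by (simp add: gen_def W.MA_star_single)

lemma word_Cons:
  "Poly_Mapping.single ((i, j) # w) 1 = gen i j \<otimes>\<^bsub>free_star_algebra n\<^esub> Poly_Mapping.single w 1"
  by (simp add: gen_def W.MA_mult_single)

text \<open>
  A word is sent to the product of the matrix entries that it spells.
\<close>

lemma free_hom_exists:
  assumes "star_alg T" and X: "\<And>i j. i < n \<Longrightarrow> j < n \<Longrightarrow> X i j \<in> carrier T"
    "\<And>i j. i < n \<Longrightarrow> j < n \<Longrightarrow> star T (X i j) = X i j"
  shows "\<exists>\<Phi> \<in> star_hom (free_star_algebra n) T. \<forall>i<n. \<forall>j<n. \<Phi> (gen i j) = X i j"
proof -
  interpret T: star_alg T by fact
  define \<theta> where "\<theta> w = foldr (\<lambda>(i, j) y. X i j \<otimes>\<^bsub>T\<^esub> y) w \<one>\<^bsub>T\<^esub>" for w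
  have \<theta>N: "\<theta> [] = \<one>\<^bsub>T\<^esub>" and \<theta>C: "\<theta> ((i, j) # w) = X i j \<otimes>\<^bsub>T\<^esub> \<theta> w" for i j w
    by (simp_all add: \<theta>_def)
  have cl: "\<theta> w \<in> carrier T" if "w \<in> lists ({..<n} \<times> {..<n})" for w
    using that by (induction rule: lists.induct) (auto simp: \<theta>N \<theta>C X)
  have app: "\<theta> (v @ w) = \<theta> v \<otimes>\<^bsub>T\<^esub> \<theta> w"
    if "v \<in> lists ({..<n} \<times> {..<n})" "w \<in> lists ({..<n} \<times> {..<n})" for v w
    using that(1)
  proof (induction rule: lists.induct)
    case (Cons p v)
    obtain i j where p: "p = (i, j)" "i < n" "j < n" using Cons(1) by auto
    show ?case using Cons cl[OF Cons(2)] cl[OF that(2)] p X by (simp add: \<theta>C T.m_assoc)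
  qed (simp add: \<theta>N cl[OF that(2)])
  have rev: "\<theta> (rev w) = star T (\<theta> w)" if "w \<in> lists ({..<n} \<times> {..<n})" for w
    using that
  proof (induction rule: lists.induct)
    case (Cons p w)
    obtain i j where p: "p = (i, j)" "i < n" "j < n" using Cons(1) by auto
    have "\<theta> [p] = X i j" using p X by (simp add: \<theta>N \<theta>C)
    moreover have "\<theta> (rev w @ [p]) = \<theta> (rev w) \<otimes>\<^bsub>T\<^esub> \<theta> [p]"
      using Cons by (intro app) auto
    ultimately show ?case using Cons(3) p X cl[OF Cons(2)] by (simp add: \<theta>C T.star_mult)
  qed (simp add: \<theta>N)
  have "\<exists>h \<in> star_hom (free_star_algebra n) T. \<forall>a \<in> carrier (words n). \<forall>c.
      h (Poly_Mapping.single a c) = c \<odot>\<^bsub>T\<^esub> \<theta> a"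
    by (rule W.MA_universal[OF assms(1)]) (simp_all add: cl app rev \<theta>N)
  then obtain h where h: "h \<in> star_hom (free_star_algebra n) T"
    "\<And>a. a \<in> lists ({..<n} \<times> {..<n}) \<Longrightarrow> h (Poly_Mapping.single a 1) = 1 \<odot>\<^bsub>T\<^esub> \<theta> a" by auto
  show ?thesis
    by (rule bexI[OF _ h(1)]) (auto simp: gen_def h(2) \<theta>N \<theta>C X)
qed

lemma free_hom_ext:
  assumes "star_alg T" "\<Phi> \<in> star_hom (free_star_algebra n) T" "\<Psi> \<in> star_hom (free_star_algebra n) T"
    and eq: "\<And>i j. i < n \<Longrightarrow> j < n \<Longrightarrow> \<Phi> (gen i j) = \<Psi> (gen i j)"
    and f: "f \<in> carrier (free_star_algebra n)"
  shows "\<Phi> f = \<Psi> f"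
proof -
  interpret T: star_alg T by fact
  interpret \<Phi>: star_morphism "free_star_algebra n" T \<Phi> by unfold_locales fact
  interpret \<Psi>: star_morphism "free_star_algebra n" T \<Psi> by unfold_locales fact
  have w: "\<Phi> (Poly_Mapping.single w 1) = \<Psi> (Poly_Mapping.single w 1)"
    if "w \<in> lists ({..<n} \<times> {..<n})" for w
    using that
  proof (induction rule: lists.induct)
    case Nil
    then show ?case using \<Phi>.hom_one \<Psi>.hom_one by (simp add: W.MA_one[of n, simplified])
  next
    case (Cons p w)
    obtain i j where p: "p = (i, j)" "i < n" "j < n" using Cons(1) by auto
    have "Poly_Mapping.single w 1 \<in> carrier (free_star_algebra n)" using Cons by simp
    then show ?case unfolding p word_Cons[of i j w n] using Cons p eq by (simp add: \<Phi>.hom_mult \<Psi>.hom_mult)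
  qed
  show ?thesis using f
  proof (induction rule: W.MA_induct)
    case (single a c)
    have "Poly_Mapping.single a c = c \<odot>\<^bsub>free_star_algebra n\<^esub> Poly_Mapping.single a 1"
      by simp
    moreover have "Poly_Mapping.single a 1 \<in> carrier (free_star_algebra n)" using single by (rule W.MA_single)
    ultimately show ?case using w[of a] single by (simp only: \<Phi>.hom_smult \<Psi>.hom_smult) simp
  next
    case (add f g)
    then show ?case using \<Phi>.hom_add[of f g] \<Psi>.hom_add[of f g] by simp
  qed
qed

text \<open>
  The matrix \<open>X\<close> satisfies the relations \<open>R\<close> if the homomorphism from the free $*$-algebra that sends
  the generators to its entries identifies both sides of each relation.  For self-adjoint entries this
  homomorphism exists and is unique, so that the quantifier over \<open>\<Phi>\<close> may be read either way.
\<close>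

definition satisfies ::
  "('a, 'r) star_algebra_scheme \<Rightarrow> nat \<Rightarrow> (nat \<Rightarrow> nat \<Rightarrow> 'a) \<Rightarrow> relations \<Rightarrow> bool" where
  "satisfies T n X R \<longleftrightarrow> (\<forall>\<Phi> \<in> star_hom (free_star_algebra n) T.
     (\<forall>i<n. \<forall>j<n. \<Phi> (gen i j) = X i j) \<longrightarrow> (\<forall>(y, z) \<in> R. \<Phi> y = \<Phi> z))"

lemma satisfies_Un [simp]: "satisfies T n X (R \<union> S) \<longleftrightarrow> satisfies T n X R \<and> satisfies T n X S"
  by (auto simp: satisfies_def)

lemma satisfies_empty [simp]: "satisfies T n X {}"
  by (simp add: satisfies_def)

locale star_matrix = star_alg T for T :: "('a, 'r) star_algebra_scheme" (structure) +
  fixes n :: nat and X :: "nat \<Rightarrow> nat \<Rightarrow> 'a"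
  assumes X_closed [simp, intro]: "i < n \<Longrightarrow> j < n \<Longrightarrow> X i j \<in> carrier T"
    and X_star: "i < n \<Longrightarrow> j < n \<Longrightarrow> star T (X i j) = X i j"
begin

abbreviation "sat \<equiv> satisfies T n X"
abbreviation "F \<equiv> free_star_algebra n"

definition "orth \<longleftrightarrow> (\<forall>i<n. \<forall>j<n. (\<Oplus>k\<in>{..<n}. X i k \<otimes> X j k) = (if i = j then \<one> else \<zero>) \<and>
    (\<Oplus>k\<in>{..<n}. X k i \<otimes> X k j) = (if i = j then \<one> else \<zero>))"
definition "line_sums s \<longleftrightarrow> (\<forall>i<n. (\<Oplus>k\<in>{..<n}. X i k) = s \<and> (\<Oplus>k\<in>{..<n}. X k i) = s)"
definition "cubic \<longleftrightarrow> (\<forall>i<n. \<forall>j<n. \<forall>k<n. j \<noteq> k \<longrightarrow> X i j \<otimes> X i k = \<zero> \<and> X j i \<otimes> X k i = \<zero>)"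
definition "idem \<longleftrightarrow> (\<forall>i<n. \<forall>j<n. X i j \<otimes> X i j = X i j)"
definition "commut \<longleftrightarrow> (\<forall>i<n. \<forall>j<n. \<forall>k<n. \<forall>l<n. X i j \<otimes> X k l = X k l \<otimes> X i j)"
definition "half \<longleftrightarrow> (\<forall>a<n. \<forall>b<n. \<forall>c<n. \<forall>d<n. \<forall>e<n. \<forall>f<n.
    X a b \<otimes> X c d \<otimes> X e f = X e f \<otimes> X c d \<otimes> X a b)"

text \<open>
  Evaluating the relations under one homomorphism is enough.
\<close>

lemma sat_iff:
  assumes "\<And>\<Phi>. star_morphism F T \<Phi> \<Longrightarrow> (\<And>i j. i < n \<Longrightarrow> j < n \<Longrightarrow> \<Phi> (gen i j) = X i j) \<Longrightarrow>
    (\<forall>(y, z) \<in> R. \<Phi> y = \<Phi> z) \<longleftrightarrow> P"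
  shows "sat R \<longleftrightarrow> P"
proof -
  have m: "star_morphism F T \<Phi>" if "\<Phi> \<in> star_hom F T" for \<Phi>
    using that by unfold_locales
  obtain \<Phi> where "\<Phi> \<in> star_hom F T" "\<forall>i<n. \<forall>j<n. \<Phi> (gen i j) = X i j"
    using free_hom_exists[OF star_alg_axioms, of n X] X_closed X_star by blast
  then show ?thesis using assms m unfolding satisfies_def by blast
qed

context
  fixes \<Phi> assumes m: "star_morphism F T \<Phi>" and \<Phi>: "\<And>i j. i < n \<Longrightarrow> j < n \<Longrightarrow> \<Phi> (gen i j) = X i j"
begin

interpretation \<Phi>: star_morphism F T \<Phi> by (rule m)

lemma \<Phi>_prod2: "\<lbrakk>i < n; j < n; k < n; l < n\<rbrakk> \<Longrightarrow> \<Phi> (gen i j \<otimes>\<^bsub>F\<^esub> gen k l) = X i j \<otimes> X k l"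
  by (simp add: \<Phi>.hom_mult \<Phi>)

lemma \<Phi>_prod3: "\<lbrakk>i < n; j < n; k < n; l < n; p < n; q < n\<rbrakk> \<Longrightarrow>
    \<Phi> (gen i j \<otimes>\<^bsub>F\<^esub> gen k l \<otimes>\<^bsub>F\<^esub> gen p q) = X i j \<otimes> X k l \<otimes> X p q"
  by (simp add: \<Phi>.hom_mult \<Phi>)

lemma \<Phi>_rows: "i < n \<Longrightarrow> \<Phi> (row_sum n i) = (\<Oplus>k\<in>{..<n}. X i k)"
  unfolding row_sum_def by (subst \<Phi>.hom_finsum) (auto intro!: finsum_cong' simp: \<Phi>)

lemma \<Phi>_cols: "i < n \<Longrightarrow> \<Phi> (col_sum n i) = (\<Oplus>k\<in>{..<n}. X k i)"
  unfolding col_sum_def by (subst \<Phi>.hom_finsum) (auto intro!: finsum_cong' simp: \<Phi>)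

lemma \<Phi>_orth1: "i < n \<Longrightarrow> j < n \<Longrightarrow>
    \<Phi> (\<Oplus>\<^bsub>F\<^esub>k\<in>{..<n}. gen i k \<otimes>\<^bsub>F\<^esub> gen j k) = (\<Oplus>k\<in>{..<n}. X i k \<otimes> X j k)"
  by (subst \<Phi>.hom_finsum) (auto intro!: finsum_cong' simp: \<Phi>_prod2 simp del: W.MA_add)

lemma \<Phi>_orth2: "i < n \<Longrightarrow> j < n \<Longrightarrow>
    \<Phi> (\<Oplus>\<^bsub>F\<^esub>k\<in>{..<n}. gen k i \<otimes>\<^bsub>F\<^esub> gen k j) = (\<Oplus>k\<in>{..<n}. X k i \<otimes> X k j)"
  by (subst \<Phi>.hom_finsum) (auto intro!: finsum_cong' simp: \<Phi>_prod2 simp del: W.MA_add)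

lemma \<Phi>_one: "\<Phi> \<one>\<^bsub>F\<^esub> = \<one>" and \<Phi>_zero: "\<Phi> \<zero>\<^bsub>F\<^esub> = \<zero>"
  by (rule \<Phi>.hom_one, rule \<Phi>.hom_zero)

lemma \<Phi>_orth: "(\<forall>(y, z) \<in> orthogonal_rel n. \<Phi> y = \<Phi> z) \<longleftrightarrow> orth"
proof -
  have d: "\<Phi> (if i = j then \<one>\<^bsub>F\<^esub> else \<zero>\<^bsub>F\<^esub>) = (if i = j then \<one> else \<zero>)" for i j :: nat
    using \<Phi>_one \<Phi>_zero by simp
  have "(\<forall>(y, z) \<in> orthogonal_rel n. \<Phi> y = \<Phi> z) \<longleftrightarrow> (\<forall>i<n. \<forall>j<n.
      \<Phi> (\<Oplus>\<^bsub>F\<^esub>k\<in>{..<n}. gen i k \<otimes>\<^bsub>F\<^esub> gen j k) = \<Phi> (if i = j then \<one>\<^bsub>F\<^esub> else \<zero>\<^bsub>F\<^esub>) \<and>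
      \<Phi> (\<Oplus>\<^bsub>F\<^esub>k\<in>{..<n}. gen k i \<otimes>\<^bsub>F\<^esub> gen k j) = \<Phi> (if i = j then \<one>\<^bsub>F\<^esub> else \<zero>\<^bsub>F\<^esub>))"
    unfolding orthogonal_rel_def Let_def by blast
  also have "\<dots> \<longleftrightarrow> orth" unfolding orth_def by (simp only: \<Phi>_orth1 \<Phi>_orth2 d cong: imp_cong)
  finally show ?thesis .
qed

lemma \<Phi>_idem: "(\<forall>(y, z) \<in> projection_rel n. \<Phi> y = \<Phi> z) \<longleftrightarrow> idem"
proof -
  have "(\<forall>(y, z) \<in> projection_rel n. \<Phi> y = \<Phi> z) \<longleftrightarrow> (\<forall>i<n. \<forall>j<n.
      \<Phi> (gen i j \<otimes>\<^bsub>F\<^esub> gen i j) = \<Phi> (gen i j))"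
    unfolding projection_rel_def by blast
  then show ?thesis unfolding idem_def by (simp only: \<Phi>_prod2 \<Phi> cong: imp_cong)
qed

lemma \<Phi>_sum_one: "(\<forall>(y, z) \<in> sum_one_rel n. \<Phi> y = \<Phi> z) \<longleftrightarrow> line_sums \<one>"
proof -
  have "(\<forall>(y, z) \<in> sum_one_rel n. \<Phi> y = \<Phi> z) \<longleftrightarrow> (\<forall>i<n.
      \<Phi> (row_sum n i) = \<Phi> \<one>\<^bsub>F\<^esub> \<and> \<Phi> (col_sum n i) = \<Phi> \<one>\<^bsub>F\<^esub>)"
    unfolding sum_one_rel_def by blast
  then show ?thesis unfolding line_sums_def by (simp only: \<Phi>_rows \<Phi>_cols \<Phi>_one cong: imp_cong)
qed

lemma \<Phi>_same_sum: "(\<forall>(y, z) \<in> same_sum_rel n. \<Phi> y = \<Phi> z) \<longleftrightarrow> (\<exists>s \<in> carrier T. line_sums s)"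
proof -
  have eq: "(\<forall>(y, z) \<in> same_sum_rel n. \<Phi> y = \<Phi> z) \<longleftrightarrow> (\<forall>i<n. \<forall>j<n.
      \<Phi> (row_sum n i) = \<Phi> (row_sum n j) \<and> \<Phi> (col_sum n i) = \<Phi> (col_sum n j) \<and> \<Phi> (row_sum n i) = \<Phi> (col_sum n j))"
    unfolding same_sum_rel_def by blast
  show ?thesis
  proof
    assume "\<forall>(y, z) \<in> same_sum_rel n. \<Phi> y = \<Phi> z"
    then have h: "\<forall>i<n. \<forall>j<n.
      \<Phi> (row_sum n i) = \<Phi> (row_sum n j) \<and> \<Phi> (col_sum n i) = \<Phi> (col_sum n j) \<and> \<Phi> (row_sum n i) = \<Phi> (col_sum n j)"
      unfolding eq .
    show "\<exists>s \<in> carrier T. line_sums s"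
    proof (cases "n = 0")
      case True
      then have "line_sums \<zero>" unfolding line_sums_def by simp
      then show ?thesis by blast
    next
      case False
      then have n: "0 < n" by simp
      have "line_sums (\<Oplus>k\<in>{..<n}. X 0 k)" unfolding line_sums_def
      proof (intro allI impI conjI)
        fix i assume i: "i < n"
        show "(\<Oplus>k\<in>{..<n}. X i k) = (\<Oplus>k\<in>{..<n}. X 0 k)" using h i n \<Phi>_rows[OF i] \<Phi>_rows[OF n] by metis
        show "(\<Oplus>k\<in>{..<n}. X k i) = (\<Oplus>k\<in>{..<n}. X 0 k)" using h i n \<Phi>_cols[OF i] \<Phi>_rows[OF n] by metis
      qed
      then show ?thesis using False by (intro bexI[of _ "\<Oplus>k\<in>{..<n}. X 0 k"]) (auto intro!: finsum_closed)
    qed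
  next
    assume "\<exists>s \<in> carrier T. line_sums s"
    then show "\<forall>(y, z) \<in> same_sum_rel n. \<Phi> y = \<Phi> z"
      unfolding eq line_sums_def by (auto simp: \<Phi>_rows \<Phi>_cols)
  qed
qed

lemma \<Phi>_cubic: "(\<forall>(y, z) \<in> cubic_rel n. \<Phi> y = \<Phi> z) \<longleftrightarrow> cubic"
proof -
  have "(\<forall>(y, z) \<in> cubic_rel n. \<Phi> y = \<Phi> z) \<longleftrightarrow> (\<forall>i<n. \<forall>j<n. \<forall>k<n. j \<noteq> k \<longrightarrow>
      \<Phi> (gen i j \<otimes>\<^bsub>F\<^esub> gen i k) = \<Phi> \<zero>\<^bsub>F\<^esub> \<and> \<Phi> (gen j i \<otimes>\<^bsub>F\<^esub> gen k i) = \<Phi> \<zero>\<^bsub>F\<^esub>)"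
    unfolding cubic_rel_def Let_def by blast
  then show ?thesis unfolding cubic_def by (simp only: \<Phi>_prod2 \<Phi>_zero cong: imp_cong)
qed

lemma \<Phi>_commut: "(\<forall>(y, z) \<in> commutation_rel n. \<Phi> y = \<Phi> z) \<longleftrightarrow> commut"
proof -
  have "(\<forall>(y, z) \<in> commutation_rel n. \<Phi> y = \<Phi> z) \<longleftrightarrow> (\<forall>i<n. \<forall>j<n. \<forall>k<n. \<forall>l<n.
      \<Phi> (gen i j \<otimes>\<^bsub>F\<^esub> gen k l) = \<Phi> (gen k l \<otimes>\<^bsub>F\<^esub> gen i j))"
    unfolding commutation_rel_def Let_def by blast
  then show ?thesis unfolding commut_def by (simp only: \<Phi>_prod2 cong: imp_cong)
qed

lemma \<Phi>_half: "(\<forall>(y, z) \<in> half_commutation_rel n. \<Phi> y = \<Phi> z) \<longleftrightarrow> half"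
proof -
  define U where "U = {gen i j | i j. i < n \<and> j < n}"
  have U: "(\<forall>x\<in>U. Q x) \<longleftrightarrow> (\<forall>i<n. \<forall>j<n. Q (gen i j))" for Q unfolding U_def by blast
  have "(\<forall>(y, z) \<in> half_commutation_rel n. \<Phi> y = \<Phi> z) \<longleftrightarrow>
    (\<forall>x\<in>U. \<forall>y\<in>U. \<forall>z\<in>U. \<Phi> (x \<otimes>\<^bsub>F\<^esub> y \<otimes>\<^bsub>F\<^esub> z) = \<Phi> (z \<otimes>\<^bsub>F\<^esub> y \<otimes>\<^bsub>F\<^esub> x))"
    unfolding half_commutation_rel_def Let_def U_def[symmetric] by blast
  then show ?thesis unfolding half_def U by (simp only: \<Phi>_prod3 cong: imp_cong)
qed

end

lemma sat_orth: "sat (orthogonal_rel n) \<longleftrightarrow> orth"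
  and sat_idem: "sat (projection_rel n) \<longleftrightarrow> idem"
  and sat_sum_one: "sat (sum_one_rel n) \<longleftrightarrow> line_sums \<one>"
  and sat_same_sum: "sat (same_sum_rel n) \<longleftrightarrow> (\<exists>s \<in> carrier T. line_sums s)"
  and sat_cubic: "sat (cubic_rel n) \<longleftrightarrow> cubic"
  and sat_commut: "sat (commutation_rel n) \<longleftrightarrow> commut"
  and sat_half: "sat (half_commutation_rel n) \<longleftrightarrow> half"
  by (rule sat_iff, erule \<Phi>_orth \<Phi>_idem \<Phi>_sum_one \<Phi>_same_sum \<Phi>_cubic \<Phi>_commut \<Phi>_half, assumption)+

end

lemma F_finsum_closed: "(\<And>k. k < n \<Longrightarrow> f k \<in> carrier (free_star_algebra n)) \<Longrightarrow>
    finsum (free_star_algebra n) f {..<n} \<in> carrier (free_star_algebra n)"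
  by (rule W.MA.finsum_closed) auto

lemma relations_closed:
  fixes n :: nat
  defines "F \<equiv> free_star_algebra n"
  shows "orthogonal_rel n \<subseteq> carrier F \<times> carrier F" "projection_rel n \<subseteq> carrier F \<times> carrier F"
    "sum_one_rel n \<subseteq> carrier F \<times> carrier F" "same_sum_rel n \<subseteq> carrier F \<times> carrier F"
    "cubic_rel n \<subseteq> carrier F \<times> carrier F" "commutation_rel n \<subseteq> carrier F \<times> carrier F"
    "half_commutation_rel n \<subseteq> carrier F \<times> carrier F"
proof -
  have rows: "row_sum n i \<in> carrier (free_star_algebra n)" "col_sum n i \<in> carrier (free_star_algebra n)" if "i < n" for i
    unfolding row_sum_def col_sum_def using that by (auto intro!: F_finsum_closed)
  have one: "\<one>\<^bsub>free_star_algebra n\<^esub> \<in> carrier (free_star_algebra n)" by (rule W.MA.one_closed)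
  have zero: "\<zero>\<^bsub>free_star_algebra n\<^esub> \<in> carrier (free_star_algebra n)" by (rule W.MA.zero_closed)
  show "orthogonal_rel n \<subseteq> carrier F \<times> carrier F" unfolding orthogonal_rel_def Let_def F_def
    using one zero by (auto intro!: F_finsum_closed)
  show "projection_rel n \<subseteq> carrier F \<times> carrier F" unfolding projection_rel_def F_def by auto
  show "sum_one_rel n \<subseteq> carrier F \<times> carrier F" unfolding sum_one_rel_def F_def using rows one by auto
  show "same_sum_rel n \<subseteq> carrier F \<times> carrier F" unfolding same_sum_rel_def F_def using rows by auto
  show "cubic_rel n \<subseteq> carrier F \<times> carrier F" unfolding cubic_rel_def Let_def F_def using zero by auto
  show "commutation_rel n \<subseteq> carrier F \<times> carrier F" unfolding commutation_rel_def Let_def F_def by auto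
  show "half_commutation_rel n \<subseteq> carrier F \<times> carrier F" unfolding half_commutation_rel_def Let_def F_def by auto
qed

lemma orthogonal_bounded:
  assumes "cstar_alg D" "star_matrix D n X" "star_matrix.orth D n X" "i < n" "j < n"
  shows "nrm D (X i j) \<le> 2"
proof -
  interpret D: cstar_alg D by fact
  interpret X: star_matrix D n X by fact
  show ?thesis
    by (rule D.bounded_of_squares_sum_one[of "{..<n}" "\<lambda>k. X i k"])
      (use assms X.X_star in \<open>auto simp: X.orth_def\<close>)
qed

context seminormed
begin

interpretation C: cstar_alg C by (rule completion_cstar_alg)

text \<open>
  Sequences from the dense subalgebra, so that commutativity passes to the completion by continuity of
  the product.
\<close>

lemma emb_approx:
  assumes "P \<in> carrier C" shows "\<exists>x. (\<forall>k. x k \<in> carrier A) \<and> C.conv (\<lambda>k. emb (x k)) P"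
proof -
  obtain x where x: "\<And>k. x k \<in> carrier A"
    "\<And>k. nrm C (P \<ominus>\<^bsub>C\<^esub> emb (x k)) < 1 / real (Suc k)"
    using emb_sequence[of "\<lambda>_. P"] assms by blast
  have "C.conv (\<lambda>k. emb (x k)) P"
  proof (rule C.convI)
    show "nrm C (emb (x k) \<ominus>\<^bsub>C\<^esub> P) \<le> inverse (real (Suc k))" for k
      using x(2)[of k] C.p_diff_commute[OF emb.hom_closed[OF x(1)[of k]] assms] by (simp add: inverse_eq_divide)
  qed (use x assms LIMSEQ_inverse_real_of_nat in auto)
  then show ?thesis using x by blast
qed

lemma completion_commutative:
  assumes comm: "\<And>x y. x \<in> carrier A \<Longrightarrow> y \<in> carrier A \<Longrightarrow> emb x \<otimes>\<^bsub>C\<^esub> emb y = emb y \<otimes>\<^bsub>C\<^esub> emb x"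
    and P: "P \<in> carrier C" and Q: "Q \<in> carrier C"
  shows "P \<otimes>\<^bsub>C\<^esub> Q = Q \<otimes>\<^bsub>C\<^esub> P"
proof -
  obtain x y where x: "\<And>k. x k \<in> carrier A" "C.conv (\<lambda>k. emb (x k)) P"
    and y: "\<And>k. y k \<in> carrier A" "C.conv (\<lambda>k. emb (y k)) Q"
    using emb_approx[OF P] emb_approx[OF Q] by blast
  show ?thesis
    using C.conv_unique[OF C.conv_mult[OF x(2) y(2)]] C.conv_mult[OF y(2) x(2)] comm[OF x(1) y(1)] by simp
qed

end

section \<open>Matrix quantum groups\<close>

locale mqg =
  fixes n :: nat and R :: relations
  assumes R_closed: "R \<subseteq> carrier (free_star_algebra n) \<times> carrier (free_star_algebra n)"
begin

abbreviation "F \<equiv> free_star_algebra n"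
abbreviation "RR \<equiv> orthogonal_rel n \<union> R"
abbreviation "A \<equiv> universal_cstar F RR"
abbreviation "V \<equiv> \<lambda>i j. in_completion F (universal_norm F RR) (gen i j)"

text \<open>
  A C*-seminorm that kills the orthogonality relations makes the images of the generators in its
  completion an orthogonal matrix, to which the a priori bound applies.
\<close>

lemma gen_bound:
  assumes "kills F RR p" "i < n" "j < n" shows "p (gen i j) \<le> 2"
proof -
  interpret p: seminormed F p
    by (intro seminormed.intro W.MA_star_alg seminormed_axioms.intro) (use assms in \<open>simp add: kills_def\<close>)
  interpret C: cstar_alg p.C by (rule p.completion_cstar_alg)
  interpret X: star_matrix p.C n "\<lambda>i j. p.emb (gen i j)"
    by unfold_locales (auto simp: p.emb.hom_star[symmetric] gen_star)
  have "p.emb y = p.emb z" if yz: "(y, z) \<in> orthogonal_rel n" for y z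
  proof -
    have c: "y \<in> carrier F" "z \<in> carrier F" using yz relations_closed(1) by auto
    have "p (y \<ominus>\<^bsub>F\<^esub> z) = 0" using assms(1) yz by (auto simp: kills_def)
    then have "nrm p.C (p.emb y \<ominus>\<^bsub>p.C\<^esub> p.emb z) = 0"
      using p.nrm_emb[of "y \<ominus>\<^bsub>F\<^esub> z"] c by (simp add: p.emb.hom_diff)
    then show ?thesis using c by (intro C.nrm_eqI) auto
  qed
  then have "\<forall>(y, z) \<in> orthogonal_rel n. p.emb y = p.emb z" by blast
  then have "X.orth" using X.\<Phi>_orth[OF p.emb.star_morphism_axioms] by simp
  then have "nrm p.C (p.emb (gen i j)) \<le> 2"
    by (rule orthogonal_bounded[OF C.cstar_alg_axioms X.star_matrix_axioms _ assms(2,3)])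
  then show ?thesis using assms by simp
qed

sublocale U: universal F RR
proof (intro universal.intro universal_axioms.intro W.MA_star_alg)
  show "RR \<subseteq> carrier F \<times> carrier F" using relations_closed(1) R_closed by blast
  fix f assume f: "f \<in> carrier F"
  show "\<exists>K. \<forall>p. kills F RR p \<longrightarrow> p f \<le> K"
  proof (intro exI allI impI)
    fix p assume p: "kills F RR p"
    interpret p: seminormed F p
      by (intro seminormed.intro W.MA_star_alg seminormed_axioms.intro) (use p in \<open>simp add: kills_def\<close>)
    have "p (Poly_Mapping.single w 1) \<le> 2 ^ length w" if "w \<in> lists ({..<n} \<times> {..<n})" for w
      using that
    proof (induction rule: lists.induct)
      case Nil
      then show ?case using p.p_one W.MA_one[of n] by simp
    next
      case (Cons q w)
      obtain i j where q: "q = (i, j)" "i < n" "j < n" using Cons(1) by auto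
      have w: "Poly_Mapping.single w 1 \<in> carrier F" using Cons by simp
      have "p (Poly_Mapping.single (q # w) 1) \<le> p (gen i j) * p (Poly_Mapping.single w 1)"
        unfolding q word_Cons[of i j w n] using q w by (intro p.p_mult) auto
      also have "\<dots> \<le> 2 * 2 ^ length w"
        using Cons q w gen_bound[OF p] by (intro mult_mono p.p_nonneg) auto
      finally show ?case by simp
    qed
    then show "p f \<le> (\<Sum>w\<in>Poly_Mapping.keys f. cmod (Poly_Mapping.lookup f w) * 2 ^ length w)"
      by (intro W.MA_seminorm_bound[of n p f "\<lambda>w. 2 ^ length w"] p.seminorm f) auto
  qed
qed

lemma A_eq: "A = U.C" by (simp add: universal_cstar_def)

lemma A_cstar: "cstar_alg A" unfolding A_eq by (rule U.completion_cstar_alg)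

sublocale A: cstar_alg A by (rule A_cstar)

lemma emb_hom: "U.emb \<in> star_hom F A"
  unfolding A_eq by (rule U.emb_hom)

sublocale emb: star_morphism F A U.emb
  by (intro star_morphism.intro star_morphism_axioms.intro W.MA_star_alg A.star_alg_axioms emb_hom)

sublocale V: star_matrix A n V
  by unfold_locales (auto simp: emb.hom_star[symmetric] gen_star)

text \<open>
  The homomorphism in the definition of satisfaction is the canonical map to the completion, which
  identifies both sides of every relation because their difference has universal norm \<open>0\<close>.
\<close>

lemma V_sat: "V.sat R" "V.sat (orthogonal_rel n)"
proof -
  have "\<Phi> y = \<Phi> z" if h: "\<Phi> \<in> star_hom F A" "\<forall>i<n. \<forall>j<n. \<Phi> (gen i j) = V i j" "(y, z) \<in> RR" for \<Phi> y z
  proof -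
    have c: "y \<in> carrier F" "z \<in> carrier F" using U.R_carrier h(3) by auto
    have "\<Phi> f = U.emb f" if "f \<in> carrier F" for f
      by (rule free_hom_ext[OF A.star_alg_axioms h(1) emb_hom _ that]) (use h(2) in auto)
    then show ?thesis using U.emb_rel[OF h(3)] c by simp
  qed
  then show "V.sat R" "V.sat (orthogonal_rel n)" unfolding satisfies_def by auto
qed

lemma C_alg_eq: "C_alg (matrix_quantum_group n R) = A"
  by (simp add: matrix_quantum_group_def Let_def)

text \<open>
  The commutation of the generators spreads to words, to linear combinations and, by density, to the
  whole algebra.
\<close>

lemma classicalI: assumes "V.commut" shows "classical (matrix_quantum_group n R)"
proof -
  have word: "x \<otimes>\<^bsub>A\<^esub> U.emb (Poly_Mapping.single w 1) = U.emb (Poly_Mapping.single w 1) \<otimes>\<^bsub>A\<^esub> x"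
    if "w \<in> lists ({..<n} \<times> {..<n})" and x: "x \<in> carrier A"
      "\<And>i j. i < n \<Longrightarrow> j < n \<Longrightarrow> x \<otimes>\<^bsub>A\<^esub> V i j = V i j \<otimes>\<^bsub>A\<^esub> x" for w x
    using that(1)
  proof (induction rule: lists.induct)
    case Nil
    then show ?case using emb.hom_one W.MA_one[of n] x by simp
  next
    case (Cons q w)
    obtain i j where q: "q = (i, j)" "i < n" "j < n" using Cons(1) by auto
    let ?w = "U.emb (Poly_Mapping.single w 1)"
    have sw: "Poly_Mapping.single w 1 \<in> carrier F" using Cons by simp
    then have w: "?w \<in> carrier A" by (rule emb.hom_closed)
    have "U.emb (Poly_Mapping.single (q # w) 1) = V i j \<otimes>\<^bsub>A\<^esub> ?w"
      unfolding q word_Cons[of i j w n] using q sw by (intro emb.hom_mult) auto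
    moreover have "x \<otimes>\<^bsub>A\<^esub> (V i j \<otimes>\<^bsub>A\<^esub> ?w) = V i j \<otimes>\<^bsub>A\<^esub> ?w \<otimes>\<^bsub>A\<^esub> x"
      using x q w Cons.IH by (metis A.m_assoc V.X_closed)
    ultimately show ?case by simp
  qed
  have lin: "x \<otimes>\<^bsub>A\<^esub> U.emb f = U.emb f \<otimes>\<^bsub>A\<^esub> x" if f: "f \<in> carrier F" and x: "x \<in> carrier A"
      "\<And>i j. i < n \<Longrightarrow> j < n \<Longrightarrow> x \<otimes>\<^bsub>A\<^esub> V i j = V i j \<otimes>\<^bsub>A\<^esub> x" for f x
    using f
  proof (induction rule: W.MA_induct)
    case (single a c)
    then have a: "a \<in> lists ({..<n} \<times> {..<n})" by simp
    have s: "Poly_Mapping.single a 1 \<in> carrier F" using single by (rule W.MA_single)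
    have "Poly_Mapping.single a c = c \<odot>\<^bsub>F\<^esub> Poly_Mapping.single a 1" by simp
    then have e: "U.emb (Poly_Mapping.single a c) = c \<odot>\<^bsub>A\<^esub> U.emb (Poly_Mapping.single a 1)"
      using s by (simp only: emb.hom_smult)
    show ?case unfolding e using word[OF a x] x s by (simp add: A.smult_l_assoc A.smult_r_assoc)
  next
    case (add f g)
    then show ?case using emb.hom_add[of f g] x by (simp add: A.l_distr A.r_distr)
  qed
  have Vf: "V i j \<otimes>\<^bsub>A\<^esub> U.emb f = U.emb f \<otimes>\<^bsub>A\<^esub> V i j" if "f \<in> carrier F" "i < n" "j < n" for f i j
  proof (rule lin[OF that(1)])
    show "V i j \<in> carrier A" using that by blast
    show "V i j \<otimes>\<^bsub>A\<^esub> V k l = V k l \<otimes>\<^bsub>A\<^esub> V i j" if "k < n" "l < n" for k l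
      using assms \<open>i < n\<close> \<open>j < n\<close> that unfolding V.commut_def by blast
  qed
  have "U.emb f \<otimes>\<^bsub>A\<^esub> U.emb g = U.emb g \<otimes>\<^bsub>A\<^esub> U.emb f" if "f \<in> carrier F" "g \<in> carrier F" for f g
  proof (rule lin[OF that(2)])
    show "U.emb f \<in> carrier A" using that by blast
    show "U.emb f \<otimes>\<^bsub>A\<^esub> V k l = V k l \<otimes>\<^bsub>A\<^esub> U.emb f" if "k < n" "l < n" for k l
      using Vf[OF \<open>f \<in> carrier F\<close> that] by simp
  qed
  then show ?thesis unfolding classical_def C_alg_eq
    unfolding A_eq using U.completion_commutative by blast
qed

end

section \<open>Coproducts\<close>

text \<open>
  The matrix \<open>X\<close> has as entries the prescribed values of the comultiplication.  A comultiplication exists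
  if \<open>X\<close> inherits the defining relations from \<open>V\<close>.
\<close>

locale coproduct = cstar_pair A A + V: star_matrix A n V
  for A :: "('a, 'r) cstar_algebra_scheme" and n :: nat and V :: "nat \<Rightarrow> nat \<Rightarrow> 'a"
begin

abbreviation "E \<equiv> min_tensor A A"

definition X :: "nat \<Rightarrow> nat \<Rightarrow> ('a, 'a) tensor"
  where "X i j = (\<Oplus>\<^bsub>E\<^esub>k\<in>{..<n}. et (V i k) (V k j))"

lemma X_closed: "i < n \<Longrightarrow> j < n \<Longrightarrow> X i j \<in> carrier E"
  unfolding X_def by (intro MT.finsum_closed) auto

sublocale X: star_matrix E n X
proof unfold_locales
  show "star E (X i j) = X i j" if "i < n" "j < n" for i j
    unfolding X_def using that
    by (subst MT.star_finsum, force, intro MT.finsum_cong' refl) (auto simp: et_star V.X_star)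
qed (rule X_closed)

lemma X_mult:
  assumes "i < n" "j < n" "k < n" "l < n"
  shows "X i j \<otimes>\<^bsub>E\<^esub> X k l
    = (\<Oplus>\<^bsub>E\<^esub>p\<in>{..<n}. \<Oplus>\<^bsub>E\<^esub>q\<in>{..<n}. et (V i p \<otimes>\<^bsub>A\<^esub> V k q) (V p j \<otimes>\<^bsub>A\<^esub> V q l))"
proof -
  have "X i j \<otimes>\<^bsub>E\<^esub> X k l = (\<Oplus>\<^bsub>E\<^esub>p\<in>{..<n}. et (V i p) (V p j) \<otimes>\<^bsub>E\<^esub> X k l)"
    unfolding X_def[of i j] using assms by (intro MT.finsum_mult_right X_closed) auto
  also have "\<dots> = (\<Oplus>\<^bsub>E\<^esub>p\<in>{..<n}. \<Oplus>\<^bsub>E\<^esub>q\<in>{..<n}. et (V i p \<otimes>\<^bsub>A\<^esub> V k q) (V p j \<otimes>\<^bsub>A\<^esub> V q l))"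
  proof (rule MT.finsum_cong')
    fix p assume p: "p \<in> {..<n}"
    have "et (V i p) (V p j) \<otimes>\<^bsub>E\<^esub> X k l = (\<Oplus>\<^bsub>E\<^esub>q\<in>{..<n}. et (V i p) (V p j) \<otimes>\<^bsub>E\<^esub> et (V k q) (V q l))"
      unfolding X_def using assms p by (intro MT.finsum_mult_left) auto
    also have "\<dots> = (\<Oplus>\<^bsub>E\<^esub>q\<in>{..<n}. et (V i p \<otimes>\<^bsub>A\<^esub> V k q) (V p j \<otimes>\<^bsub>A\<^esub> V q l))"
      using assms p by (intro MT.finsum_cong') (auto simp: et_mult)
    finally show "et (V i p) (V p j) \<otimes>\<^bsub>E\<^esub> X k l = \<dots>" .
  qed (use assms in \<open>auto intro!: MT.finsum_closed\<close>)
  finally show ?thesis .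
qed

lemma sum_right:
  assumes "\<And>k. k < n \<Longrightarrow> f k \<in> carrier A" "a \<in> carrier A"
  shows "(\<Oplus>\<^bsub>E\<^esub>k\<in>{..<n}. et a (f k)) = et a (\<Oplus>\<^bsub>A\<^esub>k\<in>{..<n}. f k)"
  using assms by (intro et_finsum_right[symmetric]) auto

lemma sum_left:
  assumes "\<And>k. k < n \<Longrightarrow> f k \<in> carrier A" "a \<in> carrier A"
  shows "(\<Oplus>\<^bsub>E\<^esub>k\<in>{..<n}. et (f k) a) = et (\<Oplus>\<^bsub>A\<^esub>k\<in>{..<n}. f k) a"
  using assms by (intro et_finsum_left[symmetric]) auto

lemma diag_sum:
  assumes "\<And>p q. p < n \<Longrightarrow> q < n \<Longrightarrow> f p q \<in> carrier E"
    and "\<And>p q. p < n \<Longrightarrow> q < n \<Longrightarrow> p \<noteq> q \<Longrightarrow> f p q = \<zero>\<^bsub>E\<^esub>"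
  shows "(\<Oplus>\<^bsub>E\<^esub>p\<in>{..<n}. \<Oplus>\<^bsub>E\<^esub>q\<in>{..<n}. f p q) = (\<Oplus>\<^bsub>E\<^esub>p\<in>{..<n}. f p p)"
proof (rule MT.finsum_cong')
  fix p assume p: "p \<in> {..<n}"
  have "(\<Oplus>\<^bsub>E\<^esub>q\<in>{..<n}. f p q) = (\<Oplus>\<^bsub>E\<^esub>q\<in>{..<n}. if q = p then f p q else \<zero>\<^bsub>E\<^esub>)"
    using assms p by (intro MT.finsum_cong') auto
  also have "\<dots> = f p p" using assms p by (intro MT.finsum_delta) auto
  finally show "(\<Oplus>\<^bsub>E\<^esub>q\<in>{..<n}. f p q) = f p p" .
qed (use assms in auto)

text \<open>
  Summing over the index shared by the two factors first contracts one tensor leg to a Kronecker delta, after which the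
  other leg contracts as well.
\<close>

lemma X_orth: assumes "V.orth" shows "X.orth"
  unfolding X.orth_def
proof (intro allI impI conjI)
  fix i j assume ij: "i < n" "j < n"
  have V1: "(\<Oplus>\<^bsub>A\<^esub>k\<in>{..<n}. V p k \<otimes>\<^bsub>A\<^esub> V q k) = (if p = q then \<one>\<^bsub>A\<^esub> else \<zero>\<^bsub>A\<^esub>)"
    and V2: "(\<Oplus>\<^bsub>A\<^esub>k\<in>{..<n}. V k p \<otimes>\<^bsub>A\<^esub> V k q) = (if p = q then \<one>\<^bsub>A\<^esub> else \<zero>\<^bsub>A\<^esub>)"
    if "p < n" "q < n" for p q using assms that unfolding V.orth_def by auto
  have "(\<Oplus>\<^bsub>E\<^esub>k\<in>{..<n}. X i k \<otimes>\<^bsub>E\<^esub> X j k) = (\<Oplus>\<^bsub>E\<^esub>k\<in>{..<n}. \<Oplus>\<^bsub>E\<^esub>p\<in>{..<n}. \<Oplus>\<^bsub>E\<^esub>q\<in>{..<n}.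
      et (V i p \<otimes>\<^bsub>A\<^esub> V j q) (V p k \<otimes>\<^bsub>A\<^esub> V q k))"
    using ij by (intro MT.finsum_cong' X_mult) (auto intro!: MT.finsum_closed)
  also have "\<dots> = (\<Oplus>\<^bsub>E\<^esub>p\<in>{..<n}. \<Oplus>\<^bsub>E\<^esub>k\<in>{..<n}. \<Oplus>\<^bsub>E\<^esub>q\<in>{..<n}.
      et (V i p \<otimes>\<^bsub>A\<^esub> V j q) (V p k \<otimes>\<^bsub>A\<^esub> V q k))"
    using ij by (intro MT.finsum_swap) (auto intro!: MT.finsum_closed)
  also have "\<dots> = (\<Oplus>\<^bsub>E\<^esub>p\<in>{..<n}. \<Oplus>\<^bsub>E\<^esub>q\<in>{..<n}. \<Oplus>\<^bsub>E\<^esub>k\<in>{..<n}.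
      et (V i p \<otimes>\<^bsub>A\<^esub> V j q) (V p k \<otimes>\<^bsub>A\<^esub> V q k))"
    using ij by (intro MT.finsum_cong' MT.finsum_swap refl) (auto intro!: MT.finsum_closed)
  also have "\<dots> = (\<Oplus>\<^bsub>E\<^esub>p\<in>{..<n}. \<Oplus>\<^bsub>E\<^esub>q\<in>{..<n}.
      et (V i p \<otimes>\<^bsub>A\<^esub> V j q) (if p = q then \<one>\<^bsub>A\<^esub> else \<zero>\<^bsub>A\<^esub>))"
    using ij by (intro MT.finsum_cong' refl) (auto intro!: MT.finsum_closed simp: sum_right V1)
  also have "\<dots> = (\<Oplus>\<^bsub>E\<^esub>p\<in>{..<n}. et (V i p \<otimes>\<^bsub>A\<^esub> V j p) \<one>\<^bsub>A\<^esub>)"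
    using ij by (subst diag_sum) auto
  also have "\<dots> = et (if i = j then \<one>\<^bsub>A\<^esub> else \<zero>\<^bsub>A\<^esub>) \<one>\<^bsub>A\<^esub>"
    using ij by (subst sum_left) (auto simp: V1)
  finally show "(\<Oplus>\<^bsub>E\<^esub>k\<in>{..<n}. X i k \<otimes>\<^bsub>E\<^esub> X j k) = (if i = j then \<one>\<^bsub>E\<^esub> else \<zero>\<^bsub>E\<^esub>)"
    by (simp add: et_one)
  have "(\<Oplus>\<^bsub>E\<^esub>k\<in>{..<n}. X k i \<otimes>\<^bsub>E\<^esub> X k j) = (\<Oplus>\<^bsub>E\<^esub>k\<in>{..<n}. \<Oplus>\<^bsub>E\<^esub>p\<in>{..<n}. \<Oplus>\<^bsub>E\<^esub>q\<in>{..<n}.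
      et (V k p \<otimes>\<^bsub>A\<^esub> V k q) (V p i \<otimes>\<^bsub>A\<^esub> V q j))"
    using ij by (intro MT.finsum_cong' X_mult) (auto intro!: MT.finsum_closed)
  also have "\<dots> = (\<Oplus>\<^bsub>E\<^esub>p\<in>{..<n}. \<Oplus>\<^bsub>E\<^esub>k\<in>{..<n}. \<Oplus>\<^bsub>E\<^esub>q\<in>{..<n}.
      et (V k p \<otimes>\<^bsub>A\<^esub> V k q) (V p i \<otimes>\<^bsub>A\<^esub> V q j))"
    using ij by (intro MT.finsum_swap) (auto intro!: MT.finsum_closed)
  also have "\<dots> = (\<Oplus>\<^bsub>E\<^esub>p\<in>{..<n}. \<Oplus>\<^bsub>E\<^esub>q\<in>{..<n}. \<Oplus>\<^bsub>E\<^esub>k\<in>{..<n}.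
      et (V k p \<otimes>\<^bsub>A\<^esub> V k q) (V p i \<otimes>\<^bsub>A\<^esub> V q j))"
    using ij by (intro MT.finsum_cong' MT.finsum_swap refl) (auto intro!: MT.finsum_closed)
  also have "\<dots> = (\<Oplus>\<^bsub>E\<^esub>p\<in>{..<n}. \<Oplus>\<^bsub>E\<^esub>q\<in>{..<n}.
      et (if p = q then \<one>\<^bsub>A\<^esub> else \<zero>\<^bsub>A\<^esub>) (V p i \<otimes>\<^bsub>A\<^esub> V q j))"
    using ij by (intro MT.finsum_cong' refl) (auto intro!: MT.finsum_closed simp: sum_left V2)
  also have "\<dots> = (\<Oplus>\<^bsub>E\<^esub>p\<in>{..<n}. et \<one>\<^bsub>A\<^esub> (V p i \<otimes>\<^bsub>A\<^esub> V p j))"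
    using ij by (subst diag_sum) auto
  also have "\<dots> = et \<one>\<^bsub>A\<^esub> (if i = j then \<one>\<^bsub>A\<^esub> else \<zero>\<^bsub>A\<^esub>)"
    using ij by (subst sum_right) (auto simp: V2)
  finally show "(\<Oplus>\<^bsub>E\<^esub>k\<in>{..<n}. X k i \<otimes>\<^bsub>E\<^esub> X k j) = (if i = j then \<one>\<^bsub>E\<^esub> else \<zero>\<^bsub>E\<^esub>)"
    by (simp add: et_one)
qed

lemma X_line_sums: assumes "V.line_sums s" "s \<in> carrier A" shows "X.line_sums (et s s)"
  unfolding X.line_sums_def
proof (intro allI impI conjI)
  fix i assume i: "i < n"
  have s: "(\<Oplus>\<^bsub>A\<^esub>k\<in>{..<n}. V j k) = s" "(\<Oplus>\<^bsub>A\<^esub>k\<in>{..<n}. V k j) = s" if "j < n" for j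
    using assms that by (auto simp: V.line_sums_def)
  have "(\<Oplus>\<^bsub>E\<^esub>k\<in>{..<n}. X i k) = (\<Oplus>\<^bsub>E\<^esub>p\<in>{..<n}. \<Oplus>\<^bsub>E\<^esub>k\<in>{..<n}. et (V i p) (V p k))"
    unfolding X_def using i by (intro MT.finsum_swap) auto
  also have "\<dots> = (\<Oplus>\<^bsub>E\<^esub>p\<in>{..<n}. et (V i p) s)"
    using i assms(2) by (intro MT.finsum_cong' refl) (auto simp: sum_right s)
  also have "\<dots> = et s s" using i assms(2) by (subst sum_left) (auto simp: s)
  finally show "(\<Oplus>\<^bsub>E\<^esub>k\<in>{..<n}. X i k) = et s s" .
  have "(\<Oplus>\<^bsub>E\<^esub>k\<in>{..<n}. X k i) = (\<Oplus>\<^bsub>E\<^esub>p\<in>{..<n}. \<Oplus>\<^bsub>E\<^esub>k\<in>{..<n}. et (V k p) (V p i))"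
    unfolding X_def using i by (intro MT.finsum_swap) auto
  also have "\<dots> = (\<Oplus>\<^bsub>E\<^esub>p\<in>{..<n}. et s (V p i))"
    using i assms(2) by (intro MT.finsum_cong' refl) (auto simp: sum_left s)
  also have "\<dots> = et s s" using i assms(2) by (subst sum_right) (auto simp: s)
  finally show "(\<Oplus>\<^bsub>E\<^esub>k\<in>{..<n}. X k i) = et s s" .
qed

lemma X_cubic: assumes "V.cubic" shows "X.cubic"
  unfolding X.cubic_def
proof (intro allI impI)
  fix i j k assume ijk: "i < n" "j < n" "k < n" "j \<noteq> k"
  have z: "V p q \<otimes>\<^bsub>A\<^esub> V p r = \<zero>\<^bsub>A\<^esub>" "V q p \<otimes>\<^bsub>A\<^esub> V r p = \<zero>\<^bsub>A\<^esub>"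
    if "p < n" "q < n" "r < n" "q \<noteq> r" for p q r
    using assms that unfolding V.cubic_def by auto
  have t: "et (V i p \<otimes>\<^bsub>A\<^esub> V i q) (V p j \<otimes>\<^bsub>A\<^esub> V q k) = \<zero>\<^bsub>E\<^esub>"
    "et (V j p \<otimes>\<^bsub>A\<^esub> V k q) (V p i \<otimes>\<^bsub>A\<^esub> V q i) = \<zero>\<^bsub>E\<^esub>" if "p < n" "q < n" for p q
    using that ijk z by (cases "p = q"; simp)+
  have "(\<Oplus>\<^bsub>E\<^esub>p\<in>{..<n}. \<Oplus>\<^bsub>E\<^esub>q\<in>{..<n}. et (V i p \<otimes>\<^bsub>A\<^esub> V i q) (V p j \<otimes>\<^bsub>A\<^esub> V q k)) = \<zero>\<^bsub>E\<^esub>"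
    "(\<Oplus>\<^bsub>E\<^esub>p\<in>{..<n}. \<Oplus>\<^bsub>E\<^esub>q\<in>{..<n}. et (V j p \<otimes>\<^bsub>A\<^esub> V k q) (V p i \<otimes>\<^bsub>A\<^esub> V q i)) = \<zero>\<^bsub>E\<^esub>"
    using t by (auto intro!: MT.add.finprod_one_eqI)
  then show "X i j \<otimes>\<^bsub>E\<^esub> X i k = \<zero>\<^bsub>E\<^esub> \<and> X j i \<otimes>\<^bsub>E\<^esub> X k i = \<zero>\<^bsub>E\<^esub>"
    using ijk by (simp add: X_mult)
qed

text \<open>
  Idempotency alone does not pass to \<open>X\<close>; orthogonality within the rows removes the mixed terms of the
  square.
\<close>

lemma X_idem: assumes "V.cubic" "V.idem" shows "X.idem"
  unfolding X.idem_def
proof (intro allI impI)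
  fix i j assume ij: "i < n" "j < n"
  have z: "V p q \<otimes>\<^bsub>A\<^esub> V p r = \<zero>\<^bsub>A\<^esub>" if "p < n" "q < n" "r < n" "q \<noteq> r" for p q r
    using assms(1) that unfolding V.cubic_def by auto
  have e: "V p q \<otimes>\<^bsub>A\<^esub> V p q = V p q" if "p < n" "q < n" for p q
    using assms(2) that unfolding V.idem_def by auto
  have "X i j \<otimes>\<^bsub>E\<^esub> X i j = (\<Oplus>\<^bsub>E\<^esub>p\<in>{..<n}. et (V i p \<otimes>\<^bsub>A\<^esub> V i p) (V p j \<otimes>\<^bsub>A\<^esub> V p j))"
    unfolding X_mult[OF ij ij] using ij by (intro diag_sum) (auto simp: z)
  also have "\<dots> = X i j" unfolding X_def using ij by (intro MT.finsum_cong') (auto simp: e)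
  finally show "X i j \<otimes>\<^bsub>E\<^esub> X i j = X i j" .
qed

text \<open>
  A product of three entries of \<open>X\<close> is a triple sum whose legs are products of three entries of \<open>V\<close>;
  reversing both legs term by term and renaming the summation indices reverses the product.
\<close>

lemma X_half: assumes "V.half" shows "X.half"
  unfolding X.half_def
proof (intro allI impI)
  fix a b c d e f assume l: "a < n" "b < n" "c < n" "d < n" "e < n" "f < n"
  have three: "X a b \<otimes>\<^bsub>E\<^esub> X c d \<otimes>\<^bsub>E\<^esub> X e f = (\<Oplus>\<^bsub>E\<^esub>p\<in>{..<n}. \<Oplus>\<^bsub>E\<^esub>q\<in>{..<n}. \<Oplus>\<^bsub>E\<^esub>r\<in>{..<n}.
      et (V a p \<otimes>\<^bsub>A\<^esub> V c q \<otimes>\<^bsub>A\<^esub> V e r) (V p b \<otimes>\<^bsub>A\<^esub> V q d \<otimes>\<^bsub>A\<^esub> V r f))"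
    if l: "a < n" "b < n" "c < n" "d < n" "e < n" "f < n" for a b c d e f
  proof -
    let ?m = "\<lambda>p q. et (V a p \<otimes>\<^bsub>A\<^esub> V c q) (V p b \<otimes>\<^bsub>A\<^esub> V q d)"
    have "X a b \<otimes>\<^bsub>E\<^esub> X c d \<otimes>\<^bsub>E\<^esub> X e f = (\<Oplus>\<^bsub>E\<^esub>p\<in>{..<n}. (\<Oplus>\<^bsub>E\<^esub>q\<in>{..<n}. ?m p q) \<otimes>\<^bsub>E\<^esub> X e f)"
      unfolding X_mult[OF l(1-4)] using l by (intro MT.finsum_mult_right X_closed) (auto intro!: MT.finsum_closed)
    also have "\<dots> = (\<Oplus>\<^bsub>E\<^esub>p\<in>{..<n}. \<Oplus>\<^bsub>E\<^esub>q\<in>{..<n}. ?m p q \<otimes>\<^bsub>E\<^esub> X e f)"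
      using l by (intro MT.finsum_cong' refl MT.finsum_mult_right X_closed) (auto intro!: MT.finsum_closed)
    also have "\<dots> = (\<Oplus>\<^bsub>E\<^esub>p\<in>{..<n}. \<Oplus>\<^bsub>E\<^esub>q\<in>{..<n}. \<Oplus>\<^bsub>E\<^esub>r\<in>{..<n}. ?m p q \<otimes>\<^bsub>E\<^esub> et (V e r) (V r f))"
      unfolding X_def[of e f] using l
      by (intro MT.finsum_cong' refl MT.finsum_mult_left) (auto intro!: MT.finsum_closed)
    also have "\<dots> = (\<Oplus>\<^bsub>E\<^esub>p\<in>{..<n}. \<Oplus>\<^bsub>E\<^esub>q\<in>{..<n}. \<Oplus>\<^bsub>E\<^esub>r\<in>{..<n}.
      et (V a p \<otimes>\<^bsub>A\<^esub> V c q \<otimes>\<^bsub>A\<^esub> V e r) (V p b \<otimes>\<^bsub>A\<^esub> V q d \<otimes>\<^bsub>A\<^esub> V r f))"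
      using l by (intro MT.finsum_cong' refl) (auto intro!: MT.finsum_closed simp: et_mult)
    finally show ?thesis .
  qed
  let ?t = "\<lambda>p q r. et (V a p \<otimes>\<^bsub>A\<^esub> V c q \<otimes>\<^bsub>A\<^esub> V e r) (V p b \<otimes>\<^bsub>A\<^esub> V q d \<otimes>\<^bsub>A\<^esub> V r f)"
  have rev: "?t p q r = et (V e r \<otimes>\<^bsub>A\<^esub> V c q \<otimes>\<^bsub>A\<^esub> V a p) (V r f \<otimes>\<^bsub>A\<^esub> V q d \<otimes>\<^bsub>A\<^esub> V p b)"
    if "p < n" "q < n" "r < n" for p q r
    using assms l that unfolding V.half_def by metis
  have "X a b \<otimes>\<^bsub>E\<^esub> X c d \<otimes>\<^bsub>E\<^esub> X e f = (\<Oplus>\<^bsub>E\<^esub>p\<in>{..<n}. \<Oplus>\<^bsub>E\<^esub>q\<in>{..<n}. \<Oplus>\<^bsub>E\<^esub>r\<in>{..<n}. ?t p q r)"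
    by (rule three[OF l])
  also have "\<dots> = (\<Oplus>\<^bsub>E\<^esub>p\<in>{..<n}. \<Oplus>\<^bsub>E\<^esub>r\<in>{..<n}. \<Oplus>\<^bsub>E\<^esub>q\<in>{..<n}. ?t p q r)"
    using l by (intro MT.finsum_cong' MT.finsum_swap refl) (auto intro!: MT.finsum_closed)
  also have "\<dots> = (\<Oplus>\<^bsub>E\<^esub>r\<in>{..<n}. \<Oplus>\<^bsub>E\<^esub>p\<in>{..<n}. \<Oplus>\<^bsub>E\<^esub>q\<in>{..<n}. ?t p q r)"
    using l by (intro MT.finsum_swap) (auto intro!: MT.finsum_closed)
  also have "\<dots> = (\<Oplus>\<^bsub>E\<^esub>r\<in>{..<n}. \<Oplus>\<^bsub>E\<^esub>q\<in>{..<n}. \<Oplus>\<^bsub>E\<^esub>p\<in>{..<n}. ?t p q r)"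
    using l by (intro MT.finsum_cong' MT.finsum_swap refl) (auto intro!: MT.finsum_closed)
  also have "\<dots> = X e f \<otimes>\<^bsub>E\<^esub> X c d \<otimes>\<^bsub>E\<^esub> X a b"
    unfolding three[OF l(5,6,3,4,1,2)] using l
    by (intro MT.finsum_cong' refl) (auto intro!: MT.finsum_closed simp: rev)
  finally show "X a b \<otimes>\<^bsub>E\<^esub> X c d \<otimes>\<^bsub>E\<^esub> X e f = X e f \<otimes>\<^bsub>E\<^esub> X c d \<otimes>\<^bsub>E\<^esub> X a b" .
qed

end

context mqg
begin

sublocale cop: coproduct A n V
  by (intro coproduct.intro cstar_pair.intro A_cstar V.star_matrix_axioms)

text \<open>
  The comultiplication is specified by choice among the homomorphisms with the right values on
  generators.  One exists by the universal property, so the chosen map has these values.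
\<close>

lemma comult_on_generators:
  assumes "cop.X.sat R"
  defines "\<Delta> \<equiv> comult (matrix_quantum_group n R)"
  shows "\<Delta> \<in> star_hom A (min_tensor A A)" "\<And>i j. i < n \<Longrightarrow> j < n \<Longrightarrow> \<Delta> (V i j) = cop.X i j"
proof -
  have sat: "cop.X.sat RR"
    using assms cop.X_orth V_sat cop.X.sat_orth V.sat_orth by simp
  obtain \<Phi> where \<Phi>: "\<Phi> \<in> star_hom F (min_tensor A A)" "\<forall>i<n. \<forall>j<n. \<Phi> (gen i j) = cop.X i j"
    using free_hom_exists[OF cop.MT.star_alg_axioms, of n cop.X] cop.X.X_closed cop.X.X_star by blast
  have "\<exists>H \<in> star_hom A (min_tensor A A). \<forall>x \<in> carrier F. H (U.emb x) = \<Phi> x"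
  proof (rule U.universal_extend[OF cop.min_tensor_cstar \<Phi>(1)])
    have "\<forall>(y, z) \<in> RR. \<Phi> y = \<Phi> z"
      by (rule mp[OF bspec[OF sat[unfolded satisfies_def] \<Phi>(1)] \<Phi>(2)])
    then show "\<Phi> y = \<Phi> z" if "(y, z) \<in> RR" for y z
      using that by fast
  qed
  then obtain H where H: "H \<in> star_hom A (min_tensor A A)" "\<And>x. x \<in> carrier F \<Longrightarrow> H (U.emb x) = \<Phi> x"
    by (elim bexE) fast
  let ?P = "\<lambda>D. D \<in> star_hom A (min_tensor A A) \<and> (\<forall>i<n. \<forall>j<n. D (V i j) = cop.X i j)"
  have "?P H" using H(1) H(2)[OF gen_closed] \<Phi>(2) by simp
  then have "?P (Eps ?P)" by (rule someI[of ?P])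
  moreover have "\<Delta> = Eps ?P"
    unfolding \<Delta>_def matrix_quantum_group_def Let_def cop.X_def quantum_group.simps ..
  ultimately have "?P \<Delta>" by simp
  then show "\<Delta> \<in> star_hom A (min_tensor A A)" "\<And>i j. i < n \<Longrightarrow> j < n \<Longrightarrow> \<Delta> (V i j) = cop.X i j" by auto
qed

end

section \<open>Duals of finite groups\<close>

locale finite_group_dual = group \<Lambda> for \<Lambda> :: "'g monoid" +
  assumes fin: "finite (carrier \<Lambda>)"
begin

sublocale D: star_monoid \<Lambda> "m_inv \<Lambda>"
  by unfold_locales (auto simp: inv_mult_group)

abbreviation "MA \<equiv> monoid_algebra \<Lambda> (m_inv \<Lambda>)"
abbreviation "sg \<equiv> Poly_Mapping.single :: 'g \<Rightarrow> complex \<Rightarrow> 'g \<Rightarrow>\<^sub>0 complex"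

text \<open>
  Group elements are unitary.
\<close>

lemma seminorm_le_1: assumes "cstar_seminorm MA p" "g \<in> carrier \<Lambda>" shows "p (sg g 1) \<le> 1"
proof -
  interpret p: seminormed MA p by unfold_locales (rule assms)
  have "(p (sg g 1))\<^sup>2 = p (star MA (sg g 1) \<otimes>\<^bsub>MA\<^esub> sg g 1)" using assms by (simp add: p.p_star_mult)
  also have "star MA (sg g 1) \<otimes>\<^bsub>MA\<^esub> sg g 1 = \<one>\<^bsub>MA\<^esub>"
    using assms by (simp add: D.MA_star_single D.MA_mult_single D.MA_one)
  finally have "(p (sg g 1))\<^sup>2 \<le> 1\<^sup>2" using p.p_one by simp
  then show ?thesis by (rule power2_le_imp_le) simp
qed

lemma seminorm_le_sum:
  assumes "cstar_seminorm MA p" "f \<in> carrier MA"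
  shows "p f \<le> (\<Sum>a\<in>Poly_Mapping.keys f. cmod (Poly_Mapping.lookup f a))"
  using D.MA_seminorm_bound[OF assms, of "\<lambda>_. 1"] seminorm_le_1[OF assms(1)] by simp

sublocale U: universal MA "{}"
  by unfold_locales (auto simp: kills_def intro: seminorm_le_sum)

abbreviation "B \<equiv> group_cstar \<Lambda>"

lemma B_eq: "B = U.C" by (simp add: group_cstar_def universal_cstar_def)

lemma B_cstar: "cstar_alg B" unfolding B_eq by (rule U.completion_cstar_alg)

sublocale B: cstar_alg B by (rule B_cstar)

lemma emb_hom: "U.emb \<in> star_hom MA B" unfolding B_eq by (rule U.emb_hom)

sublocale emb: star_morphism MA B U.emb by unfold_locales (rule emb_hom)

lemma ge_eq: "group_elem \<Lambda> g = U.emb (sg g 1)" by (simp add: group_elem_def)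

lemma ge_closed [simp, intro]: "g \<in> carrier \<Lambda> \<Longrightarrow> group_elem \<Lambda> g \<in> carrier B"
  by (simp add: ge_eq)

lemma ge_mult: "\<lbrakk>g \<in> carrier \<Lambda>; h \<in> carrier \<Lambda>\<rbrakk> \<Longrightarrow> group_elem \<Lambda> g \<otimes>\<^bsub>B\<^esub> group_elem \<Lambda> h = group_elem \<Lambda> (g \<otimes>\<^bsub>\<Lambda>\<^esub> h)"
  unfolding ge_eq by (subst emb.hom_mult[symmetric]) (auto simp: D.MA_mult_single)

lemma ge_star: "g \<in> carrier \<Lambda> \<Longrightarrow> star B (group_elem \<Lambda> g) = group_elem \<Lambda> (inv\<^bsub>\<Lambda>\<^esub> g)"
  unfolding ge_eq by (subst emb.hom_star[symmetric]) (auto simp: D.MA_star_single)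

lemma ge_one: "group_elem \<Lambda> \<one>\<^bsub>\<Lambda>\<^esub> = \<one>\<^bsub>B\<^esub>"
  unfolding ge_eq using emb.hom_one by (simp add: D.MA_one)

text \<open>
  The coefficient of the neutral element is a positive functional whose GNS representation is the left
  regular representation.
\<close>

definition trace :: "('g \<Rightarrow>\<^sub>0 complex) \<Rightarrow> complex" where "trace f = Poly_Mapping.lookup f \<one>\<^bsub>\<Lambda>\<^esub>"

lemma trace_star_mult:
  assumes "f \<in> carrier MA"
  shows "trace (star MA f \<otimes>\<^bsub>MA\<^esub> f) = (\<Sum>a\<in>Poly_Mapping.keys f. complex_of_real ((cmod (Poly_Mapping.lookup f a))\<^sup>2))"
proof -
  let ?K = "Poly_Mapping.keys f" and ?l = "Poly_Mapping.lookup f"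
  have K: "a \<in> carrier \<Lambda>" if "a \<in> ?K" for a using that assms by (auto simp: D.MA_carrier)
  have "trace (star MA f \<otimes>\<^bsub>MA\<^esub> f) = (\<Sum>a\<in>?K. \<Sum>b\<in>?K.
      Poly_Mapping.lookup (sg (inv\<^bsub>\<Lambda>\<^esub> a \<otimes>\<^bsub>\<Lambda>\<^esub> b) (cnj (?l a) * ?l b)) \<one>\<^bsub>\<Lambda>\<^esub>)"
    unfolding trace_def D.MA_star_mult_self[OF assms] lookup_sum ..
  also have "\<dots> = (\<Sum>a\<in>?K. \<Sum>b\<in>?K. if a = b then cnj (?l a) * ?l b else 0)"
  proof (intro sum.cong refl)
    fix a b assume "a \<in> ?K" "b \<in> ?K"
    then have "inv\<^bsub>\<Lambda>\<^esub> a \<otimes>\<^bsub>\<Lambda>\<^esub> b = \<one>\<^bsub>\<Lambda>\<^esub> \<longleftrightarrow> a = b"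
      using K[of a] K[of b] by (metis inv_closed inv_equality inv_inv l_inv)
    then show "Poly_Mapping.lookup (sg (inv\<^bsub>\<Lambda>\<^esub> a \<otimes>\<^bsub>\<Lambda>\<^esub> b) (cnj (?l a) * ?l b)) \<one>\<^bsub>\<Lambda>\<^esub> =
      (if a = b then cnj (?l a) * ?l b else 0)" by (simp add: lookup_single when_def)
  qed
  also have "\<dots> = (\<Sum>a\<in>?K. cnj (?l a) * ?l a)" by simp
  also have "\<dots> = (\<Sum>a\<in>?K. complex_of_real ((cmod (?l a))\<^sup>2))"
    by (intro sum.cong refl) (simp only: complex_norm_square mult.commute)
  finally show ?thesis .
qed

lemma trace_positive: "positive_functional MA trace"
proof -
  have "trace (star MA f \<otimes>\<^bsub>MA\<^esub> f) \<in> \<real>\<^sub>\<ge>\<^sub>0" if "f \<in> carrier MA" for f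
    unfolding trace_star_mult[OF that] of_real_sum[symmetric]
    by (simp only: nonneg_Reals_of_real_iff) (auto intro: sum_nonneg)
  then show ?thesis by (auto simp: positive_functional_def trace_def lookup_add D.MA_smult_lookup)
qed

sublocale tr: positive MA trace by unfold_locales (rule trace_positive)

lemma trace_unitary:
  assumes "g \<in> carrier \<Lambda>" "y \<in> carrier MA" shows "tr.N (sg g c \<otimes>\<^bsub>MA\<^esub> y) = cmod c * tr.N y"
proof -
  have "star MA (sg g 1 \<otimes>\<^bsub>MA\<^esub> y) \<otimes>\<^bsub>MA\<^esub> (sg g 1 \<otimes>\<^bsub>MA\<^esub> y) = star MA y \<otimes>\<^bsub>MA\<^esub> (star MA (sg g 1) \<otimes>\<^bsub>MA\<^esub> sg g 1) \<otimes>\<^bsub>MA\<^esub> y"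
    using assms by (simp add: D.MA.star_mult D.MA.m_assoc)
  also have "star MA (sg g 1) \<otimes>\<^bsub>MA\<^esub> sg g 1 = \<one>\<^bsub>MA\<^esub>"
    using assms by (simp add: D.MA_star_single D.MA_mult_single D.MA_one)
  finally have 1: "tr.N (sg g 1 \<otimes>\<^bsub>MA\<^esub> y) = tr.N y" using assms by (simp add: tr.N_def)
  have "sg g c = c \<odot>\<^bsub>MA\<^esub> sg g 1" by simp
  then have "sg g c \<otimes>\<^bsub>MA\<^esub> y = c \<odot>\<^bsub>MA\<^esub> (sg g 1 \<otimes>\<^bsub>MA\<^esub> y)"
    using assms by (simp only: D.MA.smult_l_assoc D.MA_single)
  then show ?thesis using assms 1 by (simp add: tr.N_smult)
qed

sublocale reg: positive_family MA "{trace}"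
proof unfold_locales
  show "positive_functional MA \<tau>" if "\<tau> \<in> {trace}" for \<tau> using that trace_positive by simp
  fix x assume "x \<in> carrier MA"
  then have "\<exists>K\<ge>0. \<forall>y\<in>carrier MA. tr.N (x \<otimes>\<^bsub>MA\<^esub> y) \<le> K * tr.N y"
  proof (induction rule: D.MA_induct)
    case (single a c)
    then show ?case using trace_unitary by (intro exI[of _ "cmod c"]) auto
  next
    case (add f g)
    obtain K L where KL: "K \<ge> 0" "\<forall>y\<in>carrier MA. tr.N (f \<otimes>\<^bsub>MA\<^esub> y) \<le> K * tr.N y"
      "L \<ge> 0" "\<forall>y\<in>carrier MA. tr.N (g \<otimes>\<^bsub>MA\<^esub> y) \<le> L * tr.N y" using add(3,4) by blast
    have "tr.N ((f + g) \<otimes>\<^bsub>MA\<^esub> y) \<le> (K + L) * tr.N y" if "y \<in> carrier MA" for y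
      using tr.N_add[of "f \<otimes>\<^bsub>MA\<^esub> y" "g \<otimes>\<^bsub>MA\<^esub> y"] bspec[OF KL(2) that] bspec[OF KL(4) that] add that
      by (simp add: D.MA_mult_add_left distrib_right)
    then show ?case using KL by (intro exI[of _ "K + L"]) auto
  qed
  then show "\<exists>K\<ge>0. \<forall>\<tau>\<in>{trace}. \<forall>y\<in>carrier MA. positive.N MA \<tau> (x \<otimes>\<^bsub>MA\<^esub> y) \<le> K * positive.N MA \<tau> y"
    by simp
qed

text \<open>
  Applied to the vector of the neutral element, the regular representation recovers all coefficients;
  hence the universal norm dominates each of them and is a norm on the group algebra.
\<close>

lemma coeff_le_norm:
  assumes f: "f \<in> carrier MA" shows "cmod (Poly_Mapping.lookup f a) \<le> universal_norm MA {} f"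
proof -
  have 1: "\<one>\<^bsub>MA\<^esub> \<in> carrier MA" by (rule D.MA.one_closed)
  have N1: "tr.N \<one>\<^bsub>MA\<^esub> = 1"
    unfolding tr.N_def using trace_star_mult[OF 1] by (simp add: D.MA_one)
  have "cmod (Poly_Mapping.lookup f a) \<le> tr.N f"
  proof (cases "a \<in> Poly_Mapping.keys f")
    case True
    have "(cmod (Poly_Mapping.lookup f a))\<^sup>2 \<le> (\<Sum>a\<in>Poly_Mapping.keys f. (cmod (Poly_Mapping.lookup f a))\<^sup>2)"
      by (rule member_le_sum[OF True]) auto
    also have "\<dots> = (tr.N f)\<^sup>2" using f trace_star_mult[OF f] by (simp add: tr.N_sq)
    finally show ?thesis using tr.N_nonneg[OF f] by (rule power2_le_imp_le)
  qed (use tr.N_nonneg[OF f] in \<open>simp add: in_keys_iff\<close>)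
  also have "\<dots> \<le> reg.gns f" using reg.gns_bound[OF f _ 1, of trace] N1 f by simp
  also have "\<dots> \<le> universal_norm MA {} f"
    by (rule U.le_universal_norm[OF _ f]) (simp add: kills_def reg.gns_seminorm)
  finally show ?thesis .
qed

text \<open>
  The group algebra of a finite group is finite-dimensional, hence already complete: the coefficients of
  a Cauchy sequence converge, and there are finitely many of them.  This makes surjectivity onto the
  C*-algebra of the group a purely algebraic matter.
\<close>

lemma emb_surj: assumes "P \<in> carrier B" shows "\<exists>f \<in> carrier MA. P = U.emb f"
proof -
  obtain s where s: "s \<in> U.cauchy" "P = U.cls s" using assms unfolding B_eq by (rule U.carrier_CE)
  note sc = U.cauchyD[OF s(1)]
  have lk: "Poly_Mapping.lookup (s k \<ominus>\<^bsub>MA\<^esub> s l) a = Poly_Mapping.lookup (s k) a - Poly_Mapping.lookup (s l) a" for k l a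
    using sc by (simp add: D.MA_minus lookup_minus)
  have "\<exists>L. (\<lambda>k. Poly_Mapping.lookup (s k) a) \<longlonglongrightarrow> L" for a
  proof -
    have "Cauchy (\<lambda>k. Poly_Mapping.lookup (s k) a)"
    proof (rule metric_CauchyI)
      fix e :: real assume "0 < e"
      then obtain N where N: "\<forall>k\<ge>N. \<forall>l\<ge>N. universal_norm MA {} (s k \<ominus>\<^bsub>MA\<^esub> s l) < e"
        using U.cauchyD'[OF s(1)] by blast
      have "dist (Poly_Mapping.lookup (s k) a) (Poly_Mapping.lookup (s l) a) \<le> universal_norm MA {} (s k \<ominus>\<^bsub>MA\<^esub> s l)" for k l
        using coeff_le_norm[of "s k \<ominus>\<^bsub>MA\<^esub> s l" a] sc by (simp add: dist_norm lk)
      then show "\<exists>M. \<forall>m\<ge>M. \<forall>n\<ge>M. dist (Poly_Mapping.lookup (s m) a) (Poly_Mapping.lookup (s n) a) < e"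
        using N by (meson le_less_trans)
    qed
    then show ?thesis using Cauchy_convergent by (auto simp: convergent_def)
  qed
  then obtain L where L: "\<And>a. (\<lambda>k. Poly_Mapping.lookup (s k) a) \<longlonglongrightarrow> L a" by metis
  define f where "f = (\<Sum>a\<in>carrier \<Lambda>. sg a (L a))"
  have f: "f \<in> carrier MA" unfolding f_def by (rule D.MA_sum) auto
  have fl: "Poly_Mapping.lookup f a = L a" if "a \<in> carrier \<Lambda>" for a
    unfolding f_def lookup_sum using that fin by (simp add: lookup_single when_def)
  have "U.null s (\<lambda>_. f)"
  proof (rule U.nullI[OF sc f])
    fix k
    have d: "s k \<ominus>\<^bsub>MA\<^esub> f \<in> carrier MA" using sc f by simp
    have "universal_norm MA {} (s k \<ominus>\<^bsub>MA\<^esub> f) \<le> (\<Sum>a\<in>Poly_Mapping.keys (s k \<ominus>\<^bsub>MA\<^esub> f). cmod (Poly_Mapping.lookup (s k \<ominus>\<^bsub>MA\<^esub> f) a))"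
      by (rule seminorm_le_sum[OF U.seminorm d])
    also have "\<dots> \<le> (\<Sum>a\<in>carrier \<Lambda>. cmod (Poly_Mapping.lookup (s k \<ominus>\<^bsub>MA\<^esub> f) a))"
      using d fin by (intro sum_mono2) (auto simp: D.MA_carrier)
    also have "\<dots> = (\<Sum>a\<in>carrier \<Lambda>. cmod (Poly_Mapping.lookup (s k) a - L a))"
      using f fl by (intro sum.cong refl) (simp add: D.MA_minus lookup_minus)
    finally show "universal_norm MA {} (s k \<ominus>\<^bsub>MA\<^esub> f) \<le> (\<Sum>a\<in>carrier \<Lambda>. cmod (Poly_Mapping.lookup (s k) a - L a))" .
  next
    have "(\<lambda>k. cmod (Poly_Mapping.lookup (s k) a - L a)) \<longlonglongrightarrow> 0" for a
      using L[of a] by (intro tendsto_norm_zero) (simp add: LIM_zero_iff)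
    then show "(\<lambda>k. \<Sum>a\<in>carrier \<Lambda>. cmod (Poly_Mapping.lookup (s k) a - L a)) \<longlonglongrightarrow> 0"
      by (intro tendsto_null_sum)
  qed
  then have "P = U.emb f"
    unfolding s(2) U.emb_eq using U.cls_eq[OF s(1) U.cauchy_const[OF f]] by simp
  then show ?thesis using f by blast
qed

lemma group_dual_C_alg: "C_alg (group_dual \<Lambda>) = B"
  by (simp add: group_dual_def Let_def)

text \<open>
  The coefficient of \<open>g h\<close> separates \<open>g h\<close> from \<open>h g\<close> in the completion.
\<close>

lemma not_classical:
  assumes "g \<in> carrier \<Lambda>" "h \<in> carrier \<Lambda>" "g \<otimes>\<^bsub>\<Lambda>\<^esub> h \<noteq> h \<otimes>\<^bsub>\<Lambda>\<^esub> g"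
  shows "\<not> classical (group_dual \<Lambda>)"
proof
  assume "classical (group_dual \<Lambda>)"
  then have "group_elem \<Lambda> g \<otimes>\<^bsub>B\<^esub> group_elem \<Lambda> h = group_elem \<Lambda> h \<otimes>\<^bsub>B\<^esub> group_elem \<Lambda> g"
    unfolding classical_def group_dual_C_alg using assms by blast
  then have eq: "U.emb (sg (g \<otimes>\<^bsub>\<Lambda>\<^esub> h) 1) = U.emb (sg (h \<otimes>\<^bsub>\<Lambda>\<^esub> g) 1)"
    using assms by (simp add: ge_mult) (simp add: ge_eq)
  let ?x = "sg (g \<otimes>\<^bsub>\<Lambda>\<^esub> h) 1" and ?y = "sg (h \<otimes>\<^bsub>\<Lambda>\<^esub> g) 1"
  have xy: "?x \<in> carrier MA" "?y \<in> carrier MA" using assms by auto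
  have "universal_norm MA {} (?x \<ominus>\<^bsub>MA\<^esub> ?y) = nrm B (U.emb ?x \<ominus>\<^bsub>B\<^esub> U.emb ?y)"
    using xy U.nrm_emb[of "?x \<ominus>\<^bsub>MA\<^esub> ?y"] by (simp add: emb.hom_diff B_eq)
  also have "\<dots> = 0" unfolding eq using emb.hom_closed[OF xy(2)] by (simp add: a_minus_def B.r_neg)
  finally have "cmod (Poly_Mapping.lookup (?x \<ominus>\<^bsub>MA\<^esub> ?y) (g \<otimes>\<^bsub>\<Lambda>\<^esub> h)) \<le> 0"
    using coeff_le_norm[of "?x \<ominus>\<^bsub>MA\<^esub> ?y" "g \<otimes>\<^bsub>\<Lambda>\<^esub> h"] xy by simp
  then show False using xy assms by (simp add: D.MA_minus lookup_minus lookup_single when_def)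
qed

sublocale BB: cstar_pair B B by (intro cstar_pair.intro B_cstar)

lemma comult_on_group:
  defines "\<Delta> \<equiv> comult (group_dual \<Lambda>)"
  shows "\<Delta> \<in> star_hom B (min_tensor B B)"
    "\<And>g. g \<in> carrier \<Lambda> \<Longrightarrow> \<Delta> (group_elem \<Lambda> g) = elem_tensor B B (group_elem \<Lambda> g) (group_elem \<Lambda> g)"
proof -
  let ?\<theta> = "\<lambda>g. elem_tensor B B (group_elem \<Lambda> g) (group_elem \<Lambda> g)"
  have "\<exists>h\<in>star_hom MA (min_tensor B B). \<forall>a\<in>carrier \<Lambda>. \<forall>c. h (sg a c) = c \<odot>\<^bsub>min_tensor B B\<^esub> ?\<theta> a"
    by (rule D.MA_universal[OF BB.MT.star_alg_axioms])
      (auto simp: BB.et_one ge_one BB.et_mult ge_mult BB.et_star ge_star)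
  then obtain \<Phi> where \<Phi>: "\<Phi> \<in> star_hom MA (min_tensor B B)"
    "\<And>a. a \<in> carrier \<Lambda> \<Longrightarrow> \<Phi> (sg a 1) = 1 \<odot>\<^bsub>min_tensor B B\<^esub> ?\<theta> a" by blast
  have "\<exists>H \<in> star_hom (universal_cstar MA {}) (min_tensor B B). \<forall>x \<in> carrier MA. H (U.emb x) = \<Phi> x"
    by (rule U.universal_extend[OF BB.min_tensor_cstar \<Phi>(1)]) simp
  then obtain H where H: "H \<in> star_hom B (min_tensor B B)" "\<And>x. x \<in> carrier MA \<Longrightarrow> H (U.emb x) = \<Phi> x"
    unfolding group_cstar_def by blast
  let ?P = "\<lambda>D. D \<in> star_hom B (min_tensor B B) \<and> (\<forall>g\<in>carrier \<Lambda>. D (group_elem \<Lambda> g) = ?\<theta> g)"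
  have "H (group_elem \<Lambda> g) = ?\<theta> g" if "g \<in> carrier \<Lambda>" for g
    unfolding ge_eq[of g] H(2)[OF D.MA_single[OF that]] \<Phi>(2)[OF that] using that
    by (simp add: ge_eq[symmetric])
  then have "?P H" using H(1) by blast
  then have "?P (Eps ?P)" by (rule someI[of ?P])
  moreover have "\<Delta> = Eps ?P"
    unfolding \<Delta>_def group_dual_def Let_def quantum_group.simps ..
  ultimately have "?P \<Delta>" by simp
  then show "\<Delta> \<in> star_hom B (min_tensor B B)"
    "\<And>g. g \<in> carrier \<Lambda> \<Longrightarrow> \<Delta> (group_elem \<Lambda> g) = ?\<theta> g" by auto
qed

end

section \<open>Group duals inside matrix quantum groups\<close>

text \<open>
  Three mutually orthogonal projections of the real space of dimension \<open>n\<close> with sum \<open>1\<close>, given by their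
  matrix entries.
\<close>

locale projection_family =
  fixes n :: nat and P :: "nat \<Rightarrow> nat \<Rightarrow> nat \<Rightarrow> real"
  assumes proj: "\<lbrakk>a < 3; b < 3; i < n; j < n\<rbrakk> \<Longrightarrow> (\<Sum>k<n. P a i k * P b k j) = (if a = b then P a i j else 0)"
    and symm: "\<lbrakk>a < 3; i < n; j < n\<rbrakk> \<Longrightarrow> P a i j = P a j i"
    and total: "\<lbrakk>i < n; j < n\<rbrakk> \<Longrightarrow> (\<Sum>a<3. P a i j) = (if i = j then 1 else 0)"

text \<open>
  The entries of the matrix \<open>P\<^sub>0 \<otimes> G\<^sub>0 + P\<^sub>1 \<otimes> G\<^sub>1 + P\<^sub>2 \<otimes> G\<^sub>2\<close>, block diagonal in the decomposition of the
  space given by the projections.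
\<close>

definition mix ::
  "('a, 'r) star_algebra_scheme \<Rightarrow> (nat \<Rightarrow> nat \<Rightarrow> nat \<Rightarrow> real) \<Rightarrow> (nat \<Rightarrow> 'a) \<Rightarrow> nat \<Rightarrow> nat \<Rightarrow> 'a" where
  "mix T P G i j = (\<Oplus>\<^bsub>T\<^esub>a\<in>{..<3}. complex_of_real (P a i j) \<odot>\<^bsub>T\<^esub> G a)"

lemma (in star_alg) scaled_bilinear:
  assumes "finite I" "finite J" "\<And>a. a \<in> I \<Longrightarrow> G a \<in> carrier A" "\<And>b. b \<in> J \<Longrightarrow> H b \<in> carrier A"
  shows "(\<Oplus>a\<in>I. c a \<odot> G a) \<otimes> (\<Oplus>b\<in>J. d b \<odot> H b) = (\<Oplus>a\<in>I. \<Oplus>b\<in>J. (c a * d b) \<odot> (G a \<otimes> H b))"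
proof -
  have "(\<Oplus>a\<in>I. c a \<odot> G a) \<otimes> (\<Oplus>b\<in>J. d b \<odot> H b) = (\<Oplus>a\<in>I. (c a \<odot> G a) \<otimes> (\<Oplus>b\<in>J. d b \<odot> H b))"
    using assms by (intro finsum_mult_right) auto
  also have "\<dots> = (\<Oplus>a\<in>I. \<Oplus>b\<in>J. (c a \<odot> G a) \<otimes> (d b \<odot> H b))"
    using assms by (intro finsum_cong' finsum_mult_left refl) auto
  also have "\<dots> = (\<Oplus>a\<in>I. \<Oplus>b\<in>J. (c a * d b) \<odot> (G a \<otimes> H b))"
    using assms by (intro finsum_cong' refl) (auto simp: smult_l_assoc smult_r_assoc smult_smult mult.commute)
  finally show ?thesis .
qed

lemma (in star_alg) smult_scaled:
  assumes "\<And>a. a \<in> I \<Longrightarrow> G a \<in> carrier A"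
  shows "c \<odot> (\<Oplus>a\<in>I. d a \<odot> G a) = (\<Oplus>a\<in>I. (c * d a) \<odot> G a)"
proof -
  have "c \<odot> (\<Oplus>a\<in>I. d a \<odot> G a) = (\<Oplus>a\<in>I. c \<odot> (d a \<odot> G a))"
    using assms by (intro smult_finsum) auto
  also have "\<dots> = (\<Oplus>a\<in>I. (c * d a) \<odot> G a)"
    using assms by (intro finsum_cong' refl) (auto simp: smult_smult)
  finally show ?thesis .
qed

text \<open>
  \<open>P\<^sub>a P\<^sub>b = \<delta>\<^sub>a\<^sub>b P\<^sub>a\<close>, for an arbitrary family \<open>y\<close> of coefficients.  With \<open>y a b = G\<^sub>a G\<^sub>b\<close> this makes the mixed
  matrix orthogonal; with \<open>y a b = G\<^sub>a \<otimes> G\<^sub>b\<close> it makes it compatible with the comultiplications.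
\<close>

lemma (in star_alg) contract:
  assumes "projection_family n P" "\<And>a b. a < 3 \<Longrightarrow> b < 3 \<Longrightarrow> y a b \<in> carrier A" "i < n" "j < n"
  shows "(\<Oplus>k\<in>{..<n}. \<Oplus>a\<in>{..<3}. \<Oplus>b\<in>{..<3}. (complex_of_real (P a i k) * complex_of_real (P b k j)) \<odot> y a b)
    = (\<Oplus>a\<in>{..<3}. complex_of_real (P a i j) \<odot> y a a)"
proof -
  interpret projection_family n P by fact
  have "(\<Oplus>k\<in>{..<n}. \<Oplus>a\<in>{..<3}. \<Oplus>b\<in>{..<3}. (complex_of_real (P a i k) * complex_of_real (P b k j)) \<odot> y a b)
    = (\<Oplus>a\<in>{..<3}. \<Oplus>k\<in>{..<n}. \<Oplus>b\<in>{..<3}. (complex_of_real (P a i k) * complex_of_real (P b k j)) \<odot> y a b)"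
    using assms by (intro finsum_swap) (auto intro!: finsum_closed)
  also have "\<dots> = (\<Oplus>a\<in>{..<3}. \<Oplus>b\<in>{..<3}. \<Oplus>k\<in>{..<n}. (complex_of_real (P a i k) * complex_of_real (P b k j)) \<odot> y a b)"
    using assms by (intro finsum_cong' finsum_swap refl) (auto intro!: finsum_closed)
  also have "\<dots> = (\<Oplus>a\<in>{..<3}. \<Oplus>b\<in>{..<3}. (if b = a then complex_of_real (P a i j) \<odot> y a b else \<zero>))"
  proof (intro finsum_cong' refl funcsetI)
    fix a b :: nat assume "a \<in> {..<3}" "b \<in> {..<3}"
    then have ab: "a < 3" "b < 3" by auto
    have "(\<Oplus>k\<in>{..<n}. (complex_of_real (P a i k) * complex_of_real (P b k j)) \<odot> y a b)
        = (\<Sum>k<n. complex_of_real (P a i k) * complex_of_real (P b k j)) \<odot> y a b"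
      using assms ab by (intro smult_sum[symmetric]) auto
    also have "(\<Sum>k<n. complex_of_real (P a i k) * complex_of_real (P b k j)) = complex_of_real (\<Sum>k<n. P a i k * P b k j)"
      by simp
    also have "\<dots> = complex_of_real (if a = b then P a i j else 0)" using proj ab assms by simp
    finally show "(\<Oplus>k\<in>{..<n}. (complex_of_real (P a i k) * complex_of_real (P b k j)) \<odot> y a b)
        = (if b = a then complex_of_real (P a i j) \<odot> y a b else \<zero>)"
      using assms(2)[OF ab] by (auto split: if_splits)
  qed (use assms in \<open>auto intro!: finsum_closed\<close>)
  also have "\<dots> = (\<Oplus>a\<in>{..<3}. complex_of_real (P a i j) \<odot> y a a)"
    using assms by (intro finsum_cong' finsum_delta) auto
  finally show ?thesis .
qed

locale mixture = star_alg A + projection_family n P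
  for A :: "('a, 'r) star_algebra_scheme" (structure) and n P +
  fixes G :: "nat \<Rightarrow> 'a"
  assumes G_closed [simp, intro]: "a < 3 \<Longrightarrow> G a \<in> carrier A"
    and G_star: "a < 3 \<Longrightarrow> star A (G a) = G a"
    and G_sq: "a < 3 \<Longrightarrow> G a \<otimes> G a = \<one>"
begin

lemma mix_closed: "mix A P G i j \<in> carrier A"
  unfolding mix_def by (auto intro!: finsum_closed)

sublocale X: star_matrix A n "mix A P G"
proof unfold_locales
  show "star A (mix A P G i j) = mix A P G i j" for i j
    unfolding mix_def
    by (subst star_finsum, force, intro finsum_cong' refl) (auto simp: star_smult G_star)
qed (rule mix_closed)

lemma mix_orth: "X.orth"
  unfolding X.orth_def
proof (intro allI impI conjI)
  fix i j assume ij: "i < n" "j < n"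
  have "mix A P G i k \<otimes> mix A P G j k =
      (\<Oplus>a\<in>{..<3}. \<Oplus>b\<in>{..<3}. (complex_of_real (P a i k) * complex_of_real (P b k j)) \<odot> (G a \<otimes> G b))"
    "mix A P G k i \<otimes> mix A P G k j =
      (\<Oplus>a\<in>{..<3}. \<Oplus>b\<in>{..<3}. (complex_of_real (P a i k) * complex_of_real (P b k j)) \<odot> (G a \<otimes> G b))"
    if k: "k < n" for k
  proof -
    show "mix A P G i k \<otimes> mix A P G j k =
      (\<Oplus>a\<in>{..<3}. \<Oplus>b\<in>{..<3}. (complex_of_real (P a i k) * complex_of_real (P b k j)) \<odot> (G a \<otimes> G b))"
      unfolding mix_def using symm[OF _ ij(2) k]
      by (subst scaled_bilinear, simp, simp, simp, simp, intro finsum_cong' refl) (auto intro!: finsum_closed)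
    show "mix A P G k i \<otimes> mix A P G k j =
      (\<Oplus>a\<in>{..<3}. \<Oplus>b\<in>{..<3}. (complex_of_real (P a i k) * complex_of_real (P b k j)) \<odot> (G a \<otimes> G b))"
      unfolding mix_def using symm[OF _ k ij(1)]
      by (subst scaled_bilinear, simp, simp, simp, simp, intro finsum_cong' refl) (auto intro!: finsum_closed)
  qed
  then have eq: "(\<Oplus>k\<in>{..<n}. mix A P G i k \<otimes> mix A P G j k) = (\<Oplus>k\<in>{..<n}. \<Oplus>a\<in>{..<3}. \<Oplus>b\<in>{..<3}.
       (complex_of_real (P a i k) * complex_of_real (P b k j)) \<odot> (G a \<otimes> G b))"
    "(\<Oplus>k\<in>{..<n}. mix A P G k i \<otimes> mix A P G k j) = (\<Oplus>k\<in>{..<n}. \<Oplus>a\<in>{..<3}. \<Oplus>b\<in>{..<3}.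
       (complex_of_real (P a i k) * complex_of_real (P b k j)) \<odot> (G a \<otimes> G b))"
    by (intro finsum_cong' refl; auto intro!: finsum_closed)+
  have "(\<Oplus>k\<in>{..<n}. \<Oplus>a\<in>{..<3}. \<Oplus>b\<in>{..<3}. (complex_of_real (P a i k) * complex_of_real (P b k j)) \<odot> (G a \<otimes> G b))
      = (\<Oplus>a\<in>{..<3}. complex_of_real (P a i j) \<odot> (G a \<otimes> G a))"
    using ij by (intro contract[OF projection_family_axioms]) auto
  also have "\<dots> = (\<Oplus>a\<in>{..<3}. complex_of_real (P a i j) \<odot> \<one>)"
    by (intro finsum_cong' refl) (auto simp: G_sq)
  also have "\<dots> = (\<Sum>a<3. complex_of_real (P a i j)) \<odot> \<one>" by (intro smult_sum[symmetric]) auto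
  also have "(\<Sum>a<3. complex_of_real (P a i j)) = complex_of_real (\<Sum>a<3. P a i j)" by simp
  also have "\<dots> \<odot> \<one> = (if i = j then \<one> else \<zero>)" using total[OF ij] by simp
  finally have fin: "(\<Oplus>k\<in>{..<n}. \<Oplus>a\<in>{..<3}. \<Oplus>b\<in>{..<3}.
      (complex_of_real (P a i k) * complex_of_real (P b k j)) \<odot> (G a \<otimes> G b)) = (if i = j then \<one> else \<zero>)" .
  show "(\<Oplus>k\<in>{..<n}. mix A P G i k \<otimes> mix A P G j k) = (if i = j then \<one> else \<zero>)"
    unfolding eq by (rule fin)
  show "(\<Oplus>k\<in>{..<n}. mix A P G k i \<otimes> mix A P G k j) = (if i = j then \<one> else \<zero>)"
    unfolding eq by (rule fin)
qed

text \<open>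
  If the vector of ones lies in the range of \<open>P\<^sub>c\<close>, then the mixed matrix acts on it as \<open>G\<^sub>c\<close>.
\<close>

lemma mix_line_sums:
  assumes c: "c < 3" and s: "\<And>a i. a < 3 \<Longrightarrow> i < n \<Longrightarrow> (\<Sum>j<n. P a i j) = (if a = c then 1 else 0)"
  shows "X.line_sums (G c)"
  unfolding X.line_sums_def
proof (intro allI impI conjI)
  fix i assume i: "i < n"
  have row: "(\<Oplus>j\<in>{..<n}. \<Oplus>a\<in>{..<3}. complex_of_real (P a i j) \<odot> G a) = G c"
  proof -
    have "(\<Oplus>j\<in>{..<n}. \<Oplus>a\<in>{..<3}. complex_of_real (P a i j) \<odot> G a)
        = (\<Oplus>a\<in>{..<3}. \<Oplus>j\<in>{..<n}. complex_of_real (P a i j) \<odot> G a)"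
      by (intro finsum_swap) auto
    also have "\<dots> = (\<Oplus>a\<in>{..<3}. if a = c then G a else \<zero>)"
    proof (intro finsum_cong' refl funcsetI)
      fix a :: nat assume a: "a \<in> {..<3}"
      have "(\<Oplus>j\<in>{..<n}. complex_of_real (P a i j) \<odot> G a) = (\<Sum>j<n. complex_of_real (P a i j)) \<odot> G a"
        using a by (intro smult_sum[symmetric]) auto
      also have "(\<Sum>j<n. complex_of_real (P a i j)) = complex_of_real (\<Sum>j<n. P a i j)" by simp
      also have "\<dots> = complex_of_real (if a = c then 1 else 0)" using s a i by simp
      finally show "(\<Oplus>j\<in>{..<n}. complex_of_real (P a i j) \<odot> G a) = (if a = c then G a else \<zero>)"
        using a by (auto split: if_splits)
    qed auto
    also have "\<dots> = G c" using c by (intro finsum_delta) auto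
    finally show ?thesis .
  qed
  then show "(\<Oplus>k\<in>{..<n}. mix A P G i k) = G c" by (simp add: mix_def)
  have "(\<Oplus>k\<in>{..<n}. mix A P G k i) = (\<Oplus>j\<in>{..<n}. \<Oplus>a\<in>{..<3}. complex_of_real (P a i j) \<odot> G a)"
    unfolding mix_def using symm[OF _ _ i] by (intro finsum_cong' refl) (auto intro!: finsum_closed)
  then show "(\<Oplus>k\<in>{..<n}. mix A P G k i) = G c" using row by simp
qed

lemma mix_3: "mix A P G i j = complex_of_real (P 0 i j) \<odot> G 0 \<oplus>
    (complex_of_real (P 1 i j) \<odot> G 1 \<oplus> complex_of_real (P 2 i j) \<odot> G 2)"
proof -
  have 3: "{..<3::nat} = {0, 1, 2}" by auto
  show ?thesis unfolding mix_def 3 by (simp add: Pi_def)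
qed

end

text \<open>
  The homomorphism \<open>\<pi>\<close> with \<open>\<pi> u\<^sub>i\<^sub>j = \<Sum>\<^sub>a P\<^sub>a(i,j) G\<^sub>a\<close> exists by the universal property, the mixed matrix being
  orthogonal and satisfying \<open>R\<close>.  It is surjective because multiplying the mixed matrix by \<open>P\<^sub>a\<close> isolates a multiple of \<open>G\<^sub>a\<close>, so that the
  image contains the group generators.  It intertwines the comultiplications because both composites send
  \<open>u\<^sub>i\<^sub>j\<close> to \<open>\<Sum>\<^sub>a P\<^sub>a(i,j) G\<^sub>a \<otimes> G\<^sub>a\<close>, and homomorphisms are determined by the generators.
\<close>

theorem closed_subgroup_dual:
  fixes \<Lambda> :: "'g monoid" and R :: relations and n :: nat
  defines "\<A> \<equiv> universal_cstar (free_star_algebra n) (orthogonal_rel n \<union> R)"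
  defines "\<V> \<equiv> \<lambda>i j. in_completion (free_star_algebra n) (universal_norm (free_star_algebra n) (orthogonal_rel n \<union> R)) (gen i j)"
  assumes "mqg n R" "finite_group_dual \<Lambda>" "projection_family n P"
    and G: "\<And>a. a < 3 \<Longrightarrow> G a \<in> carrier \<Lambda>" "\<And>a. a < 3 \<Longrightarrow> G a \<otimes>\<^bsub>\<Lambda>\<^esub> G a = \<one>\<^bsub>\<Lambda>\<^esub>"
    and nz: "\<And>a. a \<in> {1, 2} \<Longrightarrow> \<exists>i<n. P a i i \<noteq> 0"
    and generated: "\<And>S. \<lbrakk>\<one>\<^bsub>\<Lambda>\<^esub> \<in> S; G 1 \<in> S; G 2 \<in> S; \<And>x y. x \<in> S \<Longrightarrow> y \<in> S \<Longrightarrow> x \<otimes>\<^bsub>\<Lambda>\<^esub> y \<in> S\<rbrakk> \<Longrightarrow> carrier \<Lambda> \<subseteq> S"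
    and sat: "satisfies (group_cstar \<Lambda>) n (mix (group_cstar \<Lambda>) P (\<lambda>a. group_elem \<Lambda> (G a))) R"
    and stable: "satisfies (min_tensor \<A> \<A>) n (coproduct.X \<A> n \<V>) R"
  shows "closed_subgroup (group_dual \<Lambda>) (matrix_quantum_group n R)"
proof -
  interpret Q: mqg n R by fact
  interpret L: finite_group_dual \<Lambda> by fact
  interpret projection_family n P by fact
  let ?g = "\<lambda>a. group_elem \<Lambda> (G a)"
  have inv: "inv\<^bsub>\<Lambda>\<^esub> G a = G a" if "a < 3" for a
    using G that L.inv_equality by blast
  interpret X: mixture L.B n P ?g
    by unfold_locales (auto simp: G L.ge_star inv L.ge_mult L.ge_one)
  obtain \<Phi> where \<Phi>: "\<Phi> \<in> star_hom Q.F L.B" "\<forall>i<n. \<forall>j<n. \<Phi> (gen i j) = mix L.B P ?g i j"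
    using free_hom_exists[OF L.B.star_alg_axioms, of n "mix L.B P ?g"] X.X.X_closed X.X.X_star by blast
  have "satisfies L.B n (mix L.B P ?g) Q.RR" using sat X.mix_orth X.X.sat_orth by simp
  then have "\<forall>(y, z) \<in> Q.RR. \<Phi> y = \<Phi> z"
    unfolding satisfies_def using \<Phi> by blast
  then have "\<exists>H \<in> star_hom Q.A L.B. \<forall>x \<in> carrier Q.F. H (Q.U.emb x) = \<Phi> x"
    by (intro Q.U.universal_extend[OF L.B_cstar \<Phi>(1)]) fast
  then obtain \<pi> where \<pi>: "\<pi> \<in> star_hom Q.A L.B" "\<And>x. x \<in> carrier Q.F \<Longrightarrow> \<pi> (Q.U.emb x) = \<Phi> x"
    by (elim bexE) fast
  interpret \<pi>: star_morphism Q.A L.B \<pi> by unfold_locales (rule \<pi>(1))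
  have \<pi>V: "\<pi> (Q.V i j) = mix L.B P ?g i j" if "i < n" "j < n" for i j
    using \<pi>(2)[OF gen_closed[OF that]] \<Phi>(2) that by simp
  define Im where "Im = \<pi> ` carrier Q.A"
  have Im_smult: "c \<odot>\<^bsub>L.B\<^esub> x \<in> Im" if "x \<in> Im" for c x
    using that \<pi>.hom_smult unfolding Im_def image_iff by (metis Q.A.smult_closed)
  have Im_mult: "x \<otimes>\<^bsub>L.B\<^esub> y \<in> Im" if "x \<in> Im" "y \<in> Im" for x y
    using that \<pi>.hom_mult unfolding Im_def image_iff by (metis Q.A.m_closed)
  have Im_add: "x \<oplus>\<^bsub>L.B\<^esub> y \<in> Im" if "x \<in> Im" "y \<in> Im" for x y
    using that \<pi>.hom_add unfolding Im_def image_iff by (metis Q.A.a_closed)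
  have Im_sum: "finsum L.B f I \<in> Im" if "finite I" "\<And>i. i \<in> I \<Longrightarrow> f i \<in> Im" for f and I :: "nat set"
    using that
  proof (induction I rule: finite_induct)
    case empty
    show ?case using \<pi>.hom_zero Q.A.zero_closed unfolding Im_def image_iff by (metis L.B.finsum_empty)
  next
    case (insert i I)
    have "Im \<subseteq> carrier L.B" unfolding Im_def using \<pi>.hom_closed by (intro image_subsetI)
    then have "f \<in> I \<rightarrow> carrier L.B" "f i \<in> carrier L.B" using insert(4) by blast+
    then show ?case using insert Im_add by simp
  qed
  have mixIm: "mix L.B P ?g i j \<in> Im" if "i < n" "j < n" for i j
    using \<pi>V[OF that] Q.V.X_closed[OF that] unfolding Im_def by (metis imageI)
  have gIm: "?g a \<in> Im" if a: "a \<in> {1, 2}" for a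
  proof -
    have a3: "a < 3" using a by auto
    obtain i where i: "i < n" "P a i i \<noteq> 0" using nz[OF a] by blast
    \<comment> \<open>The entry \<open>(i, i)\<close> of \<open>P\<^sub>a\<close> times the mixed matrix.\<close>
    have row: "(\<Oplus>\<^bsub>L.B\<^esub>k\<in>{..<n}. complex_of_real (P a i k) \<odot>\<^bsub>L.B\<^esub> mix L.B P ?g k i) = complex_of_real (P a i i) \<odot>\<^bsub>L.B\<^esub> ?g a"
    proof -
      have "(\<Oplus>\<^bsub>L.B\<^esub>k\<in>{..<n}. complex_of_real (P a i k) \<odot>\<^bsub>L.B\<^esub> mix L.B P ?g k i)
          = (\<Oplus>\<^bsub>L.B\<^esub>k\<in>{..<n}. \<Oplus>\<^bsub>L.B\<^esub>b\<in>{..<3}. (complex_of_real (P a i k) * complex_of_real (P b k i)) \<odot>\<^bsub>L.B\<^esub> ?g b)"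
        unfolding mix_def
        using G by (intro L.B.finsum_cong' refl L.B.smult_scaled funcsetI L.B.finsum_closed) auto
      also have "\<dots> = (\<Oplus>\<^bsub>L.B\<^esub>b\<in>{..<3}. \<Oplus>\<^bsub>L.B\<^esub>k\<in>{..<n}. (complex_of_real (P a i k) * complex_of_real (P b k i)) \<odot>\<^bsub>L.B\<^esub> ?g b)"
        by (intro L.B.finsum_swap) (auto simp: G)
      also have "\<dots> = (\<Oplus>\<^bsub>L.B\<^esub>b\<in>{..<3}. if b = a then complex_of_real (P a i i) \<odot>\<^bsub>L.B\<^esub> ?g b else \<zero>\<^bsub>L.B\<^esub>)"
      proof (intro L.B.finsum_cong' refl funcsetI)
        fix b :: nat assume b: "b \<in> {..<3}"
        have "(\<Oplus>\<^bsub>L.B\<^esub>k\<in>{..<n}. (complex_of_real (P a i k) * complex_of_real (P b k i)) \<odot>\<^bsub>L.B\<^esub> ?g b)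
          = (\<Sum>k<n. complex_of_real (P a i k) * complex_of_real (P b k i)) \<odot>\<^bsub>L.B\<^esub> ?g b"
          using b G by (intro L.B.smult_sum[symmetric]) auto
        also have "(\<Sum>k<n. complex_of_real (P a i k) * complex_of_real (P b k i)) = complex_of_real (\<Sum>k<n. P a i k * P b k i)"
          by simp
        also have "\<dots> = complex_of_real (if a = b then P a i i else 0)" using proj[OF a3 _ i(1) i(1)] b by simp
        finally show "(\<Oplus>\<^bsub>L.B\<^esub>k\<in>{..<n}. (complex_of_real (P a i k) * complex_of_real (P b k i)) \<odot>\<^bsub>L.B\<^esub> ?g b)
           = (if b = a then complex_of_real (P a i i) \<odot>\<^bsub>L.B\<^esub> ?g b else \<zero>\<^bsub>L.B\<^esub>)"
          using b G by (cases "a = b") simp_all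
      qed (use G in auto)
      also have "\<dots> = complex_of_real (P a i i) \<odot>\<^bsub>L.B\<^esub> ?g a"
        using a3 G by (intro L.B.finsum_delta) auto
      finally show ?thesis .
    qed
    have "(\<Oplus>\<^bsub>L.B\<^esub>k\<in>{..<n}. complex_of_real (P a i k) \<odot>\<^bsub>L.B\<^esub> mix L.B P ?g k i) \<in> Im"
      using i mixIm by (intro Im_sum Im_smult) auto
    then have "complex_of_real (1 / P a i i) \<odot>\<^bsub>L.B\<^esub> (complex_of_real (P a i i) \<odot>\<^bsub>L.B\<^esub> ?g a) \<in> Im"
      unfolding row by (rule Im_smult)
    then show ?thesis using i a3 G by (simp add: L.B.smult_smult)
  qed
  have "carrier \<Lambda> \<subseteq> {x \<in> carrier \<Lambda>. group_elem \<Lambda> x \<in> Im}"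
  proof (rule generated)
    have "group_elem \<Lambda> \<one>\<^bsub>\<Lambda>\<^esub> \<in> Im"
      using \<pi>.hom_one Q.A.one_closed unfolding L.ge_one Im_def image_iff by metis
    then show "\<one>\<^bsub>\<Lambda>\<^esub> \<in> {x \<in> carrier \<Lambda>. group_elem \<Lambda> x \<in> Im}" by simp
    show "x \<otimes>\<^bsub>\<Lambda>\<^esub> y \<in> {x \<in> carrier \<Lambda>. group_elem \<Lambda> x \<in> Im}"
      if "x \<in> {x \<in> carrier \<Lambda>. group_elem \<Lambda> x \<in> Im}" "y \<in> {x \<in> carrier \<Lambda>. group_elem \<Lambda> x \<in> Im}" for x y
      using that Im_mult[of "group_elem \<Lambda> x" "group_elem \<Lambda> y"] L.ge_mult[of x y] by simp
  qed (use gIm[of 1] gIm[of 2] G in auto)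
  then have ge_Im: "group_elem \<Lambda> x \<in> Im" if "x \<in> carrier \<Lambda>" for x using that by blast
  have emb_Im: "L.U.emb f \<in> Im" if "f \<in> carrier L.MA" for f
    using that
  proof (induction rule: L.D.MA_induct)
    case (single a c)
    have "L.sg a c = c \<odot>\<^bsub>L.MA\<^esub> L.sg a 1" by simp
    then have "L.U.emb (L.sg a c) = c \<odot>\<^bsub>L.B\<^esub> group_elem \<Lambda> a"
      unfolding L.ge_eq using single by (simp only: L.emb.hom_smult L.D.MA_single)
    then show ?case using Im_smult[OF ge_Im[OF single]] by simp
  next
    case (add f g)
    then show ?case using L.emb.hom_add[of f g] Im_add by simp
  qed
  have surj: "\<pi> ` carrier Q.A = carrier L.B"
  proof
    show "\<pi> ` carrier Q.A \<subseteq> carrier L.B" using \<pi>.hom_closed by (intro image_subsetI)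
    show "carrier L.B \<subseteq> \<pi> ` carrier Q.A"
    proof
      fix b assume "b \<in> carrier L.B"
      then obtain f where f: "f \<in> carrier L.MA" "b = L.U.emb f" using L.emb_surj by blast
      show "b \<in> \<pi> ` carrier Q.A" using emb_Im[OF f(1)] unfolding f(2) Im_def .
    qed
  qed
  obtain \<rho> where \<rho>: "\<rho> \<in> star_hom (min_tensor Q.A Q.A) (min_tensor L.B L.B)"
    "\<forall>a \<in> carrier Q.A. \<forall>b \<in> carrier Q.A. \<rho> (elem_tensor Q.A Q.A a b) = elem_tensor L.B L.B (\<pi> a) (\<pi> b)"
    using tensor_of_surjections[OF Q.A_cstar L.B_cstar \<pi>(1) surj] by blast
  have st: "Q.cop.X.sat R" using stable unfolding \<A>_def \<V>_def .
  let ?\<Delta>G = "comult (matrix_quantum_group n R)" and ?\<Delta>H = "comult (group_dual \<Lambda>)"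
  note \<Delta>G = Q.comult_on_generators[OF st] and \<Delta>H = L.comult_on_group
  interpret \<Delta>H: star_morphism L.B "min_tensor L.B L.B" ?\<Delta>H by unfold_locales (rule \<Delta>H(1))
  interpret \<rho>: star_morphism "min_tensor Q.A Q.A" "min_tensor L.B L.B" \<rho> by unfold_locales (rule \<rho>(1))
  let ?t = "elem_tensor L.B L.B"
  have gens: "?\<Delta>H (\<pi> (Q.V i j)) = \<rho> (?\<Delta>G (Q.V i j))" if ij: "i < n" "j < n" for i j
  proof -
    have "?\<Delta>H (\<pi> (Q.V i j)) = (\<Oplus>\<^bsub>min_tensor L.B L.B\<^esub>a\<in>{..<3}. ?\<Delta>H (complex_of_real (P a i j) \<odot>\<^bsub>L.B\<^esub> ?g a))"
      unfolding \<pi>V[OF ij] mix_def using G by (intro \<Delta>H.hom_finsum) auto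
    also have "\<dots> = (\<Oplus>\<^bsub>min_tensor L.B L.B\<^esub>a\<in>{..<3}. complex_of_real (P a i j) \<odot>\<^bsub>min_tensor L.B L.B\<^esub> ?t (?g a) (?g a))"
      using G by (intro L.BB.MT.finsum_cong' refl) (auto simp: \<Delta>H.hom_smult \<Delta>H(2))
    also have "\<dots> = (\<Oplus>\<^bsub>min_tensor L.B L.B\<^esub>k\<in>{..<n}. \<Oplus>\<^bsub>min_tensor L.B L.B\<^esub>a\<in>{..<3}. \<Oplus>\<^bsub>min_tensor L.B L.B\<^esub>b\<in>{..<3}.
        (complex_of_real (P a i k) * complex_of_real (P b k j)) \<odot>\<^bsub>min_tensor L.B L.B\<^esub> ?t (?g a) (?g b))"
      using G ij by (intro L.BB.MT.contract[OF assms(5), symmetric]) auto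
    also have "\<dots> = (\<Oplus>\<^bsub>min_tensor L.B L.B\<^esub>k\<in>{..<n}. ?t (mix L.B P ?g i k) (mix L.B P ?g k j))"
    proof (intro L.BB.MT.finsum_cong' refl funcsetI)
      fix k assume k: "k \<in> {..<n}"
      have "?t (mix L.B P ?g i k) (mix L.B P ?g k j) = (\<Oplus>\<^bsub>min_tensor L.B L.B\<^esub>a\<in>{..<3}.
          ?t (complex_of_real (P a i k) \<odot>\<^bsub>L.B\<^esub> ?g a) (mix L.B P ?g k j))"
        unfolding mix_def[of _ _ _ i k] using G X.mix_closed by (intro L.BB.et_finsum_left) auto
      also have "\<dots> = (\<Oplus>\<^bsub>min_tensor L.B L.B\<^esub>a\<in>{..<3}. \<Oplus>\<^bsub>min_tensor L.B L.B\<^esub>b\<in>{..<3}.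
          ?t (complex_of_real (P a i k) \<odot>\<^bsub>L.B\<^esub> ?g a) (complex_of_real (P b k j) \<odot>\<^bsub>L.B\<^esub> ?g b))"
        unfolding mix_def using G
        by (intro L.BB.MT.finsum_cong' refl L.BB.et_finsum_right) (auto intro!: L.BB.MT.finsum_closed)
      also have "\<dots> = (\<Oplus>\<^bsub>min_tensor L.B L.B\<^esub>a\<in>{..<3}. \<Oplus>\<^bsub>min_tensor L.B L.B\<^esub>b\<in>{..<3}.
        (complex_of_real (P a i k) * complex_of_real (P b k j)) \<odot>\<^bsub>min_tensor L.B L.B\<^esub> ?t (?g a) (?g b))"
        using G by (intro L.BB.MT.finsum_cong' refl)
          (auto intro!: L.BB.MT.finsum_closed simp: L.BB.et_smult_left L.BB.et_smult_right L.BB.MT.smult_smult mult.commute)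
      finally show "(\<Oplus>\<^bsub>min_tensor L.B L.B\<^esub>a\<in>{..<3}. \<Oplus>\<^bsub>min_tensor L.B L.B\<^esub>b\<in>{..<3}.
        (complex_of_real (P a i k) * complex_of_real (P b k j)) \<odot>\<^bsub>min_tensor L.B L.B\<^esub> ?t (?g a) (?g b))
        = ?t (mix L.B P ?g i k) (mix L.B P ?g k j)" by simp
    qed (use X.mix_closed in auto)
    also have "\<dots> = (\<Oplus>\<^bsub>min_tensor L.B L.B\<^esub>k\<in>{..<n}. \<rho> (elem_tensor Q.A Q.A (Q.V i k) (Q.V k j)))"
      using ij \<rho>(2) \<pi>V X.mix_closed by (intro L.BB.MT.finsum_cong' refl funcsetI) auto
    also have "\<dots> = \<rho> (?\<Delta>G (Q.V i j))"
      unfolding \<Delta>G(2)[OF ij] Q.cop.X_def using ij by (intro \<rho>.hom_finsum[symmetric]) auto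
    finally show ?thesis .
  qed
  have hom1: "(\<lambda>x. ?\<Delta>H (\<pi> x)) \<in> star_hom Q.A (min_tensor L.B L.B)" by (rule star_hom_comp[OF \<pi>(1) \<Delta>H(1)])
  have hom2: "(\<lambda>x. \<rho> (?\<Delta>G x)) \<in> star_hom Q.A (min_tensor L.B L.B)" by (rule star_hom_comp[OF \<Delta>G(1) \<rho>(1)])
  have free: "?\<Delta>H (\<pi> (Q.U.emb f)) = \<rho> (?\<Delta>G (Q.U.emb f))" if "f \<in> carrier Q.F" for f
    by (rule free_hom_ext[OF L.BB.MT.star_alg_axioms star_hom_comp[OF Q.emb_hom hom1] star_hom_comp[OF Q.emb_hom hom2] _ that])
      (rule gens)
  have "?\<Delta>H (\<pi> a) = \<rho> (?\<Delta>G a)" if "a \<in> carrier Q.A" for a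
    by (rule Q.U.star_hom_ext[OF L.BB.min_tensor_cstar hom1[unfolded Q.A_eq] hom2[unfolded Q.A_eq] free])
      (use that in \<open>simp_all add: Q.A_eq\<close>)
  then have "hopf_morphism (matrix_quantum_group n R) (group_dual \<Lambda>) \<pi>"
    unfolding hopf_morphism_def Let_def Q.C_alg_eq L.group_dual_C_alg using \<pi>(1) \<rho> by blast
  then show ?thesis
    unfolding closed_subgroup_def Q.C_alg_eq L.group_dual_C_alg using surj by blast
qed

section \<open>Projections from two orthonormal vectors\<close>

text \<open>
  The indices \<open>1\<close> and \<open>2\<close> give the projections onto the lines of \<open>v\<close> and \<open>w\<close>; index \<open>0\<close>, where all remaining
  values of \<open>a\<close> end up, gives the projection onto the orthogonal complement of both.
\<close>

definition vec_proj :: "(nat \<Rightarrow> real) \<Rightarrow> (nat \<Rightarrow> real) \<Rightarrow> nat \<Rightarrow> nat \<Rightarrow> nat \<Rightarrow> real" where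
  "vec_proj v w a i j = (if a = 1 then v i * v j else if a = 2 then w i * w j
     else (if i = j then 1 else 0) - v i * v j - w i * w j)"

locale orthonormal_pair =
  fixes n :: nat and v w :: "nat \<Rightarrow> real"
  assumes vv: "(\<Sum>k<n. v k * v k) = 1" and ww: "(\<Sum>k<n. w k * w k) = 1" and vw: "(\<Sum>k<n. v k * w k) = 0"
begin

lemma apply_proj:
  assumes "i < n"
  shows "(\<Sum>k<n. vec_proj v w 1 i k * x k) = v i * (\<Sum>k<n. v k * x k)"
    "(\<Sum>k<n. vec_proj v w 2 i k * x k) = w i * (\<Sum>k<n. w k * x k)"
    "(\<Sum>k<n. vec_proj v w 0 i k * x k) = x i - v i * (\<Sum>k<n. v k * x k) - w i * (\<Sum>k<n. w k * x k)"
proof -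
  show "(\<Sum>k<n. vec_proj v w 1 i k * x k) = v i * (\<Sum>k<n. v k * x k)"
    "(\<Sum>k<n. vec_proj v w 2 i k * x k) = w i * (\<Sum>k<n. w k * x k)"
    by (simp_all add: vec_proj_def sum_distrib_left mult.assoc)
  have "(\<Sum>k<n. vec_proj v w 0 i k * x k)
      = (\<Sum>k<n. (if i = k then x k else 0) - v i * (v k * x k) - w i * (w k * x k))"
    by (intro sum.cong refl) (simp add: vec_proj_def algebra_simps)
  then show "(\<Sum>k<n. vec_proj v w 0 i k * x k) = x i - v i * (\<Sum>k<n. v k * x k) - w i * (\<Sum>k<n. w k * x k)"
    using assms by (simp add: sum_subtractf sum_distrib_left)
qed

lemma inner_proj:
  assumes "j < n"
  shows "(\<Sum>k<n. v k * vec_proj v w 1 k j) = v j" "(\<Sum>k<n. v k * vec_proj v w 2 k j) = 0"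
    "(\<Sum>k<n. v k * vec_proj v w 0 k j) = 0"
    "(\<Sum>k<n. w k * vec_proj v w 1 k j) = 0" "(\<Sum>k<n. w k * vec_proj v w 2 k j) = w j"
    "(\<Sum>k<n. w k * vec_proj v w 0 k j) = 0"
proof -
  have wv: "(\<Sum>k<n. w k * v k) = 0" using vw by (simp add: mult.commute)
  have s: "vec_proj v w a k j = vec_proj v w a j k" for a k by (simp add: vec_proj_def)
  have c: "(\<Sum>k<n. u k * vec_proj v w a k j) = (\<Sum>k<n. vec_proj v w a j k * u k)" for u a
    using s by (simp add: mult.commute)
  show "(\<Sum>k<n. v k * vec_proj v w 1 k j) = v j" "(\<Sum>k<n. v k * vec_proj v w 2 k j) = 0"
    "(\<Sum>k<n. v k * vec_proj v w 0 k j) = 0"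
    "(\<Sum>k<n. w k * vec_proj v w 1 k j) = 0" "(\<Sum>k<n. w k * vec_proj v w 2 k j) = w j"
    "(\<Sum>k<n. w k * vec_proj v w 0 k j) = 0"
    unfolding c apply_proj[OF assms] vv ww vw wv by simp_all
qed

sublocale projection_family n "vec_proj v w"
proof
  fix a b i j :: nat assume ab: "a < 3" "b < 3" and ij: "i < n" "j < n"
  have "a \<in> {0, 1, 2}" "b \<in> {0, 1, 2}" using ab by auto
  then show "(\<Sum>k<n. vec_proj v w a i k * vec_proj v w b k j) = (if a = b then vec_proj v w a i j else 0)"
    using apply_proj[OF ij(1), of "\<lambda>k. vec_proj v w b k j"] inner_proj[OF ij(2)]
    by (elim insertE emptyE; simp) (simp_all add: vec_proj_def)
next
  fix i j :: nat
  have 3: "{..<3::nat} = {0, 1, 2}" by auto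
  show "(\<Sum>a<3. vec_proj v w a i j) = (if i = j then 1 else 0)" unfolding 3 by (simp add: vec_proj_def)
qed (simp add: vec_proj_def)

lemma row_sums:
  assumes "i < n"
  shows "(\<Sum>j<n. vec_proj v w 1 i j) = v i * (\<Sum>k<n. v k)" "(\<Sum>j<n. vec_proj v w 2 i j) = w i * (\<Sum>k<n. w k)"
    "(\<Sum>j<n. vec_proj v w 0 i j) = 1 - v i * (\<Sum>k<n. v k) - w i * (\<Sum>k<n. w k)"
  using apply_proj[OF assms, of "\<lambda>_. 1"] by simp_all

lemma diag_nonzero:
  assumes "a \<in> {1, 2}" shows "\<exists>i<n. vec_proj v w a i i \<noteq> 0"
proof (rule ccontr)
  assume "\<not> ?thesis"
  then have "\<forall>i<n. vec_proj v w a i i = 0" by blast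
  then have "\<forall>k<n. v k * v k = 0" if "a = 1" using that by (simp add: vec_proj_def)
  moreover have "\<forall>k<n. w k * w k = 0" if "a = 2" using that \<open>\<forall>i<n. vec_proj v w a i i = 0\<close> by (simp add: vec_proj_def)
  ultimately show False using vv ww assms by (auto simp: sum.neutral)
qed

end

section \<open>A non-abelian group generated by two involutions\<close>

text \<open>
  The dihedral group of order 6: a pair consists of a rotation modulo 3 and a flag for reflections, and a
  reflection inverts the rotation that follows it.  Inversion of \<open>r\<close> is written \<open>2 * r\<close>, which avoids the
  truncated subtraction on natural numbers.
\<close>

definition d3_mult :: "nat \<times> bool \<Rightarrow> nat \<times> bool \<Rightarrow> nat \<times> bool" where
  "d3_mult x y = ((fst x + (if snd x then 2 * fst y else fst y)) mod 3, snd x \<noteq> snd y)"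

definition D3 :: "(nat \<times> bool) monoid" where
  "D3 = \<lparr>carrier = {0, 1, 2} \<times> UNIV, mult = d3_mult, one = (0, False)\<rparr>"

lemma D3_simps [simp]: "carrier D3 = {0, 1, 2} \<times> UNIV" "mult D3 = d3_mult" "one D3 = (0, False)"
  by (simp_all add: D3_def)

lemma D3_group: "group D3"
proof (rule groupI)
  show "x \<otimes>\<^bsub>D3\<^esub> y \<in> carrier D3" for x y
    by (auto simp: d3_mult_def)
  fix x y z assume xyz: "x \<in> carrier D3" "y \<in> carrier D3" "z \<in> carrier D3"
  show "x \<otimes>\<^bsub>D3\<^esub> y \<otimes>\<^bsub>D3\<^esub> z = x \<otimes>\<^bsub>D3\<^esub> (y \<otimes>\<^bsub>D3\<^esub> z)"
    using xyz by (auto simp: d3_mult_def)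
  show "\<one>\<^bsub>D3\<^esub> \<otimes>\<^bsub>D3\<^esub> x = x" using xyz by (auto simp: d3_mult_def)
  have "((if snd x then fst x else (3 - fst x) mod 3), snd x) \<otimes>\<^bsub>D3\<^esub> x = \<one>\<^bsub>D3\<^esub>"
    using xyz by (auto simp: d3_mult_def)
  then show "\<exists>y\<in>carrier D3. y \<otimes>\<^bsub>D3\<^esub> x = \<one>\<^bsub>D3\<^esub>"
    using xyz by (intro bexI[of _ "((if snd x then fst x else (3 - fst x) mod 3), snd x)"]) auto
qed simp

text \<open>
  Generation is stated by closure under products: involutions generate a group as a monoid.
\<close>

locale dihedral = group \<Lambda> for \<Lambda> :: "'a monoid" +
  fixes g h :: 'a
  assumes finite_carrier: "finite (carrier \<Lambda>)"
    and gens: "g \<in> carrier \<Lambda>" "h \<in> carrier \<Lambda>"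
    and invols: "g \<otimes>\<^bsub>\<Lambda>\<^esub> g = \<one>\<^bsub>\<Lambda>\<^esub>" "h \<otimes>\<^bsub>\<Lambda>\<^esub> h = \<one>\<^bsub>\<Lambda>\<^esub>"
    and noncomm: "g \<otimes>\<^bsub>\<Lambda>\<^esub> h \<noteq> h \<otimes>\<^bsub>\<Lambda>\<^esub> g"
    and generated: "\<lbrakk>\<one>\<^bsub>\<Lambda>\<^esub> \<in> S; g \<in> S; h \<in> S; \<And>x y. \<lbrakk>x \<in> S; y \<in> S\<rbrakk> \<Longrightarrow> x \<otimes>\<^bsub>\<Lambda>\<^esub> y \<in> S\<rbrakk> \<Longrightarrow> carrier \<Lambda> \<subseteq> S"

text \<open>
  A copy of the dihedral group inside any type with room for it.  Its two generators are the reflections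
  \<open>(0, True)\<close> and \<open>(1, True)\<close>, whose products in the two orders are the two nontrivial rotations.
\<close>

lemma dihedral_exists:
  fixes e :: "nat \<times> bool \<Rightarrow> 'a"
  assumes e: "inj e"
  shows "\<exists>(\<Lambda> :: 'a monoid) g h. dihedral \<Lambda> g h"
proof -
  define \<Lambda> :: "'a monoid" where
    "\<Lambda> = \<lparr>carrier = e ` carrier D3, mult = (\<lambda>x y. e (d3_mult (inv_into UNIV e x) (inv_into UNIV e y))), one = e (0, False)\<rparr>"
  have m: "e x \<otimes>\<^bsub>\<Lambda>\<^esub> e y = e (d3_mult x y)" for x y by (simp add: \<Lambda>_def inv_f_f[OF e])
  have c: "carrier \<Lambda> = e ` carrier D3" and o: "\<one>\<^bsub>\<Lambda>\<^esub> = e (0, False)" by (simp_all add: \<Lambda>_def)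
  interpret D: group D3 by (rule D3_group)
  have "group \<Lambda>"
  proof (rule groupI)
    fix x y z assume "x \<in> carrier \<Lambda>" "y \<in> carrier \<Lambda>" "z \<in> carrier \<Lambda>"
    then obtain a b d where abd: "x = e a" "y = e b" "z = e d" "a \<in> carrier D3" "b \<in> carrier D3" "d \<in> carrier D3"
      unfolding c by blast
    show "x \<otimes>\<^bsub>\<Lambda>\<^esub> y \<in> carrier \<Lambda>" unfolding abd m c using D.m_closed[OF abd(4,5)] by (intro imageI) simp
    show "x \<otimes>\<^bsub>\<Lambda>\<^esub> y \<otimes>\<^bsub>\<Lambda>\<^esub> z = x \<otimes>\<^bsub>\<Lambda>\<^esub> (y \<otimes>\<^bsub>\<Lambda>\<^esub> z)"
      unfolding abd m using D.m_assoc[OF abd(4-6)] by (intro arg_cong[of _ _ e]) simp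
    show "\<one>\<^bsub>\<Lambda>\<^esub> \<otimes>\<^bsub>\<Lambda>\<^esub> x = x" unfolding abd o m using D.l_one[OF abd(4)] by (intro arg_cong[of _ _ e]) simp
    obtain a' where a': "a' \<in> carrier D3" "d3_mult a' a = (0, False)" using D.l_inv_ex[OF abd(4)] by auto
    show "\<exists>y\<in>carrier \<Lambda>. y \<otimes>\<^bsub>\<Lambda>\<^esub> x = \<one>\<^bsub>\<Lambda>\<^esub>"
      unfolding abd c o by (rule bexI[of _ "e a'"]) (use a' in \<open>auto simp: m\<close>)
  qed (simp add: c o)
  moreover have "finite (carrier \<Lambda>)" by (simp add: c)
  ultimately have gf: "group \<Lambda>" "finite (carrier \<Lambda>)" by simp_all
  have gen: "carrier \<Lambda> \<subseteq> S" if S: "\<one>\<^bsub>\<Lambda>\<^esub> \<in> S" "e (0, True) \<in> S" "e (1, True) \<in> S"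
    "\<And>x y. \<lbrakk>x \<in> S; y \<in> S\<rbrakk> \<Longrightarrow> x \<otimes>\<^bsub>\<Lambda>\<^esub> y \<in> S" for S
  proof -
    have p: "e (d3_mult x y) \<in> S" if "e x \<in> S" "e y \<in> S" for x y using S(4) that m by metis
    have 2: "e (2, False) \<in> S" and 1: "e (1, False) \<in> S"
      using p[OF S(2,3)] p[OF S(3,2)] by (simp_all add: d3_mult_def flip: numeral_2_eq_2)
    have "e (2, True) \<in> S" using p[OF 2 S(2)] by (simp add: d3_mult_def)
    then have "e (r, b) \<in> S" if "r \<in> {0, 1, 2}" for r b
      using that 1 2 S(1-3) by (cases b) (auto simp: o)
    then show ?thesis by (auto simp: c)
  qed
  have "e (0, True) \<otimes>\<^bsub>\<Lambda>\<^esub> e (1, True) \<noteq> e (1, True) \<otimes>\<^bsub>\<Lambda>\<^esub> e (0, True)"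
    using e by (simp add: m d3_mult_def inj_eq)
  moreover have "e (0, True) \<in> carrier \<Lambda>" "e (1, True) \<in> carrier \<Lambda>"
    "e (0, True) \<otimes>\<^bsub>\<Lambda>\<^esub> e (0, True) = \<one>\<^bsub>\<Lambda>\<^esub>" "e (1, True) \<otimes>\<^bsub>\<Lambda>\<^esub> e (1, True) = \<one>\<^bsub>\<Lambda>\<^esub>"
    by (simp_all add: c m o d3_mult_def)
  ultimately have facts: "group \<Lambda>" "finite (carrier \<Lambda>)" "e (0, True) \<in> carrier \<Lambda>" "e (1, True) \<in> carrier \<Lambda>"
    "e (0, True) \<otimes>\<^bsub>\<Lambda>\<^esub> e (0, True) = \<one>\<^bsub>\<Lambda>\<^esub>" "e (1, True) \<otimes>\<^bsub>\<Lambda>\<^esub> e (1, True) = \<one>\<^bsub>\<Lambda>\<^esub>"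
    "e (0, True) \<otimes>\<^bsub>\<Lambda>\<^esub> e (1, True) \<noteq> e (1, True) \<otimes>\<^bsub>\<Lambda>\<^esub> e (0, True)"
    using gf by simp_all
  have "dihedral \<Lambda> (e (0, True)) (e (1, True))"
  proof (intro dihedral.intro dihedral_axioms.intro facts)
    show "carrier \<Lambda> \<subseteq> S" if "\<one>\<^bsub>\<Lambda>\<^esub> \<in> S" "e (0, True) \<in> S" "e (1, True) \<in> S"
      "\<And>x y. \<lbrakk>x \<in> S; y \<in> S\<rbrakk> \<Longrightarrow> x \<otimes>\<^bsub>\<Lambda>\<^esub> y \<in> S" for S by (rule gen[OF that])
  qed
  then show ?thesis by blast
qed

text \<open>
  Places the dihedral group in the type of elements of \<open>C(G)\<close>, as the definition of basic quantum groups
  requires.  Words of pairwise different lengths are used; any injection would do.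
\<close>

definition code :: "nat \<times> bool \<Rightarrow> (nat \<Rightarrow> free_elem) set" where
  "code x = {\<lambda>_. Poly_Mapping.single (replicate (2 * fst x + (if snd x then 1 else 0)) (0, 0)) 1}"

lemma inj_code: "inj code"
proof (rule injI)
  fix x y assume "code x = code y"
  then have "Poly_Mapping.single (replicate (2 * fst x + (if snd x then 1 else 0)) (0::nat, 0::nat)) (1::complex)
      = Poly_Mapping.single (replicate (2 * fst y + (if snd y then 1 else 0)) (0, 0)) 1"
    unfolding code_def by (metis singleton_inject)
  then have "Poly_Mapping.keys (Poly_Mapping.single (replicate (2 * fst x + (if snd x then 1 else 0)) (0::nat, 0::nat)) (1::complex))
      = Poly_Mapping.keys (Poly_Mapping.single (replicate (2 * fst y + (if snd y then 1 else 0)) (0::nat, 0::nat)) (1::complex))"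
    by simp
  then have "replicate (2 * fst x + (if snd x then 1 else 0)) (0::nat, 0::nat) = replicate (2 * fst y + (if snd y then 1 else 0)) (0, 0)"
    by simp
  then have "2 * fst x + (if snd x then 1 else 0) = 2 * fst y + (if snd y then 1 else 0 :: nat)"
    by (metis length_replicate)
  then have "fst x = fst y \<and> snd x = snd y" by (auto split: if_splits) presburger+
  then show "x = y" by (simp add: prod_eq_iff)
qed

section \<open>Stable relations\<close>

text \<open>
  The condition under which the comultiplication of the matrix quantum group exists.
\<close>

definition stable :: "nat \<Rightarrow> relations \<Rightarrow> bool" where
  "stable n R \<longleftrightarrow> (\<forall>(A :: (nat \<Rightarrow> free_elem) set cstar_algebra) V. coproduct A n V \<longrightarrow>
     satisfies A n V R \<longrightarrow> satisfies (min_tensor A A) n (coproduct.X A n V) R)"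

lemma stable_empty: "stable n {}"
  by (simp add: stable_def)

lemma stable_Un: "stable n R \<Longrightarrow> stable n S \<Longrightarrow> stable n (R \<union> S)"
  by (simp add: stable_def)

lemma stable_sum_one: "stable n (sum_one_rel n)"
  unfolding stable_def
proof (intro allI impI)
  fix A :: "(nat \<Rightarrow> free_elem) set cstar_algebra" and V
  assume c: "coproduct A n V" and s: "satisfies A n V (sum_one_rel n)"
  interpret coproduct A n V by (rule c)
  show "satisfies (min_tensor A A) n X (sum_one_rel n)"
    using s X_line_sums[of "\<one>\<^bsub>A\<^esub>"] by (simp add: V.sat_sum_one X.sat_sum_one et_one)
qed

lemma stable_same_sum: "stable n (same_sum_rel n)"
  unfolding stable_def
proof (intro allI impI)
  fix A :: "(nat \<Rightarrow> free_elem) set cstar_algebra" and V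
  assume c: "coproduct A n V" and s: "satisfies A n V (same_sum_rel n)"
  interpret coproduct A n V by (rule c)
  show "satisfies (min_tensor A A) n X (same_sum_rel n)"
    using s X_line_sums et_closed unfolding V.sat_same_sum X.sat_same_sum by blast
qed

lemma stable_cubic: "stable n (cubic_rel n)"
  unfolding stable_def
proof (intro allI impI)
  fix A :: "(nat \<Rightarrow> free_elem) set cstar_algebra" and V
  assume c: "coproduct A n V" and s: "satisfies A n V (cubic_rel n)"
  interpret coproduct A n V by (rule c)
  show "satisfies (min_tensor A A) n X (cubic_rel n)"
    using s X_cubic by (simp add: V.sat_cubic X.sat_cubic)
qed

lemma stable_half: "stable n (half_commutation_rel n)"
  unfolding stable_def
proof (intro allI impI)
  fix A :: "(nat \<Rightarrow> free_elem) set cstar_algebra" and V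
  assume c: "coproduct A n V" and s: "satisfies A n V (half_commutation_rel n)"
  interpret coproduct A n V by (rule c)
  show "satisfies (min_tensor A A) n X (half_commutation_rel n)"
    using s X_half by (simp add: V.sat_half X.sat_half)
qed

text \<open>
  The rows and columns of a magic unitary consist of projections with sum \<open>1\<close>, hence of orthogonal ones.
\<close>

lemma magic_cubic:
  assumes "cstar_alg A" "star_matrix A n V" "star_matrix.idem A n V" "star_matrix.line_sums A n V \<one>\<^bsub>A\<^esub>"
  shows "star_matrix.cubic A n V"
proof -
  interpret cstar_alg A by fact
  interpret V: star_matrix A n V by fact
  show ?thesis unfolding V.cubic_def
  proof (intro allI impI conjI)
    fix i j k assume ijk: "i < n" "j < n" "k < n" "j \<noteq> k"
    show "V i j \<otimes>\<^bsub>A\<^esub> V i k = \<zero>\<^bsub>A\<^esub>"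
      by (rule projections_orthogonal[of "{..<n}" "\<lambda>k. V i k" k j])
        (use assms(3,4) ijk in \<open>auto simp: V.X_star V.idem_def V.line_sums_def\<close>)
    show "V j i \<otimes>\<^bsub>A\<^esub> V k i = \<zero>\<^bsub>A\<^esub>"
      by (rule projections_orthogonal[of "{..<n}" "\<lambda>k. V k i" k j])
        (use assms(3,4) ijk in \<open>auto simp: V.X_star V.idem_def V.line_sums_def\<close>)
  qed
qed

text \<open>
  The two relations are treated together, because idempotency of the entries of the coproduct matrix
  uses the orthogonality within rows that both of them imply jointly.
\<close>

lemma stable_magic: "stable n (projection_rel n \<union> sum_one_rel n)"
  unfolding stable_def
proof (intro allI impI)
  fix A :: "(nat \<Rightarrow> free_elem) set cstar_algebra" and V
  assume c: "coproduct A n V" and s: "satisfies A n V (projection_rel n \<union> sum_one_rel n)"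
  interpret coproduct A n V by (rule c)
  have "V.idem" "V.line_sums \<one>\<^bsub>A\<^esub>" using s by (auto simp: V.sat_sum_one V.sat_idem)
  moreover from this have "V.cubic" by (intro magic_cubic A.cstar_alg_axioms V.star_matrix_axioms)
  ultimately show "satisfies (min_tensor A A) n X (projection_rel n \<union> sum_one_rel n)"
    using X_line_sums[of "\<one>\<^bsub>A\<^esub>"] X_idem by (simp add: X.sat_sum_one X.sat_idem et_one)
qed

section \<open>The two ways of being basic\<close>

text \<open>
  It remains to check that the mixed matrix satisfies the relations \<open>R\<close>.  The flag \<open>d\<close> tells whether the
  complement of the span of \<open>v\<close> and \<open>w\<close> carries the second involution or \<open>1\<close>.  The group enters only through
  the mixture locale: three self-adjoint involutions in a C*-algebra.
\<close>

lemma basic_dual: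
  assumes "mqg n R" "orthonormal_pair n v w" "stable n R"
    and sat: "\<And>(B :: (nat \<Rightarrow> ((nat \<Rightarrow> free_elem) set \<Rightarrow>\<^sub>0 complex)) set cstar_algebra) G.
      \<lbrakk>cstar_alg B; mixture B n (vec_proj v w) G; G 0 = (if d then G 2 else \<one>\<^bsub>B\<^esub>)\<rbrakk> \<Longrightarrow>
      satisfies B n (mix B (vec_proj v w) G) R"
  shows "basic (matrix_quantum_group n R)"
proof -
  interpret orthonormal_pair n v w by fact
  interpret Q: mqg n R by fact
  obtain \<Lambda> :: "(nat \<Rightarrow> free_elem) set monoid" and g h where "dihedral \<Lambda> g h"
    using dihedral_exists[OF inj_code] by blast
  then interpret dihedral \<Lambda> g h .
  interpret L: finite_group_dual \<Lambda> by unfold_locales (rule finite_carrier)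
  define G where "G a = (if a = 1 then g else if a = 2 \<or> d then h else \<one>\<^bsub>\<Lambda>\<^esub>)" for a :: nat
  have G: "G a \<in> carrier \<Lambda>" "G a \<otimes>\<^bsub>\<Lambda>\<^esub> G a = \<one>\<^bsub>\<Lambda>\<^esub>" for a using gens invols by (auto simp: G_def)
  have inv: "inv\<^bsub>\<Lambda>\<^esub> G a = G a" for a using G inv_equality by blast
  have m: "mixture L.B n (vec_proj v w) (\<lambda>a. group_elem \<Lambda> (G a))"
    by unfold_locales (auto simp: G L.ge_star inv L.ge_mult L.ge_one)
  have "closed_subgroup (group_dual \<Lambda>) (matrix_quantum_group n R)"
  proof (rule closed_subgroup_dual[of n R \<Lambda> "vec_proj v w" G])
    show "satisfies L.B n (mix L.B (vec_proj v w) (\<lambda>a. group_elem \<Lambda> (G a))) R"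
      by (rule sat[OF L.B_cstar m]) (simp add: G_def L.ge_one)
    show "Q.cop.X.sat R"
      using assms(3) Q.cop.coproduct_axioms Q.V_sat(1) unfolding stable_def by blast
    show "carrier \<Lambda> \<subseteq> S" if "\<one>\<^bsub>\<Lambda>\<^esub> \<in> S" "G 1 \<in> S" "G 2 \<in> S" "\<And>x y. x \<in> S \<Longrightarrow> y \<in> S \<Longrightarrow> x \<otimes>\<^bsub>\<Lambda>\<^esub> y \<in> S" for S
      using that by (intro generated) (simp_all add: G_def)
  qed (use G diag_nonzero in \<open>auto intro: Q.mqg_axioms L.finite_group_dual_axioms projection_family_axioms\<close>)
  then show ?thesis unfolding basic_def using is_group L.not_classical[OF gens noncomm] by blast
qed

lemma basic_commuting:
  assumes "mqg n R"
    and comm: "\<And>(A :: (nat \<Rightarrow> free_elem) set cstar_algebra) V. \<lbrakk>cstar_alg A; star_matrix A n V;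
      star_matrix.orth A n V; satisfies A n V R\<rbrakk> \<Longrightarrow> star_matrix.commut A n V"
  shows "basic (matrix_quantum_group n R)"
proof -
  interpret Q: mqg n R by fact
  have "Q.V.commut"
    by (rule comm[OF Q.A_cstar Q.V.star_matrix_axioms]) (use Q.V_sat Q.V.sat_orth in auto)
  then show ?thesis unfolding basic_def using Q.classicalI by blast
qed

lemma mqgI: "R \<subseteq> carrier (free_star_algebra n) \<times> carrier (free_star_algebra n) \<Longrightarrow> mqg n R"
  by unfold_locales

lemmas mqg_intros = mqgI Un_least relations_closed empty_subsetI

lemma basic_classical:
  assumes "R \<subseteq> carrier (free_star_algebra n) \<times> carrier (free_star_algebra n)"
  shows "basic (matrix_quantum_group n (R \<union> commutation_rel n))"
proof (rule basic_commuting)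
  show "mqg n (R \<union> commutation_rel n)" by (intro mqg_intros assms)
qed (simp add: star_matrix.sat_commut)

lemma basic_one:
  assumes "R \<subseteq> carrier (free_star_algebra 1) \<times> carrier (free_star_algebra 1)"
  shows "basic (matrix_quantum_group 1 R)"
  by (rule basic_commuting) (use assms in \<open>auto intro!: mqgI simp: star_matrix.commut_def\<close>)

section \<open>Small sizes\<close>

text \<open>
  Let \<open>i \<noteq> k\<close> and \<open>j \<noteq> l\<close>.  In \<open>u\<^sub>i\<^sub>j u\<^sub>k\<^sub>l s = \<Sum>\<^sub>m u\<^sub>i\<^sub>j u\<^sub>k\<^sub>l u\<^sub>i\<^sub>m\<close> only the term \<open>m = j\<close> survives: the term \<open>m = l\<close> has two
  entries from one column, and if \<open>m\<close> is the third index, then \<open>u\<^sub>k\<^sub>l\<close> may be replaced by the whole row sum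
  \<open>s\<close>, since the other summands vanish by the cubic relations, and the central \<open>s\<close> moves away from
  \<open>u\<^sub>i\<^sub>j u\<^sub>i\<^sub>m = 0\<close>.  So \<open>u\<^sub>i\<^sub>j u\<^sub>k\<^sub>l s\<close> equals \<open>u\<^sub>i\<^sub>j u\<^sub>k\<^sub>l u\<^sub>i\<^sub>j\<close>, which is self-adjoint; taking adjoints and cancelling
  \<open>s\<close> gives commutation.
\<close>

lemma cubic_small_commut:
  assumes "star_matrix T n X" "n \<le> 3" "star_matrix.cubic T n X" "star_matrix.line_sums T n X s"
    and s: "s \<in> carrier T" "s \<otimes>\<^bsub>T\<^esub> s = \<one>\<^bsub>T\<^esub>" "star T s = s"
      "\<And>i j. i < n \<Longrightarrow> j < n \<Longrightarrow> s \<otimes>\<^bsub>T\<^esub> X i j = X i j \<otimes>\<^bsub>T\<^esub> s"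
  shows "star_matrix.commut T n X"
proof -
  interpret star_matrix T n X by fact
  have z: "X p q \<otimes>\<^bsub>T\<^esub> X p r = \<zero>\<^bsub>T\<^esub>" "X q p \<otimes>\<^bsub>T\<^esub> X r p = \<zero>\<^bsub>T\<^esub>"
    if "p < n" "q < n" "r < n" "q \<noteq> r" for p q r
    using assms(3) that unfolding cubic_def by auto
  have row: "(\<Oplus>\<^bsub>T\<^esub>k\<in>{..<n}. X i k) = s" if "i < n" for i
    using assms(4) that unfolding line_sums_def by auto
  have single: "(\<Oplus>\<^bsub>T\<^esub>k\<in>{..<n}. f k) = f l"
    if "l < n" "f l \<in> carrier T" "\<And>k. k < n \<Longrightarrow> k \<noteq> l \<Longrightarrow> f k = \<zero>\<^bsub>T\<^esub>" for f l
  proof -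
    have "(\<Oplus>\<^bsub>T\<^esub>k\<in>{..<n}. f k) = (\<Oplus>\<^bsub>T\<^esub>k\<in>{..<n}. if k = l then f k else \<zero>\<^bsub>T\<^esub>)"
      using that by (intro finsum_cong') auto
    also have "\<dots> = f l" using that by (intro finsum_delta) auto
    finally show ?thesis .
  qed
  have main: "X i j \<otimes>\<^bsub>T\<^esub> X k l = X k l \<otimes>\<^bsub>T\<^esub> X i j"
    if i: "i < n" "j < n" "k < n" "l < n" "i \<noteq> k" "j \<noteq> l" for i j k l
  proof -
    have third: "X i j \<otimes>\<^bsub>T\<^esub> X k l \<otimes>\<^bsub>T\<^esub> X i m = \<zero>\<^bsub>T\<^esub>" if m: "m < n" "m \<noteq> j" for m
    proof (cases "m = l")
      case True
      then show ?thesis using i z(2)[of l k i] by (simp add: m_assoc)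
    next
      case False
      have "X i j \<otimes>\<^bsub>T\<^esub> X k q \<otimes>\<^bsub>T\<^esub> X i m = \<zero>\<^bsub>T\<^esub>" if q: "q < n" "q \<noteq> l" for q
      proof -
        have "q = j \<or> q = m" using q i m False \<open>n \<le> 3\<close> by auto
        then show ?thesis
        proof
          assume "q = j"
          then show ?thesis using i m z(2)[of j i k] by simp
        next
          assume "q = m"
          then show ?thesis using i m z(2)[of m k i] by (simp add: m_assoc)
        qed
      qed
      then have "X i j \<otimes>\<^bsub>T\<^esub> X k l \<otimes>\<^bsub>T\<^esub> X i m = (\<Oplus>\<^bsub>T\<^esub>q\<in>{..<n}. X i j \<otimes>\<^bsub>T\<^esub> X k q \<otimes>\<^bsub>T\<^esub> X i m)"
        using i m by (intro single[symmetric]) auto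
      also have "\<dots> = (\<Oplus>\<^bsub>T\<^esub>q\<in>{..<n}. X i j \<otimes>\<^bsub>T\<^esub> X k q) \<otimes>\<^bsub>T\<^esub> X i m"
        using i m by (intro finsum_mult_right[symmetric]) auto
      also have "(\<Oplus>\<^bsub>T\<^esub>q\<in>{..<n}. X i j \<otimes>\<^bsub>T\<^esub> X k q) = X i j \<otimes>\<^bsub>T\<^esub> s"
        unfolding row[OF i(3), symmetric] using i by (intro finsum_mult_left[symmetric]) auto
      also have "X i j \<otimes>\<^bsub>T\<^esub> s \<otimes>\<^bsub>T\<^esub> X i m = s \<otimes>\<^bsub>T\<^esub> (X i j \<otimes>\<^bsub>T\<^esub> X i m)"
        using s i m by (simp add: s(4)[symmetric] m_assoc)
      also have "\<dots> = \<zero>\<^bsub>T\<^esub>" using z(1)[of i j m] i m s by simp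
      finally show ?thesis .
    qed
    have "X i j \<otimes>\<^bsub>T\<^esub> X k l \<otimes>\<^bsub>T\<^esub> s = (\<Oplus>\<^bsub>T\<^esub>m\<in>{..<n}. X i j \<otimes>\<^bsub>T\<^esub> X k l \<otimes>\<^bsub>T\<^esub> X i m)"
      unfolding row[OF i(1), symmetric] using i by (intro finsum_mult_left) auto
    also have "\<dots> = X i j \<otimes>\<^bsub>T\<^esub> X k l \<otimes>\<^bsub>T\<^esub> X i j"
      using i third by (intro single) auto
    finally have eq: "X i j \<otimes>\<^bsub>T\<^esub> X k l \<otimes>\<^bsub>T\<^esub> s = X i j \<otimes>\<^bsub>T\<^esub> X k l \<otimes>\<^bsub>T\<^esub> X i j" .
    have "star T (X i j \<otimes>\<^bsub>T\<^esub> X k l \<otimes>\<^bsub>T\<^esub> s) = X i j \<otimes>\<^bsub>T\<^esub> X k l \<otimes>\<^bsub>T\<^esub> X i j"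
      unfolding eq using i by (simp add: star_mult X_star m_assoc)
    moreover have "star T (X i j \<otimes>\<^bsub>T\<^esub> X k l \<otimes>\<^bsub>T\<^esub> s) = s \<otimes>\<^bsub>T\<^esub> (X k l \<otimes>\<^bsub>T\<^esub> X i j)"
      using i s by (simp add: star_mult X_star)
    moreover have "s \<otimes>\<^bsub>T\<^esub> (X k l \<otimes>\<^bsub>T\<^esub> X i j) = X k l \<otimes>\<^bsub>T\<^esub> X i j \<otimes>\<^bsub>T\<^esub> s"
      using i s(1) s(4)[of k l] s(4)[of i j] by (metis m_assoc X_closed)
    ultimately have "X i j \<otimes>\<^bsub>T\<^esub> X k l \<otimes>\<^bsub>T\<^esub> s = X k l \<otimes>\<^bsub>T\<^esub> X i j \<otimes>\<^bsub>T\<^esub> s" using eq by simp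
    then have "X i j \<otimes>\<^bsub>T\<^esub> X k l \<otimes>\<^bsub>T\<^esub> s \<otimes>\<^bsub>T\<^esub> s = X k l \<otimes>\<^bsub>T\<^esub> X i j \<otimes>\<^bsub>T\<^esub> s \<otimes>\<^bsub>T\<^esub> s" by simp
    then show ?thesis using i s by (simp add: m_assoc)
  qed
  show ?thesis unfolding commut_def
  proof (intro allI impI)
    fix i j k l assume i: "i < n" "j < n" "k < n" "l < n"
    consider "i = k" "j = l" | "i = k" "j \<noteq> l" | "i \<noteq> k" "j = l" | "i \<noteq> k" "j \<noteq> l" by blast
    then show "X i j \<otimes>\<^bsub>T\<^esub> X k l = X k l \<otimes>\<^bsub>T\<^esub> X i j"
      by cases (use i z main in auto)
  qed
qed

lemma S_small:
  assumes "n \<le> 3" shows "basic (S_plus n)"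
  unfolding S_plus_def
proof (rule basic_commuting)
  fix A :: "(nat \<Rightarrow> free_elem) set cstar_algebra" and V
  assume A: "cstar_alg A" "star_matrix A n V" "satisfies A n V (projection_rel n \<union> sum_one_rel n)"
  interpret cstar_alg A by fact
  interpret V: star_matrix A n V by fact
  have h: "V.idem" "V.line_sums \<one>\<^bsub>A\<^esub>" using A(3) by (auto simp: V.sat_sum_one V.sat_idem)
  then have "V.cubic" using A magic_cubic by blast
  then show "V.commut" using h assms by (intro cubic_small_commut[OF A(2)]) auto
qed (intro mqg_intros)

text \<open>
  The common line sum \<open>s\<close> satisfies \<open>s u\<^sub>i\<^sub>j = u\<^sub>i\<^sub>j\<^sup>2 = u\<^sub>i\<^sub>j s\<close> by the cubic relations, so it is central, and summing
  over a row gives \<open>s\<^sup>2 = 1\<close> by orthogonality.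
\<close>

lemma S'_small:
  assumes "n \<le> 3" shows "basic (S'_plus n)"
  unfolding S'_plus_def
proof (rule basic_commuting)
  fix A :: "(nat \<Rightarrow> free_elem) set cstar_algebra" and V
  assume A: "cstar_alg A" "star_matrix A n V" "star_matrix.orth A n V" "satisfies A n V (cubic_rel n \<union> same_sum_rel n)"
  interpret cstar_alg A by fact
  interpret V: star_matrix A n V by fact
  obtain s where h: "V.cubic" "V.line_sums s" "s \<in> carrier A" using A(4) by (auto simp: V.sat_cubic V.sat_same_sum)
  show "V.commut"
  proof (cases "n = 0")
    case True
    then show ?thesis unfolding V.commut_def by simp
  next
    case False
    have row: "(\<Oplus>\<^bsub>A\<^esub>k\<in>{..<n}. V i k) = s" if "i < n" for i
      using h(2) that unfolding V.line_sums_def by auto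
    have z: "V p q \<otimes>\<^bsub>A\<^esub> V p r = \<zero>\<^bsub>A\<^esub>" if "p < n" "q < n" "r < n" "q \<noteq> r" for p q r
      using h(1) that unfolding V.cubic_def by auto
    have sV: "s \<otimes>\<^bsub>A\<^esub> V i j = V i j \<otimes>\<^bsub>A\<^esub> V i j" "V i j \<otimes>\<^bsub>A\<^esub> s = V i j \<otimes>\<^bsub>A\<^esub> V i j" if "i < n" "j < n" for i j
    proof -
      have "s \<otimes>\<^bsub>A\<^esub> V i j = (\<Oplus>\<^bsub>A\<^esub>k\<in>{..<n}. V i k \<otimes>\<^bsub>A\<^esub> V i j)"
        unfolding row[OF that(1), symmetric] using that by (intro finsum_mult_right) auto
      also have "\<dots> = (\<Oplus>\<^bsub>A\<^esub>k\<in>{..<n}. if k = j then V i k \<otimes>\<^bsub>A\<^esub> V i j else \<zero>\<^bsub>A\<^esub>)"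
        using that by (intro finsum_cong' refl) (auto simp: z)
      also have "\<dots> = V i j \<otimes>\<^bsub>A\<^esub> V i j" using that by (intro finsum_delta) auto
      finally show "s \<otimes>\<^bsub>A\<^esub> V i j = V i j \<otimes>\<^bsub>A\<^esub> V i j" .
      have "V i j \<otimes>\<^bsub>A\<^esub> s = (\<Oplus>\<^bsub>A\<^esub>k\<in>{..<n}. V i j \<otimes>\<^bsub>A\<^esub> V i k)"
        unfolding row[OF that(1), symmetric] using that by (intro finsum_mult_left) auto
      also have "\<dots> = (\<Oplus>\<^bsub>A\<^esub>k\<in>{..<n}. if k = j then V i j \<otimes>\<^bsub>A\<^esub> V i k else \<zero>\<^bsub>A\<^esub>)"
        using that by (intro finsum_cong' refl) (auto simp: z)
      also have "\<dots> = V i j \<otimes>\<^bsub>A\<^esub> V i j" using that by (intro finsum_delta) auto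
      finally show "V i j \<otimes>\<^bsub>A\<^esub> s = V i j \<otimes>\<^bsub>A\<^esub> V i j" .
    qed
    have "star A s = (\<Oplus>\<^bsub>A\<^esub>k\<in>{..<n}. star A (V 0 k))"
      using row[of 0] False star_finsum[of "\<lambda>k. V 0 k" "{..<n}"] by fastforce
    also have "\<dots> = (\<Oplus>\<^bsub>A\<^esub>k\<in>{..<n}. V 0 k)" using False by (intro finsum_cong' refl) (auto simp: V.X_star)
    also have "\<dots> = s" using row[of 0] False by simp
    finally have ss: "star A s = s" .
    have "s \<otimes>\<^bsub>A\<^esub> s = (\<Oplus>\<^bsub>A\<^esub>k\<in>{..<n}. s \<otimes>\<^bsub>A\<^esub> V 0 k)"
      using row[of 0] False h(3) finsum_mult_left[of "\<lambda>k. V 0 k" "{..<n}" s] by fastforce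
    also have "\<dots> = (\<Oplus>\<^bsub>A\<^esub>k\<in>{..<n}. V 0 k \<otimes>\<^bsub>A\<^esub> V 0 k)"
      using False by (intro finsum_cong' refl) (auto simp: sV)
    also have "\<dots> = \<one>\<^bsub>A\<^esub>" using A(3) False unfolding V.orth_def by auto
    finally show ?thesis
      using h ss sV assms by (intro cubic_small_commut[OF A(2)]) auto
  qed
qed (intro mqg_intros)

text \<open>
  A \<open>2 \<times> 2\<close> matrix with line sums \<open>1\<close> has the entries \<open>p\<close> and \<open>1 - p\<close> only.
\<close>

lemma B_small:
  assumes "n \<le> 2" shows "basic (B_plus n)"
  unfolding B_plus_def
proof (rule basic_commuting)
  fix A :: "(nat \<Rightarrow> free_elem) set cstar_algebra" and V
  assume A: "cstar_alg A" "star_matrix A n V" "satisfies A n V (sum_one_rel n)"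
  interpret cstar_alg A by fact
  interpret V: star_matrix A n V by fact
  have s: "V.line_sums \<one>\<^bsub>A\<^esub>" using A(3) by (simp add: V.sat_sum_one)
  show "V.commut"
  proof (cases "n = 2")
    case False
    then have "n \<le> 1" using assms by simp
    then show ?thesis unfolding V.commut_def by (auto simp: le_Suc_eq)
  next
    case n: True
    have lt: "{..<2::nat} = {0, 1}" by auto
    have c: "V 0 0 \<in> carrier A" "V 0 1 \<in> carrier A" "V 1 0 \<in> carrier A" "V 1 1 \<in> carrier A" using n by auto
    have e: "V 0 0 \<oplus>\<^bsub>A\<^esub> V 0 1 = \<one>\<^bsub>A\<^esub>" "V 0 0 \<oplus>\<^bsub>A\<^esub> V 1 0 = \<one>\<^bsub>A\<^esub>" "V 0 1 \<oplus>\<^bsub>A\<^esub> V 1 1 = \<one>\<^bsub>A\<^esub>"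
    proof -
      have "(\<Oplus>\<^bsub>A\<^esub>k\<in>{0, 1}. V i k) = \<one>\<^bsub>A\<^esub>" "(\<Oplus>\<^bsub>A\<^esub>k\<in>{0, 1}. V k i) = \<one>\<^bsub>A\<^esub>" if "i < 2" for i
        using s that unfolding V.line_sums_def unfolding n lt by blast+
      from this[of 0] this[of 1]
      show "V 0 0 \<oplus>\<^bsub>A\<^esub> V 0 1 = \<one>\<^bsub>A\<^esub>" "V 0 0 \<oplus>\<^bsub>A\<^esub> V 1 0 = \<one>\<^bsub>A\<^esub>" "V 0 1 \<oplus>\<^bsub>A\<^esub> V 1 1 = \<one>\<^bsub>A\<^esub>"
        using c by (simp_all add: Pi_def)
    qed
    have solve: "y = \<one>\<^bsub>A\<^esub> \<ominus>\<^bsub>A\<^esub> x" if "x \<oplus>\<^bsub>A\<^esub> y = \<one>\<^bsub>A\<^esub>" "x \<in> carrier A" "y \<in> carrier A" for x y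
    proof -
      have "y = (x \<oplus>\<^bsub>A\<^esub> y) \<ominus>\<^bsub>A\<^esub> x" using that(2,3) by algebra
      then show ?thesis using that(1) by simp
    qed
    let ?p = "V 0 0"
    have 01: "V 0 1 = \<one>\<^bsub>A\<^esub> \<ominus>\<^bsub>A\<^esub> ?p" and 10: "V 1 0 = \<one>\<^bsub>A\<^esub> \<ominus>\<^bsub>A\<^esub> ?p"
      by (rule solve[OF e(1) c(1,2)], rule solve[OF e(2) c(1,3)])
    have "V 1 1 = \<one>\<^bsub>A\<^esub> \<ominus>\<^bsub>A\<^esub> V 0 1" by (rule solve[OF e(3) c(2,4)])
    also have "\<dots> = ?p" unfolding 01 using c(1) by algebra
    finally have 11: "V 1 1 = ?p" .
    have mem: "V i j \<in> {?p, \<one>\<^bsub>A\<^esub> \<ominus>\<^bsub>A\<^esub> ?p}" if "i < 2" "j < 2" for i j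
    proof -
      have "(i = 0 \<or> i = 1) \<and> (j = 0 \<or> j = 1)" using that by auto
      then show ?thesis using 01 10 11 by (elim conjE disjE) simp_all
    qed
    have comm: "x \<otimes>\<^bsub>A\<^esub> y = y \<otimes>\<^bsub>A\<^esub> x" if "x \<in> {?p, \<one>\<^bsub>A\<^esub> \<ominus>\<^bsub>A\<^esub> ?p}" "y \<in> {?p, \<one>\<^bsub>A\<^esub> \<ominus>\<^bsub>A\<^esub> ?p}" for x y
    proof -
      have "?p \<otimes>\<^bsub>A\<^esub> (\<one>\<^bsub>A\<^esub> \<ominus>\<^bsub>A\<^esub> ?p) = (\<one>\<^bsub>A\<^esub> \<ominus>\<^bsub>A\<^esub> ?p) \<otimes>\<^bsub>A\<^esub> ?p" using c(1) by algebra
      then show ?thesis using that by auto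
    qed
    show ?thesis unfolding V.commut_def unfolding n by (intro allI impI comm mem)
  qed
qed (intro mqg_intros)

section \<open>Large sizes\<close>

abbreviation ev :: "nat \<Rightarrow> nat \<Rightarrow> real" where "ev i k \<equiv> (if k = i then 1 else 0)"

lemma sum_ev: "i < n \<Longrightarrow> (\<Sum>k<n. ev i k * x k) = (x i :: real)"
  by (simp add: if_distrib[of "\<lambda>y. y * _"] cong: if_cong)

lemma diagonal_pair: "2 \<le> n \<Longrightarrow> orthonormal_pair n (ev 0) (ev 1)"
  by unfold_locales (simp_all only: sum_ev, simp_all)

lemma diagonal_matrix:
  assumes "mixture B n (vec_proj (ev 0) (ev 1)) G" "G 0 = G 2"
  shows "mix B (vec_proj (ev 0) (ev 1)) G i j = (if i = j then (if i = 0 then G 1 else G 2) else \<zero>\<^bsub>B\<^esub>)"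
proof -
  interpret mixture B n "vec_proj (ev 0) (ev 1)" G by fact
  show ?thesis unfolding mix_3 using assms(2) by (auto simp: vec_proj_def)
qed

lemma basic_diagonal:
  assumes "2 \<le> n" "mqg n R" "stable n R"
    and sat: "\<And>(B :: (nat \<Rightarrow> ((nat \<Rightarrow> free_elem) set \<Rightarrow>\<^sub>0 complex)) set cstar_algebra) X g h.
      \<lbrakk>cstar_alg B; star_matrix B n X; g \<in> carrier B; h \<in> carrier B; g \<otimes>\<^bsub>B\<^esub> g = \<one>\<^bsub>B\<^esub>; h \<otimes>\<^bsub>B\<^esub> h = \<one>\<^bsub>B\<^esub>;
        \<And>i j. X i j = (if i = j then (if i = 0 then g else h) else \<zero>\<^bsub>B\<^esub>)\<rbrakk> \<Longrightarrow> satisfies B n X R"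
  shows "basic (matrix_quantum_group n R)"
proof (rule basic_dual[OF assms(2) diagonal_pair[OF assms(1)] assms(3), where d = True])
  fix B :: "(nat \<Rightarrow> ((nat \<Rightarrow> free_elem) set \<Rightarrow>\<^sub>0 complex)) set cstar_algebra" and G
  assume B: "cstar_alg B" "mixture B n (vec_proj (ev 0) (ev 1)) G" "G 0 = (if True then G 2 else \<one>\<^bsub>B\<^esub>)"
  interpret mixture B n "vec_proj (ev 0) (ev 1)" G by fact
  show "satisfies B n (mix B (vec_proj (ev 0) (ev 1)) G) R"
    by (rule sat[OF B(1) X.star_matrix_axioms, of "G 1" "G 2"])
      (use G_closed G_sq diagonal_matrix[OF B(2)] B(3) in auto)
qed

lemma diagonal_cubic:
  assumes "star_matrix B n X" "g \<in> carrier B" "h \<in> carrier B"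
    "\<And>i j. X i j = (if i = j then (if i = 0 then g else h) else \<zero>\<^bsub>B\<^esub>)"
  shows "satisfies B n X (cubic_rel n)"
proof -
  interpret star_matrix B n X by fact
  show ?thesis unfolding sat_cubic cubic_def using assms by auto
qed

text \<open>
  The only entries are \<open>0\<close>, \<open>g\<close> and \<open>h\<close>, and \<open>g\<close>, \<open>h\<close> half-commute because \<open>g\<^sup>2\<close> and \<open>h\<^sup>2\<close> are central.
\<close>

lemma diagonal_half:
  assumes "star_matrix B n X" "g \<in> carrier B" "h \<in> carrier B" "g \<otimes>\<^bsub>B\<^esub> g = \<one>\<^bsub>B\<^esub>" "h \<otimes>\<^bsub>B\<^esub> h = \<one>\<^bsub>B\<^esub>"
    "\<And>i j. X i j = (if i = j then (if i = 0 then g else h) else \<zero>\<^bsub>B\<^esub>)"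
  shows "satisfies B n X (half_commutation_rel n)"
proof -
  interpret star_matrix B n X by fact
  have g: "X i j \<in> {\<zero>\<^bsub>B\<^esub>, g, h}" for i j using assms(6) by auto
  have comm: "x \<otimes>\<^bsub>B\<^esub> y \<otimes>\<^bsub>B\<^esub> z = z \<otimes>\<^bsub>B\<^esub> y \<otimes>\<^bsub>B\<^esub> x"
    if "x \<in> {\<zero>\<^bsub>B\<^esub>, g, h}" "y \<in> {\<zero>\<^bsub>B\<^esub>, g, h}" "z \<in> {\<zero>\<^bsub>B\<^esub>, g, h}" for x y z
    using that assms(2-5) by (elim insertE emptyE) (simp_all add: m_assoc)
  show ?thesis unfolding sat_half half_def by (intro allI impI comm g)
qed

lemma O_plus_large: assumes "2 \<le> n" shows "basic (O_plus n)"
  unfolding O_plus_def by (rule basic_diagonal[OF assms]) (intro mqg_intros, rule stable_empty, simp)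

lemma H_plus_large: assumes "2 \<le> n" shows "basic (H_plus n)"
  unfolding H_plus_def
  by (rule basic_diagonal[OF assms]) (intro mqg_intros, rule stable_cubic, rule diagonal_cubic)

lemma O_half_large: assumes "2 \<le> n" shows "basic (O_half n)"
  unfolding O_half_def
  by (rule basic_diagonal[OF assms]) (intro mqg_intros, rule stable_half, rule diagonal_half)

lemma H_half_large: assumes "2 \<le> n" shows "basic (H_half n)"
  unfolding H_half_def
proof (rule basic_diagonal[OF assms])
  show "mqg n (cubic_rel n \<union> half_commutation_rel n)" by (intro mqg_intros)
  show "stable n (cubic_rel n \<union> half_commutation_rel n)" by (intro stable_Un stable_cubic stable_half)
qed (simp only: satisfies_Un, intro conjI diagonal_cubic diagonal_half)

lemma sum_ev_diff: "\<lbrakk>i < n; j < n\<rbrakk> \<Longrightarrow> (\<Sum>k<n. (ev i k - ev j k) * x k) = x i - (x j :: real)"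
  by (simp add: left_diff_distrib sum_subtractf sum_ev)

lemma sum_ev_diff_scaled:
  assumes "i < n" "j < n"
  shows "(\<Sum>k<n. (ev i k - ev j k) * (1 / c) * x k) = (x i - x j) / (c :: real)"
proof -
  have "(\<Sum>k<n. (ev i k - ev j k) * (1 / c) * x k) = (\<Sum>k<n. (ev i k - ev j k) * (x k / c))"
    by (intro sum.cong refl) simp
  also have "\<dots> = x i / c - x j / c" by (rule sum_ev_diff[OF assms])
  finally show ?thesis by (simp add: diff_divide_distrib)
qed

text \<open>
  For \<open>v\<close> proportional to the vector of ones, and hence \<open>w\<close> orthogonal to it, all lines of the mixed matrix
  have the sum \<open>G\<^sub>1\<close>.
\<close>

lemma B'_plus_large: assumes "2 \<le> n" shows "basic (B'_plus n)"
proof -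
  define v :: "nat \<Rightarrow> real" where "v k = 1 / sqrt n" for k
  define w :: "nat \<Rightarrow> real" where "w k = (ev 0 k - ev 1 k) * (1 / sqrt 2)" for k
  have n: "0 < real n" "0 < n" "1 < n" using assms by auto
  have w: "(\<Sum>k<n. w k * x k) = (x 0 - x 1) / sqrt 2" for x
    unfolding w_def using n by (intro sum_ev_diff_scaled) auto
  interpret orthonormal_pair n v w
  proof
    show "(\<Sum>k<n. v k * v k) = 1" using n by (simp add: v_def)
    show "(\<Sum>k<n. w k * w k) = 1" unfolding w by (simp add: w_def field_simps)
    show "(\<Sum>k<n. v k * w k) = 0" using w[of v] by (simp add: v_def mult.commute)
  qed
  have sv: "v i * (\<Sum>k<n. v k) = 1" for i using n by (simp add: v_def)
  have sw: "(\<Sum>k<n. w k) = 0" using w[of "\<lambda>_. 1"] by simp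
  show ?thesis unfolding B'_plus_def
  proof (rule basic_dual[OF _ orthonormal_pair_axioms stable_same_sum, where d = False])
    fix B :: "(nat \<Rightarrow> ((nat \<Rightarrow> free_elem) set \<Rightarrow>\<^sub>0 complex)) set cstar_algebra" and G
    assume B: "cstar_alg B" "mixture B n (vec_proj v w) G"
    interpret mixture B n "vec_proj v w" G by fact
    have "X.line_sums (G 1)"
    proof (rule mix_line_sums)
      fix a i :: nat assume a: "a < 3" and i: "i < n"
      then have "a \<in> {0, 1, 2}" by auto
      then show "(\<Sum>j<n. vec_proj v w a i j) = (if a = 1 then 1 else 0)"
        using row_sums[OF i] sv sw by (elim insertE emptyE) simp_all
    qed simp
    then show "satisfies B n (mix B (vec_proj v w) G) (same_sum_rel n)"
      unfolding X.sat_same_sum using G_closed[of 1] by auto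
  qed (intro mqg_intros)
qed

text \<open>
  Vectors with coordinate sum \<open>0\<close> leave the vector of ones in the range of \<open>P\<^sub>0\<close>.
\<close>

lemma (in mixture) mix_sum_one:
  assumes "P = vec_proj v w" "orthonormal_pair n v w" "(\<Sum>k<n. v k) = 0" "(\<Sum>k<n. w k) = 0" "G 0 = \<one>"
  shows "X.line_sums \<one>"
proof -
  interpret o: orthonormal_pair n v w by fact
  have "X.line_sums (G 0)"
  proof (rule mix_line_sums)
    fix a i :: nat assume a: "a < 3" and i: "i < n"
    then have "a \<in> {0, 1, 2}" by auto
    then show "(\<Sum>j<n. P a i j) = (if a = 0 then 1 else 0)"
      unfolding assms(1) using o.row_sums[OF i] assms(3,4) by (elim insertE emptyE) simp_all
  qed simp
  then show ?thesis using assms(5) by simp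
qed

text \<open>
  Two orthonormal vectors with coordinate sum \<open>0\<close> exist as soon as \<open>n \<ge> 3\<close>.
\<close>

lemma B_plus_large: assumes "3 \<le> n" shows "basic (B_plus n)"
proof -
  define v :: "nat \<Rightarrow> real" where "v k = (ev 0 k - ev 1 k) * (1 / sqrt 2)" for k
  define w :: "nat \<Rightarrow> real" where "w k = (ev 0 k + ev 1 k - 2 * ev 2 k) * (1 / sqrt 6)" for k
  have n: "0 < n" "1 < n" "2 < n" using assms by auto
  have v: "(\<Sum>k<n. v k * x k) = (x 0 - x 1) / sqrt 2" for x
    unfolding v_def using n by (intro sum_ev_diff_scaled) auto
  have w: "(\<Sum>k<n. w k * x k) = (x 0 + x 1 - 2 * x 2) / sqrt 6" for x
  proof -
    have "(\<Sum>k<n. w k * x k) = (\<Sum>k<n. ev 0 k * (x k / sqrt 6)) + (\<Sum>k<n. ev 1 k * (x k / sqrt 6))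
        - 2 * (\<Sum>k<n. ev 2 k * (x k / sqrt 6))"
      unfolding sum_distrib_left sum.distrib[symmetric] sum_subtractf[symmetric]
      by (intro sum.cong refl) (simp add: w_def)
    then show ?thesis using n by (simp only: sum_ev) (simp add: field_simps)
  qed
  interpret orthonormal_pair n v w
  proof
    show "(\<Sum>k<n. v k * v k) = 1" unfolding v by (simp add: v_def field_simps)
    show "(\<Sum>k<n. w k * w k) = 1" unfolding w by (simp add: w_def field_simps)
    show "(\<Sum>k<n. v k * w k) = 0" unfolding v by (simp add: w_def)
  qed
  have s: "(\<Sum>k<n. v k) = 0" "(\<Sum>k<n. w k) = 0" using v[of "\<lambda>_. 1"] w[of "\<lambda>_. 1"] by simp_all
  show ?thesis unfolding B_plus_def
  proof (rule basic_dual[OF _ orthonormal_pair_axioms stable_sum_one, where d = False])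
    fix B :: "(nat \<Rightarrow> ((nat \<Rightarrow> free_elem) set \<Rightarrow>\<^sub>0 complex)) set cstar_algebra" and G
    assume B: "cstar_alg B" "mixture B n (vec_proj v w) G" "G 0 = (if False then G 2 else \<one>\<^bsub>B\<^esub>)"
    interpret mixture B n "vec_proj v w" G by fact
    show "satisfies B n (mix B (vec_proj v w) G) (sum_one_rel n)"
      unfolding X.sat_sum_one using mix_sum_one[OF refl orthonormal_pair_axioms s] B(3) by simp
  qed (intro mqg_intros)
qed

text \<open>
  For \<open>c = \<plusminus>1/2\<close> these are the spectral projections of the involution \<open>u\<close>.
\<close>

lemma (in star_alg) half_involution_idem:
  assumes u: "u \<in> carrier A" "u \<otimes> u = \<one>" and c: "c * c = 1 / 4"
  shows "((1 / 2) \<odot> \<one> \<oplus> c \<odot> u) \<otimes> ((1 / 2) \<odot> \<one> \<oplus> c \<odot> u) = (1 / 2) \<odot> \<one> \<oplus> c \<odot> u"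
proof -
  have "((1 / 2) \<odot> \<one> \<oplus> c \<odot> u) \<otimes> ((1 / 2) \<odot> \<one> \<oplus> c \<odot> u)
      = ((1 / 4) \<odot> \<one> \<oplus> (c / 2) \<odot> u) \<oplus> ((c / 2) \<odot> u \<oplus> (c * c) \<odot> \<one>)"
    using u by (simp add: l_distr r_distr smult_r_distr smult_l_assoc smult_r_assoc smult_smult mult.commute)
  also have "\<dots> = ((1 / 4) \<odot> \<one> \<oplus> (c * c) \<odot> \<one>) \<oplus> ((c / 2) \<odot> u \<oplus> (c / 2) \<odot> u)"
    using u by (simp add: a_ac)
  also have "\<dots> = (1 / 4 + c * c) \<odot> \<one> \<oplus> (c / 2 + c / 2) \<odot> u"
    using u by (simp only: smult_l_distr one_closed)
  finally show ?thesis unfolding c by simp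
qed

text \<open>
  The vectors \<open>(e\<^sub>0 - e\<^sub>1) / \<surd>2\<close> and \<open>(e\<^sub>2 - e\<^sub>3) / \<surd>2\<close> give the block diagonal magic unitary with two \<open>2 \<times> 2\<close> blocks
  formed by the projections \<open>(1 \<plusminus> g) / 2\<close> and \<open>(1 \<plusminus> h) / 2\<close>, completed by the identity matrix.
\<close>

lemma basic_magic:
  assumes "4 \<le> n" "mqg n R" "stable n R"
    and sat: "\<And>(B :: (nat \<Rightarrow> ((nat \<Rightarrow> free_elem) set \<Rightarrow>\<^sub>0 complex)) set cstar_algebra) X.
      \<lbrakk>cstar_alg B; star_matrix B n X; star_matrix.idem B n X; star_matrix.line_sums B n X \<one>\<^bsub>B\<^esub>\<rbrakk> \<Longrightarrow> satisfies B n X R"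
  shows "basic (matrix_quantum_group n R)"
proof -
  define v :: "nat \<Rightarrow> real" where "v k = (ev 0 k - ev 1 k) * (1 / sqrt 2)" for k
  define w :: "nat \<Rightarrow> real" where "w k = (ev 2 k - ev 3 k) * (1 / sqrt 2)" for k
  have n: "0 < n" "1 < n" "2 < n" "3 < n" using assms by auto
  have v: "(\<Sum>k<n. v k * x k) = (x 0 - x 1) / sqrt 2" for x
    unfolding v_def using n by (intro sum_ev_diff_scaled) auto
  have w: "(\<Sum>k<n. w k * x k) = (x 2 - x 3) / sqrt 2" for x
    unfolding w_def using n by (intro sum_ev_diff_scaled) auto
  interpret orthonormal_pair n v w
  proof
    show "(\<Sum>k<n. v k * v k) = 1" unfolding v by (simp add: v_def field_simps)
    show "(\<Sum>k<n. w k * w k) = 1" unfolding w by (simp add: w_def field_simps)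
    show "(\<Sum>k<n. v k * w k) = 0" unfolding v by (simp add: w_def)
  qed
  have s: "(\<Sum>k<n. v k) = 0" "(\<Sum>k<n. w k) = 0" using v[of "\<lambda>_. 1"] w[of "\<lambda>_. 1"] by simp_all
  show ?thesis
  proof (rule basic_dual[OF assms(2) orthonormal_pair_axioms assms(3), where d = False])
    fix B :: "(nat \<Rightarrow> ((nat \<Rightarrow> free_elem) set \<Rightarrow>\<^sub>0 complex)) set cstar_algebra" and G
    assume B: "cstar_alg B" "mixture B n (vec_proj v w) G" "G 0 = (if False then G 2 else \<one>\<^bsub>B\<^esub>)"
    interpret mixture B n "vec_proj v w" G by fact
    have G0: "G 0 = \<one>\<^bsub>B\<^esub>" using B(3) by simp
    have G1: "G 1 \<in> carrier B" "G 1 \<otimes>\<^bsub>B\<^esub> G 1 = \<one>\<^bsub>B\<^esub>" "G 2 \<in> carrier B" "G 2 \<otimes>\<^bsub>B\<^esub> G 2 = \<one>\<^bsub>B\<^esub>"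
      using G_closed[of 1] G_closed[of 2] G_sq[of 1] G_sq[of 2] by auto
    have "X.idem" unfolding X.idem_def
    proof (intro allI impI)
      fix i j
      let ?X = "mix B (vec_proj v w) G i j"
      have Xv: "?X = complex_of_real ((if i = j then 1 else 0) - v i * v j - w i * w j) \<odot>\<^bsub>B\<^esub> \<one>\<^bsub>B\<^esub> \<oplus>\<^bsub>B\<^esub>
          (complex_of_real (v i * v j) \<odot>\<^bsub>B\<^esub> G 1 \<oplus>\<^bsub>B\<^esub> complex_of_real (w i * w j) \<odot>\<^bsub>B\<^esub> G 2)"
        unfolding mix_3 G0 by (simp add: vec_proj_def)
      have half: "complex_of_real (1 / 2) = 1 / 2" by simp
      consider "i \<in> {0, 1}" "j \<in> {0, 1}" | "i \<in> {2, 3}" "j \<in> {2, 3}"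
        | "v i * v j = 0" "w i * w j = 0"
      proof -
        have "v k = 0 \<or> k \<in> {0, 1}" "w k = 0 \<or> k \<in> {2, 3}" for k by (simp_all add: v_def w_def)
        then show thesis using that mult_eq_0_iff by metis
      qed
      then show "?X \<otimes>\<^bsub>B\<^esub> ?X = ?X"
      proof cases
        case 1
        define c where "c = v i * v j"
        have w0: "w i * w j = 0" using 1 by (auto simp: w_def)
        have p: "(if i = j then 1 else 0) - v i * v j - w i * w j = 1 / 2" using 1 by (auto simp: v_def w_def)
        have c: "complex_of_real c * complex_of_real c = 1 / 4" using 1 by (auto simp: c_def v_def)
        have "?X = (1 / 2) \<odot>\<^bsub>B\<^esub> \<one>\<^bsub>B\<^esub> \<oplus>\<^bsub>B\<^esub> complex_of_real c \<odot>\<^bsub>B\<^esub> G 1"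
          unfolding Xv unfolding p half unfolding w0 c_def[symmetric] using G1 by simp
        then show ?thesis using half_involution_idem[OF G1(1,2) c] by simp
      next
        case 2
        define c where "c = w i * w j"
        have v0: "v i * v j = 0" using 2 by (auto simp: v_def)
        have p: "(if i = j then 1 else 0) - v i * v j - w i * w j = 1 / 2" using 2 by (auto simp: v_def w_def)
        have c: "complex_of_real c * complex_of_real c = 1 / 4" using 2 by (auto simp: c_def w_def)
        have "?X = (1 / 2) \<odot>\<^bsub>B\<^esub> \<one>\<^bsub>B\<^esub> \<oplus>\<^bsub>B\<^esub> complex_of_real c \<odot>\<^bsub>B\<^esub> G 2"
          unfolding Xv unfolding p half unfolding v0 c_def[symmetric] using G1 by simp
        then show ?thesis using half_involution_idem[OF G1(3,4) c] by simp
      next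
        case 3
        have "?X = (if i = j then \<one>\<^bsub>B\<^esub> else \<zero>\<^bsub>B\<^esub>)" unfolding Xv 3 using G1 by simp
        then show ?thesis by simp
      qed
    qed
    moreover have "X.line_sums \<one>\<^bsub>B\<^esub>" by (rule mix_sum_one[OF refl orthonormal_pair_axioms s G0])
    ultimately show "satisfies B n (mix B (vec_proj v w) G) R"
      using sat[OF B(1) X.star_matrix_axioms] by blast
  qed
qed

lemma S_plus_large: "4 \<le> n \<Longrightarrow> basic (S_plus n)"
  unfolding S_plus_def
proof (rule basic_magic)
  fix B :: "(nat \<Rightarrow> ((nat \<Rightarrow> free_elem) set \<Rightarrow>\<^sub>0 complex)) set cstar_algebra" and X
  assume B: "star_matrix B n X" "star_matrix.idem B n X" "star_matrix.line_sums B n X \<one>\<^bsub>B\<^esub>"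
  interpret star_matrix B n X by fact
  show "sat (projection_rel n \<union> sum_one_rel n)" using B by (simp add: sat_idem sat_sum_one)
qed (intro mqg_intros stable_magic | assumption)+

lemma S'_plus_large: "4 \<le> n \<Longrightarrow> basic (S'_plus n)"
  unfolding S'_plus_def
proof (rule basic_magic)
  fix B :: "(nat \<Rightarrow> ((nat \<Rightarrow> free_elem) set \<Rightarrow>\<^sub>0 complex)) set cstar_algebra" and X
  assume B: "cstar_alg B" "star_matrix B n X" "star_matrix.idem B n X" "star_matrix.line_sums B n X \<one>\<^bsub>B\<^esub>"
  interpret star_matrix B n X by fact
  have cubic by (rule magic_cubic[OF B])
  then show "sat (cubic_rel n \<union> same_sum_rel n)" using B(4) one_closed by (auto simp: sat_cubic sat_same_sum)
qed (intro mqg_intros stable_Un stable_cubic stable_same_sum | assumption)+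

section \<open>The fourteen families\<close>

theorem proposition3p5:
  fixes n :: nat
  assumes "n \<ge> 1"
  shows
    "(basic (O_class n) \<and> basic (S_class n) \<and> basic (H_class n) \<and>
      basic (B_class n) \<and> basic (S'_class n) \<and> basic (B'_class n)) \<and>
     (basic (O_plus n) \<and> basic (S_plus n) \<and> basic (H_plus n) \<and>
      basic (B_plus n) \<and> basic (S'_plus n) \<and> basic (B'_plus n)) \<and>
     (basic (O_half n) \<and> basic (H_half n))"
proof -
  have "basic (matrix_quantum_group n ({} \<union> commutation_rel n))"
    by (intro basic_classical empty_subsetI)
  then have "basic (O_class n)" by (simp add: O_class_def)
  moreover have "basic (S_class n)" "basic (H_class n)" "basic (B_class n)" "basic (S'_class n)" "basic (B'_class n)"
    unfolding S_class_def H_class_def B_class_def S'_class_def B'_class_def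
    by (intro basic_classical Un_least relations_closed)+
  moreover have "basic (O_plus n) \<and> basic (H_plus n) \<and> basic (B'_plus n) \<and> basic (O_half n) \<and> basic (H_half n)"
  proof (cases "n = 1")
    case True
    show ?thesis
      unfolding True O_plus_def H_plus_def B'_plus_def O_half_def H_half_def
      by (intro conjI basic_one Un_least relations_closed empty_subsetI)
  next
    case False
    then have "2 \<le> n" using assms by simp
    then show ?thesis by (intro conjI O_plus_large H_plus_large B'_plus_large O_half_large H_half_large)
  qed
  moreover have "basic (S_plus n)" using S_small[of n] S_plus_large[of n] by linarith
  moreover have "basic (S'_plus n)" using S'_small[of n] S'_plus_large[of n] by linarith
  moreover have "basic (B_plus n)" using B_small[of n] B_plus_large[of n] by linarith
  ultimately show ?thesis by blast
qed

end
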